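(* Let $k\ge1$, let $\mathsf{F}$ be a field, and let $\Lambda$ and $\Omega$ be row-finite $k$-graphs without sources such that $|\Lambda^0|,|\Omega^0|<\infty$. The following two conditions are equivalent: (i) there is a $\mathbb{Z}^k$-monoid isomorphism between $T_\Lambda$ and $T_\Omega$; (ii) there is an order-preserving $\mathbb{Z}[\mathbb{Z}^k]$-module isomorphism between $K_0^{\mathrm{gr}}(\mathrm{KP}_{\mathsf F}(\Lambda))$ and $K_0^{\mathrm{gr}}(\mathrm{KP}_{\mathsf F}(\Omega))$. Moreover, if either of them holds, then $\mathrm{KP}_{\mathsf F}(\Lambda)$ is locally finite if and only if $\mathrm{KP}_{\mathsf F}(\Omega)$ is locally finite.
   Context: $\mathbb{N}=\{0,1,2,\dots\}$; $\mathbf{e}_i$ is the $i$-th unit vector of $\mathbb{Z}^k$. A $k$-graph is a countable small category $\Lambda$ with a functor $d:\Lambda\to\mathbb{N}^k$ (degree) such that whenever $d(\lambda)=\mathbf{n}+\mathbf{m}$ with $\mathbf{n},\mathbf{m}\in\mathbb{N}^k$ there are unique $\alpha,\beta\in\Lambda$ with $d(\alpha)=\mathbf{n}$, $d(\beta)=\mathbf{m}$, $\lambda=\alpha\beta$. The codomain and domain of a morphism (path) $\lambda$ are $r(\lambda)$ and $s(\lambda)$; $\lambda\mu$ is defined when $s(\lambda)=r(\mu)$. $\Lambda^{\mathbf{n}}=d^{-1}(\mathbf{n})$; elements of $\Lambda^0$ are identified with objects (vertices). $v\Lambda^{\mathbf{n}}=\{\lambda\in\Lambda^{\mathbf{n}}:r(\lambda)=v\}$.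 $\Lambda$ is row-finite without sources if $0<|v\Lambda^{\mathbf{n}}|<\infty$ for all $v,\mathbf{n}$. The talented monoid $T_\Lambda$ is the commutative monoid generated by symbols $v(\mathbf{n})$ ($v\in\Lambda^0$, $\mathbf{n}\in\mathbb{Z}^k$) subject to $v(\mathbf{n})=\sum_{\alpha\in v\Lambda^{\mathbf{e}_i}}s(\alpha)(\mathbf{n}+\mathbf{e}_i)$ for all $v,\mathbf{n}$ and $1\le i\le k$; $\mathbb{Z}^k$ acts by ${}^{\mathbf{q}}v(\mathbf{n})=v(\mathbf{n}+\mathbf{q})$. A $\mathbb{Z}^k$-monoid isomorphism is a monoid isomorphism commuting with the $\mathbb{Z}^k$-actions. $\mathrm{KP}_{\mathsf F}(\Lambda)$ is the universal associative $\mathsf{F}$-algebra generated by $p_v$ ($v\in\Lambda^0$), $s_\lambda,s_{\lambda^*}$ ($\lambda\in\Lambda\setminus\Lambda^0$) with relations: (KP1) $p_up_v=\delta_{u,v}p_u$; (KP2) $s_\lambda s_\mu=s_{\lambda\mu}$, $s_{\mu^*}s_{\lambda^*}=s_{(\lambda\mu)^*}$ when $s(\lambda)=r(\mu)$, $p_{r(\lambda)}s_\lambda=s_\lambda=s_\lambda p_{s(\lambda)}$, $p_{s(\lambda)}s_{\lambda^*}=s_{\lambda^*}=s_{\lambda^*}p_{r(\lambda)}$; (KP3) $s_{\lambda^*}s_\mu=\delta_{\lambda,\mu}p_{s(\lambda)}$ if $d(\lambda)=d(\mu)$; (KP4) $p_v=\sum_{\lambda\in v\Lambda^{\mathbf{n}}}s_\lambda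 s_{\lambda^*}$ for all $v$, $\mathbf{n}\ne0$. With $s_v=s_{v^*}=p_v$, it is $\mathbb{Z}^k$-graded with $\mathrm{KP}_{\mathsf F}(\Lambda)_{\mathbf{n}}=\mathrm{span}_{\mathsf F}\{s_\lambda s_{\mu^*}: d(\lambda)-d(\mu)=\mathbf{n}\}$; it is unital when $|\Lambda^0|<\infty$. A graded $\mathsf{F}$-algebra is locally finite if every homogeneous component is finite-dimensional over $\mathsf{F}$. For a unital $\mathbb{Z}^k$-graded ring $A$, $\mathcal{V}^{\mathrm{gr}}(A)$ is the monoid (under $\oplus$) of graded isomorphism classes of graded finitely generated projective left $A$-modules, with $\mathbb{Z}^k$-action ${}^{\mathbf{n}}[P]=[P(\mathbf{n})]$, where $P(\mathbf{n})_{\mathbf{m}}=P_{\mathbf{n}+\mathbf{m}}$. $K_0^{\mathrm{gr}}(A)$ is its group completion, a $\mathbb{Z}[\mathbb{Z}^k]$-module, pre-ordered with positive cone the image of $\mathcal{V}^{\mathrm{gr}}(A)$. An order-preserving isomorphism is one carrying the positive cone onto the positive cone. Known fact: $T_\Lambda\cong\mathcal{V}^{\mathrm{gr}}(\mathrm{KP}_{\mathsf F}(\Lambda))$ as $\mathbb{Z}^k$-monoids via $v(\mathbf{n})\mapsto[\mathrm{KP}_{\mathsf F}(\Lambda)p_v(\mathbf{n})]$, and $T_\Lambda$ is cancellative. *)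

theory Defs
  imports
    "HOL-Analysis.Finite_Cartesian_Product"
    "HOL-Algebra.Module"
    "HOL-Library.Poly_Mapping"
    "HOL-Library.Multiset"
    "HOL-Library.Countable_Set"
begin

section \<open>Higher-rank graphs\<close>

text \<open>
  A small category is presented by its morphisms only, an object being identified with
  its identity morphism; thus \<open>rng\<close> and \<open>src\<close> (codomain and domain) take morphisms to
  identity morphisms, and \<open>cmp \<mu> \<nu>\<close> is meaningful when \<open>src \<mu> = rng \<nu>\<close>.
  The rank is the cardinality of the index type \<open>'k\<close>.
\<close>

record ('p, 'k) kgraph =
  paths :: "'p set"
  rng :: "'p \<Rightarrow> 'p"
  src :: "'p \<Rightarrow> 'p"
  cmp :: "'p \<Rightarrow> 'p \<Rightarrow> 'p"
  deg :: "'p \<Rightarrow> nat ^ 'k"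

locale k_graph =
  fixes \<Lambda> :: "('p, 'k::finite) kgraph"
  assumes countable_paths: "countable (paths \<Lambda>)"
    and rng_closed: "\<mu> \<in> paths \<Lambda> \<Longrightarrow> rng \<Lambda> \<mu> \<in> paths \<Lambda>"
    and src_closed: "\<mu> \<in> paths \<Lambda> \<Longrightarrow> src \<Lambda> \<mu> \<in> paths \<Lambda>"
    and rng_rng: "\<mu> \<in> paths \<Lambda> \<Longrightarrow> rng \<Lambda> (rng \<Lambda> \<mu>) = rng \<Lambda> \<mu>"
    and src_rng: "\<mu> \<in> paths \<Lambda> \<Longrightarrow> src \<Lambda> (rng \<Lambda> \<mu>) = rng \<Lambda> \<mu>"
    and rng_src: "\<mu> \<in> paths \<Lambda> \<Longrightarrow> rng \<Lambda> (src \<Lambda> \<mu>) = src \<Lambda> \<mu>"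
    and src_src: "\<mu> \<in> paths \<Lambda> \<Longrightarrow> src \<Lambda> (src \<Lambda> \<mu>) = src \<Lambda> \<mu>"
    and cmp_closed: "\<lbrakk>\<mu> \<in> paths \<Lambda>; \<nu> \<in> paths \<Lambda>; src \<Lambda> \<mu> = rng \<Lambda> \<nu>\<rbrakk>
          \<Longrightarrow> cmp \<Lambda> \<mu> \<nu> \<in> paths \<Lambda>"
    and rng_cmp: "\<lbrakk>\<mu> \<in> paths \<Lambda>; \<nu> \<in> paths \<Lambda>; src \<Lambda> \<mu> = rng \<Lambda> \<nu>\<rbrakk>
          \<Longrightarrow> rng \<Lambda> (cmp \<Lambda> \<mu> \<nu>) = rng \<Lambda> \<mu>"
    and src_cmp: "\<lbrakk>\<mu> \<in> paths \<Lambda>; \<nu> \<in> paths \<Lambda>; src \<Lambda> \<mu> = rng \<Lambda> \<nu>\<rbrakk>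
          \<Longrightarrow> src \<Lambda> (cmp \<Lambda> \<mu> \<nu>) = src \<Lambda> \<nu>"
    and cmp_assoc: "\<lbrakk>\<mu> \<in> paths \<Lambda>; \<nu> \<in> paths \<Lambda>; \<rho> \<in> paths \<Lambda>;
            src \<Lambda> \<mu> = rng \<Lambda> \<nu>; src \<Lambda> \<nu> = rng \<Lambda> \<rho>\<rbrakk>
          \<Longrightarrow> cmp \<Lambda> (cmp \<Lambda> \<mu> \<nu>) \<rho> = cmp \<Lambda> \<mu> (cmp \<Lambda> \<nu> \<rho>)"
    and cmp_rng: "\<mu> \<in> paths \<Lambda> \<Longrightarrow> cmp \<Lambda> (rng \<Lambda> \<mu>) \<mu> = \<mu>"
    and cmp_src: "\<mu> \<in> paths \<Lambda> \<Longrightarrow> cmp \<Lambda> \<mu> (src \<Lambda> \<mu>) = \<mu>"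
    and deg_rng: "\<mu> \<in> paths \<Lambda> \<Longrightarrow> deg \<Lambda> (rng \<Lambda> \<mu>) = 0"
    and deg_src: "\<mu> \<in> paths \<Lambda> \<Longrightarrow> deg \<Lambda> (src \<Lambda> \<mu>) = 0"
    and deg_cmp: "\<lbrakk>\<mu> \<in> paths \<Lambda>; \<nu> \<in> paths \<Lambda>; src \<Lambda> \<mu> = rng \<Lambda> \<nu>\<rbrakk>
          \<Longrightarrow> deg \<Lambda> (cmp \<Lambda> \<mu> \<nu>) = deg \<Lambda> \<mu> + deg \<Lambda> \<nu>"
    and factorization: "\<lbrakk>\<mu> \<in> paths \<Lambda>; deg \<Lambda> \<mu> = n + m\<rbrakk> \<Longrightarrow>
          \<exists>!p. case p of (\<alpha>, \<beta>) \<Rightarrow>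
            \<alpha> \<in> paths \<Lambda> \<and> \<beta> \<in> paths \<Lambda> \<and> src \<Lambda> \<alpha> = rng \<Lambda> \<beta> \<and>
            deg \<Lambda> \<alpha> = n \<and> deg \<Lambda> \<beta> = m \<and> \<mu> = cmp \<Lambda> \<alpha> \<beta>"

definition paths_deg :: "('p, 'k::finite) kgraph \<Rightarrow> nat ^ 'k \<Rightarrow> 'p set" where
  "paths_deg \<Lambda> n = {\<mu> \<in> paths \<Lambda>. deg \<Lambda> \<mu> = n}"

abbreviation vertices :: "('p, 'k::finite) kgraph \<Rightarrow> 'p set" where
  "vertices \<Lambda> \<equiv> paths_deg \<Lambda> 0"

definition paths_from :: "('p, 'k::finite) kgraph \<Rightarrow> 'p \<Rightarrow> nat ^ 'k \<Rightarrow> 'p set" where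
  "paths_from \<Lambda> v n = {\<mu> \<in> paths_deg \<Lambda> n. rng \<Lambda> \<mu> = v}"

lemma (in k_graph) vertices_eq_identities:
  "vertices \<Lambda> = rng \<Lambda> ` paths \<Lambda>" "vertices \<Lambda> = src \<Lambda> ` paths \<Lambda>"
proof -
  have "rng \<Lambda> \<mu> = \<mu> \<and> src \<Lambda> \<mu> = \<mu>" if "\<mu> \<in> vertices \<Lambda>" for \<mu>
  proof -
    from that have p: "\<mu> \<in> paths \<Lambda>" and "deg \<Lambda> \<mu> = 0"
      by (auto simp: paths_deg_def)
    then have "deg \<Lambda> \<mu> = 0 + 0" by simp
    note ex1 = factorization[OF p this]
    have "(rng \<Lambda> \<mu>, \<mu>) = (\<mu>, src \<Lambda> \<mu>)"
      by (rule ex1E[OF ex1])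
        (use p \<open>deg \<Lambda> \<mu> = 0\<close> in \<open>smt (verit) case_prodI cmp_rng cmp_src deg_rng deg_src
          rng_closed rng_src src_closed src_rng\<close>)
    then show ?thesis by simp
  qed
  then show "vertices \<Lambda> = rng \<Lambda> ` paths \<Lambda>" "vertices \<Lambda> = src \<Lambda> ` paths \<Lambda>"
    by (force simp: paths_deg_def rng_closed deg_rng src_closed deg_src)+
qed

locale row_finite_k_graph = k_graph +
  assumes row_finite: "v \<in> vertices \<Lambda> \<Longrightarrow> finite (paths_from \<Lambda> v n)"
    and no_sources: "v \<in> vertices \<Lambda> \<Longrightarrow> paths_from \<Lambda> v n \<noteq> {}"


section \<open>Commutative monoids with a group action\<close>

record ('z, 'a) act_monoid = "'a monoid" +
  act :: "'z \<Rightarrow> 'a \<Rightarrow> 'a"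

definition act_monoid_isomorphic ::
    "('z, 'a) act_monoid \<Rightarrow> ('z, 'b) act_monoid \<Rightarrow> bool" where
  "act_monoid_isomorphic M N \<longleftrightarrow>
     (\<exists>h \<in> iso M N. \<forall>n. \<forall>x \<in> carrier M. h (act M n x) = act N n (h x))"


subsection \<open>The talented monoid\<close>

inductive talented_eq ::
    "('p, 'k::finite) kgraph \<Rightarrow> ('p \<times> (int ^ 'k)) multiset \<Rightarrow> ('p \<times> (int ^ 'k)) multiset \<Rightarrow> bool"
  for \<Lambda> where
  relation: "v \<in> vertices \<Lambda> \<Longrightarrow>
     talented_eq \<Lambda> {#(v, n)#}
       (image_mset (\<lambda>\<alpha>. (src \<Lambda> \<alpha>, n + axis i 1)) (mset_set (paths_from \<Lambda> v (axis i 1))))"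
| refl: "talented_eq \<Lambda> x x"
| sym: "talented_eq \<Lambda> x y \<Longrightarrow> talented_eq \<Lambda> y x"
| trans: "talented_eq \<Lambda> x y \<Longrightarrow> talented_eq \<Lambda> y z \<Longrightarrow> talented_eq \<Lambda> x z"
| add: "talented_eq \<Lambda> x y \<Longrightarrow> talented_eq \<Lambda> (x + z) (y + z)"

definition talented_rel ::
    "('p, 'k::finite) kgraph \<Rightarrow> (('p \<times> (int ^ 'k)) multiset \<times> ('p \<times> (int ^ 'k)) multiset) set" where
  "talented_rel \<Lambda> = {(x, y). set_mset x \<subseteq> vertices \<Lambda> \<times> UNIV \<and>
     set_mset y \<subseteq> vertices \<Lambda> \<times> UNIV \<and> talented_eq \<Lambda> x y}"

definition talented_monoid ::
    "('p, 'k::finite) kgraph \<Rightarrow> (int ^ 'k, ('p \<times> (int ^ 'k)) multiset set) act_monoid" where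
  "talented_monoid \<Lambda> =
     \<lparr>carrier = {x. set_mset x \<subseteq> vertices \<Lambda> \<times> UNIV} // talented_rel \<Lambda>,
      monoid.mult = (\<lambda>X Y. \<Union>x \<in> X. \<Union>y \<in> Y. talented_rel \<Lambda> `` {x + y}),
      one = talented_rel \<Lambda> `` {{#}},
      act = (\<lambda>q X. \<Union>x \<in> X. talented_rel \<Lambda> `` {image_mset (\<lambda>(v, n). (v, n + q)) x})\<rparr>"


subsection \<open>Group completion\<close>

text \<open>
  The completion of a \<open>'z\<close>-monoid is a module over the integral group ring of \<open>'z\<close>, which
  is the type \<open>'z \<Rightarrow>\<^sub>0 int\<close> with its convolution product. As in the \<open>module\<close>
  locale, the fields \<open>mult\<close> and \<open>one\<close> of a record representing a module carry no information.
\<close>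

record ('r, 'm) preordered_module = "('r, 'm) module" +
  pos_cone :: "'m set"

definition completion_rel :: "('z, 'a) act_monoid \<Rightarrow> (('a \<times> 'a) \<times> ('a \<times> 'a)) set" where
  "completion_rel M = {((a, b), (c, d)). a \<in> carrier M \<and> b \<in> carrier M \<and>
     c \<in> carrier M \<and> d \<in> carrier M \<and>
     (\<exists>e \<in> carrier M. a \<otimes>\<^bsub>M\<^esub> d \<otimes>\<^bsub>M\<^esub> e = c \<otimes>\<^bsub>M\<^esub> b \<otimes>\<^bsub>M\<^esub> e)}"

definition completion_group :: "('z, 'a) act_monoid \<Rightarrow> ('a \<times> 'a) set ring" where
  "completion_group M =
     \<lparr>carrier = (carrier M \<times> carrier M) // completion_rel M,
      monoid.mult = undefined,
      one = undefined,
      zero = completion_rel M `` {(\<one>\<^bsub>M\<^esub>, \<one>\<^bsub>M\<^esub>)},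
      add = (\<lambda>X Y. \<Union>(a, b) \<in> X. \<Union>(c, d) \<in> Y.
               completion_rel M `` {(a \<otimes>\<^bsub>M\<^esub> c, b \<otimes>\<^bsub>M\<^esub> d)})\<rparr>"

definition completion_act :: "('z, 'a) act_monoid \<Rightarrow> 'z \<Rightarrow> ('a \<times> 'a) set \<Rightarrow> ('a \<times> 'a) set" where
  "completion_act M n X = (\<Union>(a, b) \<in> X. completion_rel M `` {(act M n a, act M n b)})"

definition completion ::
    "('z, 'a) act_monoid \<Rightarrow> ('z \<Rightarrow>\<^sub>0 int, ('a \<times> 'a) set) preordered_module" where
  "completion M = ring.extend (completion_group M)
     \<lparr>smult = (\<lambda>c X. \<Oplus>\<^bsub>completion_group M\<^esub> n \<in> Poly_Mapping.keys c.
         [Poly_Mapping.lookup c n] \<cdot>\<^bsub>completion_group M\<^esub> completion_act M n X),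
      pos_cone = (\<lambda>a. completion_rel M `` {(a, \<one>\<^bsub>M\<^esub>)}) ` carrier M\<rparr>"

definition preordered_module_isomorphic ::
    "('r, 'm) preordered_module \<Rightarrow> ('r, 'n) preordered_module \<Rightarrow> bool" where
  "preordered_module_isomorphic M N \<longleftrightarrow>
     (\<exists>h \<in> iso (add_monoid M) (add_monoid N).
        (\<forall>c. \<forall>x \<in> carrier M. h (c \<odot>\<^bsub>M\<^esub> x) = c \<odot>\<^bsub>N\<^esub> h x) \<and>
        h ` pos_cone M = pos_cone N)"


section \<open>Graded modules and the graded Grothendieck group\<close>

text \<open>
  The library locale \<open>module\<close> requires commutative scalars, so its axioms are
  repeated over an arbitrary ring. The same record serves for graded algebras over a field.
\<close>

record ('a, 'm, 'z) graded_module = "('a, 'm) module" +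
  hcomp :: "'z \<Rightarrow> 'm set"

locale left_module = R?: ring A + M?: abelian_group M
  for A :: "('a, 'c) ring_scheme" (structure) and M :: "('a, 'm, 'd) module_scheme" (structure) +
  assumes smult_closed: "\<lbrakk>a \<in> carrier A; x \<in> carrier M\<rbrakk> \<Longrightarrow> a \<odot>\<^bsub>M\<^esub> x \<in> carrier M"
    and smult_l_distr: "\<lbrakk>a \<in> carrier A; b \<in> carrier A; x \<in> carrier M\<rbrakk>
          \<Longrightarrow> (a \<oplus>\<^bsub>A\<^esub> b) \<odot>\<^bsub>M\<^esub> x = a \<odot>\<^bsub>M\<^esub> x \<oplus>\<^bsub>M\<^esub> b \<odot>\<^bsub>M\<^esub> x"
    and smult_r_distr: "\<lbrakk>a \<in> carrier A; x \<in> carrier M; y \<in> carrier M\<rbrakk>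
          \<Longrightarrow> a \<odot>\<^bsub>M\<^esub> (x \<oplus>\<^bsub>M\<^esub> y) = a \<odot>\<^bsub>M\<^esub> x \<oplus>\<^bsub>M\<^esub> a \<odot>\<^bsub>M\<^esub> y"
    and smult_assoc: "\<lbrakk>a \<in> carrier A; b \<in> carrier A; x \<in> carrier M\<rbrakk>
          \<Longrightarrow> (a \<otimes>\<^bsub>A\<^esub> b) \<odot>\<^bsub>M\<^esub> x = a \<odot>\<^bsub>M\<^esub> (b \<odot>\<^bsub>M\<^esub> x)"
    and smult_one: "x \<in> carrier M \<Longrightarrow> \<one>\<^bsub>A\<^esub> \<odot>\<^bsub>M\<^esub> x = x"

lemma module_imp_left_module: "module R M \<Longrightarrow> left_module R M"
  by (simp add: module_def cring_def left_module_def left_module_axioms_def module_axioms_def)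

locale graded_left_module = left_module A M
  for A :: "('s, 'a, 'z::ab_group_add) graded_module" (structure)
    and M :: "('a, 'm, 'z) graded_module" (structure) +
  assumes hcomp_subgroup: "subgroup (hcomp M n) (add_monoid M)"
    and hcomp_direct_sum: "x \<in> carrier M \<Longrightarrow>
          \<exists>!f. (\<forall>n. f n \<in> hcomp M n) \<and> finite {n. f n \<noteq> \<zero>\<^bsub>M\<^esub>} \<and>
            x = (\<Oplus>\<^bsub>M\<^esub> n \<in> {n. f n \<noteq> \<zero>\<^bsub>M\<^esub>}. f n)"
    and hcomp_smult: "\<lbrakk>a \<in> hcomp A n; x \<in> hcomp M m\<rbrakk> \<Longrightarrow> a \<odot>\<^bsub>M\<^esub> x \<in> hcomp M (n + m)"

definition lin_span :: "'a set \<Rightarrow> ('a, 'm, 'c) module_scheme \<Rightarrow> 'm set \<Rightarrow> 'm set" where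
  "lin_span K M S = {\<Oplus>\<^bsub>M\<^esub> x \<in> B. c x \<odot>\<^bsub>M\<^esub> x | B c. finite B \<and> B \<subseteq> S \<and> c \<in> B \<rightarrow> K}"

definition finitely_generated ::
    "('a, 'c) ring_scheme \<Rightarrow> ('a, 'm, 'd) module_scheme \<Rightarrow> bool" where
  "finitely_generated A M \<longleftrightarrow>
     (\<exists>S. finite S \<and> S \<subseteq> carrier M \<and> carrier M = lin_span (carrier A) M S)"

definition graded_hom ::
    "('s, 'a, 'z) graded_module \<Rightarrow> ('a, 'm, 'z) graded_module \<Rightarrow>
     ('a, 'n, 'z) graded_module \<Rightarrow> ('m \<Rightarrow> 'n) set" where
  "graded_hom A M N = {f \<in> hom (add_monoid M) (add_monoid N).
     (\<forall>a \<in> carrier A. \<forall>x \<in> carrier M. f (a \<odot>\<^bsub>M\<^esub> x) = a \<odot>\<^bsub>N\<^esub> f x) \<and>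
     (\<forall>n. f ` hcomp M n \<subseteq> hcomp N n)}"

definition graded_isomorphic ::
    "('s, 'a, 'z) graded_module \<Rightarrow> ('a, 'm, 'z) graded_module \<Rightarrow>
     ('a, 'n, 'z) graded_module \<Rightarrow> bool" where
  "graded_isomorphic A M N \<longleftrightarrow>
     (\<exists>f \<in> graded_hom A M N. bij_betw f (carrier M) (carrier N))"

text \<open>
  The type \<open>'a list\<close> is a universe of modules: a left module over \<open>A\<close> with \<open>n\<close> generators
  is a quotient of \<open>A\<^sup>n\<close>, so its carrier injects into the lists of length \<open>n\<close> and
  it has an isomorphic copy in that type, as has every graded free module of finite rank.
  Hence, for finitely generated graded modules, having the lifting property against surjections
  within the universe is the same as being projective in the category of all graded modules,
  and every isomorphism class of finitely generated graded modules is represented in the universe.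
\<close>

definition graded_projective ::
    "('s, 'a, 'z::ab_group_add) graded_module \<Rightarrow> ('a, 'm, 'z) graded_module \<Rightarrow> bool" where
  "graded_projective A P \<longleftrightarrow>
     (\<forall>(E :: ('a, 'a list, 'z) graded_module) (N :: ('a, 'a list, 'z) graded_module).
        \<forall>g \<in> graded_hom A E N. \<forall>f \<in> graded_hom A P N.
          graded_left_module A E \<and> graded_left_module A N \<and> g ` carrier E = carrier N \<longrightarrow>
          (\<exists>h \<in> graded_hom A P E. \<forall>x \<in> carrier P. g (h x) = f x))"

definition graded_fg_projective ::
    "('s, 'a, 'z::ab_group_add) graded_module \<Rightarrow> ('a, 'm, 'z) graded_module \<Rightarrow> bool" where
  "graded_fg_projective A P \<longleftrightarrow>
     graded_left_module A P \<and> finitely_generated A P \<and> graded_projective A P"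

definition graded_class ::
    "('s, 'a, 'z::ab_group_add) graded_module \<Rightarrow> ('a, 'm, 'z) graded_module \<Rightarrow>
     ('a, 'a list, 'z) graded_module set" where
  "graded_class A P = {Q. graded_fg_projective A Q \<and> graded_isomorphic A P Q}"

definition direct_sum ::
    "('a, 'm, 'z) graded_module \<Rightarrow> ('a, 'n, 'z) graded_module \<Rightarrow>
     ('a, 'm \<times> 'n, 'z) graded_module" where
  "direct_sum P Q =
     \<lparr>carrier = carrier P \<times> carrier Q,
      monoid.mult = undefined,
      one = undefined,
      zero = (\<zero>\<^bsub>P\<^esub>, \<zero>\<^bsub>Q\<^esub>),
      add = (\<lambda>(x, y) (x', y'). (x \<oplus>\<^bsub>P\<^esub> x', y \<oplus>\<^bsub>Q\<^esub> y')),
      smult = (\<lambda>a (x, y). (a \<odot>\<^bsub>P\<^esub> x, a \<odot>\<^bsub>Q\<^esub> y)),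
      hcomp = (\<lambda>n. hcomp P n \<times> hcomp Q n)\<rparr>"

definition shift :: "'z::ab_group_add \<Rightarrow> ('a, 'm, 'z) graded_module \<Rightarrow> ('a, 'm, 'z) graded_module" where
  "shift n P = P\<lparr>hcomp := (\<lambda>m. hcomp P (n + m))\<rparr>"

definition V_gr ::
    "('s, 'a, 'z::ab_group_add) graded_module \<Rightarrow>
     ('z, ('a, 'a list, 'z) graded_module set) act_monoid" where
  "V_gr A =
     \<lparr>carrier = graded_class A ` {P :: ('a, 'a list, 'z) graded_module. graded_fg_projective A P},
      monoid.mult = (\<lambda>X Y. \<Union>P \<in> X. \<Union>Q \<in> Y. graded_class A (direct_sum P Q)),
      one = {P. graded_fg_projective A P \<and> carrier P = {\<zero>\<^bsub>P\<^esub>}},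
      act = (\<lambda>n X. \<Union>P \<in> X. graded_class A (shift n P))\<rparr>"

definition K0_gr ::
    "('s, 'a, 'z::ab_group_add) graded_module \<Rightarrow>
     ('z \<Rightarrow>\<^sub>0 int, (('a, 'a list, 'z) graded_module set \<times> ('a, 'a list, 'z) graded_module set) set)
       preordered_module" where
  "K0_gr A = completion (V_gr A)"

definition locally_finite :: "('f::field, 'a, 'z) graded_module \<Rightarrow> bool" where
  "locally_finite A \<longleftrightarrow>
     (\<forall>n. \<exists>B. finite B \<and> B \<subseteq> hcomp A n \<and> hcomp A n = lin_span UNIV A B)"


section \<open>Kumjian-Pask algebras\<close>

subsection \<open>Associative algebras given by generators and relations\<close>

datatype (gens: 'g, 'f) alg_term =
    Gen 'g
  | Zero
  | Add "('g, 'f) alg_term" "('g, 'f) alg_term"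
  | Mult "('g, 'f) alg_term" "('g, 'f) alg_term"
  | Scale 'f "('g, 'f) alg_term"

text \<open>
  The least congruence containing \<open>R\<close> whose quotient satisfies the axioms of an associative,
  not necessarily unital, algebra; additive inverses are given by \<open>Scale (-1)\<close>.
\<close>

inductive alg_eq ::
    "(('g, 'f::field) alg_term \<Rightarrow> ('g, 'f) alg_term \<Rightarrow> bool) \<Rightarrow>
     ('g, 'f) alg_term \<Rightarrow> ('g, 'f) alg_term \<Rightarrow> bool"
  for R where
  relation: "R x y \<Longrightarrow> alg_eq R x y"
| refl: "alg_eq R x x"
| sym: "alg_eq R x y \<Longrightarrow> alg_eq R y x"
| trans: "alg_eq R x y \<Longrightarrow> alg_eq R y z \<Longrightarrow> alg_eq R x z"
| cong_Add: "alg_eq R x x' \<Longrightarrow> alg_eq R y y' \<Longrightarrow> alg_eq R (Add x y) (Add x' y')"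
| cong_Mult: "alg_eq R x x' \<Longrightarrow> alg_eq R y y' \<Longrightarrow> alg_eq R (Mult x y) (Mult x' y')"
| cong_Scale: "alg_eq R x x' \<Longrightarrow> alg_eq R (Scale a x) (Scale a x')"
| Add_assoc: "alg_eq R (Add (Add x y) z) (Add x (Add y z))"
| Add_comm: "alg_eq R (Add x y) (Add y x)"
| Add_Zero: "alg_eq R (Add Zero x) x"
| Add_minus: "alg_eq R (Add (Scale (- 1) x) x) Zero"
| Mult_assoc: "alg_eq R (Mult (Mult x y) z) (Mult x (Mult y z))"
| Mult_Add_left: "alg_eq R (Mult (Add x y) z) (Add (Mult x z) (Mult y z))"
| Mult_Add_right: "alg_eq R (Mult x (Add y z)) (Add (Mult x y) (Mult x z))"
| Scale_Add: "alg_eq R (Scale a (Add x y)) (Add (Scale a x) (Scale a y))"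
| Scale_plus: "alg_eq R (Scale (a + b) x) (Add (Scale a x) (Scale b x))"
| Scale_times: "alg_eq R (Scale (a * b) x) (Scale a (Scale b x))"
| Scale_one: "alg_eq R (Scale 1 x) x"
| Scale_Mult_left: "alg_eq R (Mult (Scale a x) y) (Scale a (Mult x y))"
| Scale_Mult_right: "alg_eq R (Mult x (Scale a y)) (Scale a (Mult x y))"

definition alg_rel ::
    "'g set \<Rightarrow> (('g, 'f::field) alg_term \<Rightarrow> ('g, 'f) alg_term \<Rightarrow> bool) \<Rightarrow>
     (('g, 'f) alg_term \<times> ('g, 'f) alg_term) set" where
  "alg_rel G R = {(x, y). gens x \<subseteq> G \<and> gens y \<subseteq> G \<and> alg_eq R x y}"

text \<open>The algebra need not have a unit, so its \<open>one\<close> field is left unspecified.\<close>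

definition presented_algebra ::
    "'g set \<Rightarrow> (('g, 'f::field) alg_term \<Rightarrow> ('g, 'f) alg_term \<Rightarrow> bool) \<Rightarrow>
     ('f, ('g, 'f) alg_term set) module" where
  "presented_algebra G R =
     \<lparr>carrier = {x. gens x \<subseteq> G} // alg_rel G R,
      monoid.mult = (\<lambda>X Y. \<Union>x \<in> X. \<Union>y \<in> Y. alg_rel G R `` {Mult x y}),
      one = undefined,
      zero = alg_rel G R `` {Zero},
      add = (\<lambda>X Y. \<Union>x \<in> X. \<Union>y \<in> Y. alg_rel G R `` {Add x y}),
      smult = (\<lambda>a X. \<Union>x \<in> X. alg_rel G R `` {Scale a x})\<rparr>"


subsection \<open>The Kumjian-Pask algebra of a higher-rank graph\<close>

datatype 'p kp_gen = Vert 'p | Path 'p | Ghost 'p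

definition kp_gens :: "('p, 'k::finite) kgraph \<Rightarrow> 'p kp_gen set" where
  "kp_gens \<Lambda> = Vert ` vertices \<Lambda> \<union> Path ` (paths \<Lambda> - vertices \<Lambda>) \<union>
     Ghost ` (paths \<Lambda> - vertices \<Lambda>)"

text \<open>The sum in the last relation is written out along an arbitrary enumeration of its index set.\<close>

inductive kp_relation ::
    "('p, 'k::finite) kgraph \<Rightarrow>
     ('p kp_gen, 'f::field) alg_term \<Rightarrow> ('p kp_gen, 'f) alg_term \<Rightarrow> bool"
  for \<Lambda> where
  KP1: "\<lbrakk>u \<in> vertices \<Lambda>; v \<in> vertices \<Lambda>\<rbrakk> \<Longrightarrow>
     kp_relation \<Lambda> (Mult (Gen (Vert u)) (Gen (Vert v))) (if u = v then Gen (Vert u) else Zero)"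
| KP2_path: "\<lbrakk>\<mu> \<in> paths \<Lambda> - vertices \<Lambda>; \<nu> \<in> paths \<Lambda> - vertices \<Lambda>; src \<Lambda> \<mu> = rng \<Lambda> \<nu>\<rbrakk> \<Longrightarrow>
     kp_relation \<Lambda> (Mult (Gen (Path \<mu>)) (Gen (Path \<nu>))) (Gen (Path (cmp \<Lambda> \<mu> \<nu>)))"
| KP2_ghost: "\<lbrakk>\<mu> \<in> paths \<Lambda> - vertices \<Lambda>; \<nu> \<in> paths \<Lambda> - vertices \<Lambda>; src \<Lambda> \<mu> = rng \<Lambda> \<nu>\<rbrakk> \<Longrightarrow>
     kp_relation \<Lambda> (Mult (Gen (Ghost \<nu>)) (Gen (Ghost \<mu>))) (Gen (Ghost (cmp \<Lambda> \<mu> \<nu>)))"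
| KP2_rng_path: "\<mu> \<in> paths \<Lambda> - vertices \<Lambda> \<Longrightarrow>
     kp_relation \<Lambda> (Mult (Gen (Vert (rng \<Lambda> \<mu>))) (Gen (Path \<mu>))) (Gen (Path \<mu>))"
| KP2_path_src: "\<mu> \<in> paths \<Lambda> - vertices \<Lambda> \<Longrightarrow>
     kp_relation \<Lambda> (Mult (Gen (Path \<mu>)) (Gen (Vert (src \<Lambda> \<mu>)))) (Gen (Path \<mu>))"
| KP2_src_ghost: "\<mu> \<in> paths \<Lambda> - vertices \<Lambda> \<Longrightarrow>
     kp_relation \<Lambda> (Mult (Gen (Vert (src \<Lambda> \<mu>))) (Gen (Ghost \<mu>))) (Gen (Ghost \<mu>))"
| KP2_ghost_rng: "\<mu> \<in> paths \<Lambda> - vertices \<Lambda> \<Longrightarrow>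
     kp_relation \<Lambda> (Mult (Gen (Ghost \<mu>)) (Gen (Vert (rng \<Lambda> \<mu>)))) (Gen (Ghost \<mu>))"
| KP3: "\<lbrakk>\<mu> \<in> paths \<Lambda> - vertices \<Lambda>; \<nu> \<in> paths \<Lambda> - vertices \<Lambda>; deg \<Lambda> \<mu> = deg \<Lambda> \<nu>\<rbrakk> \<Longrightarrow>
     kp_relation \<Lambda> (Mult (Gen (Ghost \<mu>)) (Gen (Path \<nu>)))
       (if \<mu> = \<nu> then Gen (Vert (src \<Lambda> \<mu>)) else Zero)"
| KP4: "\<lbrakk>v \<in> vertices \<Lambda>; n \<noteq> 0; distinct ls; set ls = paths_from \<Lambda> v n\<rbrakk> \<Longrightarrow>
     kp_relation \<Lambda> (Gen (Vert v))
       (foldr (\<lambda>\<mu> t. Add (Mult (Gen (Path \<mu>)) (Gen (Ghost \<mu>))) t) ls Zero)"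

definition kp_base ::
    "'f::field itself \<Rightarrow> ('p, 'k::finite) kgraph \<Rightarrow> ('f, ('p kp_gen, 'f) alg_term set) module" where
  "kp_base F \<Lambda> = presented_algebra (kp_gens \<Lambda>) (kp_relation \<Lambda>)"

definition kp_gen ::
    "'f::field itself \<Rightarrow> ('p, 'k::finite) kgraph \<Rightarrow> 'p kp_gen \<Rightarrow> ('p kp_gen, 'f) alg_term set" where
  "kp_gen F \<Lambda> g = alg_rel (kp_gens \<Lambda>) (kp_relation \<Lambda>) `` {Gen g}"

definition kp_path ::
    "'f::field itself \<Rightarrow> ('p, 'k::finite) kgraph \<Rightarrow> 'p \<Rightarrow> ('p kp_gen, 'f) alg_term set" where
  "kp_path F \<Lambda> \<mu> = kp_gen F \<Lambda> (if \<mu> \<in> vertices \<Lambda> then Vert \<mu> else Path \<mu>)"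

definition kp_ghost ::
    "'f::field itself \<Rightarrow> ('p, 'k::finite) kgraph \<Rightarrow> 'p \<Rightarrow> ('p kp_gen, 'f) alg_term set" where
  "kp_ghost F \<Lambda> \<mu> = kp_gen F \<Lambda> (if \<mu> \<in> vertices \<Lambda> then Vert \<mu> else Ghost \<mu>)"

text \<open>
  When there are finitely many vertices, the sum of the vertex idempotents is the unit.
\<close>

definition kp ::
    "'f::field itself \<Rightarrow> ('p, 'k::finite) kgraph \<Rightarrow>
     ('f, ('p kp_gen, 'f) alg_term set, int ^ 'k) graded_module" where
  "kp F \<Lambda> = module.extend
     ((kp_base F \<Lambda>)\<lparr>one := \<Oplus>\<^bsub>kp_base F \<Lambda>\<^esub> v \<in> vertices \<Lambda>. kp_gen F \<Lambda> (Vert v)\<rparr>)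
     \<lparr>hcomp = (\<lambda>n. lin_span UNIV (kp_base F \<Lambda>)
        {kp_path F \<Lambda> \<mu> \<otimes>\<^bsub>kp_base F \<Lambda>\<^esub> kp_ghost F \<Lambda> \<nu> | \<mu> \<nu>.
           \<mu> \<in> paths \<Lambda> \<and> \<nu> \<in> paths \<Lambda> \<and>
           (\<forall>i. int (deg \<Lambda> \<mu> $ i) - int (deg \<Lambda> \<nu> $ i) = n $ i)})\<rparr>"

end

theory Submission
  imports Defs
begin

text \<open>
  Both \<open>T\<^sub>\<Lambda>\<close> and \<open>V\<^sup>g\<^sup>r(KP(\<Lambda>))\<close> are classified by multisets of pairs \<open>(v, n)\<close>. Such a multiset is
  the type of a graded basis of a module \<open>P\<close>, a finite family of homogeneous elements, each spanning
  a shifted copy of the projective module of a vertex, of which \<open>P\<close> is the direct sum. Replacing a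
  basis element \<open>x\<close> of type \<open>(v, n)\<close> by the elements \<open>T\<^sub>\<alpha> x\<close>, where \<open>\<alpha>\<close> runs over the paths of degree
  \<open>q\<close> with range \<open>v\<close>, changes the type by a defining relation of \<open>T\<^sub>\<Lambda>\<close>. After sufficiently many such
  refinements homogeneous transition matrices have entries in the field, so linear algebra shows that the
  type of a basis is unique up to the relations of \<open>T\<^sub>\<Lambda>\<close> and that graded direct summands of modules
  with a basis have a basis. Hence \<open>T\<^sub>\<Lambda>\<close> and \<open>V\<^sup>g\<^sup>r(KP(\<Lambda>))\<close> are isomorphic and cancellative, and a
  cancellative monoid is recovered from its completion as the positive cone.

  Local finiteness is equivalent to a bound on the number of paths of each degree, and this to a bound,
  for each element of \<open>T\<^sub>\<Lambda>\<close>, on the number of nonzero summands into which it decomposes.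
\<close>

section \<open>Paths and the talented monoid\<close>

text \<open>Raising to a diagonal degree \<open>vec M\<close> presents the talented monoid as a
  direct limit of free commutative monoids on the vertices, the diagonal being cofinal among the
  degrees. Equality and cancellation thereby become equality and cancellation of multisets for large
  \<open>M\<close>. On the side of modules the same passage works because a homogeneous element is a
  finite combination of monomials \<open>S \<mu> \<otimes> T \<nu>\<close> with a fixed difference
  of degrees, and such a monomial, placed between \<open>T \<alpha>\<close> and
  \<open>S \<beta>\<close> of suitable large degrees, becomes zero or a vertex idempotent. The
  obstacle is that the algebra is given by generators and relations, so that nothing in it is
  visibly nonzero. A representation has to show that the vertex idempotents survive and that the
  homogeneous components are independent. Infinite paths are avoided: functions on finite paths,
  taken up to agreement on all paths of large degree, already satisfy the relations.\<close>

definition int_vec :: "nat ^ 'k \<Rightarrow> int ^ 'k" where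
  "int_vec n = (\<chi> i. int (n $ i))"

lemma int_vec_zero [simp]: "int_vec 0 = 0"
  by (simp add: int_vec_def vec_eq_iff)

lemma int_vec_add: "int_vec (p + q) = int_vec p + int_vec q"
  by (simp add: int_vec_def vec_eq_iff)

lemma int_vec_axis: "int_vec (axis i (Suc 0)) = axis i 1"
  by (simp add: int_vec_def vec_eq_iff axis_def)

lemma int_vec_inject [simp]: "int_vec p = int_vec q \<longleftrightarrow> p = q"
  by (simp add: int_vec_def vec_eq_iff)

text \<open>The relations of the talented monoid only concern the unit degrees
  \<open>axis i 1\<close>; this rule carries statements from them to arbitrary degrees.\<close>

lemma vec_nat_induct [case_names zero axis]:
  fixes n :: "nat ^ 'k::finite"
  assumes "P 0" and "\<And>i n. P n \<Longrightarrow> P (axis i 1 + n)"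
  shows "P n"
proof (induction "\<Sum>i\<in>UNIV. n $ i" arbitrary: n)
  case 0
  then have "n = 0" by (simp add: vec_eq_iff)
  then show ?case using assms(1) by simp
next
  case (Suc m)
  obtain i where i: "n $ i \<noteq> 0"
    using Suc.hyps(2) by (metis old.nat.distinct(2) sum.neutral)
  define n' where "n' = (\<chi> j. if j = i then n $ i - 1 else n $ j)"
  have n: "n = axis i 1 + n'"
    using i by (auto simp: vec_eq_iff n'_def axis_def)
  have "(\<Sum>j\<in>UNIV. n $ j) = (\<Sum>j\<in>UNIV. (axis i 1 :: nat ^ 'k) $ j) + (\<Sum>j\<in>UNIV. n' $ j)"
    by (subst n) (simp add: sum.distrib)
  also have "(\<Sum>j\<in>UNIV. (axis i 1 :: nat ^ 'k) $ j) = 1"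
    by (simp add: axis_def)
  finally have "m = (\<Sum>j\<in>UNIV. n' $ j)" using Suc.hyps(2) by simp
  then show ?case using Suc.hyps(1)[of n'] assms(2)[of n' i] n by simp
qed

lemma vec_nat_le_imp_add:
  fixes p q :: "nat ^ 'k::finite"
  assumes "p \<le> q" shows "q = p + (q - p)"
  using assms by (simp add: vec_eq_iff less_eq_vec_def)

section \<open>Paths, vertices and unique factorization\<close>

context k_graph
begin

lemma paths_degD: "\<mu> \<in> paths_deg \<Lambda> n \<Longrightarrow> \<mu> \<in> paths \<Lambda>"
  and deg_paths_deg: "\<mu> \<in> paths_deg \<Lambda> n \<Longrightarrow> deg \<Lambda> \<mu> = n"
  by (simp_all add: paths_deg_def)

lemma paths_fromD: "\<mu> \<in> paths_from \<Lambda> v n \<Longrightarrow> \<mu> \<in> paths \<Lambda>"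
  and rng_paths_from: "\<mu> \<in> paths_from \<Lambda> v n \<Longrightarrow> rng \<Lambda> \<mu> = v"
  and deg_paths_from: "\<mu> \<in> paths_from \<Lambda> v n \<Longrightarrow> deg \<Lambda> \<mu> = n"
  by (simp_all add: paths_deg_def paths_from_def)

lemma paths_fromI:
  "\<mu> \<in> paths \<Lambda> \<Longrightarrow> rng \<Lambda> \<mu> = v \<Longrightarrow> deg \<Lambda> \<mu> = n \<Longrightarrow> \<mu> \<in> paths_from \<Lambda> v n"
  by (simp add: paths_deg_def paths_from_def)

lemma src_vertex [simp]: "\<mu> \<in> paths \<Lambda> \<Longrightarrow> src \<Lambda> \<mu> \<in> vertices \<Lambda>"
  and rng_vertex [simp]: "\<mu> \<in> paths \<Lambda> \<Longrightarrow> rng \<Lambda> \<mu> \<in> vertices \<Lambda>"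
  using vertices_eq_identities by blast+

lemma vertex_path: "v \<in> vertices \<Lambda> \<Longrightarrow> v \<in> paths \<Lambda>"
  by (rule paths_degD)

lemma src_of_vertex [simp]: "v \<in> vertices \<Lambda> \<Longrightarrow> src \<Lambda> v = v"
  and rng_of_vertex [simp]: "v \<in> vertices \<Lambda> \<Longrightarrow> rng \<Lambda> v = v"
  using vertices_eq_identities rng_src src_src rng_rng src_rng by (auto simp: image_iff)

lemma deg_vertex [simp]: "v \<in> vertices \<Lambda> \<Longrightarrow> deg \<Lambda> v = 0"
  by (rule deg_paths_deg)

lemma src_paths_from: "\<mu> \<in> paths_from \<Lambda> v n \<Longrightarrow> src \<Lambda> \<mu> \<in> vertices \<Lambda>"
  by (simp add: paths_fromD)

lemma paths_from_vertex: "\<mu> \<in> paths_from \<Lambda> v n \<Longrightarrow> v \<in> vertices \<Lambda>"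
  using paths_fromD rng_paths_from rng_vertex by blast

lemma paths_from_zero: "v \<in> vertices \<Lambda> \<Longrightarrow> paths_from \<Lambda> v 0 = {v}"
  by (auto simp: paths_from_def)

lemma factorE:
  assumes "\<mu> \<in> paths \<Lambda>" "deg \<Lambda> \<mu> = p + q"
  obtains \<alpha> \<beta> where "\<alpha> \<in> paths \<Lambda>" "\<beta> \<in> paths \<Lambda>" "src \<Lambda> \<alpha> = rng \<Lambda> \<beta>"
    "deg \<Lambda> \<alpha> = p" "deg \<Lambda> \<beta> = q" "\<mu> = cmp \<Lambda> \<alpha> \<beta>"
  using factorization[OF assms] by (auto simp: Ex1_def)

lemma factor_unique:
  assumes "\<alpha> \<in> paths \<Lambda>" "\<beta> \<in> paths \<Lambda>" "src \<Lambda> \<alpha> = rng \<Lambda> \<beta>"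
    and "\<alpha>' \<in> paths \<Lambda>" "\<beta>' \<in> paths \<Lambda>" "src \<Lambda> \<alpha>' = rng \<Lambda> \<beta>'"
    and "deg \<Lambda> \<alpha> = deg \<Lambda> \<alpha>'" "cmp \<Lambda> \<alpha> \<beta> = cmp \<Lambda> \<alpha>' \<beta>'"
  shows "\<alpha> = \<alpha>' \<and> \<beta> = \<beta>'"
proof -
  let ?\<mu> = "cmp \<Lambda> \<alpha> \<beta>"
  have \<mu>: "?\<mu> \<in> paths \<Lambda>" "deg \<Lambda> ?\<mu> = deg \<Lambda> \<alpha> + deg \<Lambda> \<beta>"
    using assms(1-3) by (simp_all add: cmp_closed deg_cmp)
  have "deg \<Lambda> ?\<mu> = deg \<Lambda> \<alpha>' + deg \<Lambda> \<beta>'"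
    using deg_cmp[OF assms(4-6)] assms(8) by simp
  then have "deg \<Lambda> \<alpha> + deg \<Lambda> \<beta> = deg \<Lambda> \<alpha> + deg \<Lambda> \<beta>'" using \<mu>(2) assms(7) by metis
  then have "deg \<Lambda> \<beta>' = deg \<Lambda> \<beta>" by simp
  with assms have "case (\<alpha>', \<beta>') of (\<gamma>, \<delta>) \<Rightarrow>
      \<gamma> \<in> paths \<Lambda> \<and> \<delta> \<in> paths \<Lambda> \<and> src \<Lambda> \<gamma> = rng \<Lambda> \<delta> \<and>
      deg \<Lambda> \<gamma> = deg \<Lambda> \<alpha> \<and> deg \<Lambda> \<delta> = deg \<Lambda> \<beta> \<and> ?\<mu> = cmp \<Lambda> \<gamma> \<delta>"
    by (simp only: prod.case simp_thms)
  moreover have "case (\<alpha>, \<beta>) of (\<gamma>, \<delta>) \<Rightarrow>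
      \<gamma> \<in> paths \<Lambda> \<and> \<delta> \<in> paths \<Lambda> \<and> src \<Lambda> \<gamma> = rng \<Lambda> \<delta> \<and>
      deg \<Lambda> \<gamma> = deg \<Lambda> \<alpha> \<and> deg \<Lambda> \<delta> = deg \<Lambda> \<beta> \<and> ?\<mu> = cmp \<Lambda> \<gamma> \<delta>"
    using assms(1-3) by (simp only: prod.case simp_thms)
  ultimately have "(\<alpha>, \<beta>) = (\<alpha>', \<beta>')"
    using factorization[OF \<mu>] unfolding Ex1_def by blast
  then show ?thesis by simp
qed

text \<open>The factorization property as a reindexing rule: a sum over paths of degree
  \<open>p + q\<close> becomes a double sum, which is how successive expansions are
  composed.\<close>

lemma bij_betw_cmp:
  "bij_betw (\<lambda>(\<alpha>, \<beta>). cmp \<Lambda> \<alpha> \<beta>)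
     (SIGMA \<alpha>:paths_from \<Lambda> v p. paths_from \<Lambda> (src \<Lambda> \<alpha>) q) (paths_from \<Lambda> v (p + q))"
  (is "bij_betw ?c ?A ?B")
proof (rule bij_betw_imageI)
  show "inj_on ?c ?A"
  proof (rule inj_onI, clarify)
    fix \<alpha> \<beta> \<alpha>' \<beta>'
    assume "\<alpha> \<in> paths_from \<Lambda> v p" "\<beta> \<in> paths_from \<Lambda> (src \<Lambda> \<alpha>) q"
      "\<alpha>' \<in> paths_from \<Lambda> v p" "\<beta>' \<in> paths_from \<Lambda> (src \<Lambda> \<alpha>') q" "cmp \<Lambda> \<alpha> \<beta> = cmp \<Lambda> \<alpha>' \<beta>'"
    then show "\<alpha> = \<alpha>' \<and> \<beta> = \<beta>'"
      by (intro factor_unique) (simp_all add: paths_fromD rng_paths_from deg_paths_from)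
  qed
  show "?c ` ?A = ?B"
  proof
    show "?c ` ?A \<subseteq> ?B"
      by (auto intro!: paths_fromI simp: cmp_closed rng_cmp deg_cmp paths_fromD rng_paths_from deg_paths_from)
    show "?B \<subseteq> ?c ` ?A"
    proof
      fix \<mu> assume \<mu>: "\<mu> \<in> ?B"
      obtain \<alpha> \<beta> where f: "\<alpha> \<in> paths \<Lambda>" "\<beta> \<in> paths \<Lambda>" "src \<Lambda> \<alpha> = rng \<Lambda> \<beta>"
        "deg \<Lambda> \<alpha> = p" "deg \<Lambda> \<beta> = q" "\<mu> = cmp \<Lambda> \<alpha> \<beta>"
        using factorE[OF paths_fromD[OF \<mu>] deg_paths_from[OF \<mu>]] .
      then have "rng \<Lambda> \<alpha> = v" using rng_cmp rng_paths_from[OF \<mu>] by simp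
      then have "(\<alpha>, \<beta>) \<in> ?A" using f by (auto intro: paths_fromI)
      then show "\<mu> \<in> ?c ` ?A" using f by force
    qed
  qed
qed

end

context row_finite_k_graph
begin

lemma finite_paths_from [simp]: "finite (paths_from \<Lambda> v n)"
proof (cases "v \<in> vertices \<Lambda>")
  case False
  then have "paths_from \<Lambda> v n = {}" using paths_from_vertex by blast
  then show ?thesis by simp
qed (rule row_finite)

lemma sum_paths_from_add:
  "(\<Sum>\<mu>\<in>paths_from \<Lambda> v (p + q). f \<mu>) =
     (\<Sum>\<alpha>\<in>paths_from \<Lambda> v p. \<Sum>\<beta>\<in>paths_from \<Lambda> (src \<Lambda> \<alpha>) q. f (cmp \<Lambda> \<alpha> \<beta>))"
  by (subst sum.Sigma) (simp_all add: sum.reindex_bij_betw[OF bij_betw_cmp, symmetric] case_prod_unfold)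

lemma src_cmp_paths_from:
  "\<alpha> \<in> paths_from \<Lambda> v p \<Longrightarrow> \<beta> \<in> paths_from \<Lambda> (src \<Lambda> \<alpha>) q \<Longrightarrow> src \<Lambda> (cmp \<Lambda> \<alpha> \<beta>) = src \<Lambda> \<beta>"
  by (simp add: src_cmp paths_fromD rng_paths_from)

end

section \<open>Expansion of types in the talented monoid\<close>

lemma image_mset_mset_set_eq_sum:
  "finite A \<Longrightarrow> image_mset f (mset_set A) = (\<Sum>a\<in>A. {#f a#})"
  by (induction A rule: finite_induct) simp_all

lemma image_mset_sum: "image_mset f (\<Sum>a\<in>A. g a) = (\<Sum>a\<in>A. image_mset f (g a))"
  by (induction A rule: infinite_finite_induct) simp_all

declare talented_eq.trans [trans]

lemma talented_eq_add:
  "talented_eq \<Lambda> x y \<Longrightarrow> talented_eq \<Lambda> x' y' \<Longrightarrow> talented_eq \<Lambda> (x + x') (y + y')"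
  by (metis add.commute talented_eq.add talented_eq.trans)

lemma talented_eq_sum:
  assumes "\<And>a. a \<in> A \<Longrightarrow> talented_eq \<Lambda> (f a) (g a)"
  shows "talented_eq \<Lambda> (\<Sum>a\<in>A. f a) (\<Sum>a\<in>A. g a)"
  using assms
  by (induction A rule: infinite_finite_induct) (auto intro: talented_eq.refl talented_eq_add)

lemma talented_eq_sum_mset:
  assumes "\<And>a. a \<in># A \<Longrightarrow> talented_eq \<Lambda> (f a) (g a)"
  shows "talented_eq \<Lambda> (\<Sum>a\<in>#A. f a) (\<Sum>a\<in>#A. g a)"
  using assms by (induction A) (auto intro: talented_eq.refl talented_eq_add)

text \<open>The right-hand side of the defining relation for an arbitrary degree \<open>q\<close> in
  place of a unit vector.\<close>

definition unfold :: "('p, 'k::finite) kgraph \<Rightarrow> nat ^ 'k \<Rightarrow> 'p \<times> (int ^ 'k) \<Rightarrow> ('p \<times> (int ^ 'k)) multiset" where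
  "unfold \<Lambda> q t = (\<Sum>\<alpha>\<in>paths_from \<Lambda> (fst t) q. {#(src \<Lambda> \<alpha>, snd t + int_vec q)#})"

text \<open>The degree \<open>vec M - n\<close> along which a generator in degree \<open>n\<close> is expanded to
  reach the diagonal degree \<open>vec M\<close>; it is truncated unless \<open>n \<le> vec M\<close>.\<close>

definition gap :: "int \<Rightarrow> int ^ 'k \<Rightarrow> nat ^ 'k" where
  "gap M n = (\<chi> i. nat (M - n $ i))"

text \<open>All entries end in the degree \<open>vec M\<close>, so only their vertices are kept. The
  function is total and additive for every \<open>M\<close>, but has its intended meaning only under
  \<open>below M x\<close>.\<close>

definition raise :: "('p, 'k::finite) kgraph \<Rightarrow> int \<Rightarrow> ('p \<times> (int ^ 'k)) multiset \<Rightarrow> 'p multiset" where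
  "raise \<Lambda> M x = (\<Sum>t\<in>#x. \<Sum>\<alpha>\<in>paths_from \<Lambda> (fst t) (gap M (snd t)). {#src \<Lambda> \<alpha>#})"

abbreviation at_level :: "int \<Rightarrow> 'p multiset \<Rightarrow> ('p \<times> (int ^ 'k)) multiset" where
  "at_level M \<equiv> image_mset (\<lambda>v. (v, vec M))"

definition below :: "int \<Rightarrow> ('p \<times> (int ^ 'k)) multiset \<Rightarrow> bool" where
  "below M x \<longleftrightarrow> (\<forall>t\<in>#x. snd t \<le> vec M)"

lemma int_vec_gap: "n \<le> vec M \<Longrightarrow> n + int_vec (gap M n) = vec M"
  by (simp add: int_vec_def gap_def vec_eq_iff less_eq_vec_def)

text \<open>One step in direction \<open>i\<close> uses up one unit of the gap; the hypothesis
  excludes truncation in that coordinate.\<close>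

lemma gap_axis:
  fixes n :: "int ^ 'k::finite"
  assumes "n + axis i 1 \<le> vec M"
  shows "gap M n = axis i 1 + gap M (n + axis i 1)"
proof -
  have "n $ i + 1 \<le> M"
    using assms by (auto simp: less_eq_vec_def dest: spec[of _ i])
  then show ?thesis
    by (auto simp: vec_eq_iff gap_def axis_def)
qed

lemma raise_empty [simp]: "raise \<Lambda> M {#} = {#}"
  and raise_add [simp]: "raise \<Lambda> M (x + y) = raise \<Lambda> M x + raise \<Lambda> M y"
  by (simp_all add: raise_def)

lemma raise_sum: "raise \<Lambda> M (\<Sum>a\<in>A. f a) = (\<Sum>a\<in>A. raise \<Lambda> M (f a))"
  by (induction A rule: infinite_finite_induct) simp_all

text \<open>A finite multiset has only finitely many coordinates to dominate.\<close>

lemma eventually_below: "\<forall>\<^sub>F M in at_top. below M x"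
proof (induction x)
  case (add t x)
  have "\<forall>\<^sub>F M in at_top. snd t \<le> vec M"
    unfolding less_eq_vec_def by (auto intro!: eventually_all_finite eventually_ge_at_top)
  with add show ?case by (auto simp: below_def elim: eventually_elim2)
qed (simp add: below_def)

context row_finite_k_graph
begin

text \<open>Induction on the degree: one defining relation in direction \<open>i\<close>, then the
  induction hypothesis at every source, and unique factorization merges the two stages.\<close>

lemma talented_eq_unfold:
  assumes "v \<in> vertices \<Lambda>"
  shows "talented_eq \<Lambda> {#(v, n)#} (unfold \<Lambda> q (v, n))"
  using assms
proof (induction q arbitrary: v n rule: vec_nat_induct)
  case zero
  then show ?case by (simp add: unfold_def paths_from_zero talented_eq.refl)
next
  case (axis i q)
  have "talented_eq \<Lambda> {#(v, n)#} (\<Sum>\<alpha>\<in>paths_from \<Lambda> v (axis i 1). {#(src \<Lambda> \<alpha>, n + axis i 1)#})"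
    using talented_eq.relation[OF axis.prems, of n i] by (simp add: image_mset_mset_set_eq_sum)
  also have "talented_eq \<Lambda> \<dots>
      (\<Sum>\<alpha>\<in>paths_from \<Lambda> v (axis i 1). unfold \<Lambda> q (src \<Lambda> \<alpha>, n + axis i 1))"
    by (rule talented_eq_sum) (simp add: axis.IH src_paths_from)
  also have "(\<Sum>\<alpha>\<in>paths_from \<Lambda> v (axis i 1). unfold \<Lambda> q (src \<Lambda> \<alpha>, n + axis i 1)) =
      unfold \<Lambda> (axis i 1 + q) (v, n)"
    unfolding unfold_def
    by (simp add: sum_paths_from_add src_cmp_paths_from int_vec_add int_vec_axis add.assoc)
  finally show ?case .
qed

lemma talented_eq_raise:
  assumes "set_mset x \<subseteq> vertices \<Lambda> \<times> UNIV" "below M x"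
  shows "talented_eq \<Lambda> x (at_level M (raise \<Lambda> M x))"
proof -
  have "talented_eq \<Lambda> (\<Sum>t\<in>#x. {#t#}) (\<Sum>t\<in>#x. unfold \<Lambda> (gap M (snd t)) t)"
    using assms by (intro talented_eq_sum_mset) (use talented_eq_unfold in force)
  also have "(\<Sum>t\<in>#x. unfold \<Lambda> (gap M (snd t)) t) = at_level M (raise \<Lambda> M x)"
    using assms(2)
    by (induction x) (auto simp: raise_def unfold_def int_vec_gap below_def image_mset_sum)
  finally show ?thesis by simp
qed

text \<open>The two sides of a defining relation raise alike because the paths of degree
  \<open>gap M n\<close> factor through degree \<open>axis i 1\<close>. Truncation would break this
  factorization, hence the restriction to large \<open>M\<close>; the filter also absorbs the
  different thresholds met in a transitive step.\<close>

lemma talented_eq_eventually_raise: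
  "talented_eq \<Lambda> x y \<Longrightarrow> \<forall>\<^sub>F M in at_top. raise \<Lambda> M x = raise \<Lambda> M y"
proof (induction rule: talented_eq.induct)
  case (relation v n i)
  show ?case
    using eventually_below[of "{#(v, n + axis i 1)#}"]
  proof eventually_elim
    case (elim M)
    then have "gap M n = axis i 1 + gap M (n + axis i 1)"
      by (intro gap_axis) (simp add: below_def)
    then show ?case
      by (simp add: image_mset_mset_set_eq_sum raise_sum)
        (simp add: raise_def sum_paths_from_add src_cmp_paths_from)
  qed
next
  case (trans x y z)
  from trans.IH show ?case by eventually_elim simp
next
  case (sym x y)
  from sym.IH show ?case by eventually_elim (rule HOL.sym)
next
  case (refl x)
  show ?case by simp
next
  case (add x y z)
  from add.IH show ?case by (simp only: raise_add add_right_cancel)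
qed

text \<open>Replaces derivability, which is hard to refute, by an equality of multisets of vertices.
  Cancellation and nontriviality are read off from it.\<close>

lemma talented_eq_iff_raise:
  assumes "set_mset x \<subseteq> vertices \<Lambda> \<times> UNIV" "set_mset y \<subseteq> vertices \<Lambda> \<times> UNIV"
  shows "talented_eq \<Lambda> x y \<longleftrightarrow> (\<forall>\<^sub>F M in at_top. raise \<Lambda> M x = raise \<Lambda> M y)"
proof
  assume "\<forall>\<^sub>F M in at_top. raise \<Lambda> M x = raise \<Lambda> M y"
  then have "\<forall>\<^sub>F M in at_top. raise \<Lambda> M x = raise \<Lambda> M y \<and> below M x \<and> below M y"
    by (intro eventually_conj eventually_below)
  then obtain M where "raise \<Lambda> M x = raise \<Lambda> M y" "below M x" "below M y"
    using eventually_happens[of _ "at_top :: int filter"] by auto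
  then show "talented_eq \<Lambda> x y"
    using talented_eq_raise[OF assms(1), of M] talented_eq_raise[OF assms(2), of M]
    by (auto intro: talented_eq.trans talented_eq.sym)
qed (rule talented_eq_eventually_raise)

text \<open>\<open>raise\<close> is additive and multisets cancel.\<close>

lemma talented_eq_cancel:
  assumes "set_mset x \<subseteq> vertices \<Lambda> \<times> UNIV" "set_mset y \<subseteq> vertices \<Lambda> \<times> UNIV"
    and "talented_eq \<Lambda> (x + z) (y + z)"
  shows "talented_eq \<Lambda> x y"
  using talented_eq_eventually_raise[OF assms(3)] by (simp add: talented_eq_iff_raise[OF assms(1,2)])

lemma talented_eq_act:
  "talented_eq \<Lambda> x y \<Longrightarrow>
     talented_eq \<Lambda> (image_mset (\<lambda>(v, n). (v, n + q)) x) (image_mset (\<lambda>(v, n). (v, n + q)) y)"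
proof (induction rule: talented_eq.induct)
  case (relation v n i)
  show ?case
    using talented_eq.relation[OF relation, of "n + q" i]
    by (simp add: multiset.map_comp comp_def ac_simps)
qed (auto intro: talented_eq.intros)

text \<open>Absence of sources provides, for each entry, a path of the degree along which it is
  expanded.\<close>

lemma raise_nonempty:
  assumes "x \<noteq> {#}" "set_mset x \<subseteq> vertices \<Lambda> \<times> UNIV"
  shows "raise \<Lambda> M x \<noteq> {#}"
proof -
  obtain v n x' where x: "x = add_mset (v, n) x'" "v \<in> vertices \<Lambda>"
    using assms by (metis SigmaD1 insert_subset multiset_cases set_mset_add_mset_insert surj_pair)
  obtain \<alpha> where "\<alpha> \<in> paths_from \<Lambda> v (gap M n)" using x no_sources by blast
  then have "(\<Sum>\<alpha>\<in>paths_from \<Lambda> v (gap M n). {#src \<Lambda> \<alpha>#}) =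
      {#src \<Lambda> \<alpha>#} + (\<Sum>\<alpha>\<in>paths_from \<Lambda> v (gap M n) - {\<alpha>}. {#src \<Lambda> \<alpha>#})"
    by (intro sum.remove) simp
  then have "raise \<Lambda> M x = add_mset (src \<Lambda> \<alpha>)
      ((\<Sum>\<alpha>\<in>paths_from \<Lambda> v (gap M n) - {\<alpha>}. {#src \<Lambda> \<alpha>#}) + raise \<Lambda> M x')"
    using x by (simp add: raise_def)
  then show ?thesis by simp
qed

end

section \<open>Algebras over a field\<close>

locale scalar_group = abelian_group V for V :: "('f::field, 'a, 'z) module_scheme" (structure) +
  assumes scale_closed [simp]: "x \<in> carrier V \<Longrightarrow> c \<odot> x \<in> carrier V"
    and scale_add: "\<lbrakk>x \<in> carrier V; y \<in> carrier V\<rbrakk> \<Longrightarrow> c \<odot> (x \<oplus> y) = c \<odot> x \<oplus> c \<odot> y"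
    and scale_plus: "x \<in> carrier V \<Longrightarrow> (c + d) \<odot> x = c \<odot> x \<oplus> d \<odot> x"
    and scale_times: "x \<in> carrier V \<Longrightarrow> (c * d) \<odot> x = c \<odot> (d \<odot> x)"
    and scale_one [simp]: "x \<in> carrier V \<Longrightarrow> 1 \<odot> x = x"
begin

lemma scale_zero_left [simp]: "x \<in> carrier V \<Longrightarrow> 0 \<odot> x = \<zero>"
  using scale_plus[of x 0 0] by (simp add: add.l_cancel_one)

lemma scale_zero_right [simp]: "c \<odot> \<zero> = \<zero>"
  using scale_add[of \<zero> \<zero> c] by simp

lemma scale_minus_one: "x \<in> carrier V \<Longrightarrow> (- 1) \<odot> x = \<ominus> x"
  using scale_plus[of x "- 1" 1] by (simp add: minus_equality)

lemma scale_finsum: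
  "finite I \<Longrightarrow> f \<in> I \<rightarrow> carrier V \<Longrightarrow> c \<odot> (\<Oplus>i\<in>I. f i) = (\<Oplus>i\<in>I. c \<odot> f i)"
  by (induction I rule: finite_induct) (auto simp: scale_add Pi_iff)

definition subspace :: "'a set \<Rightarrow> bool" where
  "subspace U \<longleftrightarrow> U \<subseteq> carrier V \<and> \<zero> \<in> U \<and> (\<forall>x\<in>U. \<forall>y\<in>U. x \<oplus> y \<in> U) \<and> (\<forall>c. \<forall>x\<in>U. c \<odot> x \<in> U)"

lemma subspace_minus: "subspace U \<Longrightarrow> x \<in> U \<Longrightarrow> \<ominus> x \<in> U"
  unfolding subspace_def by (metis scale_minus_one subsetD)

lemma subspace_finsum:
  "finite I \<Longrightarrow> subspace U \<Longrightarrow> (\<And>i. i \<in> I \<Longrightarrow> f i \<in> U) \<Longrightarrow> (\<Oplus>i\<in>I. f i) \<in> U"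
proof (induction I rule: finite_induct)
  case (insert i I)
  then have "f i \<in> carrier V" "f \<in> I \<rightarrow> carrier V" by (auto simp: subspace_def)
  then show ?case using insert by (simp add: subspace_def)
qed (simp add: subspace_def)

lemma lin_span_subset: "subspace U \<Longrightarrow> B \<subseteq> U \<Longrightarrow> lin_span UNIV V B \<subseteq> U"
  by (auto simp: lin_span_def intro!: subspace_finsum) (auto simp: subspace_def)

lemma lin_span_superset:
  assumes "B \<subseteq> carrier V" shows "B \<subseteq> lin_span UNIV V B"
proof
  fix x assume "x \<in> B"
  then have "(\<Oplus>y\<in>{x}. 1 \<odot> y) = x" using assms by auto
  then show "x \<in> lin_span UNIV V B"
    unfolding lin_span_def using \<open>x \<in> B\<close> by (intro CollectI exI[of _ "{x}"] exI[of _ "\<lambda>_. 1"]) auto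
qed

text \<open>Both combinations are extended by zero coefficients to the union of their supports.
  Taking \<open>c = 1\<close>, or the first vector zero, gives the two closure properties of a
  subspace.\<close>

lemma lin_span_combination:
  assumes "B \<subseteq> carrier V" "x \<in> lin_span UNIV V B" "y \<in> lin_span UNIV V B"
  shows "x \<oplus> c \<odot> y \<in> lin_span UNIV V B"
proof -
  obtain F a where x: "x = (\<Oplus>v\<in>F. a v \<odot> v)" "finite F" "F \<subseteq> B"
    using assms(2) by (auto simp: lin_span_def)
  obtain G b where y: "y = (\<Oplus>v\<in>G. b v \<odot> v)" "finite G" "G \<subseteq> B"
    using assms(3) by (auto simp: lin_span_def)
  have ext: "(\<Oplus>v\<in>H. f v \<odot> v) = (\<Oplus>v\<in>F \<union> G. (if v \<in> H then f v else 0) \<odot> v)"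
    if "H \<subseteq> F \<union> G" for H f
  proof (rule add.finprod_mono_neutral_cong_left)
    show "finite (F \<union> G)" "H \<subseteq> F \<union> G" using x y that by auto
    show "(if v \<in> H then f v else 0) \<odot> v = \<zero>\<^bsub>V\<^esub>" if "v \<in> F \<union> G - H" for v
      using that x y assms(1) by auto
    show "f v \<odot> v = (if v \<in> H then f v else 0) \<odot> v" if "v \<in> H" for v
      using that by simp
    show "(\<lambda>v. (if v \<in> H then f v else 0) \<odot> v) \<in> F \<union> G \<rightarrow> carrier V"
      using x y assms(1) by auto
  qed
  have c: "v \<in> carrier V" if "v \<in> F \<union> G" for v using that x y assms(1) by auto
  have "x \<oplus> c \<odot> y = (\<Oplus>v\<in>F \<union> G. (if v \<in> F then a v else 0) \<odot> v) \<oplus>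
      c \<odot> (\<Oplus>v\<in>F \<union> G. (if v \<in> G then b v else 0) \<odot> v)"
    unfolding x(1) y(1) by (subst (1 2) ext) auto
  also have "\<dots> = (\<Oplus>v\<in>F \<union> G. (if v \<in> F then a v else 0) \<odot> v \<oplus> c \<odot> ((if v \<in> G then b v else 0) \<odot> v))"
    using x y c by (subst scale_finsum) (auto simp: finsum_addf)
  also have "\<dots> = (\<Oplus>v\<in>F \<union> G. ((if v \<in> F then a v else 0) + c * (if v \<in> G then b v else 0)) \<odot> v)"
    using c by (intro finsum_cong') (auto simp: scale_plus scale_times)
  finally show ?thesis
    unfolding lin_span_def using x y
    by (intro CollectI exI[of _ "F \<union> G"]
        exI[of _ "\<lambda>v. (if v \<in> F then a v else 0) + c * (if v \<in> G then b v else 0)"]) auto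
qed

lemma subspace_lin_span:
  assumes "B \<subseteq> carrier V" shows "subspace (lin_span UNIV V B)"
proof -
  have "lin_span UNIV V B \<subseteq> carrier V"
    by (rule lin_span_subset) (use assms in \<open>auto simp: subspace_def\<close>)
  moreover have zero: "\<zero> \<in> lin_span UNIV V B"
    unfolding lin_span_def by (intro CollectI exI[of _ "{}"]) auto
  moreover have "x \<oplus> y \<in> lin_span UNIV V B"
    if "x \<in> lin_span UNIV V B" "y \<in> lin_span UNIV V B" for x y
    using lin_span_combination[OF assms that, of 1] calculation(1) that by auto
  moreover have "c \<odot> x \<in> lin_span UNIV V B" if "x \<in> lin_span UNIV V B" for c x
    using lin_span_combination[OF assms zero that, of c] calculation(1) that by auto
  ultimately show ?thesis by (auto simp: subspace_def)
qed

end

locale field_algebra = scalar_group A for A :: "('f::field, 'a, 'z) module_scheme" (structure) +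
  assumes mult_closed [simp]: "\<lbrakk>x \<in> carrier A; y \<in> carrier A\<rbrakk> \<Longrightarrow> x \<otimes> y \<in> carrier A"
    and mult_assoc: "\<lbrakk>x \<in> carrier A; y \<in> carrier A; z \<in> carrier A\<rbrakk> \<Longrightarrow> (x \<otimes> y) \<otimes> z = x \<otimes> (y \<otimes> z)"
    and mult_add_left: "\<lbrakk>x \<in> carrier A; y \<in> carrier A; z \<in> carrier A\<rbrakk> \<Longrightarrow>
           (x \<oplus> y) \<otimes> z = x \<otimes> z \<oplus> y \<otimes> z"
    and mult_add_right: "\<lbrakk>x \<in> carrier A; y \<in> carrier A; z \<in> carrier A\<rbrakk> \<Longrightarrow>
           z \<otimes> (x \<oplus> y) = z \<otimes> x \<oplus> z \<otimes> y"
    and mult_scale_left: "\<lbrakk>x \<in> carrier A; y \<in> carrier A\<rbrakk> \<Longrightarrow> (c \<odot> x) \<otimes> y = c \<odot> (x \<otimes> y)"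
    and mult_scale_right: "\<lbrakk>x \<in> carrier A; y \<in> carrier A\<rbrakk> \<Longrightarrow> x \<otimes> (c \<odot> y) = c \<odot> (x \<otimes> y)"
begin

lemma mult_zero_left [simp]: "x \<in> carrier A \<Longrightarrow> \<zero> \<otimes> x = \<zero>"
  using mult_scale_left[of x x 0] by simp

lemma mult_zero_right [simp]: "x \<in> carrier A \<Longrightarrow> x \<otimes> \<zero> = \<zero>"
  using mult_scale_right[of x x 0] by simp

lemma finsum_mult_left:
  "finite I \<Longrightarrow> f \<in> I \<rightarrow> carrier A \<Longrightarrow> x \<in> carrier A \<Longrightarrow> (\<Oplus>i\<in>I. f i) \<otimes> x = (\<Oplus>i\<in>I. f i \<otimes> x)"
  by (induction I rule: finite_induct) (auto simp: mult_add_left Pi_iff)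

lemma finsum_mult_right:
  "finite I \<Longrightarrow> f \<in> I \<rightarrow> carrier A \<Longrightarrow> x \<in> carrier A \<Longrightarrow> x \<otimes> (\<Oplus>i\<in>I. f i) = (\<Oplus>i\<in>I. x \<otimes> f i)"
  by (induction I rule: finite_induct) (auto simp: mult_add_right Pi_iff)

end

section \<open>Algebras presented by generators and relations\<close>

locale presentation =
  fixes G :: "'g set" and R :: "('g, 'f::field) alg_term \<Rightarrow> ('g, 'f) alg_term \<Rightarrow> bool"
begin

definition cls :: "('g, 'f) alg_term \<Rightarrow> ('g, 'f) alg_term set" where
  "cls x = alg_rel G R `` {x}"

abbreviation "Q \<equiv> presented_algebra G R"

lemma equiv_alg_rel: "equiv {x. gens x \<subseteq> G} (alg_rel G R)"
  by (rule equivI)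
    (auto simp: alg_rel_def refl_on_def sym_def trans_def intro: alg_eq.refl alg_eq.sym alg_eq.trans)

lemma cls_closed [simp]: "gens x \<subseteq> G \<Longrightarrow> cls x \<in> carrier Q"
  by (auto simp: cls_def presented_algebra_def intro: quotientI)

lemma carrierE:
  assumes "X \<in> carrier Q" obtains x where "gens x \<subseteq> G" "X = cls x"
  using assms by (auto simp: cls_def presented_algebra_def elim: quotientE)

lemma cls_eq_iff: "gens x \<subseteq> G \<Longrightarrow> gens y \<subseteq> G \<Longrightarrow> cls x = cls y \<longleftrightarrow> alg_eq R x y"
  unfolding cls_def
  using eq_equiv_class_iff[OF equiv_alg_rel, of x y] by (simp add: alg_rel_def)

lemma cls_eqI: "gens x \<subseteq> G \<Longrightarrow> gens y \<subseteq> G \<Longrightarrow> alg_eq R x y \<Longrightarrow> cls x = cls y"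
  by (simp add: cls_eq_iff)

lemma in_cls: "gens x \<subseteq> G \<Longrightarrow> y \<in> cls x \<longleftrightarrow> gens y \<subseteq> G \<and> alg_eq R x y"
  by (simp add: cls_def alg_rel_def)

lemma zero_class: "\<zero>\<^bsub>Q\<^esub> = cls Zero"
  by (simp add: presented_algebra_def cls_def)

lemma add_class:
  assumes "gens x \<subseteq> G" "gens y \<subseteq> G"
  shows "cls x \<oplus>\<^bsub>Q\<^esub> cls y = cls (Add x y)"
proof -
  have "(\<lambda>x y. alg_rel G R `` {Add x y}) respects2 alg_rel G R"
    by (rule congruent2I'[OF equiv_class_eq[OF equiv_alg_rel]])
      (auto simp: alg_rel_def intro: alg_eq.cong_Add)
  then show ?thesis
    unfolding cls_def presented_algebra_def ring.simps
    by (simp add: UN_equiv_class2[OF equiv_alg_rel equiv_alg_rel] assms)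
qed

lemma mult_class:
  assumes "gens x \<subseteq> G" "gens y \<subseteq> G"
  shows "cls x \<otimes>\<^bsub>Q\<^esub> cls y = cls (Mult x y)"
proof -
  have "(\<lambda>x y. alg_rel G R `` {Mult x y}) respects2 alg_rel G R"
    by (rule congruent2I'[OF equiv_class_eq[OF equiv_alg_rel]])
      (auto simp: alg_rel_def intro: alg_eq.cong_Mult)
  then show ?thesis
    unfolding cls_def presented_algebra_def monoid.simps
    by (simp add: UN_equiv_class2[OF equiv_alg_rel equiv_alg_rel] assms)
qed

lemma scale_class:
  assumes "gens x \<subseteq> G"
  shows "c \<odot>\<^bsub>Q\<^esub> cls x = cls (Scale c x)"
proof -
  have "(\<lambda>x. alg_rel G R `` {Scale c x}) respects alg_rel G R"
    by (rule congruentI, rule equiv_class_eq[OF equiv_alg_rel])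
      (auto simp: alg_rel_def intro: alg_eq.cong_Scale)
  then show ?thesis
    unfolding cls_def presented_algebra_def module.simps
    by (simp add: UN_equiv_class[OF equiv_alg_rel] assms)
qed

lemmas class_simps = zero_class add_class mult_class scale_class

text \<open>Each axiom of an algebra is an introduction rule of \<open>alg_eq\<close>, so it can be
  checked on representatives.\<close>

lemma field_algebra_presented: "field_algebra Q"
proof -
  have [simp]: "gens (Zero :: ('g, 'f) alg_term) \<subseteq> G" by simp
  have gr: "abelian_group Q"
  proof (rule abelian_groupI)
    show "\<exists>y\<in>carrier Q. y \<oplus>\<^bsub>Q\<^esub> x = \<zero>\<^bsub>Q\<^esub>" if "x \<in> carrier Q" for x
      using that
    proof (rule carrierE)
      fix t assume "gens t \<subseteq> G" "x = cls t"
      then show ?thesis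
        by (intro bexI[of _ "cls (Scale (- 1) t)"])
          (auto simp: class_simps cls_eq_iff del: equalityI intro: alg_eq.Add_minus)
    qed
  qed (auto elim!: carrierE simp: class_simps cls_eq_iff del: equalityI
      intro: alg_eq.Add_assoc alg_eq.Add_comm alg_eq.Add_Zero)
  show ?thesis
    by (intro field_algebra.intro scalar_group.intro gr scalar_group_axioms.intro field_algebra_axioms.intro)
      (auto elim!: carrierE simp: class_simps cls_eq_iff del: equalityI
        intro: alg_eq.Scale_Add alg_eq.Scale_plus alg_eq.Scale_times alg_eq.Scale_one
          alg_eq.Mult_assoc alg_eq.Mult_Add_left alg_eq.Mult_Add_right
          alg_eq.Scale_Mult_left alg_eq.Scale_Mult_right)
qed

end

section \<open>A representation of the Kumjian-Pask relations\<close>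

text \<open>
  The generators act on functions of a degree and a path by prefixing and deleting paths.
  The relation \<open>KP4\<close> fails on short paths, so functions are identified when they agree on all
  paths of sufficiently large degree.
\<close>

definition path_action :: "('p, 'k::finite) kgraph \<Rightarrow> 'p \<Rightarrow> (int ^ 'k \<Rightarrow> 'p \<Rightarrow> 'f::field) \<Rightarrow> int ^ 'k \<Rightarrow> 'p \<Rightarrow> 'f" where
  "path_action \<Lambda> \<mu> f m \<nu> =
     (if \<exists>\<rho>\<in>paths \<Lambda>. \<mu> \<in> paths \<Lambda> \<and> src \<Lambda> \<mu> = rng \<Lambda> \<rho> \<and> \<nu> = cmp \<Lambda> \<mu> \<rho>
      then f (m - int_vec (deg \<Lambda> \<mu>)) (THE \<rho>. \<rho> \<in> paths \<Lambda> \<and> src \<Lambda> \<mu> = rng \<Lambda> \<rho> \<and> \<nu> = cmp \<Lambda> \<mu> \<rho>)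
      else 0)"

definition ghost_action :: "('p, 'k::finite) kgraph \<Rightarrow> 'p \<Rightarrow> (int ^ 'k \<Rightarrow> 'p \<Rightarrow> 'f::field) \<Rightarrow> int ^ 'k \<Rightarrow> 'p \<Rightarrow> 'f" where
  "ghost_action \<Lambda> \<mu> f m \<nu> =
     (if \<mu> \<in> paths \<Lambda> \<and> src \<Lambda> \<mu> = rng \<Lambda> \<nu> then f (m + int_vec (deg \<Lambda> \<mu>)) (cmp \<Lambda> \<mu> \<nu>) else 0)"

fun gen_action :: "('p, 'k::finite) kgraph \<Rightarrow> 'p kp_gen \<Rightarrow> (int ^ 'k \<Rightarrow> 'p \<Rightarrow> 'f::field) \<Rightarrow> int ^ 'k \<Rightarrow> 'p \<Rightarrow> 'f" where
  "gen_action \<Lambda> (Vert v) f = (\<lambda>m \<nu>. if rng \<Lambda> \<nu> = v then f m \<nu> else 0)"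
| "gen_action \<Lambda> (Path \<mu>) f = path_action \<Lambda> \<mu> f"
| "gen_action \<Lambda> (Ghost \<mu>) f = ghost_action \<Lambda> \<mu> f"

text \<open>Terms are evaluated as operators before any quotient is formed, products as
  compositions. The relations then only need to hold up to \<open>agree\<close>.\<close>

primrec rep :: "('p, 'k::finite) kgraph \<Rightarrow> ('p kp_gen, 'f::field) alg_term \<Rightarrow>
    (int ^ 'k \<Rightarrow> 'p \<Rightarrow> 'f) \<Rightarrow> int ^ 'k \<Rightarrow> 'p \<Rightarrow> 'f" where
  "rep \<Lambda> (Gen g) f = gen_action \<Lambda> g f"
| "rep \<Lambda> Zero f = (\<lambda>m \<nu>. 0)"
| "rep \<Lambda> (Add x y) f = (\<lambda>m \<nu>. rep \<Lambda> x f m \<nu> + rep \<Lambda> y f m \<nu>)"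
| "rep \<Lambda> (Mult x y) f = rep \<Lambda> x (rep \<Lambda> y f)"
| "rep \<Lambda> (Scale c x) f = (\<lambda>m \<nu>. c * rep \<Lambda> x f m \<nu>)"

definition agree :: "('p, 'k::finite) kgraph \<Rightarrow> (int ^ 'k \<Rightarrow> 'p \<Rightarrow> 'f) \<Rightarrow> (int ^ 'k \<Rightarrow> 'p \<Rightarrow> 'f) \<Rightarrow> bool" where
  "agree \<Lambda> f g \<longleftrightarrow> (\<exists>q. \<forall>m. \<forall>\<nu>\<in>paths \<Lambda>. q \<le> deg \<Lambda> \<nu> \<longrightarrow> f m \<nu> = g m \<nu>)"

lemma agreeI: "(\<And>m \<nu>. \<nu> \<in> paths \<Lambda> \<Longrightarrow> q \<le> deg \<Lambda> \<nu> \<Longrightarrow> f m \<nu> = g m \<nu>) \<Longrightarrow> agree \<Lambda> f g"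
  by (auto simp: agree_def)

lemma agree_exactI: "(\<And>m \<nu>. \<nu> \<in> paths \<Lambda> \<Longrightarrow> f m \<nu> = g m \<nu>) \<Longrightarrow> agree \<Lambda> f g"
  by (auto simp: agree_def)

lemma agree_refl [simp]: "agree \<Lambda> f f"
  by (rule agree_exactI) simp

lemma agree_sym: "agree \<Lambda> f g \<Longrightarrow> agree \<Lambda> g f"
  by (auto simp: agree_def) metis

lemma agree_combine:
  assumes "agree \<Lambda> f f'" "agree \<Lambda> g g'"
  shows "agree \<Lambda> (\<lambda>m \<nu>. H (f m \<nu>) (g m \<nu>)) (\<lambda>m \<nu>. H (f' m \<nu>) (g' m \<nu>))"
proof -
  obtain q r where q: "\<And>m \<nu>. \<nu> \<in> paths \<Lambda> \<Longrightarrow> q \<le> deg \<Lambda> \<nu> \<Longrightarrow> f m \<nu> = f' m \<nu>"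
    and r: "\<And>m \<nu>. \<nu> \<in> paths \<Lambda> \<Longrightarrow> r \<le> deg \<Lambda> \<nu> \<Longrightarrow> g m \<nu> = g' m \<nu>"
    using assms unfolding agree_def by metis
  show ?thesis
  proof (rule agreeI[of _ "q + r"])
    fix m \<nu> assume \<nu>: "\<nu> \<in> paths \<Lambda>" "q + r \<le> deg \<Lambda> \<nu>"
    then have "q \<le> deg \<Lambda> \<nu>" "r \<le> deg \<Lambda> \<nu>"
      by (auto simp: less_eq_vec_def intro: add_leD1 add_leD2)
    then show "H (f m \<nu>) (g m \<nu>) = H (f' m \<nu>) (g' m \<nu>)" using q r \<nu> by simp
  qed
qed

lemma agree_trans [trans]:
  assumes "agree \<Lambda> f g" "agree \<Lambda> g h" shows "agree \<Lambda> f h"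
proof -
  obtain q r where q: "\<And>m \<nu>. \<nu> \<in> paths \<Lambda> \<Longrightarrow> q \<le> deg \<Lambda> \<nu> \<Longrightarrow> f m \<nu> = g m \<nu>"
    and r: "\<And>m \<nu>. \<nu> \<in> paths \<Lambda> \<Longrightarrow> r \<le> deg \<Lambda> \<nu> \<Longrightarrow> g m \<nu> = h m \<nu>"
    using assms unfolding agree_def by metis
  show ?thesis
  proof (rule agreeI[of _ "q + r"])
    fix m \<nu> assume \<nu>: "\<nu> \<in> paths \<Lambda>" "q + r \<le> deg \<Lambda> \<nu>"
    then have "q \<le> deg \<Lambda> \<nu>" "r \<le> deg \<Lambda> \<nu>"
      by (auto simp: less_eq_vec_def intro: add_leD1 add_leD2)
    then show "f m \<nu> = h m \<nu>" using q r \<nu> by simp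
  qed
qed

section \<open>Linearity of the operators and compatibility with truncation\<close>

context k_graph
begin

lemma path_action_cmp [simp]:
  assumes "\<mu> \<in> paths \<Lambda>" "\<rho> \<in> paths \<Lambda>" "src \<Lambda> \<mu> = rng \<Lambda> \<rho>"
  shows "path_action \<Lambda> \<mu> f m (cmp \<Lambda> \<mu> \<rho>) = f (m - int_vec (deg \<Lambda> \<mu>)) \<rho>"
proof -
  have "(THE \<rho>'. \<rho>' \<in> paths \<Lambda> \<and> src \<Lambda> \<mu> = rng \<Lambda> \<rho>' \<and> cmp \<Lambda> \<mu> \<rho> = cmp \<Lambda> \<mu> \<rho>') = \<rho>"
    using assms factor_unique[of \<mu> \<rho> \<mu>] by (intro the_equality) metis+
  then show ?thesis using assms by (auto simp: path_action_def)
qed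

lemma path_action_not_prefix:
  "(\<And>\<rho>. \<mu> \<in> paths \<Lambda> \<Longrightarrow> \<rho> \<in> paths \<Lambda> \<Longrightarrow> src \<Lambda> \<mu> = rng \<Lambda> \<rho> \<Longrightarrow> \<nu> \<noteq> cmp \<Lambda> \<mu> \<rho>) \<Longrightarrow>
     path_action \<Lambda> \<mu> f m \<nu> = 0"
  by (auto simp: path_action_def)

lemma path_action_cases:
  obtains "\<And>\<rho>. \<mu> \<in> paths \<Lambda> \<Longrightarrow> \<rho> \<in> paths \<Lambda> \<Longrightarrow> src \<Lambda> \<mu> = rng \<Lambda> \<rho> \<Longrightarrow> \<nu> \<noteq> cmp \<Lambda> \<mu> \<rho>"
  | \<rho> where "\<mu> \<in> paths \<Lambda>" "\<rho> \<in> paths \<Lambda>" "src \<Lambda> \<mu> = rng \<Lambda> \<rho>" "\<nu> = cmp \<Lambda> \<mu> \<rho>"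
  by blast

lemma gen_action_linear:
  "gen_action \<Lambda> g (\<lambda>m \<nu>. c * f m \<nu> + h m \<nu>) m \<nu> = c * gen_action \<Lambda> g f m \<nu> + gen_action \<Lambda> g h m \<nu>"
  by (cases g) (auto simp: path_action_def ghost_action_def)

lemma rep_linear: "rep \<Lambda> x (\<lambda>m \<nu>. c * f m \<nu> + h m \<nu>) = (\<lambda>m \<nu>. c * rep \<Lambda> x f m \<nu> + rep \<Lambda> x h m \<nu>)"
proof (induction x arbitrary: f h)
  case (Gen g)
  show ?case by (intro ext) (simp add: gen_action_linear)
qed (simp_all add: algebra_simps)

lemma rep_zero [simp]: "rep \<Lambda> x (\<lambda>m \<nu>. 0) = (\<lambda>m \<nu>. 0)"
  \<comment> \<open>With the scalar \<open>- 1\<close> and zero functions the rule says that the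
    value \<open>r\<close> satisfies \<open>r = - r + r\<close>.\<close>
  using rep_linear[of x "- 1" "\<lambda>m \<nu>. 0" "\<lambda>m \<nu>. 0"] by simp

lemma rep_add: "rep \<Lambda> x (\<lambda>m \<nu>. f m \<nu> + h m \<nu>) = (\<lambda>m \<nu>. rep \<Lambda> x f m \<nu> + rep \<Lambda> x h m \<nu>)"
  using rep_linear[of x 1 f h] by simp

lemma rep_scale: "rep \<Lambda> x (\<lambda>m \<nu>. c * f m \<nu>) = (\<lambda>m \<nu>. c * rep \<Lambda> x f m \<nu>)"
  using rep_linear[of x c f "\<lambda>m \<nu>. 0"] by simp

text \<open>A ghost evaluates its argument at a longer path and keeps the bound; a path evaluates it
  after removal of a prefix, so the bound grows by the degree of that prefix.\<close>

lemma gen_action_agree: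
  assumes "agree \<Lambda> f h" shows "agree \<Lambda> (gen_action \<Lambda> g f) (gen_action \<Lambda> g h)"
proof -
  obtain q where q: "\<And>m \<nu>. \<nu> \<in> paths \<Lambda> \<Longrightarrow> q \<le> deg \<Lambda> \<nu> \<Longrightarrow> f m \<nu> = h m \<nu>"
    using assms unfolding agree_def by metis
  show ?thesis
  proof (cases g)
    case (Vert v)
    then show ?thesis by (intro agreeI[of _ q]) (simp add: q)
  next
    case (Ghost \<mu>)
    show ?thesis
    proof (rule agreeI[of _ q])
      fix m \<nu> assume \<nu>: "\<nu> \<in> paths \<Lambda>" "q \<le> deg \<Lambda> \<nu>"
      have "q \<le> deg \<Lambda> \<mu> + deg \<Lambda> \<nu>"
        using \<nu>(2) by (simp add: less_eq_vec_def trans_le_add2)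
      then show "gen_action \<Lambda> g f m \<nu> = gen_action \<Lambda> g h m \<nu>"
        using \<nu> Ghost by (auto simp: ghost_action_def cmp_closed deg_cmp q)
    qed
  next
    case (Path \<mu>)
    show ?thesis
    proof (rule agreeI[of _ "deg \<Lambda> \<mu> + q"])
      fix m \<nu> assume \<nu>: "\<nu> \<in> paths \<Lambda>" "deg \<Lambda> \<mu> + q \<le> deg \<Lambda> \<nu>"
      show "gen_action \<Lambda> g f m \<nu> = gen_action \<Lambda> g h m \<nu>"
      proof (rule path_action_cases[of \<mu> \<nu>])
        fix \<rho> assume \<rho>: "\<mu> \<in> paths \<Lambda>" "\<rho> \<in> paths \<Lambda>" "src \<Lambda> \<mu> = rng \<Lambda> \<rho>" "\<nu> = cmp \<Lambda> \<mu> \<rho>"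
        then have "q \<le> deg \<Lambda> \<rho>" using \<nu> by (simp add: deg_cmp less_eq_vec_def)
        then show ?thesis using \<rho> Path by (simp add: q)
      qed (simp_all add: Path path_action_not_prefix)
    qed
  qed
qed

lemma rep_agree: "agree \<Lambda> f h \<Longrightarrow> agree \<Lambda> (rep \<Lambda> x f) (rep \<Lambda> x h)"
proof (induction x arbitrary: f h)
  case (Gen g)
  then show ?case by (simp add: gen_action_agree)
next
  case (Add x y)
  then show ?case by (simp add: agree_combine[where H = "(+)"])
next
  case (Scale c x)
  then show ?case by (simp add: agree_combine[where H = "\<lambda>a b. c * a", OF _ agree_refl])
qed simp_all

end

section \<open>Validity of the relations up to short paths\<close>

context row_finite_k_graph
begin

lemma rep_foldr:
  "rep \<Lambda> (foldr (\<lambda>\<mu> t. Add (Mult (Gen (Path \<mu>)) (Gen (Ghost \<mu>))) t) ls Zero) f m \<nu> =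
     (\<Sum>\<mu>\<leftarrow>ls. path_action \<Lambda> \<mu> (ghost_action \<Lambda> \<mu> f) m \<nu>)"
  by (induction ls) simp_all

text \<open>All relations hold exactly except (KP4). On a path whose degree is not above
  \<open>n\<close> no prefix of degree \<open>n\<close> can be split off, so there the sum is zero
  while the vertex operator need not be; this is why the bound \<open>n\<close> appears.\<close>

lemma kp_relation_agree:
  assumes "kp_relation \<Lambda> x y" shows "agree \<Lambda> (rep \<Lambda> x f) (rep \<Lambda> y f)"
  using assms
proof cases
  case (KP1 u v)
  then show ?thesis by (intro agree_exactI) simp
next
  case (KP2_path \<mu> \<nu>)
  then have p: "\<mu> \<in> paths \<Lambda>" "\<nu> \<in> paths \<Lambda>" "src \<Lambda> \<mu> = rng \<Lambda> \<nu>" by auto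
  note c = cmp_closed[OF p] src_cmp[OF p] rng_cmp[OF p] deg_cmp[OF p]
  show ?thesis
  proof (rule agree_exactI)
    fix m \<kappa> assume \<kappa>: "\<kappa> \<in> paths \<Lambda>"
    show "rep \<Lambda> x f m \<kappa> = rep \<Lambda> y f m \<kappa>"
    proof (cases "\<exists>\<rho>\<in>paths \<Lambda>. src \<Lambda> \<nu> = rng \<Lambda> \<rho> \<and> \<kappa> = cmp \<Lambda> (cmp \<Lambda> \<mu> \<nu>) \<rho>")
      case True
      then obtain \<rho> where \<rho>: "\<rho> \<in> paths \<Lambda>" "src \<Lambda> \<nu> = rng \<Lambda> \<rho>" "\<kappa> = cmp \<Lambda> (cmp \<Lambda> \<mu> \<nu>) \<rho>" by auto
      have "\<kappa> = cmp \<Lambda> \<mu> (cmp \<Lambda> \<nu> \<rho>)" using \<rho> p by (simp add: cmp_assoc)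
      then have "rep \<Lambda> x f m \<kappa> = f (m - int_vec (deg \<Lambda> \<mu>) - int_vec (deg \<Lambda> \<nu>)) \<rho>"
        using \<rho> p KP2_path by (simp add: cmp_closed rng_cmp)
      moreover have "rep \<Lambda> y f m \<kappa> = f (m - int_vec (deg \<Lambda> \<mu> + deg \<Lambda> \<nu>)) \<rho>"
        using \<rho> c KP2_path by simp
      ultimately show ?thesis by (simp add: int_vec_add diff_diff_eq)
    next
      case False
      then have "path_action \<Lambda> (cmp \<Lambda> \<mu> \<nu>) f m \<kappa> = 0"
        using c by (intro path_action_not_prefix) auto
      moreover have "path_action \<Lambda> \<mu> (path_action \<Lambda> \<nu> f) m \<kappa> = 0"
      proof (rule path_action_cases[of \<mu> \<kappa>])
        fix \<sigma> assume \<sigma>: "\<mu> \<in> paths \<Lambda>" "\<sigma> \<in> paths \<Lambda>" "src \<Lambda> \<mu> = rng \<Lambda> \<sigma>" "\<kappa> = cmp \<Lambda> \<mu> \<sigma>"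
        have "path_action \<Lambda> \<nu> f n \<sigma> = 0" for n
        proof (rule path_action_not_prefix)
          fix \<rho> assume "\<nu> \<in> paths \<Lambda>" "\<rho> \<in> paths \<Lambda>" "src \<Lambda> \<nu> = rng \<Lambda> \<rho>"
          then show "\<sigma> \<noteq> cmp \<Lambda> \<nu> \<rho>" using False \<sigma> p by (auto simp: cmp_assoc)
        qed
        then show ?thesis using \<sigma> by simp
      qed (simp_all add: path_action_not_prefix)
      ultimately show ?thesis using KP2_path by simp
    qed
  qed
next
  case (KP2_ghost \<mu> \<nu>)
  then have p: "\<mu> \<in> paths \<Lambda>" "\<nu> \<in> paths \<Lambda>" "src \<Lambda> \<mu> = rng \<Lambda> \<nu>" by auto
  note c = cmp_closed[OF p] src_cmp[OF p] rng_cmp[OF p] deg_cmp[OF p]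
  show ?thesis
    using p c KP2_ghost
    by (intro agree_exactI) (auto simp: ghost_action_def rng_cmp cmp_assoc int_vec_add ac_simps)
next
  case (KP2_rng_path \<mu>)
  show ?thesis
  proof (rule agree_exactI)
    fix m \<kappa> assume \<kappa>: "\<kappa> \<in> paths \<Lambda>"
    show "rep \<Lambda> x f m \<kappa> = rep \<Lambda> y f m \<kappa>"
      by (rule path_action_cases[of \<mu> \<kappa>]) (simp_all add: KP2_rng_path rng_cmp path_action_not_prefix)
  qed
next
  case (KP2_path_src \<mu>)
  show ?thesis
  proof (rule agree_exactI)
    fix m \<kappa> assume \<kappa>: "\<kappa> \<in> paths \<Lambda>"
    show "rep \<Lambda> x f m \<kappa> = rep \<Lambda> y f m \<kappa>"
      by (rule path_action_cases[of \<mu> \<kappa>]) (use KP2_path_src in \<open>simp_all add: path_action_not_prefix\<close>)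
  qed
next
  case (KP2_src_ghost \<mu>)
  then show ?thesis by (intro agree_exactI) (simp add: ghost_action_def)
next
  case (KP2_ghost_rng \<mu>)
  then show ?thesis by (intro agree_exactI) (simp add: ghost_action_def rng_cmp)
next
  case (KP3 \<mu> \<nu>)
  show ?thesis
  proof (rule agree_exactI)
    fix m \<kappa> assume \<kappa>: "\<kappa> \<in> paths \<Lambda>"
    show "rep \<Lambda> x f m \<kappa> = rep \<Lambda> y f m \<kappa>"
    proof (cases "\<mu> = \<nu>")
      case True
      then show ?thesis using KP3 \<kappa> by (simp add: ghost_action_def eq_commute)
    next
      case False
      \<comment> \<open>Two different paths of equal degree cannot both be prefixes of one
        path.\<close>
      have "path_action \<Lambda> \<nu> f n (cmp \<Lambda> \<mu> \<kappa>) = 0" if "src \<Lambda> \<mu> = rng \<Lambda> \<kappa>" for n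
        using False KP3 \<kappa> that factor_unique[of \<mu> \<kappa> \<nu>] by (intro path_action_not_prefix) auto
      then show ?thesis using False KP3 \<kappa> by (simp add: ghost_action_def)
    qed
  qed
next
  case (KP4 v n ls)
  show ?thesis
  proof (rule agreeI[of _ n])
    fix m \<kappa> assume \<kappa>: "\<kappa> \<in> paths \<Lambda>" "n \<le> deg \<Lambda> \<kappa>"
    \<comment> \<open>Exactly one path of degree \<open>n\<close> is a prefix of
      \<open>\<kappa>\<close>, so at most one summand survives; it belongs to the index set
      precisely when \<open>\<kappa>\<close> has range \<open>v\<close>.\<close>
    obtain \<alpha> \<beta> where ab: "\<alpha> \<in> paths \<Lambda>" "\<beta> \<in> paths \<Lambda>" "src \<Lambda> \<alpha> = rng \<Lambda> \<beta>" "deg \<Lambda> \<alpha> = n" "\<kappa> = cmp \<Lambda> \<alpha> \<beta>"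
      using factorE[OF \<kappa>(1) vec_nat_le_imp_add[OF \<kappa>(2)]] by metis
    have z: "path_action \<Lambda> \<mu> (ghost_action \<Lambda> \<mu> f) m \<kappa> = 0" if "\<mu> \<in> paths_from \<Lambda> v n" "\<mu> \<noteq> \<alpha>" for \<mu>
      using that ab factor_unique[of \<alpha> \<beta> \<mu>]
      by (intro path_action_not_prefix) (auto simp: deg_paths_from)
    have a: "path_action \<Lambda> \<alpha> (ghost_action \<Lambda> \<alpha> f) m \<kappa> = f m \<kappa>"
      using ab by (simp add: ghost_action_def)
    have "rep \<Lambda> y f m \<kappa> = (\<Sum>\<mu>\<in>paths_from \<Lambda> v n. path_action \<Lambda> \<mu> (ghost_action \<Lambda> \<mu> f) m \<kappa>)"
      using KP4 by (simp add: rep_foldr sum_list_distinct_conv_sum_set)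
    also have "\<dots> = (if \<alpha> \<in> paths_from \<Lambda> v n then f m \<kappa> else 0)"
      by (subst sum.mono_neutral_right[of _ "paths_from \<Lambda> v n \<inter> {\<alpha>}"]) (auto simp: z a)
    also have "\<alpha> \<in> paths_from \<Lambda> v n \<longleftrightarrow> rng \<Lambda> \<kappa> = v"
      using ab by (auto simp: rng_cmp rng_paths_from intro: paths_fromI)
    finally show "rep \<Lambda> x f m \<kappa> = rep \<Lambda> y f m \<kappa>" using KP4 by simp
  qed
qed

text \<open>The induction keeps \<open>f\<close> arbitrary, because in a product the left factor
  acts on the image of \<open>f\<close> under the right one.\<close>

lemma alg_eq_agree: "alg_eq (kp_relation \<Lambda>) x y \<Longrightarrow> agree \<Lambda> (rep \<Lambda> x f) (rep \<Lambda> y f)"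
proof (induction arbitrary: f rule: alg_eq.induct)
  case (relation x y)
  then show ?case by (rule kp_relation_agree)
next
  case (sym x y)
  from sym.IH show ?case by (rule agree_sym)
next
  case (trans x y z)
  from trans.IH show ?case by (rule agree_trans)
next
  case (cong_Add x x' y y')
  from agree_combine[OF cong_Add.IH, where H = "(+)"] show ?case by simp
next
  case (cong_Mult x x' y y')
  have "agree \<Lambda> (rep \<Lambda> x (rep \<Lambda> y f)) (rep \<Lambda> x (rep \<Lambda> y' f))"
    by (rule rep_agree) (rule cong_Mult.IH)
  also have "agree \<Lambda> \<dots> (rep \<Lambda> x' (rep \<Lambda> y' f))" by (rule cong_Mult.IH)
  finally show ?case by simp
next
  case (cong_Scale x x' c)
  from agree_combine[where H = "\<lambda>a b. c * a", OF cong_Scale.IH agree_refl] show ?case by simp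
qed (simp_all add: rep_add rep_scale algebra_simps)

end

section \<open>Kumjian-Pask algebras\<close>

context abelian_monoid
begin

lemma finsum_zeroI: "(\<And>i. i \<in> I \<Longrightarrow> f i = \<zero>) \<Longrightarrow> (\<Oplus>i\<in>I. f i) = \<zero>"
  using finsum_cong'[of I I "\<lambda>_. \<zero>" f] by (simp add: finsum_zero)

lemma finsum_singleI:
  assumes "finite I" "i \<in> I" "\<And>j. j \<in> I \<Longrightarrow> j \<noteq> i \<Longrightarrow> f j = \<zero>" "f i \<in> carrier G"
  shows "(\<Oplus>j\<in>I. f j) = f i"
proof -
  have "(\<Oplus>j\<in>I. f j) = (\<Oplus>j\<in>I. if i = j then f i else \<zero>)"
    using assms by (intro finsum_cong') (auto simp: Pi_iff)
  then show ?thesis using finsum_singleton[of i I "\<lambda>_. f i"] assms by auto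
qed

end

text \<open>Separates the properties used later from the construction by terms. Vertices count as
  paths here, so the multiplication rules are uniform and (KP4) includes degree zero.
  \<open>generated\<close> is an induction principle that expresses that the algebra has no elements
  beyond those built from the generators.\<close>

locale kp_family = row_finite_k_graph \<Lambda> + field_algebra A
  for \<Lambda> :: "('p, 'k::finite) kgraph"
    and A :: "('f::field, 'a, int ^ 'k) graded_module" (structure) +
  fixes S T :: "'p \<Rightarrow> 'a"
  assumes finite_vertices [simp]: "finite (vertices \<Lambda>)"
    and S_closed [simp]: "\<mu> \<in> paths \<Lambda> \<Longrightarrow> S \<mu> \<in> carrier A"
    and T_closed [simp]: "\<mu> \<in> paths \<Lambda> \<Longrightarrow> T \<mu> \<in> carrier A"
    and T_vertex: "v \<in> vertices \<Lambda> \<Longrightarrow> T v = S v"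
    and S_mult: "\<lbrakk>\<mu> \<in> paths \<Lambda>; \<nu> \<in> paths \<Lambda>; src \<Lambda> \<mu> = rng \<Lambda> \<nu>\<rbrakk> \<Longrightarrow> S \<mu> \<otimes> S \<nu> = S (cmp \<Lambda> \<mu> \<nu>)"
    and T_mult: "\<lbrakk>\<mu> \<in> paths \<Lambda>; \<nu> \<in> paths \<Lambda>; src \<Lambda> \<mu> = rng \<Lambda> \<nu>\<rbrakk> \<Longrightarrow> T \<nu> \<otimes> T \<mu> = T (cmp \<Lambda> \<mu> \<nu>)"
    and T_S: "\<lbrakk>\<mu> \<in> paths \<Lambda>; \<nu> \<in> paths \<Lambda>; deg \<Lambda> \<mu> = deg \<Lambda> \<nu>\<rbrakk> \<Longrightarrow>
           T \<mu> \<otimes> S \<nu> = (if \<mu> = \<nu> then S (src \<Lambda> \<mu>) else \<zero>)"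
    and S_sum: "v \<in> vertices \<Lambda> \<Longrightarrow> S v = (\<Oplus>\<mu>\<in>paths_from \<Lambda> v n. S \<mu> \<otimes> T \<mu>)"
    and generated: "\<lbrakk>subspace U; \<And>\<mu>. \<mu> \<in> paths \<Lambda> \<Longrightarrow> S \<mu> \<in> U; \<And>\<mu>. \<mu> \<in> paths \<Lambda> \<Longrightarrow> T \<mu> \<in> U;
           \<And>x y. \<lbrakk>x \<in> U; y \<in> U\<rbrakk> \<Longrightarrow> x \<otimes> y \<in> U\<rbrakk> \<Longrightarrow> carrier A \<subseteq> U"
begin

lemma S_closed_vertex [simp]: "v \<in> vertices \<Lambda> \<Longrightarrow> S v \<in> carrier A"
  by (simp add: vertex_path)

lemma S_vertex_mult:
  assumes "u \<in> vertices \<Lambda>" "v \<in> vertices \<Lambda>"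
  shows "S u \<otimes> S v = (if u = v then S u else \<zero>)"
  using T_S[of u v] assms by (simp add: vertex_path T_vertex)

lemma vertex_S_rng: "\<mu> \<in> paths \<Lambda> \<Longrightarrow> S (rng \<Lambda> \<mu>) \<otimes> S \<mu> = S \<mu>"
  using S_mult[of "rng \<Lambda> \<mu>" \<mu>] by (simp add: rng_closed src_rng cmp_rng)

lemma S_src: "\<mu> \<in> paths \<Lambda> \<Longrightarrow> S \<mu> \<otimes> S (src \<Lambda> \<mu>) = S \<mu>"
  using S_mult[of \<mu> "src \<Lambda> \<mu>"] by (simp add: src_closed rng_src cmp_src)

lemma src_T: "\<mu> \<in> paths \<Lambda> \<Longrightarrow> S (src \<Lambda> \<mu>) \<otimes> T \<mu> = T \<mu>"
  using T_mult[of \<mu> "src \<Lambda> \<mu>"] by (simp add: src_closed rng_src cmp_src T_vertex)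

lemma T_rng: "\<mu> \<in> paths \<Lambda> \<Longrightarrow> T \<mu> \<otimes> S (rng \<Lambda> \<mu>) = T \<mu>"
  using T_mult[of "rng \<Lambda> \<mu>" \<mu>] by (simp add: rng_closed src_rng cmp_rng T_vertex)

lemma vertex_S:
  assumes "v \<in> vertices \<Lambda>" "\<mu> \<in> paths \<Lambda>"
  shows "S v \<otimes> S \<mu> = (if v = rng \<Lambda> \<mu> then S \<mu> else \<zero>)"
proof -
  have "S v \<otimes> S \<mu> = (S v \<otimes> S (rng \<Lambda> \<mu>)) \<otimes> S \<mu>"
    using assms by (simp add: mult_assoc vertex_S_rng)
  then show ?thesis using assms by (auto simp: S_vertex_mult vertex_S_rng)
qed

lemma S_vertex:
  assumes "v \<in> vertices \<Lambda>" "\<mu> \<in> paths \<Lambda>"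
  shows "S \<mu> \<otimes> S v = (if v = src \<Lambda> \<mu> then S \<mu> else \<zero>)"
proof -
  have "S \<mu> \<otimes> S v = S \<mu> \<otimes> (S (src \<Lambda> \<mu>) \<otimes> S v)"
    using assms by (simp add: mult_assoc[symmetric] S_src)
  then show ?thesis using assms by (auto simp: S_vertex_mult S_src)
qed

lemma vertex_T:
  assumes "v \<in> vertices \<Lambda>" "\<mu> \<in> paths \<Lambda>"
  shows "S v \<otimes> T \<mu> = (if v = src \<Lambda> \<mu> then T \<mu> else \<zero>)"
proof -
  have "S v \<otimes> T \<mu> = (S v \<otimes> S (src \<Lambda> \<mu>)) \<otimes> T \<mu>"
    using assms by (simp add: mult_assoc src_T)
  then show ?thesis using assms by (auto simp: S_vertex_mult src_T)
qed

lemma T_vertex_right: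
  assumes "v \<in> vertices \<Lambda>" "\<mu> \<in> paths \<Lambda>"
  shows "T \<mu> \<otimes> S v = (if v = rng \<Lambda> \<mu> then T \<mu> else \<zero>)"
proof -
  have "T \<mu> \<otimes> S v = T \<mu> \<otimes> (S (rng \<Lambda> \<mu>) \<otimes> S v)"
    using assms by (simp add: mult_assoc[symmetric] T_rng)
  then show ?thesis using assms by (auto simp: S_vertex_mult T_rng)
qed

lemma S_T_zero:
  assumes "\<mu> \<in> paths \<Lambda>" "\<nu> \<in> paths \<Lambda>" "src \<Lambda> \<mu> \<noteq> src \<Lambda> \<nu>"
  shows "S \<mu> \<otimes> T \<nu> = \<zero>"
proof -
  have "S \<mu> \<otimes> T \<nu> = S \<mu> \<otimes> (S (src \<Lambda> \<mu>) \<otimes> T \<nu>)"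
    using assms by (simp add: mult_assoc[symmetric] S_src)
  then show ?thesis using assms by (simp add: vertex_T)
qed

text \<open>The elements on which the sum of the vertex idempotents acts as a two-sided unit form a
  subalgebra. It contains the generators, since exactly one idempotent survives on each side of a
  path or ghost.\<close>

lemma unit_law:
  assumes "x \<in> carrier A"
  shows "(\<Oplus>v\<in>vertices \<Lambda>. S v) \<otimes> x = x" "x \<otimes> (\<Oplus>v\<in>vertices \<Lambda>. S v) = x"
proof -
  let ?e = "\<Oplus>v\<in>vertices \<Lambda>. S v"
  have e: "?e \<in> carrier A" by (intro finsum_closed) (auto simp: vertex_path)
  let ?U = "{x \<in> carrier A. ?e \<otimes> x = x \<and> x \<otimes> ?e = x}"
  have pi: "S \<in> vertices \<Lambda> \<rightarrow> carrier A" by (auto simp: vertex_path)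
  have "carrier A \<subseteq> ?U"
  proof (rule generated)
    show "subspace ?U"
      using e unfolding subspace_def
      by (auto simp: mult_add_left mult_add_right mult_scale_left mult_scale_right)
    show "S \<mu> \<in> ?U" if "\<mu> \<in> paths \<Lambda>" for \<mu>
    proof -
      have "?e \<otimes> S \<mu> = (\<Oplus>v\<in>vertices \<Lambda>. S v \<otimes> S \<mu>)"
        using that pi by (simp add: finsum_mult_left)
      also have "\<dots> = S (rng \<Lambda> \<mu>) \<otimes> S \<mu>"
        using that by (intro finsum_singleI) (auto simp: vertex_S vertex_path)
      finally have 1: "?e \<otimes> S \<mu> = S \<mu>" using that by (simp add: vertex_S_rng)
      have "S \<mu> \<otimes> ?e = (\<Oplus>v\<in>vertices \<Lambda>. S \<mu> \<otimes> S v)"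
        using that pi by (simp add: finsum_mult_right)
      also have "\<dots> = S \<mu> \<otimes> S (src \<Lambda> \<mu>)"
        using that by (intro finsum_singleI) (auto simp: S_vertex vertex_path)
      finally show ?thesis using that 1 by (simp add: S_src)
    qed
    show "T \<mu> \<in> ?U" if "\<mu> \<in> paths \<Lambda>" for \<mu>
    proof -
      have "?e \<otimes> T \<mu> = (\<Oplus>v\<in>vertices \<Lambda>. S v \<otimes> T \<mu>)"
        using that pi by (simp add: finsum_mult_left)
      also have "\<dots> = S (src \<Lambda> \<mu>) \<otimes> T \<mu>"
        using that by (intro finsum_singleI) (auto simp: vertex_T vertex_path)
      finally have 1: "?e \<otimes> T \<mu> = T \<mu>" using that by (simp add: src_T)
      have "T \<mu> \<otimes> ?e = (\<Oplus>v\<in>vertices \<Lambda>. T \<mu> \<otimes> S v)"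
        using that pi by (simp add: finsum_mult_right)
      also have "\<dots> = T \<mu> \<otimes> S (rng \<Lambda> \<mu>)"
        using that by (intro finsum_singleI) (auto simp: T_vertex_right vertex_path)
      finally show ?thesis using that 1 by (simp add: T_rng)
    qed
    show "x \<otimes> y \<in> ?U" if "x \<in> ?U" "y \<in> ?U" for x y
      using that e by (auto simp: mult_assoc) (simp add: mult_assoc[symmetric])
  qed
  then show "?e \<otimes> x = x" "x \<otimes> ?e = x" using assms by auto
qed

lemma ring_if_one_eq: "\<one> = (\<Oplus>v\<in>vertices \<Lambda>. S v) \<Longrightarrow> ring A"
proof (rule ringI)
  assume one: "\<one> = (\<Oplus>v\<in>vertices \<Lambda>. S v)"
  show "Group.monoid A"
    by (rule monoidI) (auto simp: one unit_law mult_assoc vertex_path intro!: finsum_closed)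
qed (simp_all add: abelian_group_axioms mult_add_left mult_add_right)

end

text \<open>\<open>W v\<close> is all that is kept of the representation: a subspace that contains
  the monomials of nonzero degree but no nonzero multiple of \<open>S v\<close>. From it follow the
  independence of the homogeneous components and the fact that the idempotents are nonzero.\<close>

locale graded_kp_algebra = kp_family \<Lambda> A S T + R?: ring A
  for \<Lambda> :: "('p, 'k::finite) kgraph"
    and A :: "('f::field, 'a, int ^ 'k) graded_module" (structure)
    and S T :: "'p \<Rightarrow> 'a" +
  fixes W :: "'p \<Rightarrow> 'a set"
  assumes one_eq: "\<one> = (\<Oplus>v\<in>vertices \<Lambda>. S v)"
    and hcomp_eq: "hcomp A n = lin_span UNIV A {S \<mu> \<otimes> T \<nu> |\<mu> \<nu>. \<mu> \<in> paths \<Lambda> \<and> \<nu> \<in> paths \<Lambda> \<and>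
           int_vec (deg \<Lambda> \<mu>) - int_vec (deg \<Lambda> \<nu>) = n}"
    and W_subspace: "subspace (W v)"
    and W_product: "\<lbrakk>\<mu> \<in> paths \<Lambda>; \<nu> \<in> paths \<Lambda>; deg \<Lambda> \<mu> \<noteq> deg \<Lambda> \<nu>\<rbrakk> \<Longrightarrow> S \<mu> \<otimes> T \<nu> \<in> W v"
    and W_vertex: "v \<in> vertices \<Lambda> \<Longrightarrow> c \<odot> S v \<in> W v \<Longrightarrow> c = 0"

text \<open>Used to pass from \<open>kp_base\<close> to \<open>kp\<close>, which changes the unit
  and adds the grading.\<close>

lemma field_algebra_cong:
  fixes A :: "('f::field, 'a, 'y) module_scheme" and B :: "('f, 'a, 'z) module_scheme"
  assumes "field_algebra A" "carrier B = carrier A" "add B = add A" "zero B = zero A"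
    "monoid.mult B = monoid.mult A" "smult B = smult A"
  shows "field_algebra B"
proof -
  interpret A: field_algebra A by fact
  have "abelian_group B"
  proof (rule abelian_groupI)
    fix x y z assume "x \<in> carrier B" "y \<in> carrier B" "z \<in> carrier B"
    then show "x \<oplus>\<^bsub>B\<^esub> y \<oplus>\<^bsub>B\<^esub> z = x \<oplus>\<^bsub>B\<^esub> (y \<oplus>\<^bsub>B\<^esub> z)" by (simp add: assms(2-) A.a_assoc)
  next
    fix x y assume "x \<in> carrier B" "y \<in> carrier B"
    then show "x \<oplus>\<^bsub>B\<^esub> y = y \<oplus>\<^bsub>B\<^esub> x" by (simp add: assms(2-) A.a_comm)
  next
    fix x assume "x \<in> carrier B"
    then show "\<exists>y\<in>carrier B. y \<oplus>\<^bsub>B\<^esub> x = \<zero>\<^bsub>B\<^esub>" using A.add.l_inv_ex[of x] by (simp add: assms(2-))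
  qed (simp_all add: assms(2-))
  then show ?thesis
    by (intro field_algebra.intro scalar_group.intro scalar_group_axioms.intro field_algebra_axioms.intro)
      (auto simp: assms(2-) A.scale_add A.scale_plus A.scale_times A.mult_assoc A.mult_add_left
        A.mult_add_right A.mult_scale_left A.mult_scale_right)
qed

lemma kp_simps:
  "carrier (kp F \<Lambda>) = carrier (kp_base F \<Lambda>)" "zero (kp F \<Lambda>) = zero (kp_base F \<Lambda>)"
  "add (kp F \<Lambda>) = add (kp_base F \<Lambda>)" "monoid.mult (kp F \<Lambda>) = monoid.mult (kp_base F \<Lambda>)"
  "smult (kp F \<Lambda>) = smult (kp_base F \<Lambda>)"
  by (simp_all add: kp_def module.defs)

lemma finsum_kp: "finsum (kp F \<Lambda>) = finsum (kp_base F \<Lambda>)"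
  by (simp add: finsum_def finprod_def fun_eq_iff kp_simps)

text \<open>The generators distinguish vertices from other paths; this term and
  \<open>ghost_term\<close> hide the distinction, so that each relation takes one form on all
  paths.\<close>

definition path_term :: "('p, 'k::finite) kgraph \<Rightarrow> 'p \<Rightarrow> ('p kp_gen, 'f) alg_term" where
  "path_term \<Lambda> \<mu> = Gen (if \<mu> \<in> vertices \<Lambda> then Vert \<mu> else Path \<mu>)"

definition ghost_term :: "('p, 'k::finite) kgraph \<Rightarrow> 'p \<Rightarrow> ('p kp_gen, 'f) alg_term" where
  "ghost_term \<Lambda> \<mu> = Gen (if \<mu> \<in> vertices \<Lambda> then Vert \<mu> else Ghost \<mu>)"

section \<open>The relations for arbitrary paths\<close>

context row_finite_k_graph
begin

lemma gens_path_term: "\<mu> \<in> paths \<Lambda> \<Longrightarrow> gens (path_term \<Lambda> \<mu>) \<subseteq> kp_gens \<Lambda>"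
  and gens_ghost_term: "\<mu> \<in> paths \<Lambda> \<Longrightarrow> gens (ghost_term \<Lambda> \<mu>) \<subseteq> kp_gens \<Lambda>"
  by (auto simp: path_term_def ghost_term_def kp_gens_def)

lemma cmp_not_vertex:
  assumes "\<mu> \<in> paths \<Lambda>" "\<nu> \<in> paths \<Lambda>" "src \<Lambda> \<mu> = rng \<Lambda> \<nu>" "\<mu> \<notin> vertices \<Lambda>"
  shows "cmp \<Lambda> \<mu> \<nu> \<notin> vertices \<Lambda>"
proof
  assume "cmp \<Lambda> \<mu> \<nu> \<in> vertices \<Lambda>"
  then have "deg \<Lambda> \<mu> + deg \<Lambda> \<nu> = 0" using deg_cmp[OF assms(1-3)] deg_vertex by simp
  then have "deg \<Lambda> \<mu> = 0" by (simp add: vec_eq_iff)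
  then show False using assms(1,4) unfolding paths_deg_def by simp
qed

lemma vertex_cmp: "\<mu> \<in> vertices \<Lambda> \<Longrightarrow> \<nu> \<in> paths \<Lambda> \<Longrightarrow> src \<Lambda> \<mu> = rng \<Lambda> \<nu> \<Longrightarrow> cmp \<Lambda> \<mu> \<nu> = \<nu>"
  using cmp_rng by fastforce

lemma cmp_vertex: "\<nu> \<in> vertices \<Lambda> \<Longrightarrow> \<mu> \<in> paths \<Lambda> \<Longrightarrow> src \<Lambda> \<mu> = rng \<Lambda> \<nu> \<Longrightarrow> cmp \<Lambda> \<mu> \<nu> = \<mu>"
  using cmp_src by fastforce

lemma path_term_mult:
  assumes "\<mu> \<in> paths \<Lambda>" "\<nu> \<in> paths \<Lambda>" "src \<Lambda> \<mu> = rng \<Lambda> \<nu>"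
  shows "alg_eq (kp_relation \<Lambda>) (Mult (path_term \<Lambda> \<mu>) (path_term \<Lambda> \<nu>)) (path_term \<Lambda> (cmp \<Lambda> \<mu> \<nu>))"
proof (rule alg_eq.relation)
  consider "\<mu> \<in> vertices \<Lambda>" "\<nu> \<in> vertices \<Lambda>" | "\<mu> \<in> vertices \<Lambda>" "\<nu> \<notin> vertices \<Lambda>"
    | "\<mu> \<notin> vertices \<Lambda>" "\<nu> \<in> vertices \<Lambda>" | "\<mu> \<notin> vertices \<Lambda>" "\<nu> \<notin> vertices \<Lambda>" by blast
  then show "kp_relation \<Lambda> (Mult (path_term \<Lambda> \<mu>) (path_term \<Lambda> \<nu>)) (path_term \<Lambda> (cmp \<Lambda> \<mu> \<nu>))"
  proof cases
    case 1
    then show ?thesis using assms kp_relation.KP1[of \<mu> \<Lambda> \<nu>] by (simp add: path_term_def vertex_cmp)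
  next
    case 2
    then show ?thesis using assms kp_relation.KP2_rng_path[of \<nu> \<Lambda>] by (simp add: path_term_def vertex_cmp)
  next
    case 3
    then show ?thesis using assms kp_relation.KP2_path_src[of \<mu> \<Lambda>] by (simp add: path_term_def cmp_vertex)
  next
    case 4
    have "kp_relation \<Lambda> (Mult (Gen (Path \<mu>)) (Gen (Path \<nu>))) (Gen (Path (cmp \<Lambda> \<mu> \<nu>)))"
      by (rule kp_relation.KP2_path) (use assms 4 in auto)
    then show ?thesis using 4 cmp_not_vertex[OF assms 4(1)] by (simp add: path_term_def)
  qed
qed

lemma ghost_term_mult:
  assumes "\<mu> \<in> paths \<Lambda>" "\<nu> \<in> paths \<Lambda>" "src \<Lambda> \<mu> = rng \<Lambda> \<nu>"
  shows "alg_eq (kp_relation \<Lambda>) (Mult (ghost_term \<Lambda> \<nu>) (ghost_term \<Lambda> \<mu>)) (ghost_term \<Lambda> (cmp \<Lambda> \<mu> \<nu>))"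
proof (rule alg_eq.relation)
  consider "\<mu> \<in> vertices \<Lambda>" "\<nu> \<in> vertices \<Lambda>" | "\<mu> \<in> vertices \<Lambda>" "\<nu> \<notin> vertices \<Lambda>"
    | "\<mu> \<notin> vertices \<Lambda>" "\<nu> \<in> vertices \<Lambda>" | "\<mu> \<notin> vertices \<Lambda>" "\<nu> \<notin> vertices \<Lambda>" by blast
  then show "kp_relation \<Lambda> (Mult (ghost_term \<Lambda> \<nu>) (ghost_term \<Lambda> \<mu>)) (ghost_term \<Lambda> (cmp \<Lambda> \<mu> \<nu>))"
  proof cases
    case 1
    then show ?thesis using assms kp_relation.KP1[of \<mu> \<Lambda> \<nu>] by (simp add: ghost_term_def vertex_cmp)
  next
    case 2
    then show ?thesis using assms kp_relation.KP2_ghost_rng[of \<nu> \<Lambda>] by (simp add: ghost_term_def vertex_cmp)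
  next
    case 3
    then show ?thesis using assms kp_relation.KP2_src_ghost[of \<mu> \<Lambda>] by (simp add: ghost_term_def cmp_vertex)
  next
    case 4
    have "kp_relation \<Lambda> (Mult (Gen (Ghost \<nu>)) (Gen (Ghost \<mu>))) (Gen (Ghost (cmp \<Lambda> \<mu> \<nu>)))"
      by (rule kp_relation.KP2_ghost) (use assms 4 in auto)
    then show ?thesis using 4 cmp_not_vertex[OF assms 4(1)] by (simp add: ghost_term_def)
  qed
qed

lemma ghost_path_term:
  assumes "\<mu> \<in> paths \<Lambda>" "\<nu> \<in> paths \<Lambda>" "deg \<Lambda> \<mu> = deg \<Lambda> \<nu>"
  shows "alg_eq (kp_relation \<Lambda>) (Mult (ghost_term \<Lambda> \<mu>) (path_term \<Lambda> \<nu>))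
     (if \<mu> = \<nu> then path_term \<Lambda> (src \<Lambda> \<mu>) else Zero)"
proof (rule alg_eq.relation)
  \<comment> \<open>Equal degrees make both paths vertices or neither, so the mixed cases do not
    arise.\<close>
  have iff: "\<mu> \<in> vertices \<Lambda> \<longleftrightarrow> \<nu> \<in> vertices \<Lambda>" using assms unfolding paths_deg_def by simp
  show "kp_relation \<Lambda> (Mult (ghost_term \<Lambda> \<mu>) (path_term \<Lambda> \<nu>))
     (if \<mu> = \<nu> then path_term \<Lambda> (src \<Lambda> \<mu>) else Zero)"
  proof (cases "\<mu> \<in> vertices \<Lambda>")
    case True
    then have \<nu>: "\<nu> \<in> vertices \<Lambda>" and src: "src \<Lambda> \<mu> = \<mu>" using iff by simp_all
    show ?thesis
      unfolding path_term_def ghost_term_def src if_P[OF True] if_P[OF \<nu>]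
      using True \<nu> by (rule kp_relation.KP1)
  next
    case False
    then have \<nu>: "\<nu> \<notin> vertices \<Lambda>" using iff by simp
    show ?thesis
      unfolding path_term_def ghost_term_def if_not_P[OF False] if_not_P[OF \<nu>] if_P[OF src_vertex[OF assms(1)]]
      by (rule kp_relation.KP3) (use assms False \<nu> in auto)
  qed
qed

end

text \<open>The function on which elements are tested. It is concentrated in degree
  \<open>0\<close>, so an operator of nonzero degree moves it away from there.\<close>

definition vertex_indicator :: "('p, 'k::finite) kgraph \<Rightarrow> 'p \<Rightarrow> int ^ 'k \<Rightarrow> 'p \<Rightarrow> 'f::field" where
  "vertex_indicator \<Lambda> v = (\<lambda>m \<nu>. if m = 0 \<and> rng \<Lambda> \<nu> = v then 1 else 0)"

text \<open>Separates a vertex idempotent from the homogeneous elements of nonzero degree.\<close>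

definition vanishing :: "('p, 'k::finite) kgraph \<Rightarrow> 'p \<Rightarrow> ('p kp_gen, 'f::field) alg_term \<Rightarrow> bool" where
  "vanishing \<Lambda> v x \<longleftrightarrow> agree \<Lambda> (\<lambda>_. rep \<Lambda> x (vertex_indicator \<Lambda> v) 0) (\<lambda>_ _. 0)"

section \<open>Separation of the vertex idempotents and construction of the algebra\<close>

context row_finite_k_graph
begin

lemma vanishing_cong:
  assumes "alg_eq (kp_relation \<Lambda>) x y" "vanishing \<Lambda> v x" shows "vanishing \<Lambda> v y"
proof -
  have "agree \<Lambda> (rep \<Lambda> y (vertex_indicator \<Lambda> v)) (rep \<Lambda> x (vertex_indicator \<Lambda> v))"
    using alg_eq_agree[OF assms(1)] by (rule agree_sym)
  then have "agree \<Lambda> (\<lambda>_. rep \<Lambda> y (vertex_indicator \<Lambda> v) 0) (\<lambda>_. rep \<Lambda> x (vertex_indicator \<Lambda> v) 0)"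
    by (auto simp: agree_def)
  then show ?thesis using assms(2) unfolding vanishing_def by (rule agree_trans)
qed

lemma vanishing_add:
  "vanishing \<Lambda> v x \<Longrightarrow> vanishing \<Lambda> v y \<Longrightarrow> vanishing \<Lambda> v (Add x y)"
  unfolding vanishing_def using agree_combine[where H = "(+)" and f' = "\<lambda>_ _. 0" and g' = "\<lambda>_ _. 0"]
  by fastforce

lemma vanishing_scale:
  "vanishing \<Lambda> v x \<Longrightarrow> vanishing \<Lambda> v (Scale c x)"
  unfolding vanishing_def
  using agree_combine[where H = "\<lambda>a b. c * a" and f' = "\<lambda>_ _. 0", OF _ agree_refl] by fastforce

lemma vanishing_zero: "vanishing \<Lambda> v Zero"
  by (simp add: vanishing_def)

text \<open>The monomial shifts the degree argument by the difference of the two degrees. When they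
  differ, evaluation at \<open>0\<close> meets the indicator only outside its support.\<close>

lemma vanishing_product:
  assumes "\<mu> \<in> paths \<Lambda>" "\<nu> \<in> paths \<Lambda>" "deg \<Lambda> \<mu> \<noteq> deg \<Lambda> \<nu>"
  shows "vanishing \<Lambda> v (Mult (path_term \<Lambda> \<mu>) (ghost_term \<Lambda> \<nu>))"
  unfolding vanishing_def
proof (rule agree_exactI)
  fix m \<kappa> assume \<kappa>: "\<kappa> \<in> paths \<Lambda>"
  let ?d = "vertex_indicator \<Lambda> v"
  have p: "rep \<Lambda> (path_term \<Lambda> \<mu>) f n \<kappa> = 0"
    if "\<And>\<rho>. f (n - int_vec (deg \<Lambda> \<mu>)) \<rho> = 0" for f :: "int ^ 'b \<Rightarrow> 'a \<Rightarrow> 'c" and n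
  proof (cases "\<mu> \<in> vertices \<Lambda>")
    case True
    then show ?thesis using that by (simp add: path_term_def)
  next
    case False
    then show ?thesis using that by (simp add: path_term_def path_action_def)
  qed
  have g: "rep \<Lambda> (ghost_term \<Lambda> \<nu>) ?d n \<rho> = (0 :: 'c)" if "n + int_vec (deg \<Lambda> \<nu>) \<noteq> 0" for n \<rho>
  proof (cases "\<nu> \<in> vertices \<Lambda>")
    case True
    then show ?thesis using that by (simp add: ghost_term_def vertex_indicator_def)
  next
    case False
    then show ?thesis using that by (simp add: ghost_term_def ghost_action_def vertex_indicator_def)
  qed
  have "(0 - int_vec (deg \<Lambda> \<mu>)) + int_vec (deg \<Lambda> \<nu>) \<noteq> 0"
    using assms(3) by (simp add: add_eq_0_iff)
  then have "rep \<Lambda> (path_term \<Lambda> \<mu>) (rep \<Lambda> (ghost_term \<Lambda> \<nu>) ?d) 0 \<kappa> = (0 :: 'c)"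
    using g by (intro p) simp
  then show "rep \<Lambda> (Mult (path_term \<Lambda> \<mu>) (ghost_term \<Lambda> \<nu>)) ?d 0 \<kappa> = (0 :: 'c)" by simp
qed

text \<open>Absence of sources gives a path with range \<open>v\<close> of the very degree
  \<open>q\<close> from which the function must vanish, and there its value is
  \<open>c\<close>.\<close>

lemma vanishing_vertex:
  assumes "v \<in> vertices \<Lambda>" "vanishing \<Lambda> v (Scale c (path_term \<Lambda> v))"
  shows "c = 0"
proof -
  obtain q where q: "\<And>\<nu>. \<nu> \<in> paths \<Lambda> \<Longrightarrow> q \<le> deg \<Lambda> \<nu> \<Longrightarrow>
      rep \<Lambda> (Scale c (path_term \<Lambda> v)) (vertex_indicator \<Lambda> v) 0 \<nu> = 0"
    using assms(2) by (auto simp: vanishing_def agree_def)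
  obtain \<nu> where \<nu>: "\<nu> \<in> paths_from \<Lambda> v q" using no_sources[OF assms(1), of q] by blast
  then have "rep \<Lambda> (Scale c (path_term \<Lambda> v)) (vertex_indicator \<Lambda> v) 0 \<nu> = 0"
    by (intro q) (simp_all add: paths_fromD deg_paths_from)
  then show ?thesis using \<nu> assms(1) by (simp add: path_term_def vertex_indicator_def rng_paths_from)
qed

text \<open>Term-level facts descend to the quotient. The witness \<open>W v\<close> consists of the
  classes all of whose representatives are vanishing; one representative decides, because
  \<open>vanishing\<close> respects derivable equations.\<close>

theorem kp_graded_kp_algebra:
  fixes F :: "'f::field itself"
  assumes fin: "finite (vertices \<Lambda>)"
  shows "\<exists>W. graded_kp_algebra \<Lambda> (kp F \<Lambda>) (kp_path F \<Lambda>) (kp_ghost F \<Lambda>) W"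
proof -
  interpret P: presentation "kp_gens \<Lambda>" "kp_relation \<Lambda> :: ('a kp_gen, 'f) alg_term \<Rightarrow> _" .
  let ?A = "kp F \<Lambda>"
  have base: "kp_base F \<Lambda> = P.Q" by (simp add: kp_base_def)
  note kp_eq = kp_simps[of F \<Lambda>, unfolded base]
  interpret Q: field_algebra P.Q by (rule P.field_algebra_presented)
  interpret A: field_algebra ?A
    by (rule field_algebra_cong[OF Q.field_algebra_axioms]) (simp_all add: kp_eq)
  have path: "kp_path F \<Lambda> \<mu> = P.cls (path_term \<Lambda> \<mu>)" for \<mu>
    by (simp add: kp_path_def kp_gen_def P.cls_def path_term_def)
  have ghost: "kp_ghost F \<Lambda> \<mu> = P.cls (ghost_term \<Lambda> \<mu>)" for \<mu>
    by (simp add: kp_ghost_def kp_gen_def P.cls_def ghost_term_def)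
  note [simp] = gens_path_term gens_ghost_term
  have cls_mult: "P.cls x \<otimes>\<^bsub>?A\<^esub> P.cls y = P.cls (Mult x y)"
    if "gens x \<subseteq> kp_gens \<Lambda>" "gens y \<subseteq> kp_gens \<Lambda>" for x y
    using that by (simp add: kp_eq P.mult_class)
  have carrier: "P.cls x \<in> carrier ?A" if "gens x \<subseteq> kp_gens \<Lambda>" for x
    using that by (simp add: kp_eq)
  have zero: "\<zero>\<^bsub>?A\<^esub> = P.cls Zero" by (simp add: kp_eq P.zero_class)
  have add: "P.cls x \<oplus>\<^bsub>?A\<^esub> P.cls y = P.cls (Add x y)"
    if "gens x \<subseteq> kp_gens \<Lambda>" "gens y \<subseteq> kp_gens \<Lambda>" for x y
    using that by (simp add: kp_eq P.add_class)
  have scale: "c \<odot>\<^bsub>?A\<^esub> P.cls x = P.cls (Scale c x)" if "gens x \<subseteq> kp_gens \<Lambda>" for c x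
    using that by (simp add: kp_eq P.scale_class)
  have gens_foldr: "gens (foldr (\<lambda>\<mu> t. Add (Mult (Gen (Path \<mu>)) (Gen (Ghost \<mu>))) t) ls Zero) \<subseteq> kp_gens \<Lambda>"
    if "set ls \<subseteq> paths \<Lambda> - vertices \<Lambda>" for ls
    using that by (induction ls) (auto simp: kp_gens_def)
  \<comment> \<open>The relation (KP4) is written with a nested sum along an enumeration; in the
    quotient this becomes a finite sum over a set.\<close>
  have sum_foldr: "P.cls (foldr (\<lambda>\<mu> t. Add (Mult (Gen (Path \<mu>)) (Gen (Ghost \<mu>))) t) ls Zero) =
      (\<Oplus>\<^bsub>?A\<^esub>\<mu>\<in>set ls. kp_path F \<Lambda> \<mu> \<otimes>\<^bsub>?A\<^esub> kp_ghost F \<Lambda> \<mu>)"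
    if "distinct ls" "set ls \<subseteq> paths \<Lambda> - vertices \<Lambda>" for ls
    using that
  proof (induction ls)
    case Nil
    then show ?case by (simp add: zero)
  next
    case (Cons \<mu> ls)
    have \<mu>: "kp_path F \<Lambda> \<mu> \<otimes>\<^bsub>?A\<^esub> kp_ghost F \<Lambda> \<mu> = P.cls (Mult (Gen (Path \<mu>)) (Gen (Ghost \<mu>)))"
      using Cons.prems by (simp add: path ghost cls_mult) (simp add: path_term_def ghost_term_def)
    have "(\<Oplus>\<^bsub>?A\<^esub>\<mu>\<in>set (\<mu> # ls). kp_path F \<Lambda> \<mu> \<otimes>\<^bsub>?A\<^esub> kp_ghost F \<Lambda> \<mu>) =
        kp_path F \<Lambda> \<mu> \<otimes>\<^bsub>?A\<^esub> kp_ghost F \<Lambda> \<mu> \<oplus>\<^bsub>?A\<^esub>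
        (\<Oplus>\<^bsub>?A\<^esub>\<mu>\<in>set ls. kp_path F \<Lambda> \<mu> \<otimes>\<^bsub>?A\<^esub> kp_ghost F \<Lambda> \<mu>)"
      using Cons.prems by (simp, intro A.finsum_insert) (auto simp: path ghost carrier)
    moreover have "gens (Mult (Gen (Path \<mu>)) (Gen (Ghost \<mu>))) \<subseteq> kp_gens \<Lambda>"
      using Cons.prems by (auto simp: kp_gens_def)
    moreover have ls: "set ls \<subseteq> paths \<Lambda> - vertices \<Lambda>" "distinct ls" using Cons.prems by auto
    ultimately show ?case
      unfolding foldr.simps o_apply
      by (subst add[symmetric]) (use gens_foldr[OF ls(1)] Cons.IH[OF ls(2,1)] \<mu> in simp_all)
  qed
  have "kp_family_axioms \<Lambda> ?A (kp_path F \<Lambda>) (kp_ghost F \<Lambda>)"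
  proof
    fix \<mu> \<nu> assume \<mu>: "\<mu> \<in> paths \<Lambda>"
    show "kp_path F \<Lambda> \<mu> \<in> carrier ?A" "kp_ghost F \<Lambda> \<mu> \<in> carrier ?A"
      using \<mu> by (simp_all add: path ghost carrier)
    assume \<nu>: "\<nu> \<in> paths \<Lambda>"
    show "kp_path F \<Lambda> \<mu> \<otimes>\<^bsub>?A\<^esub> kp_path F \<Lambda> \<nu> = kp_path F \<Lambda> (cmp \<Lambda> \<mu> \<nu>)" if "src \<Lambda> \<mu> = rng \<Lambda> \<nu>"
      using \<mu> \<nu> that
      by (simp add: path cls_mult P.cls_eq_iff path_term_mult cmp_closed)
    show "kp_ghost F \<Lambda> \<nu> \<otimes>\<^bsub>?A\<^esub> kp_ghost F \<Lambda> \<mu> = kp_ghost F \<Lambda> (cmp \<Lambda> \<mu> \<nu>)" if "src \<Lambda> \<mu> = rng \<Lambda> \<nu>"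
      using \<mu> \<nu> that
      by (simp add: ghost cls_mult P.cls_eq_iff ghost_term_mult cmp_closed)
    show "kp_ghost F \<Lambda> \<mu> \<otimes>\<^bsub>?A\<^esub> kp_path F \<Lambda> \<nu> = (if \<mu> = \<nu> then kp_path F \<Lambda> (src \<Lambda> \<mu>) else \<zero>\<^bsub>?A\<^esub>)"
      if "deg \<Lambda> \<mu> = deg \<Lambda> \<nu>"
      using \<mu> \<nu> ghost_path_term[OF \<mu> \<nu> that]
      by (cases "\<mu> = \<nu>") (simp_all add: path ghost zero cls_mult P.cls_eq_iff src_closed)
  next
    show "finite (vertices \<Lambda>)" by (rule fin)
  next
    fix v assume v: "v \<in> vertices \<Lambda>"
    then show "kp_ghost F \<Lambda> v = kp_path F \<Lambda> v" by (simp add: kp_ghost_def kp_path_def)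
    fix n
    show "kp_path F \<Lambda> v = (\<Oplus>\<^bsub>?A\<^esub>\<mu>\<in>paths_from \<Lambda> v n. kp_path F \<Lambda> \<mu> \<otimes>\<^bsub>?A\<^esub> kp_ghost F \<Lambda> \<mu>)"
    proof (cases "n = 0")
      \<comment> \<open>Degree zero is excluded from (KP4); there the identity is the idempotence of
        \<open>v\<close> from (KP1).\<close>
      case True
      have "alg_eq (kp_relation \<Lambda> :: ('a kp_gen, 'f) alg_term \<Rightarrow> _) (Mult (path_term \<Lambda> v) (ghost_term \<Lambda> v)) (path_term \<Lambda> v)"
        using alg_eq.relation[of "kp_relation \<Lambda>", OF kp_relation.KP1[OF v v]] v
        by (simp add: path_term_def ghost_term_def)
      then have "kp_path F \<Lambda> v \<otimes>\<^bsub>?A\<^esub> kp_ghost F \<Lambda> v = kp_path F \<Lambda> v"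
        using v by (simp add: path ghost cls_mult P.cls_eq_iff vertex_path)
      moreover have "kp_path F \<Lambda> v \<in> carrier ?A" using v by (simp add: path carrier vertex_path)
      ultimately show ?thesis using v True by (simp add: paths_from_zero)
    next
      case False
      obtain ls where ls: "distinct ls" "set ls = paths_from \<Lambda> v n"
        using finite_distinct_list[OF finite_paths_from] by blast
      have sub: "set ls \<subseteq> paths \<Lambda> - vertices \<Lambda>"
      proof
        fix \<mu> assume "\<mu> \<in> set ls"
        then have "\<mu> \<in> paths \<Lambda>" "deg \<Lambda> \<mu> = n" by (simp_all add: ls(2) paths_fromD deg_paths_from)
        then show "\<mu> \<in> paths \<Lambda> - vertices \<Lambda>" using False deg_vertex by blast
      qed
      have "alg_eq (kp_relation \<Lambda> :: ('a kp_gen, 'f) alg_term \<Rightarrow> _) (path_term \<Lambda> v)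
          (foldr (\<lambda>\<mu> t. Add (Mult (Gen (Path \<mu>)) (Gen (Ghost \<mu>))) t) ls Zero)"
        using alg_eq.relation[of "kp_relation \<Lambda>", OF kp_relation.KP4[OF v False ls]] v
        by (simp add: path_term_def)
      then have "P.cls (path_term \<Lambda> v) =
          P.cls (foldr (\<lambda>\<mu> t. Add (Mult (Gen (Path \<mu>)) (Gen (Ghost \<mu>))) t) ls Zero)"
        by (rule P.cls_eqI[OF gens_path_term[OF vertex_path[OF v]] gens_foldr[OF sub]])
      then show ?thesis
        unfolding sum_foldr[OF ls(1) sub] ls(2) path[of v, symmetric] .
    qed
  next
    fix U assume U: "A.subspace U" "\<And>\<mu>. \<mu> \<in> paths \<Lambda> \<Longrightarrow> kp_path F \<Lambda> \<mu> \<in> U"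
      "\<And>\<mu>. \<mu> \<in> paths \<Lambda> \<Longrightarrow> kp_ghost F \<Lambda> \<mu> \<in> U" "\<And>x y. x \<in> U \<Longrightarrow> y \<in> U \<Longrightarrow> x \<otimes>\<^bsub>?A\<^esub> y \<in> U"
    have "P.cls x \<in> U" if "gens x \<subseteq> kp_gens \<Lambda>" for x
      using that
    proof (induction x)
      case (Gen g)
      then consider v where "g = Vert v" "v \<in> vertices \<Lambda>" | \<mu> where "g = Path \<mu>" "\<mu> \<in> paths \<Lambda> - vertices \<Lambda>"
        | \<mu> where "g = Ghost \<mu>" "\<mu> \<in> paths \<Lambda> - vertices \<Lambda>"
        by (auto simp: kp_gens_def)
      then show ?case
      proof cases
        case 1
        then show ?thesis using U(2)[of v] by (simp add: path path_term_def vertex_path)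
      next
        case 2
        then show ?thesis using U(2)[of \<mu>] by (simp add: path path_term_def)
      next
        case 3
        then show ?thesis using U(3)[of \<mu>] by (simp add: ghost ghost_term_def)
      qed
    next
      case Zero
      then show ?case using U(1) by (simp add: zero[symmetric] A.subspace_def)
    next
      case (Add x y)
      then show ?case using U(1) by (simp add: add[symmetric] A.subspace_def)
    next
      case (Mult x y)
      then show ?case using U(4) by (simp add: cls_mult[symmetric])
    next
      case (Scale c x)
      then show ?case using U(1) by (simp add: scale[symmetric] A.subspace_def)
    qed
    then show "carrier ?A \<subseteq> U"
      unfolding kp_eq by (auto elim!: P.carrierE)
  qed
  then interpret K: kp_family \<Lambda> ?A "kp_path F \<Lambda>" "kp_ghost F \<Lambda>"
    by (intro kp_family.intro row_finite_k_graph_axioms A.field_algebra_axioms)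
  have vert: "kp_gen F \<Lambda> (Vert v) = kp_path F \<Lambda> v" if "v \<in> vertices \<Lambda>" for v
    using that by (simp add: kp_path_def)
  have one: "\<one>\<^bsub>?A\<^esub> = (\<Oplus>\<^bsub>?A\<^esub>v\<in>vertices \<Lambda>. kp_path F \<Lambda> v)"
  proof -
    have "\<one>\<^bsub>?A\<^esub> = (\<Oplus>\<^bsub>?A\<^esub>v\<in>vertices \<Lambda>. kp_gen F \<Lambda> (Vert v))"
      by (simp add: finsum_kp) (simp add: kp_def module.defs)
    also have "\<dots> = (\<Oplus>\<^bsub>?A\<^esub>v\<in>vertices \<Lambda>. kp_path F \<Lambda> v)"
      by (rule A.finsum_cong') (auto simp: vert)
    finally show ?thesis .
  qed
  define W where "W v = {X \<in> carrier ?A. \<forall>x\<in>X. vanishing \<Lambda> v x}" for v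
  have W_cls: "P.cls x \<in> W v \<longleftrightarrow> vanishing \<Lambda> v x" if "gens x \<subseteq> kp_gens \<Lambda>" for x v
  proof
    have "x \<in> P.cls x" using that by (simp add: P.in_cls alg_eq.refl)
    then show "P.cls x \<in> W v \<Longrightarrow> vanishing \<Lambda> v x" by (auto simp: W_def)
    show "vanishing \<Lambda> v x \<Longrightarrow> P.cls x \<in> W v"
      using that vanishing_cong by (auto simp: W_def carrier P.in_cls)
  qed
  have "graded_kp_algebra_axioms \<Lambda> ?A (kp_path F \<Lambda>) (kp_ghost F \<Lambda>) W"
  proof
    show "\<one>\<^bsub>?A\<^esub> = (\<Oplus>\<^bsub>?A\<^esub>v\<in>vertices \<Lambda>. kp_path F \<Lambda> v)" by (rule one)
  next
    fix n
    have "hcomp ?A n = lin_span UNIV (kp_base F \<Lambda>) {kp_path F \<Lambda> \<mu> \<otimes>\<^bsub>kp_base F \<Lambda>\<^esub> kp_ghost F \<Lambda> \<nu> | \<mu> \<nu>.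
       \<mu> \<in> paths \<Lambda> \<and> \<nu> \<in> paths \<Lambda> \<and> (\<forall>i. int (deg \<Lambda> \<mu> $ i) - int (deg \<Lambda> \<nu> $ i) = n $ i)}"
      by (simp add: kp_def module.defs)
    then show "hcomp ?A n = lin_span UNIV ?A {kp_path F \<Lambda> \<mu> \<otimes>\<^bsub>?A\<^esub> kp_ghost F \<Lambda> \<nu> | \<mu> \<nu>.
       \<mu> \<in> paths \<Lambda> \<and> \<nu> \<in> paths \<Lambda> \<and> int_vec (deg \<Lambda> \<mu>) - int_vec (deg \<Lambda> \<nu>) = n}"
      by (simp add: lin_span_def finsum_kp kp_simps vec_eq_iff int_vec_def)
  next
    fix v
    show "A.subspace (W v)"
      unfolding A.subspace_def
    proof (intro conjI ballI allI)
      show "W v \<subseteq> carrier ?A" by (auto simp: W_def)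
      show "\<zero>\<^bsub>?A\<^esub> \<in> W v" by (simp add: zero W_cls vanishing_zero)
      fix X assume X: "X \<in> W v"
      then obtain x where x: "gens x \<subseteq> kp_gens \<Lambda>" "X = P.cls x"
        by (auto simp: W_def kp_eq elim!: P.carrierE)
      then show "c \<odot>\<^bsub>?A\<^esub> X \<in> W v" for c using X by (simp add: scale W_cls vanishing_scale)
      fix Y assume Y: "Y \<in> W v"
      then obtain y where y: "gens y \<subseteq> kp_gens \<Lambda>" "Y = P.cls y"
        by (auto simp: W_def kp_eq elim!: P.carrierE)
      with x show "X \<oplus>\<^bsub>?A\<^esub> Y \<in> W v" using X Y by (simp add: add W_cls vanishing_add)
    qed
    fix \<mu> \<nu> assume "\<mu> \<in> paths \<Lambda>" "\<nu> \<in> paths \<Lambda>" "deg \<Lambda> \<mu> \<noteq> deg \<Lambda> \<nu>"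
    then show "kp_path F \<Lambda> \<mu> \<otimes>\<^bsub>?A\<^esub> kp_ghost F \<Lambda> \<nu> \<in> W v"
      by (simp add: path ghost cls_mult W_cls vanishing_product)
  next
    fix v c assume "v \<in> vertices \<Lambda>" "c \<odot>\<^bsub>?A\<^esub> kp_path F \<Lambda> v \<in> W v"
    then show "c = 0" by (simp add: path scale W_cls vertex_path vanishing_vertex)
  qed
  then have "graded_kp_algebra \<Lambda> ?A (kp_path F \<Lambda>) (kp_ghost F \<Lambda>) W"
    by (intro graded_kp_algebra.intro K.kp_family_axioms K.ring_if_one_eq one)
  then show ?thesis by blast
qed

end

section \<open>The grading of a Kumjian-Pask algebra\<close>

context graded_kp_algebra
begin

lemma one_eq_sum_vertices: "x \<in> carrier A \<Longrightarrow> x = (\<Oplus>v\<in>vertices \<Lambda>. S v \<otimes> x)"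
  using unit_law(1)[of x] finsum_mult_left[of "vertices \<Lambda>" S x] by (simp add: Pi_iff vertex_path)

lemma one_eq_sum_vertices_right: "x \<in> carrier A \<Longrightarrow> x = (\<Oplus>v\<in>vertices \<Lambda>. x \<otimes> S v)"
  using unit_law(2)[of x] finsum_mult_right[of "vertices \<Lambda>" S x] by (simp add: Pi_iff vertex_path)

lemma vertex_expand:
  assumes "v \<in> vertices \<Lambda>" "x \<in> carrier A"
  shows "S v \<otimes> x = (\<Oplus>\<mu>\<in>paths_from \<Lambda> v n. S \<mu> \<otimes> (T \<mu> \<otimes> x))"
proof -
  have "S v \<otimes> x = (\<Oplus>\<mu>\<in>paths_from \<Lambda> v n. (S \<mu> \<otimes> T \<mu>) \<otimes> x)"
    using assms by (subst S_sum[of v n]) (auto simp: finsum_mult_left paths_fromD)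
  also have "\<dots> = (\<Oplus>\<mu>\<in>paths_from \<Lambda> v n. S \<mu> \<otimes> (T \<mu> \<otimes> x))"
    using assms by (intro finsum_cong') (auto simp: paths_fromD mult_assoc)
  finally show ?thesis .
qed

lemma vertex_expand_right:
  assumes "v \<in> vertices \<Lambda>" "x \<in> carrier A"
  shows "x \<otimes> S v = (\<Oplus>\<mu>\<in>paths_from \<Lambda> v n. (x \<otimes> S \<mu>) \<otimes> T \<mu>)"
proof -
  have "x \<otimes> S v = (\<Oplus>\<mu>\<in>paths_from \<Lambda> v n. x \<otimes> (S \<mu> \<otimes> T \<mu>))"
    using assms by (subst S_sum[of v n]) (auto simp: finsum_mult_right paths_fromD)
  also have "\<dots> = (\<Oplus>\<mu>\<in>paths_from \<Lambda> v n. (x \<otimes> S \<mu>) \<otimes> T \<mu>)"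
    using assms by (intro finsum_cong') (auto simp: paths_fromD mult_assoc)
  finally show ?thesis .
qed

text \<open>Expanding each vertex idempotent in degree \<open>n\<close> writes \<open>x\<close> as
  the sum of all \<open>S \<mu> \<otimes> (T \<mu> \<otimes> x)\<close>, so the products
  \<open>T \<mu> \<otimes> x\<close> determine \<open>x\<close>.\<close>

lemma zero_if_T_mult_zero:
  assumes "x \<in> carrier A" "\<And>\<mu>. \<mu> \<in> paths_deg \<Lambda> n \<Longrightarrow> T \<mu> \<otimes> x = \<zero>"
  shows "x = \<zero>"
proof -
  have "S v \<otimes> x = \<zero>" if "v \<in> vertices \<Lambda>" for v
    using that assms
    by (subst vertex_expand[of v x n]) (auto intro!: finsum_zeroI simp: paths_from_def paths_degD)
  then show ?thesis
    using one_eq_sum_vertices[OF assms(1)] by (simp add: finsum_zeroI)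
qed

lemma zero_if_mult_S_zero:
  assumes "x \<in> carrier A" "\<And>\<mu>. \<mu> \<in> paths_deg \<Lambda> n \<Longrightarrow> x \<otimes> S \<mu> = \<zero>"
  shows "x = \<zero>"
proof -
  have "x \<otimes> S v = \<zero>" if "v \<in> vertices \<Lambda>" for v
    using that assms
    by (subst vertex_expand_right[of v x n]) (auto intro!: finsum_zeroI simp: paths_from_def paths_degD)
  then show ?thesis
    using one_eq_sum_vertices_right[OF assms(1)] by (simp add: finsum_zeroI)
qed

section \<open>Monomials and products of homogeneous elements\<close>

definition monomials :: "int ^ 'k \<Rightarrow> 'a set" where
  "monomials n = {S \<mu> \<otimes> T \<nu> |\<mu> \<nu>. \<mu> \<in> paths \<Lambda> \<and> \<nu> \<in> paths \<Lambda> \<and>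
     int_vec (deg \<Lambda> \<mu>) - int_vec (deg \<Lambda> \<nu>) = n}"

lemma monomials_closed: "monomials n \<subseteq> carrier A"
  by (auto simp: monomials_def)

lemma hcomp_span: "hcomp A n = lin_span UNIV A (monomials n)"
  by (simp add: hcomp_eq monomials_def)

lemma hcomp_subspace: "subspace (hcomp A n)"
  unfolding hcomp_span by (rule subspace_lin_span) (rule monomials_closed)

lemma hcomp_closed: "x \<in> hcomp A n \<Longrightarrow> x \<in> carrier A"
  using hcomp_subspace[of n] by (auto simp: subspace_def)

lemma hcomp_zero: "\<zero> \<in> hcomp A n"
  and hcomp_add: "x \<in> hcomp A n \<Longrightarrow> y \<in> hcomp A n \<Longrightarrow> x \<oplus> y \<in> hcomp A n"
  and hcomp_scale: "x \<in> hcomp A n \<Longrightarrow> c \<odot> x \<in> hcomp A n"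
  using hcomp_subspace by (auto simp: subspace_def)

lemma hcomp_finsum: "finite I \<Longrightarrow> (\<And>i. i \<in> I \<Longrightarrow> f i \<in> hcomp A n) \<Longrightarrow> (\<Oplus>i\<in>I. f i) \<in> hcomp A n"
  by (rule subspace_finsum[OF _ hcomp_subspace])

lemma monomial_hcomp:
  "\<mu> \<in> paths \<Lambda> \<Longrightarrow> \<nu> \<in> paths \<Lambda> \<Longrightarrow> S \<mu> \<otimes> T \<nu> \<in> hcomp A (int_vec (deg \<Lambda> \<mu>) - int_vec (deg \<Lambda> \<nu>))"
  unfolding hcomp_span
  by (rule subsetD[OF lin_span_superset[OF monomials_closed]]) (auto simp: monomials_def)

lemma hcomp_induct [consumes 1, case_names subspace monomial]:
  assumes "x \<in> hcomp A n" "subspace U"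
    and "\<And>\<mu> \<nu>. \<lbrakk>\<mu> \<in> paths \<Lambda>; \<nu> \<in> paths \<Lambda>; int_vec (deg \<Lambda> \<mu>) - int_vec (deg \<Lambda> \<nu>) = n\<rbrakk> \<Longrightarrow> S \<mu> \<otimes> T \<nu> \<in> U"
  shows "x \<in> U"
  using lin_span_subset[OF assms(2), of "monomials n"] assms(1,3)
  by (auto simp: hcomp_span monomials_def)

lemma S_hcomp: "\<mu> \<in> paths \<Lambda> \<Longrightarrow> S \<mu> \<in> hcomp A (int_vec (deg \<Lambda> \<mu>))"
  using monomial_hcomp[of \<mu> "src \<Lambda> \<mu>"] by (simp add: src_closed T_vertex S_src)

lemma T_hcomp: "\<mu> \<in> paths \<Lambda> \<Longrightarrow> T \<mu> \<in> hcomp A (- int_vec (deg \<Lambda> \<mu>))"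
  using monomial_hcomp[of "src \<Lambda> \<mu>" \<mu>] by (simp add: src_closed src_T)

lemma S_vertex_hcomp: "v \<in> vertices \<Lambda> \<Longrightarrow> S v \<in> hcomp A 0"
  using S_hcomp[of v] by (simp add: vertex_path)

lemma S_mult_if:
  assumes "\<mu> \<in> paths \<Lambda>" "\<nu> \<in> paths \<Lambda>"
  shows "S \<mu> \<otimes> S \<nu> = (if src \<Lambda> \<mu> = rng \<Lambda> \<nu> then S (cmp \<Lambda> \<mu> \<nu>) else \<zero>)"
proof (cases "src \<Lambda> \<mu> = rng \<Lambda> \<nu>")
  case False
  have "S \<mu> \<otimes> S \<nu> = S \<mu> \<otimes> (S (src \<Lambda> \<mu>) \<otimes> S \<nu>)"
    using assms by (simp add: mult_assoc[symmetric] S_src)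
  then show ?thesis using assms False by (simp add: vertex_S)
qed (use assms in \<open>simp add: S_mult\<close>)

lemma T_mult_if:
  assumes "\<mu> \<in> paths \<Lambda>" "\<nu> \<in> paths \<Lambda>"
  shows "T \<nu> \<otimes> T \<mu> = (if src \<Lambda> \<mu> = rng \<Lambda> \<nu> then T (cmp \<Lambda> \<mu> \<nu>) else \<zero>)"
proof (cases "src \<Lambda> \<mu> = rng \<Lambda> \<nu>")
  case False
  have "T \<nu> \<otimes> T \<mu> = T \<nu> \<otimes> (S (src \<Lambda> \<mu>) \<otimes> T \<mu>)"
    using assms by (simp add: src_T)
  also have "\<dots> = (T \<nu> \<otimes> S (src \<Lambda> \<mu>)) \<otimes> T \<mu>"
    using assms by (simp add: mult_assoc)
  finally show ?thesis using assms False by (simp add: T_vertex_right)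
qed (use assms in \<open>simp add: T_mult\<close>)

lemma T_mult_S_hcomp:
  assumes \<mu>: "\<mu> \<in> paths \<Lambda>" and \<nu>: "\<nu> \<in> paths \<Lambda>"
  shows "T \<mu> \<otimes> S \<nu> \<in> hcomp A (int_vec (deg \<Lambda> \<nu>) - int_vec (deg \<Lambda> \<mu>))"
proof -
  let ?B = "paths_from \<Lambda> (src \<Lambda> \<nu>) (deg \<Lambda> \<mu>)"
  have "T \<mu> \<otimes> S \<nu> = T \<mu> \<otimes> (S \<nu> \<otimes> S (src \<Lambda> \<nu>))" using assms by (simp add: S_src)
  also have "S \<nu> \<otimes> S (src \<Lambda> \<nu>) = (\<Oplus>\<beta>\<in>?B. (S \<nu> \<otimes> S \<beta>) \<otimes> T \<beta>)"
    using assms by (intro vertex_expand_right) auto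
  also have "T \<mu> \<otimes> \<dots> = (\<Oplus>\<beta>\<in>?B. T \<mu> \<otimes> ((S \<nu> \<otimes> S \<beta>) \<otimes> T \<beta>))"
    using assms by (intro finsum_mult_right) (auto simp: paths_fromD)
  also have "\<dots> \<in> hcomp A (int_vec (deg \<Lambda> \<nu>) - int_vec (deg \<Lambda> \<mu>))"
  proof (rule hcomp_finsum)
    fix \<beta> assume \<beta>: "\<beta> \<in> ?B"
    then have b: "\<beta> \<in> paths \<Lambda>" "src \<Lambda> \<nu> = rng \<Lambda> \<beta>" "deg \<Lambda> \<beta> = deg \<Lambda> \<mu>"
      by (simp_all add: paths_fromD rng_paths_from deg_paths_from)
    have c: "cmp \<Lambda> \<nu> \<beta> \<in> paths \<Lambda>" "deg \<Lambda> (cmp \<Lambda> \<nu> \<beta>) = deg \<Lambda> \<mu> + deg \<Lambda> \<nu>"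
      using b \<nu> by (simp_all add: cmp_closed deg_cmp add.commute)
    obtain \<eta> \<kappa> where e: "\<eta> \<in> paths \<Lambda>" "\<kappa> \<in> paths \<Lambda>" "src \<Lambda> \<eta> = rng \<Lambda> \<kappa>"
      "deg \<Lambda> \<eta> = deg \<Lambda> \<mu>" "deg \<Lambda> \<kappa> = deg \<Lambda> \<nu>" "cmp \<Lambda> \<nu> \<beta> = cmp \<Lambda> \<eta> \<kappa>"
      using factorE[OF c] .
    have "T \<mu> \<otimes> ((S \<nu> \<otimes> S \<beta>) \<otimes> T \<beta>) = T \<mu> \<otimes> (S (cmp \<Lambda> \<nu> \<beta>) \<otimes> T \<beta>)"
      using b \<nu> by (simp add: S_mult)
    also have "S (cmp \<Lambda> \<nu> \<beta>) = S \<eta> \<otimes> S \<kappa>"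
      using e by (simp add: S_mult)
    also have "T \<mu> \<otimes> (S \<eta> \<otimes> S \<kappa> \<otimes> T \<beta>) = (T \<mu> \<otimes> S \<eta>) \<otimes> (S \<kappa> \<otimes> T \<beta>)"
      using \<mu> b e by (simp add: mult_assoc)
    also have "\<dots> = (if \<mu> = \<eta> then S \<kappa> \<otimes> T \<beta> else \<zero>)"
    proof (cases "\<mu> = \<eta>")
      case True
      have "S (rng \<Lambda> \<kappa>) \<otimes> (S \<kappa> \<otimes> T \<beta>) = S \<kappa> \<otimes> T \<beta>"
        using e b by (simp add: mult_assoc[symmetric] vertex_S_rng)
      then show ?thesis using True e by (simp add: T_S)
    qed (use \<mu> e b in \<open>simp add: T_S\<close>)
    also have "\<dots> \<in> hcomp A (int_vec (deg \<Lambda> \<nu>) - int_vec (deg \<Lambda> \<mu>))"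
      using monomial_hcomp[OF e(2) b(1)] hcomp_zero unfolding e(5) b(3) by (cases "\<mu> = \<eta>") simp_all
    finally show "T \<mu> \<otimes> ((S \<nu> \<otimes> S \<beta>) \<otimes> T \<beta>) \<in> hcomp A (int_vec (deg \<Lambda> \<nu>) - int_vec (deg \<Lambda> \<mu>))" .
  qed simp
  finally show ?thesis .
qed

lemma subspace_left_mult:
  assumes "a \<in> carrier A" "subspace U" shows "subspace {x \<in> carrier A. a \<otimes> x \<in> U}"
proof -
  have "\<zero> \<in> U" using assms(2) by (simp add: subspace_def)
  then show ?thesis
    using assms by (auto simp: subspace_def mult_add_right mult_scale_right)
qed

lemma subspace_right_mult:
  assumes "a \<in> carrier A" "subspace U" shows "subspace {x \<in> carrier A. x \<otimes> a \<in> U}"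
proof -
  have "\<zero> \<in> U" using assms(2) by (simp add: subspace_def)
  then show ?thesis
    using assms by (auto simp: subspace_def mult_add_left mult_scale_left)
qed

lemma S_mult_hcomp:
  assumes "\<mu> \<in> paths \<Lambda>" "x \<in> hcomp A n"
  shows "S \<mu> \<otimes> x \<in> hcomp A (int_vec (deg \<Lambda> \<mu>) + n)"
proof -
  have "x \<in> {x \<in> carrier A. S \<mu> \<otimes> x \<in> hcomp A (int_vec (deg \<Lambda> \<mu>) + n)}"
    using assms(2)
  proof (induction rule: hcomp_induct)
    case subspace
    show ?case using assms by (intro subspace_left_mult hcomp_subspace) simp
  next
    case (monomial \<kappa> \<nu>)
    have "S \<mu> \<otimes> (S \<kappa> \<otimes> T \<nu>) = (S \<mu> \<otimes> S \<kappa>) \<otimes> T \<nu>"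
      using assms monomial by (simp add: mult_assoc)
    also have "\<dots> \<in> hcomp A (int_vec (deg \<Lambda> \<mu>) + n)"
    proof (cases "src \<Lambda> \<mu> = rng \<Lambda> \<kappa>")
      case True
      then show ?thesis
        using monomial_hcomp[of "cmp \<Lambda> \<mu> \<kappa>" \<nu>] assms monomial
        by (simp add: S_mult cmp_closed deg_cmp int_vec_add add_diff_eq[symmetric])
    next
      case False
      then show ?thesis using assms monomial by (simp add: S_mult_if hcomp_zero)
    qed
    finally show ?case using monomial by simp
  qed
  then show ?thesis by simp
qed

lemma hcomp_mult_T:
  assumes "\<mu> \<in> paths \<Lambda>" "x \<in> hcomp A n"
  shows "x \<otimes> T \<mu> \<in> hcomp A (n - int_vec (deg \<Lambda> \<mu>))"
proof -
  have "x \<in> {x \<in> carrier A. x \<otimes> T \<mu> \<in> hcomp A (n - int_vec (deg \<Lambda> \<mu>))}"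
    using assms(2)
  proof (induction rule: hcomp_induct)
    case subspace
    show ?case using assms by (intro subspace_right_mult hcomp_subspace) simp
  next
    case (monomial \<kappa> \<nu>)
    have "(S \<kappa> \<otimes> T \<nu>) \<otimes> T \<mu> = S \<kappa> \<otimes> (T \<nu> \<otimes> T \<mu>)"
      using assms monomial by (simp add: mult_assoc)
    also have "\<dots> \<in> hcomp A (n - int_vec (deg \<Lambda> \<mu>))"
    proof (cases "src \<Lambda> \<mu> = rng \<Lambda> \<nu>")
      case True
      have n: "n - int_vec (deg \<Lambda> \<mu>) = int_vec (deg \<Lambda> \<kappa>) - (int_vec (deg \<Lambda> \<mu>) + int_vec (deg \<Lambda> \<nu>))"
        unfolding monomial(3)[symmetric] by (simp add: algebra_simps)
      show ?thesis
        unfolding n using monomial_hcomp[of \<kappa> "cmp \<Lambda> \<mu> \<nu>"] assms monomial True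
        by (simp add: T_mult cmp_closed deg_cmp int_vec_add)
    next
      case False
      then show ?thesis using assms monomial by (simp add: T_mult_if hcomp_zero)
    qed
    finally show ?case using monomial by simp
  qed
  then show ?thesis by simp
qed

text \<open>For monomials, associativity reduces the claim to the inner factor
  \<open>T \<nu> \<otimes> S \<alpha>\<close>; the outer factors only lengthen paths.\<close>

lemma hcomp_mult:
  assumes "x \<in> hcomp A n" "y \<in> hcomp A m" shows "x \<otimes> y \<in> hcomp A (n + m)"
proof -
  have "x \<in> {x \<in> carrier A. x \<otimes> y \<in> hcomp A (n + m)}"
    using assms(1)
  proof (induction rule: hcomp_induct)
    case subspace
    show ?case using assms by (intro subspace_right_mult hcomp_subspace) (simp add: hcomp_closed)
  next
    case (monomial \<mu> \<nu>)
    have "y \<in> {y \<in> carrier A. (S \<mu> \<otimes> T \<nu>) \<otimes> y \<in> hcomp A (n + m)}"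
      using assms(2)
    proof (induction rule: hcomp_induct)
      case subspace
      show ?case using monomial by (intro subspace_left_mult hcomp_subspace) simp
    next
      case (monomial \<alpha> \<beta>)
      note p = monomial \<open>\<mu> \<in> paths \<Lambda>\<close> \<open>\<nu> \<in> paths \<Lambda>\<close>
      have "(S \<mu> \<otimes> T \<nu>) \<otimes> (S \<alpha> \<otimes> T \<beta>) = (S \<mu> \<otimes> (T \<nu> \<otimes> S \<alpha>)) \<otimes> T \<beta>"
        using p by (simp add: mult_assoc)
      also have "\<dots> \<in> hcomp A (int_vec (deg \<Lambda> \<mu>) + (int_vec (deg \<Lambda> \<alpha>) - int_vec (deg \<Lambda> \<nu>)) - int_vec (deg \<Lambda> \<beta>))"
        using p by (intro hcomp_mult_T S_mult_hcomp T_mult_S_hcomp)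
      also have "int_vec (deg \<Lambda> \<mu>) + (int_vec (deg \<Lambda> \<alpha>) - int_vec (deg \<Lambda> \<nu>)) - int_vec (deg \<Lambda> \<beta>) = n + m"
        using p(3) \<open>int_vec (deg \<Lambda> \<mu>) - int_vec (deg \<Lambda> \<nu>) = n\<close> by (simp add: algebra_simps flip: p(3))
      finally show ?case using p by simp
    qed
    then show ?case using monomial by simp
  qed
  then show ?thesis by simp
qed

text \<open>The span of all monomials is closed under products and contains the generators, hence is
  the whole algebra; the sums of homogeneous elements form a subspace that contains every
  monomial.\<close>

lemma hcomp_decompose:
  assumes "x \<in> carrier A"
  obtains D f where "finite D" "\<And>n. f n \<in> hcomp A n" "x = (\<Oplus>n\<in>D. f n)"
proof -
  let ?U = "{x. \<exists>D f. finite D \<and> (\<forall>n. f n \<in> hcomp A n) \<and> x = (\<Oplus>n\<in>D. f n)}"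
  have hom: "x \<in> ?U" if "x \<in> hcomp A n" for x n
    using that hcomp_closed[OF that]
    by (auto intro!: exI[of _ "{n}"] exI[of _ "\<lambda>m. if m = n then x else \<zero>"] simp: hcomp_zero)
  have ext: "(\<Oplus>n\<in>D. f n) = (\<Oplus>n\<in>D \<union> E. if n \<in> D then f n else \<zero>)"
    if "finite D" "finite E" "\<forall>n. f n \<in> hcomp A n" for D E and f :: "int ^ 'k \<Rightarrow> 'a"
  proof (rule add.finprod_mono_neutral_cong_left)
    have "f n \<in> carrier A" for n using that(3) hcomp_closed by blast
    then show "(\<lambda>n. if n \<in> D then f n else \<zero>) \<in> D \<union> E \<rightarrow> carrier A" by simp
  qed (use that in auto)
  have U: "subspace ?U"
    unfolding subspace_def
  proof (intro conjI ballI allI)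
    show "?U \<subseteq> carrier A" using hcomp_closed by (auto intro!: finsum_closed)
    show "\<zero> \<in> ?U" by (rule hom[OF hcomp_zero])
  next
    fix x y assume "x \<in> ?U" "y \<in> ?U"
    then obtain D f E g where x: "finite D" "\<forall>n. f n \<in> hcomp A n" "x = (\<Oplus>n\<in>D. f n)"
      and y: "finite E" "\<forall>n. g n \<in> hcomp A n" "y = (\<Oplus>n\<in>E. g n)" by auto
    let ?h = "\<lambda>n. (if n \<in> D then f n else \<zero>) \<oplus> (if n \<in> E then g n else \<zero>)"
    have c: "f n \<in> carrier A" "g n \<in> carrier A" for n using x(2) y(2) hcomp_closed by blast+
    have "x \<oplus> y = (\<Oplus>n\<in>D \<union> E. ?h n)"
      using x y ext[of D E f] ext[of E D g] c
      by (subst finsum_addf) (simp_all add: Un_commute)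
    moreover have "\<forall>n. ?h n \<in> hcomp A n" using x y by (simp add: hcomp_add hcomp_zero)
    ultimately show "x \<oplus> y \<in> ?U" using x(1) y(1)
      by (intro CollectI exI[of _ "D \<union> E"] exI[of _ ?h] conjI finite_UnI)
  next
    fix c x assume "x \<in> ?U"
    then obtain D f where x: "finite D" "\<forall>n. f n \<in> hcomp A n" "x = (\<Oplus>n\<in>D. f n)" by auto
    then have "f n \<in> carrier A" for n using hcomp_closed by blast
    then have "c \<odot> x = (\<Oplus>n\<in>D. c \<odot> f n)" using x by (simp add: scale_finsum Pi_iff)
    moreover have "\<forall>n. c \<odot> f n \<in> hcomp A n" using x(2) by (simp add: hcomp_scale)
    ultimately show "c \<odot> x \<in> ?U" using x(1)
      by (intro CollectI exI[of _ D] exI[of _ "\<lambda>n. c \<odot> f n"] conjI)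
  qed
  let ?M = "\<Union>n. monomials n"
  have M: "?M \<subseteq> carrier A" using monomials_closed by blast
  have "carrier A \<subseteq> lin_span UNIV A ?M"
  proof (rule generated)
    show sub: "subspace (lin_span UNIV A ?M)" by (rule subspace_lin_span[OF M])
    have hc: "hcomp A n \<subseteq> lin_span UNIV A ?M" for n
      unfolding hcomp_span using lin_span_superset[OF M] by (intro lin_span_subset sub) auto
    then show "S \<mu> \<in> lin_span UNIV A ?M" "T \<mu> \<in> lin_span UNIV A ?M" if "\<mu> \<in> paths \<Lambda>" for \<mu>
      using that S_hcomp T_hcomp by blast+
    fix x y assume xy: "x \<in> lin_span UNIV A ?M" "y \<in> lin_span UNIV A ?M"
    \<comment> \<open>Bilinearity in two stages: the left factor is reduced to a monomial for fixed
      \<open>y\<close>, then the right factor for that monomial.\<close>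
    have "lin_span UNIV A ?M \<subseteq> {x \<in> carrier A. x \<otimes> y \<in> lin_span UNIV A ?M}"
    proof (rule lin_span_subset)
      have y: "y \<in> carrier A" using xy sub by (auto simp: subspace_def)
      then show "subspace {x \<in> carrier A. x \<otimes> y \<in> lin_span UNIV A ?M}"
        by (intro subspace_right_mult sub)
      show "?M \<subseteq> {x \<in> carrier A. x \<otimes> y \<in> lin_span UNIV A ?M}"
      proof
        fix m assume "m \<in> ?M"
        then obtain n where n: "m \<in> monomials n" by blast
        then have m: "m \<in> hcomp A n" unfolding hcomp_span using lin_span_superset[OF monomials_closed] by blast
        have "lin_span UNIV A ?M \<subseteq> {y \<in> carrier A. m \<otimes> y \<in> lin_span UNIV A ?M}"
        proof (rule lin_span_subset)
          show "subspace {y \<in> carrier A. m \<otimes> y \<in> lin_span UNIV A ?M}"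
            by (intro subspace_left_mult sub hcomp_closed[OF m])
          show "?M \<subseteq> {y \<in> carrier A. m \<otimes> y \<in> lin_span UNIV A ?M}"
          proof
            fix l assume "l \<in> ?M"
            then obtain k where "l \<in> monomials k" by blast
            then have l: "l \<in> hcomp A k" unfolding hcomp_span using lin_span_superset[OF monomials_closed] by blast
            then show "l \<in> {y \<in> carrier A. m \<otimes> y \<in> lin_span UNIV A ?M}"
              using hcomp_mult[OF m l] hc hcomp_closed[OF l] by blast
          qed
        qed
        then show "m \<in> {x \<in> carrier A. x \<otimes> y \<in> lin_span UNIV A ?M}"
          using xy(2) hcomp_closed[OF m] by blast
      qed
    qed
    then show "x \<otimes> y \<in> lin_span UNIV A ?M" using xy(1) by blast
  qed
  also have "lin_span UNIV A ?M \<subseteq> ?U"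
  proof (rule lin_span_subset[OF U], rule subsetI)
    fix m assume "m \<in> ?M"
    then obtain n where "m \<in> monomials n" by blast
    then have "m \<in> hcomp A n" unfolding hcomp_span using lin_span_superset[OF monomials_closed] by blast
    then show "m \<in> ?U" by (rule hom)
  qed
  finally have "x \<in> ?U" using assms by (rule subsetD)
  then obtain D f where "finite D" "\<And>n. f n \<in> hcomp A n" "x = (\<Oplus>n\<in>D. f n)" by auto
  then show ?thesis by (rule that)
qed

text \<open>A homogeneous element is a scalar matrix with respect to the paths of large degree.\<close>

definition scalar_at :: "'a \<Rightarrow> nat ^ 'k \<Rightarrow> nat ^ 'k \<Rightarrow> bool" where
  "scalar_at x p q \<longleftrightarrow> (\<forall>\<mu>\<in>paths_deg \<Lambda> p. \<forall>\<nu>\<in>paths_deg \<Lambda> q.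
     (\<exists>c. T \<mu> \<otimes> x \<otimes> S \<nu> = c \<odot> S (src \<Lambda> \<mu>)) \<and> (src \<Lambda> \<mu> \<noteq> src \<Lambda> \<nu> \<longrightarrow> T \<mu> \<otimes> x \<otimes> S \<nu> = \<zero>))"

text \<open>Paths of these degrees split into a prefix and a tail of degree \<open>r\<close>. For a
  nonzero value the prefixes have to be \<open>\<mu>\<close> and \<open>\<nu>\<close>, and the
  tails, having equal degree, then contribute a vertex idempotent or zero.\<close>

lemma scalar_at_monomial:
  assumes \<mu>: "\<mu> \<in> paths \<Lambda>" and \<nu>: "\<nu> \<in> paths \<Lambda>"
  shows "scalar_at (S \<mu> \<otimes> T \<nu>) (deg \<Lambda> \<mu> + r) (deg \<Lambda> \<nu> + r)"
  unfolding scalar_at_def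
proof (intro ballI)
  fix \<alpha> \<beta> assume "\<alpha> \<in> paths_deg \<Lambda> (deg \<Lambda> \<mu> + r)" "\<beta> \<in> paths_deg \<Lambda> (deg \<Lambda> \<nu> + r)"
  note ab = this[THEN paths_degD] this[THEN deg_paths_deg]
  obtain \<alpha>1 \<alpha>2 where a: "\<alpha>1 \<in> paths \<Lambda>" "\<alpha>2 \<in> paths \<Lambda>" "src \<Lambda> \<alpha>1 = rng \<Lambda> \<alpha>2"
    "deg \<Lambda> \<alpha>1 = deg \<Lambda> \<mu>" "deg \<Lambda> \<alpha>2 = r" "\<alpha> = cmp \<Lambda> \<alpha>1 \<alpha>2"
    using factorE[OF ab(1,3)] .
  obtain \<beta>1 \<beta>2 where b: "\<beta>1 \<in> paths \<Lambda>" "\<beta>2 \<in> paths \<Lambda>" "src \<Lambda> \<beta>1 = rng \<Lambda> \<beta>2"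
    "deg \<Lambda> \<beta>1 = deg \<Lambda> \<nu>" "deg \<Lambda> \<beta>2 = r" "\<beta> = cmp \<Lambda> \<beta>1 \<beta>2"
    using factorE[OF ab(2,4)] .
  have src: "src \<Lambda> \<alpha> = src \<Lambda> \<alpha>2" "src \<Lambda> \<beta> = src \<Lambda> \<beta>2" using a b src_cmp by simp_all
  have "T \<alpha> = T \<alpha>2 \<otimes> T \<alpha>1" "S \<beta> = S \<beta>1 \<otimes> S \<beta>2" using a b T_mult S_mult by simp_all
  then have "T \<alpha> \<otimes> (S \<mu> \<otimes> T \<nu>) \<otimes> S \<beta> = T \<alpha>2 \<otimes> ((T \<alpha>1 \<otimes> S \<mu>) \<otimes> ((T \<nu> \<otimes> S \<beta>1) \<otimes> S \<beta>2))"
    using a(1,2) b(1,2) \<mu> \<nu> by (simp add: mult_assoc)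
  also have "\<dots> = \<zero> \<or> \<dots> = T \<alpha>2 \<otimes> S \<beta>2"
  proof (cases "\<alpha>1 = \<mu> \<and> \<nu> = \<beta>1")
    case True
    then have "(T \<alpha>1 \<otimes> S \<mu>) \<otimes> ((T \<nu> \<otimes> S \<beta>1) \<otimes> S \<beta>2) = S (rng \<Lambda> \<alpha>2) \<otimes> S \<beta>2"
      using a b by (simp add: T_S vertex_S_rng)
    then have "T \<alpha>2 \<otimes> ((T \<alpha>1 \<otimes> S \<mu>) \<otimes> ((T \<nu> \<otimes> S \<beta>1) \<otimes> S \<beta>2)) = T \<alpha>2 \<otimes> S \<beta>2"
      using a(1,2) b(1,2) by (simp add: mult_assoc[symmetric] T_rng)
    then show ?thesis by simp
  next
    case False
    then have "(T \<alpha>1 \<otimes> S \<mu>) \<otimes> ((T \<nu> \<otimes> S \<beta>1) \<otimes> S \<beta>2) = \<zero>"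
      using a b \<mu> \<nu> by (auto simp: T_S)
    then show ?thesis using a by simp
  qed
  finally have "T \<alpha> \<otimes> (S \<mu> \<otimes> T \<nu>) \<otimes> S \<beta> = \<zero> \<or> T \<alpha> \<otimes> (S \<mu> \<otimes> T \<nu>) \<otimes> S \<beta> = T \<alpha>2 \<otimes> S \<beta>2"
    by simp
  moreover have "T \<alpha>2 \<otimes> S \<beta>2 = (if \<alpha>2 = \<beta>2 then S (src \<Lambda> \<alpha>2) else \<zero>)"
    using a b by (simp add: T_S)
  moreover have "\<zero> = 0 \<odot> S (src \<Lambda> \<alpha>2)" "S (src \<Lambda> \<alpha>2) = 1 \<odot> S (src \<Lambda> \<alpha>2)" using a(2) by simp_all
  ultimately show "(\<exists>c. T \<alpha> \<otimes> (S \<mu> \<otimes> T \<nu>) \<otimes> S \<beta> = c \<odot> S (src \<Lambda> \<alpha>)) \<and>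
      (src \<Lambda> \<alpha> \<noteq> src \<Lambda> \<beta> \<longrightarrow> T \<alpha> \<otimes> (S \<mu> \<otimes> T \<nu>) \<otimes> S \<beta> = \<zero>)"
    unfolding src by metis
qed

lemma scalar_at_combination:
  assumes "x \<in> carrier A" "y \<in> carrier A" "scalar_at x p q" "scalar_at y p q"
  shows "scalar_at (x \<oplus> c \<odot> y) p q"
  unfolding scalar_at_def
proof (intro ballI)
  fix \<mu> \<nu> assume m: "\<mu> \<in> paths_deg \<Lambda> p" and n: "\<nu> \<in> paths_deg \<Lambda> q"
  note p = m[THEN paths_degD] n[THEN paths_degD]
  have *: "T \<mu> \<otimes> (x \<oplus> c \<odot> y) \<otimes> S \<nu> = T \<mu> \<otimes> x \<otimes> S \<nu> \<oplus> c \<odot> (T \<mu> \<otimes> y \<otimes> S \<nu>)"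
    using p assms by (simp add: mult_add_left mult_add_right mult_scale_left mult_scale_right)
  obtain a b where "T \<mu> \<otimes> x \<otimes> S \<nu> = a \<odot> S (src \<Lambda> \<mu>)" "T \<mu> \<otimes> y \<otimes> S \<nu> = b \<odot> S (src \<Lambda> \<mu>)"
    using m n assms(3,4) unfolding scalar_at_def by blast
  then have "T \<mu> \<otimes> (x \<oplus> c \<odot> y) \<otimes> S \<nu> = (a + c * b) \<odot> S (src \<Lambda> \<mu>)"
    using p by (simp add: * scale_plus scale_times)
  moreover have "T \<mu> \<otimes> (x \<oplus> c \<odot> y) \<otimes> S \<nu> = \<zero>" if "src \<Lambda> \<mu> \<noteq> src \<Lambda> \<nu>"
    using that m n assms(3,4) unfolding * scalar_at_def by simp
  ultimately show "(\<exists>a. T \<mu> \<otimes> (x \<oplus> c \<odot> y) \<otimes> S \<nu> = a \<odot> S (src \<Lambda> \<mu>)) \<and>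
      (src \<Lambda> \<mu> \<noteq> src \<Lambda> \<nu> \<longrightarrow> T \<mu> \<otimes> (x \<oplus> c \<odot> y) \<otimes> S \<nu> = \<zero>)" by blast
qed

text \<open>Demanding the property for all \<open>r\<close> makes the pairs of degrees directed: two
  pairs \<open>(p, q)\<close> and \<open>(p', q')\<close> of difference \<open>n\<close> have the
  common extension \<open>(p + p', q + p')\<close>, because \<open>q + p' = q' + p\<close>. Hence
  finitely many monomials can be handled at once.\<close>

lemma hcomp_scalar_at:
  assumes "x \<in> hcomp A n"
  obtains p q where "int_vec p - int_vec q = n" "\<And>r. scalar_at x (p + r) (q + r)"
proof -
  let ?U = "{x \<in> carrier A. \<exists>p q. int_vec p - int_vec q = n \<and> (\<forall>r. scalar_at x (p + r) (q + r))}"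
  have comb: "x \<oplus> c \<odot> y \<in> ?U" if xU: "x \<in> ?U" and yU: "y \<in> ?U" for x y c
  proof -
    obtain p q where x: "int_vec p - int_vec q = n" "\<And>r. scalar_at x (p + r) (q + r)" using xU by blast
    obtain p' q' where y: "int_vec p' - int_vec q' = n" "\<And>r. scalar_at y (p' + r) (q' + r)" using yU by blast
    have "int_vec (q + p') = int_vec (q' + p)"
      using x(1) y(1) by (simp add: int_vec_add algebra_simps)
    then have *: "q + p' = q' + p" by simp
    have n: "int_vec (p + p') - int_vec (q + p') = n" using x(1) by (simp add: int_vec_add)
    have "scalar_at (x \<oplus> c \<odot> y) (p + p' + r) (q + p' + r)" for r
    proof (rule scalar_at_combination)
      show "scalar_at x (p + p' + r) (q + p' + r)" using x(2)[of "p' + r"] by (simp add: add.assoc)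
      have "scalar_at y (p' + (p + r)) (q' + (p + r))" by (rule y(2))
      moreover have "p' + (p + r) = p + p' + r" "q' + (p + r) = q + p' + r"
        using * by (simp_all add: ac_simps)
      ultimately show "scalar_at y (p + p' + r) (q + p' + r)" by simp
    qed (use that in auto)
    moreover have "x \<oplus> c \<odot> y \<in> carrier A" using xU yU by simp
    ultimately show ?thesis using n by blast
  qed
  have zero: "\<zero> \<in> ?U"
  proof -
    have "scalar_at \<zero> p q" for p q
      unfolding scalar_at_def by (auto intro!: exI[of _ 0] simp: paths_degD)
    \<comment> \<open>For the zero element any pair of difference \<open>n\<close> will do; the
      positive and negative parts of \<open>n\<close> form one.\<close>
    moreover have "int_vec (\<chi> i. nat (n $ i)) - int_vec (\<chi> i. nat (- (n $ i))) = n"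
      by (simp add: vec_eq_iff int_vec_def)
    ultimately show ?thesis by blast
  qed
  have "x \<in> ?U"
    using assms
  proof (induction rule: hcomp_induct)
    case subspace
    have "x \<oplus> y \<in> ?U" if "x \<in> ?U" "y \<in> ?U" for x y using comb[OF that, of 1] that by simp
    moreover have "c \<odot> y \<in> ?U" if "y \<in> ?U" for y c using comb[OF zero that, of c] that by simp
    ultimately show ?case using zero unfolding subspace_def by blast
  next
    case (monomial \<mu> \<nu>)
    then have "\<forall>r. scalar_at (S \<mu> \<otimes> T \<nu>) (deg \<Lambda> \<mu> + r) (deg \<Lambda> \<nu> + r)" "S \<mu> \<otimes> T \<nu> \<in> carrier A"
      by (simp_all add: scalar_at_monomial)
    then show ?case using monomial(3) by blast
  qed
  then obtain p q where "int_vec p - int_vec q = n" "\<And>r. scalar_at x (p + r) (q + r)" by blast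
  then show ?thesis by (rule that)
qed

lemma hcomp_subset_W: "n \<noteq> 0 \<Longrightarrow> hcomp A n \<subseteq> W v"
  unfolding hcomp_span
  by (rule lin_span_subset[OF W_subspace]) (auto simp: monomials_def intro: W_product)

text \<open>Zero lies in the subspace \<open>W v\<close>, which contains no nonzero multiple of
  \<open>S v\<close>.\<close>

lemma scale_vertex_eq_zero: "v \<in> vertices \<Lambda> \<Longrightarrow> c \<odot> S v = \<zero> \<longleftrightarrow> c = 0"
  using W_vertex[of v c] W_subspace[of v] by (auto simp: subspace_def)

text \<open>Compressing by \<open>T \<mu>\<close> and \<open>S \<nu>\<close> turns the summand of
  degree \<open>m\<close> into a multiple of a vertex idempotent and moves the other summands into
  nonzero degrees. These lie in \<open>W\<close>, so the multiple lies there too and must be zero.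
  An element all of whose compressions vanish is itself zero.\<close>

lemma hcomp_independent:
  assumes D: "finite D" and f: "\<And>n. n \<in> D \<Longrightarrow> f n \<in> hcomp A n" and zero: "(\<Oplus>n\<in>D. f n) = \<zero>" and m: "m \<in> D"
  shows "f m = \<zero>"
proof -
  obtain p q where pq: "int_vec p - int_vec q = m" and sc: "\<And>r. scalar_at (f m) (p + r) (q + r)"
    using hcomp_scalar_at[OF f[OF m]] by blast
  have fc: "f \<in> D \<rightarrow> carrier A" using f hcomp_closed by blast
  have "T \<mu> \<otimes> f m \<otimes> S \<nu> = \<zero>" if \<mu>: "\<mu> \<in> paths_deg \<Lambda> p" and \<nu>: "\<nu> \<in> paths_deg \<Lambda> q" for \<mu> \<nu>
  proof -
    note pd = \<mu>[THEN paths_degD] \<nu>[THEN paths_degD]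
    obtain c where c: "T \<mu> \<otimes> f m \<otimes> S \<nu> = c \<odot> S (src \<Lambda> \<mu>)"
      using sc[of 0] \<mu> \<nu> unfolding scalar_at_def by auto
    let ?g = "\<lambda>n. T \<mu> \<otimes> f n \<otimes> S \<nu>"
    have g: "?g \<in> D \<rightarrow> carrier A" using fc pd by (simp add: Pi_iff)
    have "?g n \<in> hcomp A (n - m)" if "n \<in> D" for n
    proof -
      have "?g n \<in> hcomp A (- int_vec (deg \<Lambda> \<mu>) + n + int_vec (deg \<Lambda> \<nu>))"
        using pd f[OF that] by (intro hcomp_mult T_hcomp S_hcomp)
      then show ?thesis using \<mu> \<nu> pq by (simp add: deg_paths_deg algebra_simps)
    qed
    then have W: "?g n \<in> W (src \<Lambda> \<mu>)" if "n \<in> D - {m}" for n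
      using hcomp_subset_W[of "n - m" "src \<Lambda> \<mu>"] that by auto
    have "(\<Oplus>n\<in>D. ?g n) = T \<mu> \<otimes> (\<Oplus>n\<in>D. f n) \<otimes> S \<nu>"
      using D fc pd by (subst finsum_mult_right) (auto simp: finsum_mult_left Pi_iff)
    then have "(\<Oplus>n\<in>D. ?g n) = \<zero>" using pd zero by simp
    moreover have "(\<Oplus>n\<in>D. ?g n) = ?g m \<oplus> (\<Oplus>n\<in>D - {m}. ?g n)"
    proof -
      have "(\<Oplus>n\<in>insert m (D - {m}). ?g n) = ?g m \<oplus> (\<Oplus>n\<in>D - {m}. ?g n)"
        using D m g by (intro finsum_insert) auto
      then show ?thesis using m by (simp add: insert_absorb)
    qed
    moreover have s: "(\<Oplus>n\<in>D - {m}. ?g n) \<in> W (src \<Lambda> \<mu>)"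
      using D W by (intro subspace_finsum[OF _ W_subspace]) auto
    ultimately have "c \<odot> S (src \<Lambda> \<mu>) = \<ominus> (\<Oplus>n\<in>D - {m}. ?g n)"
      using c g m pd(1) W_subspace[of "src \<Lambda> \<mu>"]
      by (intro minus_equality[symmetric]) (auto intro!: finsum_closed)
    then have "c \<odot> S (src \<Lambda> \<mu>) \<in> W (src \<Lambda> \<mu>)"
      using subspace_minus[OF W_subspace s] by simp
    then have "c = 0" by (rule W_vertex[OF src_vertex[OF pd(1)]])
    then show ?thesis using c pd(1) by simp
  qed
  note z = this
  have fm: "f m \<in> carrier A" using f[OF m] by (rule hcomp_closed)
  have "T \<mu> \<otimes> f m = \<zero>" if \<mu>: "\<mu> \<in> paths_deg \<Lambda> p" for \<mu>
  proof (rule zero_if_mult_S_zero)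
    show "T \<mu> \<otimes> f m \<in> carrier A" using fm paths_degD[OF \<mu>] by simp
  qed (rule z[OF \<mu>])
  with fm show ?thesis by (rule zero_if_T_mult_zero)
qed

end

section \<open>Graded modules\<close>

context abelian_monoid
begin

lemma finsum_bij:
  assumes "bij_betw h I J" "f \<in> J \<rightarrow> carrier G"
  shows "(\<Oplus>j\<in>J. f j) = (\<Oplus>i\<in>I. f (h i))"
  using finsum_reindex[of f h I] assms by (auto simp: bij_betw_def)

lemma finsum_Sigma:
  assumes "finite I" "\<And>i. i \<in> I \<Longrightarrow> finite (J i)" "\<And>i j. i \<in> I \<Longrightarrow> j \<in> J i \<Longrightarrow> f i j \<in> carrier G"
  shows "(\<Oplus>i\<in>I. \<Oplus>j\<in>J i. f i j) = (\<Oplus>p\<in>Sigma I J. f (fst p) (snd p))"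
  using assms
proof (induction I rule: finite_induct)
  case (insert i I)
  let ?f = "\<lambda>p. f (fst p) (snd p)"
  have inner: "(\<Oplus>j\<in>J k. f k j) \<in> carrier G" if "k \<in> insert i I" for k
    using insert.prems that by (intro finsum_closed) auto
  have "(\<Oplus>p\<in>Sigma (insert i I) J. ?f p) = (\<Oplus>p\<in>({i} \<times> J i) \<union> Sigma I J. ?f p)"
    by (rule arg_cong[where f = "finsum G ?f"]) auto
  also have "\<dots> = (\<Oplus>p\<in>{i} \<times> J i. ?f p) \<oplus> (\<Oplus>p\<in>Sigma I J. ?f p)"
    using insert by (intro finsum_Un_disjoint) auto
  also have "(\<Oplus>p\<in>{i} \<times> J i. ?f p) = (\<Oplus>j\<in>J i. f i j)"
  proof -
    have "bij_betw (Pair i) (J i) ({i} \<times> J i)" by (auto simp: bij_betw_def inj_on_def)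
    then show ?thesis using insert.prems by (subst finsum_bij) auto
  qed
  finally show ?case
    using insert inner by (simp add: Pi_iff)
qed simp

lemma finsum_swap:
  assumes "finite I" "finite J" "\<And>i j. i \<in> I \<Longrightarrow> j \<in> J \<Longrightarrow> f i j \<in> carrier G"
  shows "(\<Oplus>i\<in>I. \<Oplus>j\<in>J. f i j) = (\<Oplus>j\<in>J. \<Oplus>i\<in>I. f i j)"
proof -
  have b: "bij_betw prod.swap (J \<times> I) (I \<times> J)" by (auto simp: bij_betw_def inj_on_def image_iff)
  have "(\<Oplus>i\<in>I. \<Oplus>j\<in>J. f i j) = (\<Oplus>p\<in>I \<times> J. f (fst p) (snd p))"
    using assms by (intro finsum_Sigma) auto
  also have "\<dots> = (\<Oplus>p\<in>J \<times> I. f (snd p) (fst p))"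
    using assms by (subst finsum_bij[OF b]) auto
  also have "\<dots> = (\<Oplus>j\<in>J. \<Oplus>i\<in>I. f i j)"
    using assms by (intro finsum_Sigma[symmetric]) auto
  finally show ?thesis .
qed

lemma finsum_extend:
  assumes "finite E" "D \<subseteq> E" "f \<in> D \<rightarrow> carrier G"
  shows "(\<Oplus>n\<in>D. f n) = (\<Oplus>n\<in>E. if n \<in> D then f n else \<zero>)"
  using assms by (intro add.finprod_mono_neutral_cong_left) auto

end

lemma finsum_additive:
  assumes "abelian_monoid M" "abelian_monoid N" "f \<in> I \<rightarrow> carrier M" "finite I"
    and "g \<in> carrier M \<rightarrow> carrier N" "g \<zero>\<^bsub>M\<^esub> = \<zero>\<^bsub>N\<^esub>"
    and "\<And>x y. x \<in> carrier M \<Longrightarrow> y \<in> carrier M \<Longrightarrow> g (x \<oplus>\<^bsub>M\<^esub> y) = g x \<oplus>\<^bsub>N\<^esub> g y"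
  shows "g (\<Oplus>\<^bsub>M\<^esub>i\<in>I. f i) = (\<Oplus>\<^bsub>N\<^esub>i\<in>I. g (f i))"
proof -
  interpret M: abelian_monoid M by fact
  interpret N: abelian_monoid N by fact
  show ?thesis
    using assms(4,3) by (induction I rule: finite_induct) (use assms(5-) in \<open>auto simp: Pi_iff\<close>)
qed

section \<open>Modules and their homogeneous components\<close>

context left_module
begin

lemma smult_zero_left [simp]: "x \<in> carrier M \<Longrightarrow> \<zero>\<^bsub>A\<^esub> \<odot>\<^bsub>M\<^esub> x = \<zero>\<^bsub>M\<^esub>"
  using smult_l_distr[of "\<zero>\<^bsub>A\<^esub>" "\<zero>\<^bsub>A\<^esub>" x] smult_closed[of "\<zero>\<^bsub>A\<^esub>" x]
  by (metis M.add.r_cancel_one R.zero_closed R.l_zero)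

lemma smult_zero_right [simp]: "a \<in> carrier A \<Longrightarrow> a \<odot>\<^bsub>M\<^esub> \<zero>\<^bsub>M\<^esub> = \<zero>\<^bsub>M\<^esub>"
  using smult_r_distr[of a "\<zero>\<^bsub>M\<^esub>" "\<zero>\<^bsub>M\<^esub>"] smult_closed[of a "\<zero>\<^bsub>M\<^esub>"]
  by (metis M.add.r_cancel_one M.zero_closed M.l_zero)

lemma smult_finsum:
  assumes "finite I" "f \<in> I \<rightarrow> carrier M" "a \<in> carrier A"
  shows "a \<odot>\<^bsub>M\<^esub> (\<Oplus>\<^bsub>M\<^esub>i\<in>I. f i) = (\<Oplus>\<^bsub>M\<^esub>i\<in>I. a \<odot>\<^bsub>M\<^esub> f i)"
  using assms
  by (intro finsum_additive M.abelian_monoid_axioms) (auto simp: smult_closed smult_r_distr)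

lemma finsum_smult:
  assumes "finite I" "f \<in> I \<rightarrow> carrier A" "x \<in> carrier M"
  shows "(\<Oplus>\<^bsub>A\<^esub>i\<in>I. f i) \<odot>\<^bsub>M\<^esub> x = (\<Oplus>\<^bsub>M\<^esub>i\<in>I. f i \<odot>\<^bsub>M\<^esub> x)"
  using assms
  by (intro finsum_additive[where g = "\<lambda>a. a \<odot>\<^bsub>M\<^esub> x"] M.abelian_monoid_axioms R.abelian_monoid_axioms)
    (auto simp: smult_closed smult_l_distr)

end

context graded_left_module
begin

lemma hcomp_carrier: "x \<in> hcomp M n \<Longrightarrow> x \<in> carrier M"
  using subgroup.subset[OF hcomp_subgroup, of n] by auto

lemma hcomp_zero_closed [simp]: "\<zero>\<^bsub>M\<^esub> \<in> hcomp M n"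
  using subgroup.one_closed[OF hcomp_subgroup, of n] by simp

lemma hcomp_add_closed: "x \<in> hcomp M n \<Longrightarrow> y \<in> hcomp M n \<Longrightarrow> x \<oplus>\<^bsub>M\<^esub> y \<in> hcomp M n"
  using subgroup.m_closed[OF hcomp_subgroup, of x n y] by simp

lemma hcomp_finsum_closed:
  "finite I \<Longrightarrow> (\<And>i. i \<in> I \<Longrightarrow> f i \<in> hcomp M n) \<Longrightarrow> (\<Oplus>\<^bsub>M\<^esub>i\<in>I. f i) \<in> hcomp M n"
proof (induction I rule: finite_induct)
  case (insert i I)
  then have "f i \<in> carrier M" "f \<in> I \<rightarrow> carrier M" by (auto intro: hcomp_carrier)
  then show ?case using insert by (simp add: hcomp_add_closed)
qed simp

lemma hcomp_decomposition:
  assumes "x \<in> carrier M"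
  obtains f D where "finite D" "\<And>n. f n \<in> hcomp M n" "x = (\<Oplus>\<^bsub>M\<^esub>n\<in>D. f n)"
  using hcomp_direct_sum[OF assms] by (auto simp: Ex1_def)

text \<open>The uniqueness in \<open>hcomp_direct_sum\<close> is stated for sums over supports, so
  both families are extended by zero outside \<open>D\<close> and the sums cut down to the
  supports.\<close>

lemma hcomp_unique:
  assumes D: "finite D" and f: "\<And>n. n \<in> D \<Longrightarrow> f n \<in> hcomp M n" and g: "\<And>n. n \<in> D \<Longrightarrow> g n \<in> hcomp M n"
    and eq: "(\<Oplus>\<^bsub>M\<^esub>n\<in>D. f n) = (\<Oplus>\<^bsub>M\<^esub>n\<in>D. g n)" and m: "m \<in> D"
  shows "f m = g m"
proof -
  have ext: "(\<Oplus>\<^bsub>M\<^esub>n\<in>D. h n) = (\<Oplus>\<^bsub>M\<^esub>n\<in>{n. h' n \<noteq> \<zero>\<^bsub>M\<^esub>}. h' n)"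
    and fin: "finite {n. h' n \<noteq> \<zero>\<^bsub>M\<^esub>}" and mem: "\<forall>n. h' n \<in> hcomp M n"
    if h: "\<And>n. n \<in> D \<Longrightarrow> h n \<in> hcomp M n" and h': "h' = (\<lambda>n. if n \<in> D then h n else \<zero>\<^bsub>M\<^esub>)" for h h'
  proof -
    have sub: "{n. h' n \<noteq> \<zero>\<^bsub>M\<^esub>} \<subseteq> D" by (auto simp: h')
    show "finite {n. h' n \<noteq> \<zero>\<^bsub>M\<^esub>}" by (rule finite_subset[OF sub D])
    show "\<forall>n. h' n \<in> hcomp M n" using h by (simp add: h')
    show "(\<Oplus>\<^bsub>M\<^esub>n\<in>D. h n) = (\<Oplus>\<^bsub>M\<^esub>n\<in>{n. h' n \<noteq> \<zero>\<^bsub>M\<^esub>}. h' n)"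
      using D sub h hcomp_carrier
      by (intro M.add.finprod_mono_neutral_cong_right) (auto simp: h')
  qed
  define f' where "f' = (\<lambda>n. if n \<in> D then f n else \<zero>\<^bsub>M\<^esub>)"
  define g' where "g' = (\<lambda>n. if n \<in> D then g n else \<zero>\<^bsub>M\<^esub>)"
  have "(\<Oplus>\<^bsub>M\<^esub>n\<in>D. f n) \<in> carrier M" using f hcomp_carrier by (intro M.finsum_closed) auto
  from hcomp_direct_sum[OF this] obtain u where u: "\<And>h. (\<forall>n. h n \<in> hcomp M n) \<and>
      finite {n. h n \<noteq> \<zero>\<^bsub>M\<^esub>} \<and> (\<Oplus>\<^bsub>M\<^esub>n\<in>D. f n) = (\<Oplus>\<^bsub>M\<^esub>n\<in>{n. h n \<noteq> \<zero>\<^bsub>M\<^esub>}. h n) \<Longrightarrow> h = u"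
    by (elim ex1E) blast
  have "f' = u"
    by (intro u conjI ext[OF f f'_def] fin[OF f f'_def] mem[OF f f'_def])
  moreover have "g' = u"
    unfolding eq by (intro u[unfolded eq] conjI ext[OF g g'_def] fin[OF g g'_def] mem[OF g g'_def])
  ultimately have "f' = g'" by simp
  then have "f' m = g' m" by simp
  then show ?thesis using m by (simp add: f'_def g'_def)
qed

text \<open>Compares \<open>f\<close> with the family that is \<open>y\<close> in degree
  \<open>m\<close> and zero elsewhere, over the set enlarged by \<open>m\<close>.\<close>

lemma hcomp_component:
  assumes D: "finite D" and f: "\<And>n. n \<in> D \<Longrightarrow> f n \<in> hcomp M n" and y: "y \<in> hcomp M m"
    and eq: "y = (\<Oplus>\<^bsub>M\<^esub>n\<in>D. f n)"
  shows "y = (if m \<in> D then f m else \<zero>\<^bsub>M\<^esub>)"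
proof -
  let ?f = "\<lambda>n. if n \<in> D then f n else \<zero>\<^bsub>M\<^esub>" and ?g = "\<lambda>n. if n = m then y else \<zero>\<^bsub>M\<^esub>"
  have fc: "f \<in> D \<rightarrow> carrier M" using f hcomp_carrier by auto
  have "(\<Oplus>\<^bsub>M\<^esub>n\<in>insert m D. ?f n) = y"
    unfolding eq using D fc by (intro M.finsum_extend[symmetric]) auto
  moreover have "(\<Oplus>\<^bsub>M\<^esub>n\<in>insert m D. ?g n) = ?g m"
    using D y hcomp_carrier by (intro M.finsum_singleI) auto
  ultimately have "(\<Oplus>\<^bsub>M\<^esub>n\<in>insert m D. ?f n) = (\<Oplus>\<^bsub>M\<^esub>n\<in>insert m D. ?g n)" by simp
  then have "?f m = ?g m" using D f y by (intro hcomp_unique[of "insert m D" ?f ?g m]) auto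
  then show ?thesis by simp
qed

end

section \<open>Graded homomorphisms\<close>

lemma graded_homD:
  assumes "f \<in> graded_hom A M N"
  shows graded_hom_closed: "x \<in> carrier M \<Longrightarrow> f x \<in> carrier N"
    and graded_hom_add: "x \<in> carrier M \<Longrightarrow> y \<in> carrier M \<Longrightarrow> f (x \<oplus>\<^bsub>M\<^esub> y) = f x \<oplus>\<^bsub>N\<^esub> f y"
    and graded_hom_smult: "a \<in> carrier A \<Longrightarrow> x \<in> carrier M \<Longrightarrow> f (a \<odot>\<^bsub>M\<^esub> x) = a \<odot>\<^bsub>N\<^esub> f x"
    and graded_hom_hcomp: "x \<in> hcomp M n \<Longrightarrow> f x \<in> hcomp N n"
  using assms by (auto simp: graded_hom_def hom_def image_subset_iff)

lemma graded_hom_zero: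
  assumes "graded_left_module A M" "graded_left_module A N" "f \<in> graded_hom A M N"
  shows "f \<zero>\<^bsub>M\<^esub> = \<zero>\<^bsub>N\<^esub>"
proof -
  interpret M: graded_left_module A M by fact
  interpret N: graded_left_module A N by fact
  have "f \<zero>\<^bsub>M\<^esub> \<oplus>\<^bsub>N\<^esub> f \<zero>\<^bsub>M\<^esub> = f \<zero>\<^bsub>M\<^esub>"
    using graded_hom_add[OF assms(3), of "\<zero>\<^bsub>M\<^esub>" "\<zero>\<^bsub>M\<^esub>"] by simp
  then show ?thesis using graded_hom_closed[OF assms(3), of "\<zero>\<^bsub>M\<^esub>"] by (simp add: N.M.add.r_cancel_one)
qed

lemma graded_hom_finsum:
  assumes "graded_left_module A M" "graded_left_module A N" "f \<in> graded_hom A M N"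
    and "finite I" "h \<in> I \<rightarrow> carrier M"
  shows "f (\<Oplus>\<^bsub>M\<^esub>i\<in>I. h i) = (\<Oplus>\<^bsub>N\<^esub>i\<in>I. f (h i))"
proof -
  interpret M: graded_left_module A M by fact
  interpret N: graded_left_module A N by fact
  show ?thesis
    using assms graded_hom_closed[OF assms(3)] graded_hom_add[OF assms(3)] graded_hom_zero[OF assms(1-3)]
    by (intro finsum_additive M.M.abelian_monoid_axioms N.M.abelian_monoid_axioms) auto
qed

text \<open>Of an arbitrary preimage only the component in degree \<open>m\<close> is kept; the
  other components map into other degrees, where the homogeneous element \<open>y\<close> has no
  part.\<close>

lemma graded_hom_surj_hcomp:
  assumes "graded_left_module A M" "graded_left_module A N" "f \<in> graded_hom A M N"
    and surj: "f ` carrier M = carrier N" and y: "y \<in> hcomp N m"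
  obtains x where "x \<in> hcomp M m" "f x = y"
proof -
  interpret M: graded_left_module A M by fact
  interpret N: graded_left_module A N by fact
  have "y \<in> f ` carrier M" using surj N.hcomp_carrier[OF y] by simp
  then obtain x where x: "x \<in> carrier M" "f x = y" by (elim imageE) simp
  obtain D h where h: "finite D" "\<And>n. h n \<in> hcomp M n" "x = (\<Oplus>\<^bsub>M\<^esub>n\<in>D. h n)"
    using M.hcomp_decomposition[OF x(1)] by metis
  have hc: "h \<in> D \<rightarrow> carrier M" using h(2) M.hcomp_carrier by blast
  have "y = (\<Oplus>\<^bsub>N\<^esub>n\<in>D. f (h n))"
    using x(2) graded_hom_finsum[OF assms(1-3) h(1) hc] h(3) by simp
  then have "y = (if m \<in> D then f (h m) else \<zero>\<^bsub>N\<^esub>)"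
    using h y graded_hom_hcomp[OF assms(3)] by (intro N.hcomp_component) auto
  then have "f (if m \<in> D then h m else \<zero>\<^bsub>M\<^esub>) = y"
    using graded_hom_zero[OF assms(1-3)] by simp
  then show ?thesis using that[of "if m \<in> D then h m else \<zero>\<^bsub>M\<^esub>"] h by simp
qed

text \<open>Allows a basis whose type is known only as a multiset to be reindexed by any family with
  that multiset.\<close>

lemma mset_eq_imp_bij_betw:
  assumes "finite I" "finite J" "image_mset f (mset_set I) = image_mset g (mset_set J)"
  obtains h where "bij_betw h I J" "\<And>i. i \<in> I \<Longrightarrow> g (h i) = f i"
proof -
  have "\<exists>h. bij_betw h I J \<and> (\<forall>i\<in>I. g (h i) = f i)"
    using assms
  proof (induction I arbitrary: J rule: finite_induct)
    case empty
    then have "J = {}" by (metis image_mset_is_empty_iff mset_set.empty mset_set_empty_iff)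
    then show ?case by (auto simp: bij_betw_def)
  next
    case (insert i I)
    have "f i \<in># image_mset g (mset_set J)" using insert by (metis insertI1 finite_insert image_eqI finite_set_mset_mset_set set_image_mset)
    then obtain j where j: "j \<in> J" "g j = f i" using insert by auto
    have "mset_set J = add_mset j (mset_set (J - {j}))" using insert j by (simp add: mset_set.remove)
    then have "image_mset f (mset_set I) = image_mset g (mset_set (J - {j}))"
      using insert j by simp
    then obtain h where h: "bij_betw h I (J - {j})" "\<forall>i\<in>I. g (h i) = f i"
      using insert.IH[of "J - {j}"] insert.prems by auto
    let ?h = "h(i := j)"
    have "bij_betw ?h I (J - {j})" using h(1) insert.hyps by (subst bij_betw_cong[of I ?h h]) auto
    then have "bij_betw ?h (I \<union> {i}) ((J - {j}) \<union> {?h i})"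
      using insert.hyps by (intro notIn_Un_bij_betw) auto
    then have "bij_betw ?h (insert i I) J" using j by (simp add: insert_absorb)
    moreover have "\<forall>k\<in>insert i I. g (?h k) = f k" using h j insert.hyps by auto
    ultimately show ?case by blast
  qed
  then show ?thesis using that by blast
qed

section \<open>Graded bases\<close>

context graded_kp_algebra
begin

text \<open>A basis element \<open>x i\<close> of type \<open>(v, n)\<close> generates a summand isomorphic to the
  projective module of the vertex \<open>v\<close>, shifted by \<open>n\<close>, in which it has degree \<open>- n\<close>.\<close>

definition homogeneous_family ::
    "('a, 'm, int ^ 'k) graded_module \<Rightarrow> 'i set \<Rightarrow> ('i \<Rightarrow> 'p \<times> (int ^ 'k)) \<Rightarrow> ('i \<Rightarrow> 'm) \<Rightarrow> bool" where
  "homogeneous_family P I \<tau> x \<longleftrightarrow> finite I \<and> (\<forall>i\<in>I. fst (\<tau> i) \<in> vertices \<Lambda> \<and>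
     x i \<in> hcomp P (- snd (\<tau> i)) \<and> S (fst (\<tau> i)) \<odot>\<^bsub>P\<^esub> x i = x i)"

text \<open>Spanning is asked with coefficients of the right degree. Independence is asked for
  coefficients in the left ideal of the vertex idempotent, because that idempotent fixes the basis
  element and only this part of a coefficient has an effect.\<close>

definition graded_basis ::
    "('a, 'm, int ^ 'k) graded_module \<Rightarrow> 'i set \<Rightarrow> ('i \<Rightarrow> 'p \<times> (int ^ 'k)) \<Rightarrow> ('i \<Rightarrow> 'm) \<Rightarrow> bool" where
  "graded_basis P I \<tau> x \<longleftrightarrow> homogeneous_family P I \<tau> x \<and>
     (\<forall>m. \<forall>y\<in>hcomp P m. \<exists>a. (\<forall>i\<in>I. a i \<in> hcomp A (m + snd (\<tau> i))) \<and> y = (\<Oplus>\<^bsub>P\<^esub>i\<in>I. a i \<odot>\<^bsub>P\<^esub> x i)) \<and>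
     (\<forall>a. (\<forall>i\<in>I. a i \<in> carrier A \<and> a i \<otimes> S (fst (\<tau> i)) = a i) \<longrightarrow>
        (\<Oplus>\<^bsub>P\<^esub>i\<in>I. a i \<odot>\<^bsub>P\<^esub> x i) = \<zero>\<^bsub>P\<^esub> \<longrightarrow> (\<forall>i\<in>I. a i = \<zero>))"

text \<open>Indices in \<open>nat\<close> keep the notion free of an index type;
  \<open>has_basis_image\<close> brings bases indexed by other types into this form.\<close>

definition has_basis :: "('a, 'm, int ^ 'k) graded_module \<Rightarrow> ('p \<times> (int ^ 'k)) multiset \<Rightarrow> bool" where
  "has_basis P X \<longleftrightarrow> (\<exists>(I :: nat set) \<tau> x. graded_basis P I \<tau> x \<and> X = image_mset \<tau> (mset_set I))"

lemma vertex_absorb: "v \<in> vertices \<Lambda> \<Longrightarrow> a \<in> carrier A \<Longrightarrow> a \<otimes> S v \<otimes> S v = a \<otimes> S v"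
  by (simp add: mult_assoc S_vertex_mult)

lemma hcomp_mult_vertex: "v \<in> vertices \<Lambda> \<Longrightarrow> a \<in> hcomp A n \<Longrightarrow> a \<otimes> S v \<in> hcomp A n"
  using hcomp_mult[OF _ S_vertex_hcomp, of a n v] by simp

end

locale kp_module = graded_kp_algebra \<Lambda> A S T W + P: graded_left_module A P
  for \<Lambda> :: "('p, 'k::finite) kgraph"
    and A :: "('f::field, 'a, int ^ 'k) graded_module" (structure)
    and S T W and P :: "('a, 'm, int ^ 'k) graded_module"
begin

lemma smult_vertex_absorb:
  "v \<in> vertices \<Lambda> \<Longrightarrow> a \<in> carrier A \<Longrightarrow> y \<in> carrier P \<Longrightarrow> S v \<odot>\<^bsub>P\<^esub> y = y \<Longrightarrow>
     (a \<otimes> S v) \<odot>\<^bsub>P\<^esub> y = a \<odot>\<^bsub>P\<^esub> y"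
  by (simp add: P.smult_assoc)

lemma sum_vertices_smult: "y \<in> carrier P \<Longrightarrow> y = (\<Oplus>\<^bsub>P\<^esub>v\<in>vertices \<Lambda>. S v \<odot>\<^bsub>P\<^esub> y)"
  using P.finsum_smult[of "vertices \<Lambda>" S y] P.smult_one[of y] by (simp add: one_eq Pi_iff)

lemma smult_vertex_expand:
  assumes "v \<in> vertices \<Lambda>" "y \<in> carrier P"
  shows "S v \<odot>\<^bsub>P\<^esub> y = (\<Oplus>\<^bsub>P\<^esub>\<mu>\<in>paths_from \<Lambda> v n. S \<mu> \<odot>\<^bsub>P\<^esub> (T \<mu> \<odot>\<^bsub>P\<^esub> y))"
proof -
  have p: "\<mu> \<in> paths \<Lambda>" if "\<mu> \<in> paths_from \<Lambda> v n" for \<mu> using that by (rule paths_fromD)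
  have "S v \<odot>\<^bsub>P\<^esub> y = (\<Oplus>\<^bsub>P\<^esub>\<mu>\<in>paths_from \<Lambda> v n. (S \<mu> \<otimes> T \<mu>) \<odot>\<^bsub>P\<^esub> y)"
    using assms p by (subst S_sum[of v n]) (simp_all add: P.finsum_smult Pi_iff)
  also have "\<dots> = (\<Oplus>\<^bsub>P\<^esub>\<mu>\<in>paths_from \<Lambda> v n. S \<mu> \<odot>\<^bsub>P\<^esub> (T \<mu> \<odot>\<^bsub>P\<^esub> y))"
    using assms p by (intro P.M.finsum_cong') (simp_all add: P.smult_assoc P.smult_closed Pi_iff)
  finally show ?thesis .
qed

section \<open>Combinations of a homogeneous family\<close>

context
  fixes I :: "'i set" and \<tau> :: "'i \<Rightarrow> 'p \<times> (int ^ 'k)" and x :: "'i \<Rightarrow> 'm"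
  assumes family: "homogeneous_family P I \<tau> x"
begin

lemma family_finite: "finite I"
  using family by (simp add: homogeneous_family_def)

lemma family_vertex: "i \<in> I \<Longrightarrow> fst (\<tau> i) \<in> vertices \<Lambda>"
  and family_hcomp: "i \<in> I \<Longrightarrow> x i \<in> hcomp P (- snd (\<tau> i))"
  and family_absorb: "i \<in> I \<Longrightarrow> S (fst (\<tau> i)) \<odot>\<^bsub>P\<^esub> x i = x i"
  using family by (simp_all add: homogeneous_family_def)

lemma family_closed: "i \<in> I \<Longrightarrow> x i \<in> carrier P"
  by (rule P.hcomp_carrier[OF family_hcomp])

lemma family_absorb_sum:
  assumes "\<And>i. i \<in> I \<Longrightarrow> a i \<in> carrier A"
  shows "(\<Oplus>\<^bsub>P\<^esub>i\<in>I. (a i \<otimes> S (fst (\<tau> i))) \<odot>\<^bsub>P\<^esub> x i) = (\<Oplus>\<^bsub>P\<^esub>i\<in>I. a i \<odot>\<^bsub>P\<^esub> x i)"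
  using assms
  by (intro P.M.finsum_cong')
    (simp_all add: smult_vertex_absorb family_vertex family_closed family_absorb P.smult_closed Pi_iff)

lemma family_sum_add:
  assumes "\<And>i. i \<in> I \<Longrightarrow> a i \<in> carrier A" "\<And>i. i \<in> I \<Longrightarrow> b i \<in> carrier A"
  shows "(\<Oplus>\<^bsub>P\<^esub>i\<in>I. a i \<odot>\<^bsub>P\<^esub> x i) \<oplus>\<^bsub>P\<^esub> (\<Oplus>\<^bsub>P\<^esub>i\<in>I. b i \<odot>\<^bsub>P\<^esub> x i) = (\<Oplus>\<^bsub>P\<^esub>i\<in>I. (a i \<oplus> b i) \<odot>\<^bsub>P\<^esub> x i)"
proof -
  have "(\<Oplus>\<^bsub>P\<^esub>i\<in>I. (a i \<oplus> b i) \<odot>\<^bsub>P\<^esub> x i) = (\<Oplus>\<^bsub>P\<^esub>i\<in>I. a i \<odot>\<^bsub>P\<^esub> x i \<oplus>\<^bsub>P\<^esub> b i \<odot>\<^bsub>P\<^esub> x i)"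
    using assms family_closed
    by (intro P.M.finsum_cong') (simp_all add: P.smult_l_distr P.smult_closed Pi_iff)
  also have "\<dots> = (\<Oplus>\<^bsub>P\<^esub>i\<in>I. a i \<odot>\<^bsub>P\<^esub> x i) \<oplus>\<^bsub>P\<^esub> (\<Oplus>\<^bsub>P\<^esub>i\<in>I. b i \<odot>\<^bsub>P\<^esub> x i)"
    using assms family_closed by (intro P.M.finsum_addf) (simp_all add: P.smult_closed Pi_iff)
  finally show ?thesis by simp
qed

lemma family_sum_smult:
  assumes "\<And>i. i \<in> I \<Longrightarrow> a i \<in> carrier A" "c \<in> carrier A"
  shows "c \<odot>\<^bsub>P\<^esub> (\<Oplus>\<^bsub>P\<^esub>i\<in>I. a i \<odot>\<^bsub>P\<^esub> x i) = (\<Oplus>\<^bsub>P\<^esub>i\<in>I. (c \<otimes> a i) \<odot>\<^bsub>P\<^esub> x i)"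
proof -
  have "c \<odot>\<^bsub>P\<^esub> (\<Oplus>\<^bsub>P\<^esub>i\<in>I. a i \<odot>\<^bsub>P\<^esub> x i) = (\<Oplus>\<^bsub>P\<^esub>i\<in>I. c \<odot>\<^bsub>P\<^esub> (a i \<odot>\<^bsub>P\<^esub> x i))"
    using assms family_closed family_finite by (intro P.smult_finsum) (simp_all add: P.smult_closed Pi_iff)
  also have "\<dots> = (\<Oplus>\<^bsub>P\<^esub>i\<in>I. (c \<otimes> a i) \<odot>\<^bsub>P\<^esub> x i)"
    using assms family_closed
    by (intro P.M.finsum_cong') (simp_all add: P.smult_assoc P.smult_closed Pi_iff)
  finally show ?thesis .
qed

lemma family_sum_closed:
  "(\<And>i. i \<in> I \<Longrightarrow> a i \<in> carrier A) \<Longrightarrow> (\<Oplus>\<^bsub>P\<^esub>i\<in>I. a i \<odot>\<^bsub>P\<^esub> x i) \<in> carrier P"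
  using family_closed by (intro P.M.finsum_closed) (simp add: P.smult_closed Pi_iff)

end

section \<open>Coefficients with respect to a basis, and reindexing\<close>

context
  fixes I :: "'i set" and \<tau> :: "'i \<Rightarrow> 'p \<times> (int ^ 'k)" and x :: "'i \<Rightarrow> 'm"
  assumes basis: "graded_basis P I \<tau> x"
begin

lemma basis_family: "homogeneous_family P I \<tau> x"
  using basis by (simp add: graded_basis_def)

lemmas basis_finite = family_finite[OF basis_family]
  and basis_vertex = family_vertex[OF basis_family]
  and basis_hcomp = family_hcomp[OF basis_family]
  and basis_absorb = family_absorb[OF basis_family]
  and basis_closed = family_closed[OF basis_family]
  and basis_absorb_sum = family_absorb_sum[OF basis_family]
  and basis_sum_add = family_sum_add[OF basis_family]
  and basis_sum_smult = family_sum_smult[OF basis_family]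
  and basis_sum_closed = family_sum_closed[OF basis_family]

lemma basis_independent:
  assumes "\<And>i. i \<in> I \<Longrightarrow> a i \<in> carrier A" "\<And>i. i \<in> I \<Longrightarrow> a i \<otimes> S (fst (\<tau> i)) = a i"
    and "(\<Oplus>\<^bsub>P\<^esub>i\<in>I. a i \<odot>\<^bsub>P\<^esub> x i) = \<zero>\<^bsub>P\<^esub>" "i \<in> I"
  shows "a i = \<zero>"
  using basis assms by (simp add: graded_basis_def)

text \<open>Multiplying the coefficients by the vertex idempotents changes neither the sum nor the
  degrees, and puts them into the form in which they are unique.\<close>

lemma basis_span_hcomp:
  assumes "y \<in> hcomp P m"
  obtains a where "\<And>i. i \<in> I \<Longrightarrow> a i \<in> hcomp A (m + snd (\<tau> i))"
    "\<And>i. i \<in> I \<Longrightarrow> a i \<otimes> S (fst (\<tau> i)) = a i" "y = (\<Oplus>\<^bsub>P\<^esub>i\<in>I. a i \<odot>\<^bsub>P\<^esub> x i)"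
proof -
  obtain a where a: "\<forall>i\<in>I. a i \<in> hcomp A (m + snd (\<tau> i))" "y = (\<Oplus>\<^bsub>P\<^esub>i\<in>I. a i \<odot>\<^bsub>P\<^esub> x i)"
    using basis assms unfolding graded_basis_def by blast
  have ac: "a i \<in> carrier A" if "i \<in> I" for i using a(1) that hcomp_closed by blast
  show ?thesis
  proof (rule that[of "\<lambda>i. a i \<otimes> S (fst (\<tau> i))"])
    fix i assume "i \<in> I"
    then show "a i \<otimes> S (fst (\<tau> i)) \<in> hcomp A (m + snd (\<tau> i))"
      "a i \<otimes> S (fst (\<tau> i)) \<otimes> S (fst (\<tau> i)) = a i \<otimes> S (fst (\<tau> i))"
      using a(1) ac basis_vertex by (simp_all add: hcomp_mult_vertex vertex_absorb)
  next
    show "y = (\<Oplus>\<^bsub>P\<^esub>i\<in>I. (a i \<otimes> S (fst (\<tau> i))) \<odot>\<^bsub>P\<^esub> x i)"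
      unfolding a(2) using ac by (simp add: basis_absorb_sum)
  qed
qed

lemma basis_span:
  assumes "y \<in> carrier P"
  obtains a where "\<And>i. i \<in> I \<Longrightarrow> a i \<in> carrier A"
    "\<And>i. i \<in> I \<Longrightarrow> a i \<otimes> S (fst (\<tau> i)) = a i" "y = (\<Oplus>\<^bsub>P\<^esub>i\<in>I. a i \<odot>\<^bsub>P\<^esub> x i)"
proof -
  obtain D f where f: "finite D" "\<And>n. f n \<in> hcomp P n" "y = (\<Oplus>\<^bsub>P\<^esub>n\<in>D. f n)"
    using P.hcomp_decomposition[OF assms] by metis
  have fc: "f n \<in> carrier P" for n by (rule P.hcomp_carrier[OF f(2)])
  have "\<exists>a. (\<forall>i\<in>I. a i \<in> carrier A \<and> a i \<otimes> S (fst (\<tau> i)) = a i) \<and>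
      (\<Oplus>\<^bsub>P\<^esub>n\<in>D. f n) = (\<Oplus>\<^bsub>P\<^esub>i\<in>I. a i \<odot>\<^bsub>P\<^esub> x i)"
    using f(1)
  proof (induction D rule: finite_induct)
    case empty
    have "(\<Oplus>\<^bsub>P\<^esub>i\<in>I. \<zero> \<odot>\<^bsub>P\<^esub> x i) = \<zero>\<^bsub>P\<^esub>"
      by (rule P.M.finsum_zeroI) (simp add: basis_closed)
    then show ?case by (intro exI[of _ "\<lambda>_. \<zero>"]) (simp add: basis_vertex)
  next
    case (insert m D)
    then obtain a where a: "\<And>i. i \<in> I \<Longrightarrow> a i \<in> carrier A"
      "\<And>i. i \<in> I \<Longrightarrow> a i \<otimes> S (fst (\<tau> i)) = a i" "(\<Oplus>\<^bsub>P\<^esub>n\<in>D. f n) = (\<Oplus>\<^bsub>P\<^esub>i\<in>I. a i \<odot>\<^bsub>P\<^esub> x i)" by blast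
    obtain b where b: "\<And>i. i \<in> I \<Longrightarrow> b i \<in> hcomp A (m + snd (\<tau> i))"
      "\<And>i. i \<in> I \<Longrightarrow> b i \<otimes> S (fst (\<tau> i)) = b i" "f m = (\<Oplus>\<^bsub>P\<^esub>i\<in>I. b i \<odot>\<^bsub>P\<^esub> x i)"
      using basis_span_hcomp[OF f(2)] by blast
    have bc: "b i \<in> carrier A" if "i \<in> I" for i by (rule hcomp_closed[OF b(1)[OF that]])
    have "(\<Oplus>\<^bsub>P\<^esub>n\<in>insert m D. f n) = f m \<oplus>\<^bsub>P\<^esub> (\<Oplus>\<^bsub>P\<^esub>n\<in>D. f n)"
      using insert.hyps fc by (intro P.M.finsum_insert) simp_all
    also have "\<dots> = (\<Oplus>\<^bsub>P\<^esub>i\<in>I. (b i \<oplus> a i) \<odot>\<^bsub>P\<^esub> x i)"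
      unfolding a(3) b(3) using a(1) bc by (simp add: basis_sum_add)
    finally show ?case
      using a(1,2) b(2) bc basis_vertex
      by (intro exI[of _ "\<lambda>i. b i \<oplus> a i"]) (simp add: mult_add_left)
  qed
  then show ?thesis using that f(3) by metis
qed

lemma basis_coefficients_unique:
  assumes a: "\<And>i. i \<in> I \<Longrightarrow> a i \<in> carrier A" "\<And>i. i \<in> I \<Longrightarrow> a i \<otimes> S (fst (\<tau> i)) = a i"
    and b: "\<And>i. i \<in> I \<Longrightarrow> b i \<in> carrier A" "\<And>i. i \<in> I \<Longrightarrow> b i \<otimes> S (fst (\<tau> i)) = b i"
    and eq: "(\<Oplus>\<^bsub>P\<^esub>i\<in>I. a i \<odot>\<^bsub>P\<^esub> x i) = (\<Oplus>\<^bsub>P\<^esub>i\<in>I. b i \<odot>\<^bsub>P\<^esub> x i)" and i: "i \<in> I"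
  shows "a i = b i"
proof -
  have nb: "(- 1) \<odot> b i \<in> carrier A" if "i \<in> I" for i using b(1)[OF that] by simp
  have zero: "c \<oplus> (- 1) \<odot> c = \<zero>" if "c \<in> carrier A" for c
    using that by (simp add: scale_minus_one r_neg)
  have "(\<Oplus>\<^bsub>P\<^esub>i\<in>I. (a i \<oplus> (- 1) \<odot> b i) \<odot>\<^bsub>P\<^esub> x i) =
      (\<Oplus>\<^bsub>P\<^esub>i\<in>I. b i \<odot>\<^bsub>P\<^esub> x i) \<oplus>\<^bsub>P\<^esub> (\<Oplus>\<^bsub>P\<^esub>i\<in>I. ((- 1) \<odot> b i) \<odot>\<^bsub>P\<^esub> x i)"
    using a(1) nb by (simp add: basis_sum_add[symmetric] eq)
  also have "\<dots> = (\<Oplus>\<^bsub>P\<^esub>i\<in>I. (b i \<oplus> (- 1) \<odot> b i) \<odot>\<^bsub>P\<^esub> x i)"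
    using b(1) nb by (simp add: basis_sum_add)
  also have "\<dots> = \<zero>\<^bsub>P\<^esub>"
    using b(1) by (intro P.M.finsum_zeroI) (simp add: zero basis_closed)
  finally have "a i \<oplus> (- 1) \<odot> b i = \<zero>"
    using a b nb i basis_vertex
    by (intro basis_independent) (simp_all add: mult_add_left mult_scale_left)
  then have "a i \<oplus> \<ominus> b i = \<zero>" using b(1)[OF i] by (simp add: scale_minus_one)
  then have "\<ominus> (\<ominus> b i) = a i" using a(1)[OF i] b(1)[OF i] by (intro minus_equality) simp_all
  then show ?thesis using b(1)[OF i] by simp
qed

lemma basis_reindex:
  assumes h: "bij_betw h J I" and \<sigma>: "\<And>j. j \<in> J \<Longrightarrow> \<tau> (h j) = \<sigma> j"
  shows "graded_basis P J \<sigma> (x \<circ> h)"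
proof -
  have hI: "h j \<in> I" if "j \<in> J" for j using h that by (auto simp: bij_betw_def)
  have finJ: "finite J" using bij_betw_finite[OF h] basis_finite by simp
  have fam: "homogeneous_family P J \<sigma> (x \<circ> h)"
    using finJ hI basis_vertex basis_hcomp basis_absorb \<sigma>
    unfolding homogeneous_family_def by (metis comp_apply)
  have sum: "(\<Oplus>\<^bsub>P\<^esub>i\<in>I. a i \<odot>\<^bsub>P\<^esub> x i) = (\<Oplus>\<^bsub>P\<^esub>j\<in>J. a (h j) \<odot>\<^bsub>P\<^esub> (x \<circ> h) j)"
    if "\<And>i. i \<in> I \<Longrightarrow> a i \<in> carrier A" for a
    using P.M.finsum_bij[OF h, of "\<lambda>i. a i \<odot>\<^bsub>P\<^esub> x i"] that basis_closed
    by (simp add: P.smult_closed Pi_iff)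
  have sp: "\<exists>a. (\<forall>j\<in>J. a j \<in> hcomp A (m + snd (\<sigma> j))) \<and> y = (\<Oplus>\<^bsub>P\<^esub>j\<in>J. a j \<odot>\<^bsub>P\<^esub> (x \<circ> h) j)"
    if y: "y \<in> hcomp P m" for m y
  proof -
    obtain a where a: "\<And>i. i \<in> I \<Longrightarrow> a i \<in> hcomp A (m + snd (\<tau> i))" "y = (\<Oplus>\<^bsub>P\<^esub>i\<in>I. a i \<odot>\<^bsub>P\<^esub> x i)"
      using basis_span_hcomp[OF y] by metis
    have "y = (\<Oplus>\<^bsub>P\<^esub>j\<in>J. (a \<circ> h) j \<odot>\<^bsub>P\<^esub> (x \<circ> h) j)"
      unfolding a(2) using sum[of a] hcomp_closed[OF a(1)] by simp
    moreover have "(a \<circ> h) j \<in> hcomp A (m + snd (\<sigma> j))" if "j \<in> J" for j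
      using a(1)[OF hI[OF that]] \<sigma>[OF that] by simp
    ultimately show ?thesis by blast
  qed
  have "a j = \<zero>" if a: "\<forall>j\<in>J. a j \<in> carrier A \<and> a j \<otimes> S (fst (\<sigma> j)) = a j"
    and zero: "(\<Oplus>\<^bsub>P\<^esub>j\<in>J. a j \<odot>\<^bsub>P\<^esub> (x \<circ> h) j) = \<zero>\<^bsub>P\<^esub>" and j: "j \<in> J" for a j
  proof -
    let ?g = "the_inv_into J h"
    have g: "?g i \<in> J" "h (?g i) = i" if "i \<in> I" for i
      using that h f_the_inv_into_f_bij_betw[OF h] bij_betwE[OF bij_betw_the_inv_into[OF h]] by auto
    have gh: "?g (h j) = j" if "j \<in> J" for j using h that by (simp add: bij_betw_def the_inv_into_f_f)
    have ag: "a (?g i) \<in> carrier A" "a (?g i) \<otimes> S (fst (\<tau> i)) = a (?g i)" if "i \<in> I" for i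
      using a g[OF that] \<sigma>[OF g(1)[OF that]] by force+
    have "(\<Oplus>\<^bsub>P\<^esub>i\<in>I. a (?g i) \<odot>\<^bsub>P\<^esub> x i) = (\<Oplus>\<^bsub>P\<^esub>j\<in>J. a (?g (h j)) \<odot>\<^bsub>P\<^esub> (x \<circ> h) j)"
      using ag(1) by (rule sum)
    also have "\<dots> = (\<Oplus>\<^bsub>P\<^esub>j\<in>J. a j \<odot>\<^bsub>P\<^esub> (x \<circ> h) j)"
      using a hI basis_closed gh by (intro P.M.finsum_cong') (simp_all add: P.smult_closed Pi_iff)
    also have "\<dots> = \<zero>\<^bsub>P\<^esub>" by (rule zero)
    finally have "a (?g (h j)) = \<zero>"
      using ag hI[OF j] by (intro basis_independent[of "\<lambda>i. a (?g i)"])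
    then show ?thesis using gh[OF j] by simp
  qed
  then show ?thesis using fam sp unfolding graded_basis_def by blast
qed

lemma has_basis_image: "has_basis P (image_mset \<tau> (mset_set I))"
proof -
  obtain h where h: "bij_betw h {..<card I} I"
    using ex_bij_betw_nat_finite[OF basis_finite] by (auto simp: atLeast0LessThan)
  have "graded_basis P {..<card I} (\<tau> \<circ> h) (x \<circ> h)"
    by (rule basis_reindex[OF h]) simp
  moreover have "image_mset (\<tau> \<circ> h) (mset_set {..<card I}) = image_mset \<tau> (mset_set I)"
    using h image_mset_mset_set[of h "{..<card I}"] by (simp add: bij_betw_def flip: multiset.map_comp)
  ultimately show ?thesis unfolding has_basis_def by metis
qed

end

lemma has_basis_obtain:
  assumes "has_basis P (image_mset \<sigma> (mset_set J))" "finite J"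
  obtains y where "graded_basis P J \<sigma> y"
proof -
  obtain I :: "nat set" and \<tau> x where b: "graded_basis P I \<tau> x"
    and eq: "image_mset \<sigma> (mset_set J) = image_mset \<tau> (mset_set I)"
    using assms(1) by (auto simp: has_basis_def)
  obtain h where h: "bij_betw h J I" "\<And>j. j \<in> J \<Longrightarrow> \<tau> (h j) = \<sigma> j"
    using mset_eq_imp_bij_betw[OF assms(2) basis_finite[OF b] eq] by metis
  show ?thesis by (rule that[OF basis_reindex[OF b h]])
qed

lemma has_basis_vertices:
  assumes "has_basis P X" shows "set_mset X \<subseteq> vertices \<Lambda> \<times> UNIV"
proof
  obtain I :: "nat set" and \<tau> x where b: "graded_basis P I \<tau> x" "X = image_mset \<tau> (mset_set I)"
    using assms by (auto simp: has_basis_def)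
  fix t assume "t \<in># X"
  then obtain i where "i \<in> I" "t = \<tau> i" using b(2) basis_finite[OF b(1)] by auto
  then show "t \<in> vertices \<Lambda> \<times> UNIV" using basis_vertex[OF b(1)] by (simp add: mem_Times_iff)
qed

end

section \<open>Refinement and coarsening of bases\<close>

context kp_module
begin

lemma smult_hcomp: "a \<in> hcomp A n \<Longrightarrow> y \<in> hcomp P m \<Longrightarrow> a \<odot>\<^bsub>P\<^esub> y \<in> hcomp P (n + m)"
  by (rule P.hcomp_smult)

lemma basis_span_hcomp_ex:
  assumes "graded_basis P I \<tau> x" "y \<in> hcomp P m"
  shows "\<exists>a. (\<forall>i\<in>I. a i \<in> hcomp A (m + snd (\<tau> i)) \<and> a i \<otimes> S (fst (\<tau> i)) = a i) \<and>
    y = (\<Oplus>\<^bsub>P\<^esub>i\<in>I. a i \<odot>\<^bsub>P\<^esub> x i)"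
proof (rule basis_span_hcomp[OF assms])
  fix a assume "\<And>i. i \<in> I \<Longrightarrow> a i \<in> hcomp A (m + snd (\<tau> i))" "\<And>i. i \<in> I \<Longrightarrow> a i \<otimes> S (fst (\<tau> i)) = a i"
    "y = (\<Oplus>\<^bsub>P\<^esub>i\<in>I. a i \<odot>\<^bsub>P\<^esub> x i)"
  then show ?thesis by (intro exI[of _ a] conjI ballI)
qed

lemma basis_span_ex:
  assumes "graded_basis P I \<tau> x" "y \<in> carrier P"
  shows "\<exists>a. (\<forall>i\<in>I. a i \<in> carrier A \<and> a i \<otimes> S (fst (\<tau> i)) = a i) \<and> y = (\<Oplus>\<^bsub>P\<^esub>i\<in>I. a i \<odot>\<^bsub>P\<^esub> x i)"
proof (rule basis_span[OF assms])
  fix a assume "\<And>i. i \<in> I \<Longrightarrow> a i \<in> carrier A" "\<And>i. i \<in> I \<Longrightarrow> a i \<otimes> S (fst (\<tau> i)) = a i"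
    "y = (\<Oplus>\<^bsub>P\<^esub>i\<in>I. a i \<odot>\<^bsub>P\<^esub> x i)"
  then show ?thesis by (intro exI[of _ a] conjI ballI)
qed

lemma graded_basisI:
  assumes "homogeneous_family P I \<tau> x"
    and "\<And>m y. y \<in> hcomp P m \<Longrightarrow>
      \<exists>a. (\<forall>i\<in>I. a i \<in> hcomp A (m + snd (\<tau> i))) \<and> y = (\<Oplus>\<^bsub>P\<^esub>i\<in>I. a i \<odot>\<^bsub>P\<^esub> x i)"
    and "\<And>a i. \<lbrakk>\<forall>i\<in>I. a i \<in> carrier A \<and> a i \<otimes> S (fst (\<tau> i)) = a i;
      (\<Oplus>\<^bsub>P\<^esub>i\<in>I. a i \<odot>\<^bsub>P\<^esub> x i) = \<zero>\<^bsub>P\<^esub>; i \<in> I\<rbrakk> \<Longrightarrow> a i = \<zero>"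
  shows "graded_basis P I \<tau> x"
  unfolding graded_basis_def using assms by (intro conjI allI ballI impI)

text \<open>Every index has its own degree \<open>q i\<close>, so that elements of different degrees
  can be refined to a common one.\<close>

abbreviation refine_index :: "'i set \<Rightarrow> ('i \<Rightarrow> 'p \<times> (int ^ 'k)) \<Rightarrow> ('i \<Rightarrow> nat ^ 'k) \<Rightarrow> ('i \<times> 'p) set" where
  "refine_index I \<tau> q \<equiv> SIGMA i:I. paths_from \<Lambda> (fst (\<tau> i)) (q i)"

abbreviation refine_type ::
    "('i \<Rightarrow> 'p \<times> (int ^ 'k)) \<Rightarrow> ('i \<Rightarrow> nat ^ 'k) \<Rightarrow> 'i \<times> 'p \<Rightarrow> 'p \<times> (int ^ 'k)" where
  "refine_type \<tau> q p \<equiv> (src \<Lambda> (snd p), snd (\<tau> (fst p)) + int_vec (q (fst p)))"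

lemma family_refine:
  assumes fam: "homogeneous_family P I \<tau> x"
  shows "homogeneous_family P (refine_index I \<tau> q) (refine_type \<tau> q) (\<lambda>p. T (snd p) \<odot>\<^bsub>P\<^esub> x (fst p))"
  unfolding homogeneous_family_def
proof (intro conjI ballI)
  show "finite (refine_index I \<tau> q)" using family_finite[OF fam] by simp
  fix p assume "p \<in> refine_index I \<tau> q"
  then obtain i \<alpha> where p: "p = (i, \<alpha>)" "i \<in> I" "\<alpha> \<in> paths_from \<Lambda> (fst (\<tau> i)) (q i)" by auto
  note \<alpha> = paths_fromD[OF p(3)]
  show "fst (refine_type \<tau> q p) \<in> vertices \<Lambda>" using \<alpha> p(1) by simp
  have "T \<alpha> \<odot>\<^bsub>P\<^esub> x i \<in> hcomp P (- int_vec (deg \<Lambda> \<alpha>) + - snd (\<tau> i))"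
    by (intro smult_hcomp T_hcomp family_hcomp[OF fam] \<alpha> p(2))
  moreover have "- int_vec (deg \<Lambda> \<alpha>) + - snd (\<tau> i) = - (snd (\<tau> i) + int_vec (q i))"
    unfolding deg_paths_from[OF p(3)] by simp
  ultimately show "T (snd p) \<odot>\<^bsub>P\<^esub> x (fst p) \<in> hcomp P (- snd (refine_type \<tau> q p))"
    by (simp only: p(1) fst_conv snd_conv)
  show "S (fst (refine_type \<tau> q p)) \<odot>\<^bsub>P\<^esub> (T (snd p) \<odot>\<^bsub>P\<^esub> x (fst p)) = T (snd p) \<odot>\<^bsub>P\<^esub> x (fst p)"
    using \<alpha> p(1) family_closed[OF fam p(2)] by (simp add: P.smult_assoc[symmetric] src_T)
qed

text \<open>Spanning holds because \<open>x i\<close> is the sum of its parts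
  \<open>S \<alpha>\<close> applied to \<open>T \<alpha>\<close> applied to \<open>x i\<close>. A
  relation with coefficients \<open>b (i, \<alpha>)\<close> collapses to one among the
  \<open>x i\<close> whose coefficients are the sums of
  \<open>b (i, \<alpha>) \<otimes> T \<alpha>\<close>; multiplying these by \<open>S \<beta>\<close>
  on the right recovers each \<open>b (i, \<beta>)\<close> by (KP3).\<close>

lemma basis_refine:
  assumes basis: "graded_basis P I \<tau> x"
  shows "graded_basis P (refine_index I \<tau> q) (refine_type \<tau> q) (\<lambda>p. T (snd p) \<odot>\<^bsub>P\<^esub> x (fst p))"
    (is "graded_basis P ?J ?\<sigma> ?y")
proof -
  note finI = basis_finite[OF basis] and xc = basis_closed[OF basis]
  have path: "i \<in> I" "\<alpha> \<in> paths \<Lambda>" "rng \<Lambda> \<alpha> = fst (\<tau> i)" "deg \<Lambda> \<alpha> = q i" "src \<Lambda> \<alpha> \<in> vertices \<Lambda>"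
    if "(i, \<alpha>) \<in> ?J" for i \<alpha>
    using that by (auto simp: paths_fromD rng_paths_from deg_paths_from)
  have fam: "homogeneous_family P ?J ?\<sigma> ?y" by (rule family_refine[OF basis_family[OF basis]])
  have expand: "x i = (\<Oplus>\<^bsub>P\<^esub>\<alpha>\<in>paths_from \<Lambda> (fst (\<tau> i)) (q i). S \<alpha> \<odot>\<^bsub>P\<^esub> (T \<alpha> \<odot>\<^bsub>P\<^esub> x i))" if "i \<in> I" for i
    using smult_vertex_expand[OF basis_vertex[OF basis that] xc[OF that], of "q i"]
      basis_absorb[OF basis that] by simp
  have sp: "\<exists>b. (\<forall>p\<in>?J. b p \<in> hcomp A (m + snd (?\<sigma> p))) \<and> y = (\<Oplus>\<^bsub>P\<^esub>p\<in>?J. b p \<odot>\<^bsub>P\<^esub> ?y p)"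
    if y: "y \<in> hcomp P m" for m y
  proof -
    obtain a where a: "\<And>i. i \<in> I \<Longrightarrow> a i \<in> hcomp A (m + snd (\<tau> i))" "y = (\<Oplus>\<^bsub>P\<^esub>i\<in>I. a i \<odot>\<^bsub>P\<^esub> x i)"
      using basis_span_hcomp[OF basis y] by metis
    have ac: "a i \<in> carrier A" if "i \<in> I" for i by (rule hcomp_closed[OF a(1)[OF that]])
    let ?b = "\<lambda>p. a (fst p) \<otimes> S (snd p)"
    have "a i \<odot>\<^bsub>P\<^esub> x i = (\<Oplus>\<^bsub>P\<^esub>\<alpha>\<in>paths_from \<Lambda> (fst (\<tau> i)) (q i). ?b (i, \<alpha>) \<odot>\<^bsub>P\<^esub> ?y (i, \<alpha>))"
      if i: "i \<in> I" for i
    proof -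
      have pt: "\<alpha> \<in> paths \<Lambda>" if "\<alpha> \<in> paths_from \<Lambda> (fst (\<tau> i)) (q i)" for \<alpha> using that by (rule paths_fromD)
      have "a i \<odot>\<^bsub>P\<^esub> x i = (\<Oplus>\<^bsub>P\<^esub>\<alpha>\<in>paths_from \<Lambda> (fst (\<tau> i)) (q i). a i \<odot>\<^bsub>P\<^esub> (S \<alpha> \<odot>\<^bsub>P\<^esub> (T \<alpha> \<odot>\<^bsub>P\<^esub> x i)))"
        using pt xc[OF i] ac[OF i]
        by (subst expand[OF i]) (simp add: P.smult_finsum P.smult_closed Pi_iff)
      also have "\<dots> = (\<Oplus>\<^bsub>P\<^esub>\<alpha>\<in>paths_from \<Lambda> (fst (\<tau> i)) (q i). ?b (i, \<alpha>) \<odot>\<^bsub>P\<^esub> ?y (i, \<alpha>))"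
        using pt xc[OF i] ac[OF i]
        by (intro P.M.finsum_cong') (simp_all add: P.smult_assoc P.smult_closed Pi_iff)
      finally show ?thesis .
    qed
    then have "y = (\<Oplus>\<^bsub>P\<^esub>i\<in>I. \<Oplus>\<^bsub>P\<^esub>\<alpha>\<in>paths_from \<Lambda> (fst (\<tau> i)) (q i). ?b (i, \<alpha>) \<odot>\<^bsub>P\<^esub> ?y (i, \<alpha>))"
      unfolding a(2) using ac xc
      by (intro P.M.finsum_cong' P.M.finsum_closed)
        (auto simp: P.smult_closed Pi_iff paths_fromD intro!: P.M.finsum_closed)
    also have "\<dots> = (\<Oplus>\<^bsub>P\<^esub>p\<in>?J. ?b (fst p, snd p) \<odot>\<^bsub>P\<^esub> ?y (fst p, snd p))"
      using ac xc finI by (intro P.M.finsum_Sigma) (simp_all add: P.smult_closed paths_fromD)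
    finally have "y = (\<Oplus>\<^bsub>P\<^esub>p\<in>?J. ?b p \<odot>\<^bsub>P\<^esub> ?y p)" by simp
    moreover have "?b p \<in> hcomp A (m + snd (?\<sigma> p))" if pJ: "p \<in> ?J" for p
    proof -
      obtain i \<alpha> where p: "p = (i, \<alpha>)" "(i, \<alpha>) \<in> ?J" using pJ by (cases p) auto
      note f = path[OF p(2)]
      have "a i \<otimes> S \<alpha> \<in> hcomp A ((m + snd (\<tau> i)) + int_vec (deg \<Lambda> \<alpha>))"
        by (intro hcomp_mult a(1) S_hcomp f)
      then show ?thesis using f(4) p(1) by (simp add: add.assoc)
    qed
    ultimately show ?thesis by (intro exI[of _ ?b] conjI ballI)
  qed
  have ind: "b p = \<zero>" if b: "\<forall>p\<in>?J. b p \<in> carrier A \<and> b p \<otimes> S (fst (?\<sigma> p)) = b p"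
    and zero: "(\<Oplus>\<^bsub>P\<^esub>p\<in>?J. b p \<odot>\<^bsub>P\<^esub> ?y p) = \<zero>\<^bsub>P\<^esub>" and p: "p \<in> ?J" for b p
  proof -
    have bc: "b (i, \<alpha>) \<in> carrier A" "b (i, \<alpha>) \<otimes> S (src \<Lambda> \<alpha>) = b (i, \<alpha>)"
      if "i \<in> I" "\<alpha> \<in> paths_from \<Lambda> (fst (\<tau> i)) (q i)" for i \<alpha>
      using b that by force+
    let ?c = "\<lambda>i. \<Oplus>\<alpha>\<in>paths_from \<Lambda> (fst (\<tau> i)) (q i). b (i, \<alpha>) \<otimes> T \<alpha>"
    have cc: "?c i \<in> carrier A" if "i \<in> I" for i
      using bc that by (intro finsum_closed) (simp add: Pi_iff paths_fromD)
    have "?c i \<odot>\<^bsub>P\<^esub> x i = (\<Oplus>\<^bsub>P\<^esub>\<alpha>\<in>paths_from \<Lambda> (fst (\<tau> i)) (q i). b (i, \<alpha>) \<odot>\<^bsub>P\<^esub> ?y (i, \<alpha>))" if i: "i \<in> I" for i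
    proof -
      have pt: "\<alpha> \<in> paths \<Lambda>" if "\<alpha> \<in> paths_from \<Lambda> (fst (\<tau> i)) (q i)" for \<alpha> using that by (rule paths_fromD)
      have "?c i \<odot>\<^bsub>P\<^esub> x i = (\<Oplus>\<^bsub>P\<^esub>\<alpha>\<in>paths_from \<Lambda> (fst (\<tau> i)) (q i). (b (i, \<alpha>) \<otimes> T \<alpha>) \<odot>\<^bsub>P\<^esub> x i)"
        using bc[OF i] pt xc[OF i] by (intro P.finsum_smult) (simp_all add: Pi_iff)
      also have "\<dots> = (\<Oplus>\<^bsub>P\<^esub>\<alpha>\<in>paths_from \<Lambda> (fst (\<tau> i)) (q i). b (i, \<alpha>) \<odot>\<^bsub>P\<^esub> ?y (i, \<alpha>))"
        using bc[OF i] pt xc[OF i]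
        by (intro P.M.finsum_cong') (simp_all add: P.smult_assoc P.smult_closed Pi_iff)
      finally show ?thesis .
    qed
    then have "(\<Oplus>\<^bsub>P\<^esub>i\<in>I. ?c i \<odot>\<^bsub>P\<^esub> x i) =
        (\<Oplus>\<^bsub>P\<^esub>i\<in>I. \<Oplus>\<^bsub>P\<^esub>\<alpha>\<in>paths_from \<Lambda> (fst (\<tau> i)) (q i). b (i, \<alpha>) \<odot>\<^bsub>P\<^esub> ?y (i, \<alpha>))"
      using bc xc
      by (intro P.M.finsum_cong' P.M.finsum_closed)
        (auto simp: P.smult_closed Pi_iff paths_fromD intro!: P.M.finsum_closed)
    also have "\<dots> = (\<Oplus>\<^bsub>P\<^esub>p\<in>?J. b (fst p, snd p) \<odot>\<^bsub>P\<^esub> ?y (fst p, snd p))"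
      using bc xc finI by (intro P.M.finsum_Sigma) (simp_all add: P.smult_closed paths_fromD)
    finally have csum: "(\<Oplus>\<^bsub>P\<^esub>i\<in>I. ?c i \<odot>\<^bsub>P\<^esub> x i) = \<zero>\<^bsub>P\<^esub>" using zero by simp
    obtain i \<beta> where p: "p = (i, \<beta>)" "(i, \<beta>) \<in> ?J" using p by (cases p) auto
    note f = path[OF p(2)]
    have \<beta>: "\<beta> \<in> paths_from \<Lambda> (fst (\<tau> i)) (q i)" using p(2) by simp
    have "?c j \<otimes> S (fst (\<tau> j)) = ?c j" if j: "j \<in> I" for j
    proof -
      have "?c j \<otimes> S (fst (\<tau> j)) = (\<Oplus>\<alpha>\<in>paths_from \<Lambda> (fst (\<tau> j)) (q j). (b (j, \<alpha>) \<otimes> T \<alpha>) \<otimes> S (fst (\<tau> j)))"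
        using bc[OF j] basis_vertex[OF basis j] by (intro finsum_mult_left) (simp_all add: Pi_iff paths_fromD)
      also have "\<dots> = ?c j"
      proof (intro finsum_cong')
        fix \<alpha> assume \<alpha>: "\<alpha> \<in> paths_from \<Lambda> (fst (\<tau> j)) (q j)"
        then show "b (j, \<alpha>) \<otimes> T \<alpha> \<otimes> S (fst (\<tau> j)) = b (j, \<alpha>) \<otimes> T \<alpha>"
          using bc(1)[OF j \<alpha>] basis_vertex[OF basis j] T_rng[of \<alpha>]
          by (simp add: mult_assoc paths_fromD rng_paths_from)
      qed (use bc[OF j] in \<open>simp_all add: Pi_iff paths_fromD\<close>)
      finally show ?thesis .
    qed
    then have c0: "?c i = \<zero>"
      using cc csum f(1) by (intro basis_independent[OF basis, of ?c]) simp_all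
    have "\<zero> = ?c i \<otimes> S \<beta>" unfolding c0 using f by simp
    also have "\<dots> = (\<Oplus>\<alpha>\<in>paths_from \<Lambda> (fst (\<tau> i)) (q i). (b (i, \<alpha>) \<otimes> T \<alpha>) \<otimes> S \<beta>)"
      using bc[OF f(1)] f by (intro finsum_mult_left) (simp_all add: Pi_iff paths_fromD)
    also have "\<dots> = (b (i, \<beta>) \<otimes> T \<beta>) \<otimes> S \<beta>"
    proof (rule finsum_singleI)
      fix \<alpha> assume \<alpha>: "\<alpha> \<in> paths_from \<Lambda> (fst (\<tau> i)) (q i)" "\<alpha> \<noteq> \<beta>"
      then have "T \<alpha> \<otimes> S \<beta> = \<zero>" using f by (simp add: T_S paths_fromD deg_paths_from)
      then show "(b (i, \<alpha>) \<otimes> T \<alpha>) \<otimes> S \<beta> = \<zero>"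
        using bc(1)[OF f(1) \<alpha>(1)] \<alpha> f by (simp add: mult_assoc paths_fromD)
    qed (use \<beta> bc(1)[OF f(1) \<beta>] f in simp_all)
    also have "\<dots> = b (i, \<beta>)"
      using bc[OF f(1) \<beta>] f(2) by (simp add: mult_assoc T_S)
    finally show ?thesis using p(1) by simp
  qed
  show ?thesis by (rule graded_basisI, rule fam, erule sp, rule ind)
qed

text \<open>Inverts a refinement: the new element is assembled from the parts
  \<open>S \<alpha>\<close> applied to \<open>y (i, \<alpha>)\<close>, and by (KP3) applying
  \<open>T \<beta>\<close> returns \<open>y (i, \<beta>)\<close>. Over a non-vertex the refined
  index set is empty, so the given basis could not vouch for the validity of the types.\<close>

lemma basis_coarsen:
  assumes basis: "graded_basis P (refine_index I \<tau> q) (refine_type \<tau> q) y" and finI: "finite I"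
    and vert: "\<And>i. i \<in> I \<Longrightarrow> fst (\<tau> i) \<in> vertices \<Lambda>"
  shows "graded_basis P I \<tau> (\<lambda>i. \<Oplus>\<^bsub>P\<^esub>\<alpha>\<in>paths_from \<Lambda> (fst (\<tau> i)) (q i). S \<alpha> \<odot>\<^bsub>P\<^esub> y (i, \<alpha>))"
    (is "graded_basis P I \<tau> ?z")
proof -
  let ?J = "refine_index I \<tau> q" and ?F = "\<lambda>i. paths_from \<Lambda> (fst (\<tau> i)) (q i)"
  have yc: "y (i, \<alpha>) \<in> carrier P" if "i \<in> I" "\<alpha> \<in> ?F i" for i \<alpha>
    using basis_closed[OF basis, of "(i, \<alpha>)"] that by simp
  have ya: "S (src \<Lambda> \<alpha>) \<odot>\<^bsub>P\<^esub> y (i, \<alpha>) = y (i, \<alpha>)" if "i \<in> I" "\<alpha> \<in> ?F i" for i \<alpha>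
    using basis_absorb[OF basis, of "(i, \<alpha>)"] that by simp
  have yh: "y (i, \<alpha>) \<in> hcomp P (- (snd (\<tau> i) + int_vec (q i)))" if "i \<in> I" "\<alpha> \<in> ?F i" for i \<alpha>
    using basis_hcomp[OF basis, of "(i, \<alpha>)"] that by simp
  have zc: "?z i \<in> carrier P" if "i \<in> I" for i
    using yc[OF that] by (intro P.M.finsum_closed) (simp add: Pi_iff P.smult_closed paths_fromD)
  have Tz: "T \<beta> \<odot>\<^bsub>P\<^esub> ?z i = y (i, \<beta>)" if i: "i \<in> I" and \<beta>: "\<beta> \<in> ?F i" for i \<beta>
  proof -
    have "T \<beta> \<odot>\<^bsub>P\<^esub> ?z i = (\<Oplus>\<^bsub>P\<^esub>\<alpha>\<in>?F i. T \<beta> \<odot>\<^bsub>P\<^esub> (S \<alpha> \<odot>\<^bsub>P\<^esub> y (i, \<alpha>)))"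
      using yc[OF i] \<beta> by (intro P.smult_finsum) (simp_all add: Pi_iff P.smult_closed paths_fromD)
    also have "\<dots> = T \<beta> \<odot>\<^bsub>P\<^esub> (S \<beta> \<odot>\<^bsub>P\<^esub> y (i, \<beta>))"
    proof (rule P.M.finsum_singleI)
      fix \<alpha> assume \<alpha>: "\<alpha> \<in> ?F i" "\<alpha> \<noteq> \<beta>"
      then have "T \<beta> \<otimes> S \<alpha> = \<zero>" using \<beta> by (simp add: T_S paths_fromD deg_paths_from)
      then show "T \<beta> \<odot>\<^bsub>P\<^esub> (S \<alpha> \<odot>\<^bsub>P\<^esub> y (i, \<alpha>)) = \<zero>\<^bsub>P\<^esub>"
        using \<alpha> \<beta> yc[OF i \<alpha>(1)] by (simp add: P.smult_assoc[symmetric] paths_fromD)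
    qed (use \<beta> yc[OF i \<beta>] in \<open>simp_all add: P.smult_closed paths_fromD\<close>)
    also have "\<dots> = y (i, \<beta>)"
      using \<beta> yc[OF i \<beta>] ya[OF i \<beta>] by (simp add: P.smult_assoc[symmetric] paths_fromD T_S)
    finally show ?thesis .
  qed
  have fam: "homogeneous_family P I \<tau> ?z"
    unfolding homogeneous_family_def
  proof (intro conjI ballI)
    show "finite I" by (rule finI)
    fix i assume i: "i \<in> I"
    show "fst (\<tau> i) \<in> vertices \<Lambda>" by (rule vert[OF i])
    show "?z i \<in> hcomp P (- snd (\<tau> i))"
    proof (rule P.hcomp_finsum_closed)
      fix \<alpha> assume \<alpha>: "\<alpha> \<in> ?F i"
      have "S \<alpha> \<odot>\<^bsub>P\<^esub> y (i, \<alpha>) \<in> hcomp P (int_vec (deg \<Lambda> \<alpha>) + - (snd (\<tau> i) + int_vec (q i)))"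
        using \<alpha> by (intro smult_hcomp S_hcomp yh i) (simp_all add: paths_fromD)
      then show "S \<alpha> \<odot>\<^bsub>P\<^esub> y (i, \<alpha>) \<in> hcomp P (- snd (\<tau> i))"
        using deg_paths_from[OF \<alpha>] by simp
    qed simp
    have "S (fst (\<tau> i)) \<odot>\<^bsub>P\<^esub> ?z i = (\<Oplus>\<^bsub>P\<^esub>\<alpha>\<in>?F i. S (fst (\<tau> i)) \<odot>\<^bsub>P\<^esub> (S \<alpha> \<odot>\<^bsub>P\<^esub> y (i, \<alpha>)))"
      using yc[OF i] vert[OF i] by (intro P.smult_finsum) (simp_all add: Pi_iff P.smult_closed paths_fromD)
    also have "\<dots> = ?z i"
    proof (rule P.M.finsum_cong')
      fix \<alpha> assume \<alpha>: "\<alpha> \<in> ?F i"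
      then show "S (fst (\<tau> i)) \<odot>\<^bsub>P\<^esub> (S \<alpha> \<odot>\<^bsub>P\<^esub> y (i, \<alpha>)) = S \<alpha> \<odot>\<^bsub>P\<^esub> y (i, \<alpha>)"
        using yc[OF i \<alpha>] vert[OF i] vertex_S_rng[of \<alpha>]
        by (simp add: P.smult_assoc[symmetric] paths_fromD rng_paths_from)
    qed (use yc[OF i] in \<open>simp_all add: Pi_iff P.smult_closed paths_fromD\<close>)
    finally show "S (fst (\<tau> i)) \<odot>\<^bsub>P\<^esub> ?z i = ?z i" .
  qed
  have sp: "\<exists>b. (\<forall>i\<in>I. b i \<in> hcomp A (m + snd (\<tau> i))) \<and> w = (\<Oplus>\<^bsub>P\<^esub>i\<in>I. b i \<odot>\<^bsub>P\<^esub> ?z i)"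
    if w: "w \<in> hcomp P m" for m w
  proof -
    from basis_span_hcomp_ex[OF basis w] obtain a where
      a: "\<forall>p\<in>?J. a p \<in> hcomp A (m + snd (refine_type \<tau> q p)) \<and> a p \<otimes> S (fst (refine_type \<tau> q p)) = a p"
      "w = (\<Oplus>\<^bsub>P\<^esub>p\<in>?J. a p \<odot>\<^bsub>P\<^esub> y p)"
      by (elim exE conjE)
    have ah: "a (i, \<alpha>) \<in> hcomp A (m + (snd (\<tau> i) + int_vec (q i)))" if "i \<in> I" "\<alpha> \<in> ?F i" for i \<alpha>
      using bspec[OF a(1), of "(i, \<alpha>)"] that by simp
    have ac: "a (i, \<alpha>) \<in> carrier A" if "i \<in> I" "\<alpha> \<in> ?F i" for i \<alpha>
      by (rule hcomp_closed[OF ah[OF that]])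
    let ?b = "\<lambda>i. \<Oplus>\<alpha>\<in>?F i. a (i, \<alpha>) \<otimes> T \<alpha>"
    have "w = (\<Oplus>\<^bsub>P\<^esub>i\<in>I. \<Oplus>\<^bsub>P\<^esub>\<alpha>\<in>?F i. a (i, \<alpha>) \<odot>\<^bsub>P\<^esub> y (i, \<alpha>))"
      unfolding a(2) using P.M.finsum_Sigma[of I ?F "\<lambda>i \<alpha>. a (i, \<alpha>) \<odot>\<^bsub>P\<^esub> y (i, \<alpha>)"] finI ac yc
      by (simp add: P.smult_closed)
    also have "\<dots> = (\<Oplus>\<^bsub>P\<^esub>i\<in>I. ?b i \<odot>\<^bsub>P\<^esub> ?z i)"
    proof (rule P.M.finsum_cong')
      fix i assume i: "i \<in> I"
      have "?b i \<odot>\<^bsub>P\<^esub> ?z i = (\<Oplus>\<^bsub>P\<^esub>\<alpha>\<in>?F i. (a (i, \<alpha>) \<otimes> T \<alpha>) \<odot>\<^bsub>P\<^esub> ?z i)"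
        using ac[OF i] zc[OF i] by (intro P.finsum_smult) (simp_all add: Pi_iff paths_fromD)
      also have "\<dots> = (\<Oplus>\<^bsub>P\<^esub>\<alpha>\<in>?F i. a (i, \<alpha>) \<odot>\<^bsub>P\<^esub> y (i, \<alpha>))"
        using ac[OF i] zc[OF i] Tz[OF i] yc[OF i]
        by (intro P.M.finsum_cong') (simp_all add: Pi_iff paths_fromD P.smult_assoc P.smult_closed)
      finally show "(\<Oplus>\<^bsub>P\<^esub>\<alpha>\<in>?F i. a (i, \<alpha>) \<odot>\<^bsub>P\<^esub> y (i, \<alpha>)) = ?b i \<odot>\<^bsub>P\<^esub> ?z i" by simp
    next
      show "(\<lambda>i. ?b i \<odot>\<^bsub>P\<^esub> ?z i) \<in> I \<rightarrow> carrier P"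
        using ac zc by (intro Pi_I P.smult_closed finsum_closed) (simp_all add: Pi_iff paths_fromD)
    qed simp
    finally have "w = (\<Oplus>\<^bsub>P\<^esub>i\<in>I. ?b i \<odot>\<^bsub>P\<^esub> ?z i)" .
    moreover have "?b i \<in> hcomp A (m + snd (\<tau> i))" if i: "i \<in> I" for i
    proof (rule hcomp_finsum)
      fix \<alpha> assume \<alpha>: "\<alpha> \<in> ?F i"
      have "a (i, \<alpha>) \<otimes> T \<alpha> \<in> hcomp A ((m + (snd (\<tau> i) + int_vec (q i))) + - int_vec (deg \<Lambda> \<alpha>))"
        using \<alpha> by (intro hcomp_mult ah i T_hcomp) (simp_all add: paths_fromD)
      then show "a (i, \<alpha>) \<otimes> T \<alpha> \<in> hcomp A (m + snd (\<tau> i))"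
        using deg_paths_from[OF \<alpha>] by (simp add: add.assoc)
    qed simp
    ultimately show ?thesis by (intro exI[of _ ?b] conjI ballI)
  qed
  have ind: "b i = \<zero>" if b: "\<forall>i\<in>I. b i \<in> carrier A \<and> b i \<otimes> S (fst (\<tau> i)) = b i"
    and zero: "(\<Oplus>\<^bsub>P\<^esub>i\<in>I. b i \<odot>\<^bsub>P\<^esub> ?z i) = \<zero>\<^bsub>P\<^esub>" and i: "i \<in> I" for b i
  proof -
    let ?c = "\<lambda>p. b (fst p) \<otimes> S (snd p)"
    have bc: "b i \<in> carrier A" if "i \<in> I" for i using b that by simp
    have "(\<Oplus>\<^bsub>P\<^esub>p\<in>?J. ?c p \<odot>\<^bsub>P\<^esub> y p) = (\<Oplus>\<^bsub>P\<^esub>i\<in>I. \<Oplus>\<^bsub>P\<^esub>\<alpha>\<in>?F i. (b i \<otimes> S \<alpha>) \<odot>\<^bsub>P\<^esub> y (i, \<alpha>))"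
      using P.M.finsum_Sigma[of I ?F "\<lambda>i \<alpha>. (b i \<otimes> S \<alpha>) \<odot>\<^bsub>P\<^esub> y (i, \<alpha>)"] finI bc yc
      by (simp add: P.smult_closed paths_fromD)
    also have "\<dots> = (\<Oplus>\<^bsub>P\<^esub>i\<in>I. b i \<odot>\<^bsub>P\<^esub> ?z i)"
    proof (rule P.M.finsum_cong')
      fix i assume i: "i \<in> I"
      have "b i \<odot>\<^bsub>P\<^esub> ?z i = (\<Oplus>\<^bsub>P\<^esub>\<alpha>\<in>?F i. b i \<odot>\<^bsub>P\<^esub> (S \<alpha> \<odot>\<^bsub>P\<^esub> y (i, \<alpha>)))"
        using bc[OF i] yc[OF i] by (intro P.smult_finsum) (simp_all add: Pi_iff paths_fromD P.smult_closed)
      also have "\<dots> = (\<Oplus>\<^bsub>P\<^esub>\<alpha>\<in>?F i. (b i \<otimes> S \<alpha>) \<odot>\<^bsub>P\<^esub> y (i, \<alpha>))"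
        using bc[OF i] yc[OF i]
        by (intro P.M.finsum_cong') (simp_all add: Pi_iff paths_fromD P.smult_assoc P.smult_closed)
      finally show "(\<Oplus>\<^bsub>P\<^esub>\<alpha>\<in>?F i. (b i \<otimes> S \<alpha>) \<odot>\<^bsub>P\<^esub> y (i, \<alpha>)) = b i \<odot>\<^bsub>P\<^esub> ?z i" by simp
    next
      show "(\<lambda>i. b i \<odot>\<^bsub>P\<^esub> ?z i) \<in> I \<rightarrow> carrier P"
        using bc zc by (intro Pi_I P.smult_closed)
    qed simp
    finally have csum: "(\<Oplus>\<^bsub>P\<^esub>p\<in>?J. ?c p \<odot>\<^bsub>P\<^esub> y p) = \<zero>\<^bsub>P\<^esub>" using zero by simp
    have "b i \<otimes> S \<alpha> = \<zero>" if \<alpha>: "\<alpha> \<in> ?F i" for \<alpha>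
    proof -
      have "?c (i, \<alpha>) = \<zero>"
      proof (rule basis_independent[OF basis])
        fix p assume "p \<in> ?J"
        then have p: "fst p \<in> I" "snd p \<in> paths \<Lambda>" by (auto simp: paths_fromD)
        then show "?c p \<in> carrier A" "?c p \<otimes> S (fst (refine_type \<tau> q p)) = ?c p"
          using bc by (simp_all add: mult_assoc S_src)
      qed (use csum i \<alpha> in simp_all)
      then show ?thesis by simp
    qed
    note z = this
    have "b i = b i \<otimes> S (fst (\<tau> i))" using b i by simp
    also have "\<dots> = (\<Oplus>\<alpha>\<in>?F i. (b i \<otimes> S \<alpha>) \<otimes> T \<alpha>)"
      by (rule vertex_expand_right[OF vert[OF i] bc[OF i]])
    also have "\<dots> = \<zero>" by (rule finsum_zeroI) (simp add: z paths_fromD)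
    finally show ?thesis .
  qed
  show ?thesis by (rule graded_basisI, rule fam, erule sp, rule ind)
qed

end

lemma mset_as_image:
  obtains I :: "nat set" and \<tau> where "finite I" "X = image_mset \<tau> (mset_set I)"
proof -
  obtain xs where xs: "mset xs = X" using ex_mset by blast
  have "mset (map ((!) xs) [0..<length xs]) = image_mset ((!) xs) (mset_set {0..<length xs})"
    by (simp only: mset_map mset_upt)
  then have "X = image_mset ((!) xs) (mset_set {0..<length xs})" by (simp only: map_nth xs)
  then show ?thesis using that[of "{0..<length xs}" "(!) xs"] by simp
qed

section \<open>Invariance of types under the talented congruence\<close>

context kp_module
begin

text \<open>Links the combinatorial operation \<open>raise\<close> with the refinement of an indexed
  family along its gaps.\<close>

lemma at_level_raise_image:
  assumes "finite I" "below M (image_mset \<tau> (mset_set I))"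
  shows "at_level M (raise \<Lambda> M (image_mset \<tau> (mset_set I))) =
    image_mset (refine_type \<tau> (\<lambda>i. gap M (snd (\<tau> i)))) (mset_set (refine_index I \<tau> (\<lambda>i. gap M (snd (\<tau> i)))))"
proof -
  let ?F = "\<lambda>i. paths_from \<Lambda> (fst (\<tau> i)) (gap M (snd (\<tau> i)))"
  have l: "snd (\<tau> i) + int_vec (gap M (snd (\<tau> i))) = vec M" if "i \<in> I" for i
    using assms that by (intro int_vec_gap) (simp add: below_def)
  have "raise \<Lambda> M (image_mset \<tau> (mset_set I)) = (\<Sum>i\<in>I. \<Sum>\<alpha>\<in>?F i. {#src \<Lambda> \<alpha>#})"
    by (simp add: raise_def multiset.map_comp comp_def sum_unfold_sum_mset)
  then have "at_level M (raise \<Lambda> M (image_mset \<tau> (mset_set I))) = (\<Sum>i\<in>I. \<Sum>\<alpha>\<in>?F i. {#(src \<Lambda> \<alpha>, vec M)#})"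
    by (simp add: image_mset_sum)
  also have "\<dots> = (\<Sum>i\<in>I. \<Sum>\<alpha>\<in>?F i. {#(src \<Lambda> \<alpha>, snd (\<tau> i) + int_vec (gap M (snd (\<tau> i))))#})"
    by (rule sum.cong[OF HOL.refl]) (simp add: l)
  also have "\<dots> = (\<Sum>p\<in>Sigma I ?F. {#refine_type \<tau> (\<lambda>i. gap M (snd (\<tau> i))) p#})"
    using assms(1) by (subst sum.Sigma) (simp_all add: case_prod_unfold)
  also have "\<dots> = image_mset (refine_type \<tau> (\<lambda>i. gap M (snd (\<tau> i)))) (mset_set (Sigma I ?F))"
    using assms(1) by (intro image_mset_mset_set_eq_sum[symmetric]) simp
  finally show ?thesis .
qed

text \<open>Refinement gives one direction and coarsening the other.\<close>

lemma has_basis_at_level_iff: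
  assumes "set_mset X \<subseteq> vertices \<Lambda> \<times> UNIV" "below M X"
  shows "has_basis P (at_level M (raise \<Lambda> M X)) \<longleftrightarrow> has_basis P X"
proof -
  obtain I :: "nat set" and \<tau> where I: "finite I" "X = image_mset \<tau> (mset_set I)"
    by (rule mset_as_image)
  let ?q = "\<lambda>i. gap M (snd (\<tau> i))"
  have vert: "fst (\<tau> i) \<in> vertices \<Lambda>" if "i \<in> I" for i
    using assms(1) that I by (force simp: mem_Times_iff)
  have eq: "at_level M (raise \<Lambda> M X) = image_mset (refine_type \<tau> ?q) (mset_set (refine_index I \<tau> ?q))"
    unfolding I(2) by (rule at_level_raise_image[OF I(1) assms(2)[unfolded I(2)]])
  show ?thesis
  proof
    assume "has_basis P (at_level M (raise \<Lambda> M X))"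
    then obtain y where "graded_basis P (refine_index I \<tau> ?q) (refine_type \<tau> ?q) y"
      unfolding eq using I(1) by (elim has_basis_obtain) simp_all
    from has_basis_image[OF basis_coarsen[OF this I(1) vert]]
    show "has_basis P X" unfolding I(2) by simp
  next
    assume "has_basis P X"
    then obtain x where "graded_basis P I \<tau> x"
      unfolding I(2) using I(1) by (elim has_basis_obtain)
    from has_basis_image[OF basis_refine[OF this, of ?q]]
    show "has_basis P (at_level M (raise \<Lambda> M X))" unfolding eq .
  qed
qed

text \<open>Equivalent types meet at a diagonal degree: a basis is refined to it from
  \<open>X\<close> and coarsened from it to \<open>Y\<close>.\<close>

lemma has_basis_talented:
  assumes X: "has_basis P X" and eq: "talented_eq \<Lambda> X Y" and Y: "set_mset Y \<subseteq> vertices \<Lambda> \<times> UNIV"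
  shows "has_basis P Y"
proof -
  have "\<forall>\<^sub>F M in at_top. raise \<Lambda> M X = raise \<Lambda> M Y \<and> below M X \<and> below M Y"
    by (intro eventually_conj eventually_below talented_eq_eventually_raise eq)
  then obtain M where M: "raise \<Lambda> M X = raise \<Lambda> M Y" "below M X" "below M Y"
    using eventually_happens[of _ "at_top :: int filter"] by auto
  have "has_basis P (at_level M (raise \<Lambda> M X))"
    using X M(2) has_basis_at_level_iff[OF has_basis_vertices[OF X]] by simp
  then show ?thesis using M has_basis_at_level_iff[OF Y] by simp
qed

section \<open>The universal property of a basis and transport along isomorphisms\<close>

lemma hom_from_basis:
  assumes basis: "graded_basis P I \<tau> x" and Q: "graded_left_module A Q"
    and z: "homogeneous_family Q I \<tau> z"
  obtains f where "f \<in> graded_hom A P Q"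
    "\<forall>a. (\<forall>i\<in>I. a i \<in> carrier A) \<longrightarrow>
       f (\<Oplus>\<^bsub>P\<^esub>i\<in>I. a i \<odot>\<^bsub>P\<^esub> x i) = (\<Oplus>\<^bsub>Q\<^esub>i\<in>I. a i \<odot>\<^bsub>Q\<^esub> z i)"
proof -
  interpret Q: kp_module \<Lambda> A S T W Q
    by (intro kp_module.intro graded_kp_algebra_axioms Q)
  \<comment> \<open>The chosen coefficients are absorbed by the vertex idempotents and hence unique,
    so the choice is additive and linear after all.\<close>
  define c where "c y = (SOME a. (\<forall>i\<in>I. a i \<in> carrier A \<and> a i \<otimes> S (fst (\<tau> i)) = a i) \<and>
    y = (\<Oplus>\<^bsub>P\<^esub>i\<in>I. a i \<odot>\<^bsub>P\<^esub> x i))" for y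
  have c: "(\<forall>i\<in>I. c y i \<in> carrier A \<and> c y i \<otimes> S (fst (\<tau> i)) = c y i) \<and>
    y = (\<Oplus>\<^bsub>P\<^esub>i\<in>I. c y i \<odot>\<^bsub>P\<^esub> x i)" if "y \<in> carrier P" for y
    unfolding c_def by (rule someI_ex[OF basis_span_ex[OF basis that]])
  define f where "f y = (\<Oplus>\<^bsub>Q\<^esub>i\<in>I. c y i \<odot>\<^bsub>Q\<^esub> z i)" for y
  note vert = basis_vertex[OF basis]
  have zc: "z i \<in> carrier Q" if "i \<in> I" for i by (rule Q.family_closed[OF z that])
  have f: "f (\<Oplus>\<^bsub>P\<^esub>i\<in>I. a i \<odot>\<^bsub>P\<^esub> x i) = (\<Oplus>\<^bsub>Q\<^esub>i\<in>I. a i \<odot>\<^bsub>Q\<^esub> z i)"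
    if a: "\<And>i. i \<in> I \<Longrightarrow> a i \<in> carrier A" for a
  proof -
    let ?y = "\<Oplus>\<^bsub>P\<^esub>i\<in>I. a i \<odot>\<^bsub>P\<^esub> x i" and ?a = "\<lambda>i. a i \<otimes> S (fst (\<tau> i))"
    have yc: "?y \<in> carrier P" by (rule basis_sum_closed[OF basis a])
    note c = c[OF yc]
    have "(\<Oplus>\<^bsub>P\<^esub>i\<in>I. ?a i \<odot>\<^bsub>P\<^esub> x i) = ?y" by (rule basis_absorb_sum[OF basis a])
    then have e: "(\<Oplus>\<^bsub>P\<^esub>i\<in>I. c ?y i \<odot>\<^bsub>P\<^esub> x i) = (\<Oplus>\<^bsub>P\<^esub>i\<in>I. ?a i \<odot>\<^bsub>P\<^esub> x i)" using c by simp
    have "c ?y i = ?a i" if i: "i \<in> I" for i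
    proof (rule basis_coefficients_unique[OF basis _ _ _ _ e i])
      fix i assume i: "i \<in> I"
      show "c ?y i \<in> carrier A" "c ?y i \<otimes> S (fst (\<tau> i)) = c ?y i"
        using conjunct1[OF c] i by simp_all
      show "?a i \<in> carrier A" "?a i \<otimes> S (fst (\<tau> i)) = ?a i"
        using a[OF i] vert[OF i] by (simp_all add: vertex_absorb)
    qed
    then have "f ?y = (\<Oplus>\<^bsub>Q\<^esub>i\<in>I. ?a i \<odot>\<^bsub>Q\<^esub> z i)"
      unfolding f_def using a zc vert by (intro Q.P.M.finsum_cong') (simp_all add: Pi_iff Q.P.smult_closed)
    also have "\<dots> = (\<Oplus>\<^bsub>Q\<^esub>i\<in>I. a i \<odot>\<^bsub>Q\<^esub> z i)" by (rule Q.family_absorb_sum[OF z a])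
    finally show ?thesis .
  qed
  have "f \<in> graded_hom A P Q"
    unfolding graded_hom_def hom_def mem_Collect_eq
  proof (intro conjI ballI allI Pi_I)
    fix y assume "y \<in> carrier (add_monoid P)"
    then have y: "y \<in> carrier P" by simp
    obtain a where a: "\<And>i. i \<in> I \<Longrightarrow> a i \<in> carrier A" "y = (\<Oplus>\<^bsub>P\<^esub>i\<in>I. a i \<odot>\<^bsub>P\<^esub> x i)"
      using c[OF y] by blast
    have fy: "f y = (\<Oplus>\<^bsub>Q\<^esub>i\<in>I. a i \<odot>\<^bsub>Q\<^esub> z i)" unfolding a(2) by (rule f[OF a(1)])
    show "f y \<in> carrier (add_monoid Q)"
      unfolding fy using Q.family_sum_closed[OF z a(1)] by simp
    fix w assume "w \<in> carrier (add_monoid P)"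
    then have w: "w \<in> carrier P" by simp
    obtain b where b: "\<And>i. i \<in> I \<Longrightarrow> b i \<in> carrier A" "w = (\<Oplus>\<^bsub>P\<^esub>i\<in>I. b i \<odot>\<^bsub>P\<^esub> x i)"
      using c[OF w] by blast
    have fw: "f w = (\<Oplus>\<^bsub>Q\<^esub>i\<in>I. b i \<odot>\<^bsub>Q\<^esub> z i)" unfolding b(2) by (rule f[OF b(1)])
    have "y \<oplus>\<^bsub>P\<^esub> w = (\<Oplus>\<^bsub>P\<^esub>i\<in>I. (a i \<oplus> b i) \<odot>\<^bsub>P\<^esub> x i)"
      unfolding a(2) b(2) by (rule basis_sum_add[OF basis a(1) b(1)])
    then have "f (y \<oplus>\<^bsub>P\<^esub> w) = (\<Oplus>\<^bsub>Q\<^esub>i\<in>I. (a i \<oplus> b i) \<odot>\<^bsub>Q\<^esub> z i)"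
      using a(1) b(1) by (simp add: f)
    also have "\<dots> = f y \<oplus>\<^bsub>Q\<^esub> f w"
      unfolding fy fw by (rule Q.family_sum_add[OF z a(1) b(1), symmetric])
    finally show "f (y \<otimes>\<^bsub>add_monoid P\<^esub> w) = f y \<otimes>\<^bsub>add_monoid Q\<^esub> f w" by simp
  next
    fix r y assume r: "r \<in> carrier A" and y: "y \<in> carrier P"
    obtain a where a: "\<And>i. i \<in> I \<Longrightarrow> a i \<in> carrier A" "y = (\<Oplus>\<^bsub>P\<^esub>i\<in>I. a i \<odot>\<^bsub>P\<^esub> x i)"
      using c[OF y] by blast
    have fy: "f y = (\<Oplus>\<^bsub>Q\<^esub>i\<in>I. a i \<odot>\<^bsub>Q\<^esub> z i)" unfolding a(2) by (rule f[OF a(1)])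
    have "r \<odot>\<^bsub>P\<^esub> y = (\<Oplus>\<^bsub>P\<^esub>i\<in>I. (r \<otimes> a i) \<odot>\<^bsub>P\<^esub> x i)"
      unfolding a(2) by (rule basis_sum_smult[OF basis a(1) r])
    then have "f (r \<odot>\<^bsub>P\<^esub> y) = (\<Oplus>\<^bsub>Q\<^esub>i\<in>I. (r \<otimes> a i) \<odot>\<^bsub>Q\<^esub> z i)"
      using a(1) r by (simp add: f)
    also have "\<dots> = r \<odot>\<^bsub>Q\<^esub> f y"
      unfolding fy by (rule Q.family_sum_smult[OF z a(1) r, symmetric])
    finally show "f (r \<odot>\<^bsub>P\<^esub> y) = r \<odot>\<^bsub>Q\<^esub> f y" .
  next
    fix m
    show "f ` hcomp P m \<subseteq> hcomp Q m"
    proof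
      fix w assume "w \<in> f ` hcomp P m"
      then obtain y where y: "y \<in> hcomp P m" "w = f y" by auto
      from basis_span_hcomp_ex[OF basis y(1)] obtain a where
        a: "\<forall>i\<in>I. a i \<in> hcomp A (m + snd (\<tau> i)) \<and> a i \<otimes> S (fst (\<tau> i)) = a i"
        "y = (\<Oplus>\<^bsub>P\<^esub>i\<in>I. a i \<odot>\<^bsub>P\<^esub> x i)" by (elim exE conjE)
      have ah: "a i \<in> hcomp A (m + snd (\<tau> i))" if "i \<in> I" for i using a(1) that by simp
      have w: "w = (\<Oplus>\<^bsub>Q\<^esub>i\<in>I. a i \<odot>\<^bsub>Q\<^esub> z i)"
        unfolding y(2) a(2) by (rule f[OF hcomp_closed[OF ah]])
      show "w \<in> hcomp Q m"
        unfolding w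
      proof (rule Q.P.hcomp_finsum_closed)
        fix i assume i: "i \<in> I"
        have "a i \<odot>\<^bsub>Q\<^esub> z i \<in> hcomp Q ((m + snd (\<tau> i)) + - snd (\<tau> i))"
          by (rule Q.smult_hcomp[OF ah[OF i] Q.family_hcomp[OF z i]])
        then show "a i \<odot>\<^bsub>Q\<^esub> z i \<in> hcomp Q m" by simp
      qed (rule basis_finite[OF basis])
    qed
  qed
  then show ?thesis by (rule that) (simp add: f)
qed

lemma isomorphic_if_same_basis:
  assumes basis: "graded_basis P I \<tau> x" and Q: "graded_left_module A Q"
    and z: "graded_basis Q I \<tau> z"
  shows "graded_isomorphic A P Q"
proof -
  interpret Q: kp_module \<Lambda> A S T W Q
    by (intro kp_module.intro graded_kp_algebra_axioms Q)
  obtain f where f: "f \<in> graded_hom A P Q"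
    "\<forall>a. (\<forall>i\<in>I. a i \<in> carrier A) \<longrightarrow>
       f (\<Oplus>\<^bsub>P\<^esub>i\<in>I. a i \<odot>\<^bsub>P\<^esub> x i) = (\<Oplus>\<^bsub>Q\<^esub>i\<in>I. a i \<odot>\<^bsub>Q\<^esub> z i)"
    by (rule hom_from_basis[OF basis Q Q.basis_family[OF z]])
  have "bij_betw f (carrier P) (carrier Q)"
  proof (rule bij_betw_imageI)
    show "inj_on f (carrier P)"
    proof (rule inj_onI)
      fix u w assume u: "u \<in> carrier P" and w: "w \<in> carrier P" and fe: "f u = f w"
      from basis_span_ex[OF basis u] obtain a where
        a: "\<forall>i\<in>I. a i \<in> carrier A \<and> a i \<otimes> S (fst (\<tau> i)) = a i" "u = (\<Oplus>\<^bsub>P\<^esub>i\<in>I. a i \<odot>\<^bsub>P\<^esub> x i)"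
        by (elim exE conjE)
      from basis_span_ex[OF basis w] obtain b where
        b: "\<forall>i\<in>I. b i \<in> carrier A \<and> b i \<otimes> S (fst (\<tau> i)) = b i" "w = (\<Oplus>\<^bsub>P\<^esub>i\<in>I. b i \<odot>\<^bsub>P\<^esub> x i)"
        by (elim exE conjE)
      have e: "(\<Oplus>\<^bsub>Q\<^esub>i\<in>I. a i \<odot>\<^bsub>Q\<^esub> z i) = (\<Oplus>\<^bsub>Q\<^esub>i\<in>I. b i \<odot>\<^bsub>Q\<^esub> z i)"
        using fe f(2)[rule_format, of a] f(2)[rule_format, of b] a b by simp
      have "a i = b i" if "i \<in> I" for i
        using a(1) b(1) by (intro Q.basis_coefficients_unique[OF z _ _ _ _ e that]) simp_all
      then show "u = w"
        unfolding a(2) b(2) using b(1) basis_closed[OF basis]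
        by (intro P.M.finsum_cong') (simp_all add: Pi_iff P.smult_closed)
    qed
    show "f ` carrier P = carrier Q"
    proof
      show "f ` carrier P \<subseteq> carrier Q" using graded_hom_closed[OF f(1)] by (rule image_subsetI)
      show "carrier Q \<subseteq> f ` carrier P"
      proof
        fix w assume w: "w \<in> carrier Q"
        from Q.basis_span_ex[OF z w] obtain b where
          b: "\<forall>i\<in>I. b i \<in> carrier A \<and> b i \<otimes> S (fst (\<tau> i)) = b i" "w = (\<Oplus>\<^bsub>Q\<^esub>i\<in>I. b i \<odot>\<^bsub>Q\<^esub> z i)"
          by (elim exE conjE)
        have bc: "b i \<in> carrier A" if "i \<in> I" for i using b(1) that by simp
        have "w = f (\<Oplus>\<^bsub>P\<^esub>i\<in>I. b i \<odot>\<^bsub>P\<^esub> x i)" unfolding b(2) by (rule f(2)[rule_format, OF bc, symmetric])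
        then show "w \<in> f ` carrier P" using basis_sum_closed[OF basis bc] by (rule image_eqI)
      qed
    qed
  qed
  then show ?thesis using f(1) unfolding graded_isomorphic_def by blast
qed

lemma basis_image:
  assumes basis: "graded_basis P I \<tau> x" and Q: "graded_left_module A Q"
    and f: "f \<in> graded_hom A P Q" "bij_betw f (carrier P) (carrier Q)"
  shows "graded_basis Q I \<tau> (\<lambda>i. f (x i))"
proof -
  interpret Q: kp_module \<Lambda> A S T W Q
    by (intro kp_module.intro graded_kp_algebra_axioms Q)
  note xc = basis_closed[OF basis]
  have sum: "f (\<Oplus>\<^bsub>P\<^esub>i\<in>I. a i \<odot>\<^bsub>P\<^esub> x i) = (\<Oplus>\<^bsub>Q\<^esub>i\<in>I. a i \<odot>\<^bsub>Q\<^esub> f (x i))"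
    if a: "\<And>i. i \<in> I \<Longrightarrow> a i \<in> carrier A" for a
  proof -
    have "f (\<Oplus>\<^bsub>P\<^esub>i\<in>I. a i \<odot>\<^bsub>P\<^esub> x i) = (\<Oplus>\<^bsub>Q\<^esub>i\<in>I. f (a i \<odot>\<^bsub>P\<^esub> x i))"
      using a xc basis_finite[OF basis]
      by (intro graded_hom_finsum[OF P.graded_left_module_axioms Q f(1)]) (simp_all add: Pi_iff P.smult_closed)
    also have "\<dots> = (\<Oplus>\<^bsub>Q\<^esub>i\<in>I. a i \<odot>\<^bsub>Q\<^esub> f (x i))"
      using a xc
      by (intro Q.P.M.finsum_cong')
        (simp_all add: Pi_iff Q.P.smult_closed graded_hom_closed[OF f(1)] graded_hom_smult[OF f(1)])
    finally show ?thesis .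
  qed
  have surj: "f ` carrier P = carrier Q" using f(2) by (rule bij_betw_imp_surj_on)
  show ?thesis
  proof (rule Q.graded_basisI)
    show "homogeneous_family Q I \<tau> (\<lambda>i. f (x i))"
      unfolding homogeneous_family_def
    proof (intro conjI ballI)
      show "finite I" by (rule basis_finite[OF basis])
      fix i assume i: "i \<in> I"
      show v: "fst (\<tau> i) \<in> vertices \<Lambda>" by (rule basis_vertex[OF basis i])
      show "f (x i) \<in> hcomp Q (- snd (\<tau> i))" by (rule graded_hom_hcomp[OF f(1) basis_hcomp[OF basis i]])
      have "S (fst (\<tau> i)) \<odot>\<^bsub>Q\<^esub> f (x i) = f (S (fst (\<tau> i)) \<odot>\<^bsub>P\<^esub> x i)"
        using v xc[OF i] by (intro graded_hom_smult[OF f(1), symmetric]) simp_all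
      then show "S (fst (\<tau> i)) \<odot>\<^bsub>Q\<^esub> f (x i) = f (x i)" using basis_absorb[OF basis i] by simp
    qed
  next
    fix m y assume y: "y \<in> hcomp Q m"
    obtain w where w: "w \<in> hcomp P m" "f w = y"
      by (rule graded_hom_surj_hcomp[OF P.graded_left_module_axioms Q f(1) surj y]) (rule that)
    from basis_span_hcomp_ex[OF basis w(1)] obtain a where
      a: "\<forall>i\<in>I. a i \<in> hcomp A (m + snd (\<tau> i)) \<and> a i \<otimes> S (fst (\<tau> i)) = a i"
      "w = (\<Oplus>\<^bsub>P\<^esub>i\<in>I. a i \<odot>\<^bsub>P\<^esub> x i)" by (elim exE conjE)
    have ah: "a i \<in> hcomp A (m + snd (\<tau> i))" if "i \<in> I" for i using a(1) that by simp
    have "y = (\<Oplus>\<^bsub>Q\<^esub>i\<in>I. a i \<odot>\<^bsub>Q\<^esub> f (x i))"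
      unfolding w(2)[symmetric] a(2) by (rule sum[OF hcomp_closed[OF ah]])
    then show "\<exists>a. (\<forall>i\<in>I. a i \<in> hcomp A (m + snd (\<tau> i))) \<and> y = (\<Oplus>\<^bsub>Q\<^esub>i\<in>I. a i \<odot>\<^bsub>Q\<^esub> f (x i))"
      using ah by (intro exI[of _ a] conjI ballI)
  next
    fix a i assume a: "\<forall>i\<in>I. a i \<in> carrier A \<and> a i \<otimes> S (fst (\<tau> i)) = a i"
      and zero: "(\<Oplus>\<^bsub>Q\<^esub>i\<in>I. a i \<odot>\<^bsub>Q\<^esub> f (x i)) = \<zero>\<^bsub>Q\<^esub>" and i: "i \<in> I"
    have ac: "a i \<in> carrier A" "a i \<otimes> S (fst (\<tau> i)) = a i" if "i \<in> I" for i using a that by simp_all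
    have "f (\<Oplus>\<^bsub>P\<^esub>i\<in>I. a i \<odot>\<^bsub>P\<^esub> x i) = f \<zero>\<^bsub>P\<^esub>"
      using sum[OF ac(1)] zero graded_hom_zero[OF P.graded_left_module_axioms Q f(1)] by simp
    then have "(\<Oplus>\<^bsub>P\<^esub>i\<in>I. a i \<odot>\<^bsub>P\<^esub> x i) = \<zero>\<^bsub>P\<^esub>"
      using basis_sum_closed[OF basis ac(1)] by (intro inj_onD[OF bij_betw_imp_inj_on[OF f(2)]]) simp_all
    then show "a i = \<zero>" using ac i by (intro basis_independent[OF basis, of a i]) simp_all
  qed
qed

lemma has_basis_isomorphic:
  assumes X: "has_basis P X" and Q: "graded_left_module A Q" and iso: "graded_isomorphic A P Q"
  shows "has_basis Q X"
proof -
  interpret Q: kp_module \<Lambda> A S T W Q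
    by (intro kp_module.intro graded_kp_algebra_axioms Q)
  obtain I :: "nat set" and \<tau> x where I: "graded_basis P I \<tau> x" "X = image_mset \<tau> (mset_set I)"
    using X unfolding has_basis_def by blast
  obtain f where "f \<in> graded_hom A P Q" "bij_betw f (carrier P) (carrier Q)"
    using iso unfolding graded_isomorphic_def by blast
  from Q.has_basis_image[OF basis_image[OF I(1) Q this]] show ?thesis unfolding I(2) .
qed

lemma isomorphic_if_has_basis:
  assumes X: "has_basis P X" and Q: "graded_left_module A Q" and Y: "has_basis Q X"
  shows "graded_isomorphic A P Q"
proof -
  interpret Q: kp_module \<Lambda> A S T W Q
    by (intro kp_module.intro graded_kp_algebra_axioms Q)
  obtain I :: "nat set" and \<tau> x where I: "graded_basis P I \<tau> x" "X = image_mset \<tau> (mset_set I)"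
    using X unfolding has_basis_def by blast
  obtain z where "graded_basis Q I \<tau> z"
    using Y basis_finite[OF I(1)] unfolding I(2) by (elim Q.has_basis_obtain)
  then show ?thesis by (rule isomorphic_if_same_basis[OF I(1) Q])
qed

end

section \<open>Uniqueness of bases and bases of direct summands\<close>

definition rows_independent :: "('i \<Rightarrow> 'j \<Rightarrow> 'f::field) \<Rightarrow> 'i set \<Rightarrow> 'j set \<Rightarrow> bool" where
  "rows_independent C I J \<longleftrightarrow> (\<forall>c. (\<forall>j\<in>J. (\<Sum>i\<in>I. c i * C i j) = 0) \<longrightarrow> (\<forall>i\<in>I. c i = 0))"

lemma rows_independentD:
  "rows_independent C I J \<Longrightarrow> (\<And>j. j \<in> J \<Longrightarrow> (\<Sum>i\<in>I. c i * C i j) = 0) \<Longrightarrow> i \<in> I \<Longrightarrow> c i = 0"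
  unfolding rows_independent_def by blast

text \<open>Gaussian elimination on the column \<open>j\<close>: a zero column is dropped, otherwise
  a row \<open>k\<close> with a nonzero entry clears the column, which removes one row and one
  column.\<close>

lemma rows_independent_card_le:
  assumes "finite J" "finite I" "rows_independent C I J" shows "card I \<le> card J"
  using assms
proof (induction J arbitrary: I C rule: finite_induct)
  case empty
  have "i \<in> I \<Longrightarrow> (1::'c) = 0" for i
    using rows_independentD[OF empty(2), of "\<lambda>_. 1" i] by simp
  then have "I = {}" by auto
  then show ?case by simp
next
  case (insert j J)
  show ?case
  proof (cases "\<forall>i\<in>I. C i j = 0")
    case True
    have "rows_independent C I J"
      unfolding rows_independent_def
    proof (intro allI impI)
      fix c assume c: "\<forall>j\<in>J. (\<Sum>i\<in>I. c i * C i j) = 0"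
      have "(\<Sum>i\<in>I. c i * C i j) = 0" using True by (intro sum.neutral) simp
      then show "\<forall>i\<in>I. c i = 0" using c rows_independentD[OF insert.prems(2), of c] by blast
    qed
    then have "card I \<le> card J" by (rule insert.IH[OF insert.prems(1)])
    then show ?thesis using insert.hyps by simp
  next
    case False
    then obtain k where k: "k \<in> I" "C k j \<noteq> 0" by blast
    define C' where "C' i l = C i l - C i j / C k j * C k l" for i l
    have "rows_independent C' (I - {k}) J"
      unfolding rows_independent_def
    proof (intro allI impI ballI)
      fix c i assume c: "\<forall>l\<in>J. (\<Sum>i\<in>I - {k}. c i * C' i l) = 0" and i: "i \<in> I - {k}"
      let ?s = "\<Sum>i\<in>I - {k}. c i * C i j"
      \<comment> \<open>The coefficient of row \<open>k\<close> is chosen to cancel column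
        \<open>j\<close>; in the other columns it reproduces the elimination step in
        \<open>C'\<close>.\<close>
      define d where "d i = (if i = k then - (?s / C k j) else c i)" for i
      have split: "(\<Sum>i\<in>I. d i * C i l) = d k * C k l + (\<Sum>i\<in>I - {k}. c i * C i l)" for l
      proof -
        have "(\<Sum>i\<in>I. d i * C i l) = d k * C k l + (\<Sum>i\<in>I - {k}. d i * C i l)"
          by (rule sum.remove[OF insert.prems(1) k(1)])
        also have "(\<Sum>i\<in>I - {k}. d i * C i l) = (\<Sum>i\<in>I - {k}. c i * C i l)"
          by (rule sum.cong) (simp_all add: d_def)
        finally show ?thesis .
      qed
      have "(\<Sum>i\<in>I. d i * C i l) = 0" if l: "l \<in> insert j J" for l
      proof (cases "l = j")
        case True
        then show ?thesis unfolding split using k(2) by (simp add: d_def)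
      next
        case False
        then have "(\<Sum>i\<in>I - {k}. c i * C' i l) = 0" using c l by simp
        moreover have "(\<Sum>i\<in>I - {k}. c i * C' i l) = (\<Sum>i\<in>I - {k}. c i * C i l) - ?s / C k j * C k l"
          by (simp add: C'_def right_diff_distrib sum_subtractf sum_divide_distrib sum_distrib_right mult.assoc)
        ultimately show ?thesis unfolding split by (simp add: d_def)
      qed
      then have "d i = 0" using i by (intro rows_independentD[OF insert.prems(2), of d]) simp_all
      then show "c i = 0" using i by (simp add: d_def)
    qed
    then have "card (I - {k}) \<le> card J" using insert.prems(1) by (intro insert.IH) simp_all
    then show ?thesis using insert.hyps insert.prems(1) k(1) by simp
  qed
qed

text \<open>Induction on the rows. With \<open>e\<close> the coefficients of the new row under the
  old right inverse, the residual \<open>r\<close> is nonzero in some column \<open>l\<close> by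
  independence. A column \<open>E\<close> killed by the old rows and paired with the new row to
  \<open>r l\<close> then corrects \<open>D\<close>.\<close>

lemma rows_independent_right_inverse:
  assumes "finite B" "finite J" "rows_independent C B J"
  shows "\<exists>D. \<forall>b\<in>B. \<forall>b'\<in>B. (\<Sum>j\<in>J. C b j * D j b') = (if b = b' then 1 else 0)"
  using assms(1,3)
proof (induction B rule: finite_induct)
  case (insert k B)
  have "rows_independent C B J"
    unfolding rows_independent_def
  proof (intro allI impI ballI)
    fix c i assume c: "\<forall>j\<in>J. (\<Sum>i\<in>B. c i * C i j) = 0" and i: "i \<in> B"
    let ?d = "c(k := 0)"
    have e: "(\<Sum>i\<in>B. ?d i * C i j) = (\<Sum>i\<in>B. c i * C i j)" for j
      using insert.hyps by (intro sum.cong) auto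
    have "?d i = 0"
      using c i insert.hyps e by (intro rows_independentD[OF insert.prems, of ?d]) simp_all
    moreover have "i \<noteq> k" using i insert.hyps by blast
    ultimately show "c i = 0" by simp
  qed
  then obtain D where D: "\<And>b b'. b \<in> B \<Longrightarrow> b' \<in> B \<Longrightarrow> (\<Sum>j\<in>J. C b j * D j b') = (if b = b' then 1 else 0)"
    using insert.IH by blast
  define e where "e b' = (\<Sum>j\<in>J. C k j * D j b')" for b'
  define r where "r j = C k j - (\<Sum>b\<in>B. e b * C b j)" for j
  have "\<exists>j\<in>J. r j \<noteq> 0"
  proof (rule ccontr)
    assume "\<not> (\<exists>j\<in>J. r j \<noteq> 0)"
    then have r: "r j = 0" if "j \<in> J" for j using that by blast
    define c where "c b = (if b = k then 1 else - e b)" for b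
    have "(\<Sum>i\<in>insert k B. c i * C i j) = 0" if "j \<in> J" for j
    proof -
      have "(\<Sum>i\<in>B. c i * C i j) = (\<Sum>i\<in>B. - (e i * C i j))"
        using insert.hyps by (intro sum.cong) (auto simp: c_def)
      then show ?thesis using r[OF that] insert.hyps by (simp add: c_def r_def sum_negf)
    qed
    then have "c k = 0" by (intro rows_independentD[OF insert.prems, of c]) simp_all
    then show False by (simp add: c_def)
  qed
  then obtain l where l: "l \<in> J" "r l \<noteq> 0" by blast
  \<comment> \<open>The unit vector at \<open>l\<close>, corrected by the old right inverse so that
    the old rows annihilate it.\<close>
  define E where "E j = (if j = l then 1 else 0) - (\<Sum>b\<in>B. C b l * D j b)" for j
  have CE: "(\<Sum>j\<in>J. C b j * E j) = C b l - (\<Sum>b'\<in>B. C b' l * (\<Sum>j\<in>J. C b j * D j b'))" for b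
  proof -
    have "(\<Sum>j\<in>J. C b j * E j) = (\<Sum>j\<in>J. C b j * (if j = l then 1 else 0)) - (\<Sum>j\<in>J. C b j * (\<Sum>b'\<in>B. C b' l * D j b'))"
      by (simp only: E_def right_diff_distrib sum_subtractf)
    also have "(\<Sum>j\<in>J. C b j * (if j = l then 1 else 0)) = C b l"
      using assms(2) l(1) by (simp add: if_distrib[of "\<lambda>x. C b _ * x"] cong: if_cong)
    also have "(\<Sum>j\<in>J. C b j * (\<Sum>b'\<in>B. C b' l * D j b')) = (\<Sum>b'\<in>B. C b' l * (\<Sum>j\<in>J. C b j * D j b'))"
      unfolding sum_distrib_left by (subst sum.swap) (simp only: mult.left_commute)
    finally show ?thesis .
  qed
  have E0: "(\<Sum>j\<in>J. C b j * E j) = 0" if b: "b \<in> B" for b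
  proof -
    have "(\<Sum>b'\<in>B. C b' l * (\<Sum>j\<in>J. C b j * D j b')) = (\<Sum>b'\<in>B. C b' l * (if b = b' then 1 else 0))"
      using D[OF b] by (intro sum.cong) simp_all
    also have "\<dots> = C b l" using insert.hyps b by (simp add: if_distrib[of "\<lambda>x. _ * x"] cong: if_cong)
    finally show ?thesis by (simp add: CE)
  qed
  have Ek: "(\<Sum>j\<in>J. C k j * E j) = r l"
    unfolding CE r_def e_def by (simp only: mult.commute)
  define D' where "D' j b = (if b = k then E j / r l else D j b - e b * E j / r l)" for j b
  have "(\<Sum>j\<in>J. C b j * D' j b') = (if b = b' then 1 else 0)" if b: "b \<in> insert k B" and b': "b' \<in> insert k B" for b b'
  proof (cases "b' = k")
    case True
    have "(\<Sum>j\<in>J. C b j * D' j b') = (\<Sum>j\<in>J. C b j * E j) / r l"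
      by (simp add: True D'_def sum_divide_distrib)
    then show ?thesis using b l insert.hyps E0 Ek True by auto
  next
    case False
    then have b'B: "b' \<in> B" using b' by simp
    have "(\<Sum>j\<in>J. C b j * D' j b') = (\<Sum>j\<in>J. C b j * D j b') - e b' * (\<Sum>j\<in>J. C b j * E j) / r l"
      using False
      by (simp add: D'_def right_diff_distrib sum_subtractf sum_divide_distrib sum_distrib_left mult.left_commute)
    then show ?thesis
      using b b'B l insert.hyps E0 Ek False D e_def by (cases "b = k") auto
  qed
  then show ?case by blast
qed simp

text \<open>An independent set of rows of maximal cardinality works: adjoining a further row creates
  a relation, in which the new row must have a nonzero coefficient.\<close>

lemma exists_independent_rows:
  assumes I: "finite I"
  obtains B where "B \<subseteq> I" "rows_independent C B J"
    "\<And>i. i \<in> I \<Longrightarrow> \<exists>d. \<forall>j\<in>J. C i j = (\<Sum>b\<in>B. d b * C b j)"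
proof -
  let ?S = "{B. B \<subseteq> I \<and> rows_independent C B J}"
  have "finite ?S" using I by simp
  moreover have "{} \<in> ?S" by (simp add: rows_independent_def)
  ultimately obtain B where B: "B \<in> ?S" "\<And>B'. B' \<in> ?S \<Longrightarrow> card B' \<le> card B"
    using obtains_MAX[of ?S card] by (metis (no_types, lifting) Max_ge empty_iff finite_imageI imageI)
  then have sub: "B \<subseteq> I" and ind: "rows_independent C B J" by simp_all
  have finB: "finite B" using sub I by (rule finite_subset)
  have "\<exists>d. \<forall>j\<in>J. C i j = (\<Sum>b\<in>B. d b * C b j)" if i: "i \<in> I" for i
  proof (cases "i \<in> B")
    case True
    have "C i j = (\<Sum>b\<in>B. (if b = i then 1 else 0) * C b j)" for j
      using finB True by (simp add: if_distrib[of "\<lambda>x. x * _"] cong: if_cong)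
    then show ?thesis by (intro exI[of _ "\<lambda>b. if b = i then 1 else 0"] ballI)
  next
    case False
    have "\<not> rows_independent C (insert i B) J"
      using B(2)[of "insert i B"] i sub False finB by auto
    then obtain c where c: "\<forall>j\<in>J. (\<Sum>b\<in>insert i B. c b * C b j) = 0" "\<not> (\<forall>b\<in>insert i B. c b = 0)"
      unfolding rows_independent_def by blast
    have s: "(\<Sum>b\<in>insert i B. c b * C b j) = c i * C i j + (\<Sum>b\<in>B. c b * C b j)" for j
      using finB False by simp
    have "c i \<noteq> 0"
    proof
      assume z: "c i = 0"
      then have "c b = 0" if "b \<in> B" for b
        using c(1) that by (intro rows_independentD[OF ind, of c]) (simp_all add: s)
      then show False using c(2) z by simp
    qed
    then have "C i j = (\<Sum>b\<in>B. (- c b / c i) * C b j)" if "j \<in> J" for j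
    proof -
      have "c i * C i j = - (\<Sum>b\<in>B. c b * C b j)"
        using c(1) that unfolding s by (simp add: eq_neg_iff_add_eq_0)
      then have "C i j = - (\<Sum>b\<in>B. c b * C b j) / c i"
        using \<open>c i \<noteq> 0\<close> by (simp add: field_simps)
      then show ?thesis by (simp add: sum_divide_distrib sum_negf)
    qed
    then show ?thesis by (intro exI[of _ "\<lambda>b. - c b / c i"]) blast
  qed
  then show ?thesis using that[OF sub ind] by blast
qed

section \<open>Scalar transition matrices\<close>

context kp_module
begin

lemma scale_one_closed [simp]: "c \<odot> \<one> \<in> carrier A"
  by simp

text \<open>The module structure knows only elements of the algebra, so a scalar acts through
  \<open>c \<odot> \<one>\<close>; on an element fixed by \<open>S v\<close> this is the same as
  \<open>c \<odot> S v\<close>.\<close>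

lemma scale_one_smult_vertex:
  assumes "v \<in> vertices \<Lambda>" "y \<in> carrier P" "S v \<odot>\<^bsub>P\<^esub> y = y"
  shows "(c \<odot> \<one>) \<odot>\<^bsub>P\<^esub> y = (c \<odot> S v) \<odot>\<^bsub>P\<^esub> y"
proof -
  have "(c \<odot> \<one>) \<odot>\<^bsub>P\<^esub> y = (c \<odot> \<one>) \<odot>\<^bsub>P\<^esub> (S v \<odot>\<^bsub>P\<^esub> y)" by (simp only: assms(3))
  also have "\<dots> = ((c \<odot> \<one>) \<otimes> S v) \<odot>\<^bsub>P\<^esub> y"
    using assms by (simp add: P.smult_assoc)
  also have "(c \<odot> \<one>) \<otimes> S v = c \<odot> S v" using assms by (simp add: mult_scale_left)
  finally show ?thesis .
qed

text \<open>For degree zero the two degrees in \<open>scalar_at\<close> coincide and can be enlarged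
  together to a diagonal one.\<close>

lemma hcomp_zero_eventually_scalar_at:
  assumes "x \<in> hcomp A 0" shows "\<forall>\<^sub>F r in sequentially. scalar_at x (vec r) (vec r)"
proof -
  obtain p q where "int_vec p - int_vec q = 0" and sc: "\<And>s. scalar_at x (p + s) (q + s)"
    using hcomp_scalar_at[OF assms] by blast
  then have pq: "q = p" by simp
  show ?thesis
    using eventually_ge_at_top[of "\<Sum>i\<in>UNIV. p $ i"]
  proof eventually_elim
    case (elim r)
    have "p $ i \<le> r" for i using member_le_sum[of i UNIV "\<lambda>i. p $ i"] elim by simp
    then have "vec r = p + (vec r - p)" by (intro vec_nat_le_imp_add) (simp add: less_eq_vec_def)
    then show ?case using sc[of "vec r - p"] unfolding pq by simp
  qed
qed

text \<open>As both families live in one degree, the coefficients of \<open>z\<close> in the basis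
  \<open>y\<close> have degree zero, and finitely many of them become scalar at a common
  \<open>vec r\<close>. Inserting the expansion of the vertex idempotents between
  \<open>T \<alpha>\<close> and \<open>y j\<close> exhibits the compressed coefficients as matrix
  entries.\<close>

lemma eventually_scalar_transition:
  assumes basis: "graded_basis P J \<sigma> y" and levJ: "\<And>j. j \<in> J \<Longrightarrow> snd (\<sigma> j) = n"
    and fam: "homogeneous_family P I \<tau> z" and levI: "\<And>i. i \<in> I \<Longrightarrow> snd (\<tau> i) = n"
  shows "\<forall>\<^sub>F r in sequentially. \<exists>C. \<forall>p\<in>refine_index I \<tau> (\<lambda>_. vec r).
    T (snd p) \<odot>\<^bsub>P\<^esub> z (fst p) =
      (\<Oplus>\<^bsub>P\<^esub>q\<in>refine_index J \<sigma> (\<lambda>_. vec r). (C p q \<odot> \<one>) \<odot>\<^bsub>P\<^esub> (T (snd q) \<odot>\<^bsub>P\<^esub> y (fst q))) \<and>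
    (\<forall>q\<in>refine_index J \<sigma> (\<lambda>_. vec r). src \<Lambda> (snd q) \<noteq> src \<Lambda> (snd p) \<longrightarrow> C p q = 0)"
proof -
  note finI = family_finite[OF fam] and finJ = basis_finite[OF basis] and yc = basis_closed[OF basis]
  have "\<forall>i\<in>I. \<exists>a. (\<forall>j\<in>J. a j \<in> hcomp A 0) \<and> z i = (\<Oplus>\<^bsub>P\<^esub>j\<in>J. a j \<odot>\<^bsub>P\<^esub> y j)"
  proof
    fix i assume i: "i \<in> I"
    from basis_span_hcomp_ex[OF basis family_hcomp[OF fam i]] obtain a where
      a: "\<forall>j\<in>J. a j \<in> hcomp A (- snd (\<tau> i) + snd (\<sigma> j)) \<and> a j \<otimes> S (fst (\<sigma> j)) = a j"
      "z i = (\<Oplus>\<^bsub>P\<^esub>j\<in>J. a j \<odot>\<^bsub>P\<^esub> y j)" by (elim exE conjE)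
    have "\<forall>j\<in>J. a j \<in> hcomp A 0" using a(1) levJ levI[OF i] by simp
    then show "\<exists>a. (\<forall>j\<in>J. a j \<in> hcomp A 0) \<and> z i = (\<Oplus>\<^bsub>P\<^esub>j\<in>J. a j \<odot>\<^bsub>P\<^esub> y j)"
      using a(2) by (intro exI[of _ a] conjI)
  qed
  from bchoice[OF this] obtain a where
    a: "\<forall>i\<in>I. (\<forall>j\<in>J. a i j \<in> hcomp A 0) \<and> z i = (\<Oplus>\<^bsub>P\<^esub>j\<in>J. a i j \<odot>\<^bsub>P\<^esub> y j)" by (elim exE)
  have ah: "a i j \<in> hcomp A 0" if "i \<in> I" "j \<in> J" for i j using a that by simp
  have ac: "a i j \<in> carrier A" if "i \<in> I" "j \<in> J" for i j by (rule hcomp_closed[OF ah[OF that]])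
  have az: "z i = (\<Oplus>\<^bsub>P\<^esub>j\<in>J. a i j \<odot>\<^bsub>P\<^esub> y j)" if "i \<in> I" for i using a that by simp
  have "\<forall>\<^sub>F r in sequentially. \<forall>i\<in>I. \<forall>j\<in>J. scalar_at (a i j) (vec r) (vec r)"
    using finI finJ ah by (intro eventually_ball_finite ballI hcomp_zero_eventually_scalar_at) simp_all
  then show ?thesis
  proof eventually_elim
    case (elim r)
    let ?F = "\<lambda>j. paths_from \<Lambda> (fst (\<sigma> j)) (vec r)"
    \<comment> \<open>Where the sources differ the entry is set to zero outright; there
      \<open>scalar_at\<close> says that the compression vanishes, so the equation below still
      holds.\<close>
    define C where "C p q = (if src \<Lambda> (snd q) = src \<Lambda> (snd p)
      then (SOME c. T (snd p) \<otimes> a (fst p) (fst q) \<otimes> S (snd q) = c \<odot> S (src \<Lambda> (snd p))) else 0)" for p q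
    have step: "T \<alpha> \<otimes> a i j \<otimes> S \<beta> = C (i, \<alpha>) (j, \<beta>) \<odot> S (src \<Lambda> \<alpha>)"
      if i: "i \<in> I" and j: "j \<in> J" and \<alpha>: "\<alpha> \<in> paths_from \<Lambda> (fst (\<tau> i)) (vec r)" and \<beta>: "\<beta> \<in> ?F j" for i j \<alpha> \<beta>
    proof -
      have ab: "\<alpha> \<in> paths_deg \<Lambda> (vec r)" "\<beta> \<in> paths_deg \<Lambda> (vec r)"
        using \<alpha> \<beta> unfolding paths_from_def by simp_all
      have sc: "\<exists>c. T \<alpha> \<otimes> a i j \<otimes> S \<beta> = c \<odot> S (src \<Lambda> \<alpha>)"
        "src \<Lambda> \<alpha> \<noteq> src \<Lambda> \<beta> \<Longrightarrow> T \<alpha> \<otimes> a i j \<otimes> S \<beta> = \<zero>"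
        using elim i j ab unfolding scalar_at_def by blast+
      show ?thesis
      proof (cases "src \<Lambda> \<beta> = src \<Lambda> \<alpha>")
        case True
        then show ?thesis using someI_ex[OF sc(1)] by (simp add: C_def)
      next
        case False
        then show ?thesis using sc(2) paths_fromD[OF \<alpha>] by (simp add: C_def)
      qed
    qed
    have main: "T \<alpha> \<odot>\<^bsub>P\<^esub> z i = (\<Oplus>\<^bsub>P\<^esub>j\<in>J. \<Oplus>\<^bsub>P\<^esub>\<beta>\<in>?F j. (C (i, \<alpha>) (j, \<beta>) \<odot> \<one>) \<odot>\<^bsub>P\<^esub> (T \<beta> \<odot>\<^bsub>P\<^esub> y j))"
      if i: "i \<in> I" and \<alpha>: "\<alpha> \<in> paths_from \<Lambda> (fst (\<tau> i)) (vec r)" for i \<alpha>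
    proof -
      note \<alpha>p = paths_fromD[OF \<alpha>]
      have "T \<alpha> \<odot>\<^bsub>P\<^esub> z i = (\<Oplus>\<^bsub>P\<^esub>j\<in>J. (T \<alpha> \<otimes> a i j) \<odot>\<^bsub>P\<^esub> y j)"
        unfolding az[OF i] using ac[OF i] \<alpha>p by (intro basis_sum_smult[OF basis]) simp_all
      also have "\<dots> = (\<Oplus>\<^bsub>P\<^esub>j\<in>J. \<Oplus>\<^bsub>P\<^esub>\<beta>\<in>?F j. (C (i, \<alpha>) (j, \<beta>) \<odot> \<one>) \<odot>\<^bsub>P\<^esub> (T \<beta> \<odot>\<^bsub>P\<^esub> y j))"
      proof (rule P.M.finsum_cong')
        fix j assume j: "j \<in> J"
        have p: "\<beta> \<in> paths \<Lambda>" if "\<beta> \<in> ?F j" for \<beta> using that by (rule paths_fromD)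
        have "(T \<alpha> \<otimes> a i j) \<odot>\<^bsub>P\<^esub> y j = (T \<alpha> \<otimes> a i j) \<odot>\<^bsub>P\<^esub> (S (fst (\<sigma> j)) \<odot>\<^bsub>P\<^esub> y j)"
          by (simp only: basis_absorb[OF basis j])
        also have "S (fst (\<sigma> j)) \<odot>\<^bsub>P\<^esub> y j = (\<Oplus>\<^bsub>P\<^esub>\<beta>\<in>?F j. S \<beta> \<odot>\<^bsub>P\<^esub> (T \<beta> \<odot>\<^bsub>P\<^esub> y j))"
          by (rule smult_vertex_expand[OF basis_vertex[OF basis j] yc[OF j]])
        also have "(T \<alpha> \<otimes> a i j) \<odot>\<^bsub>P\<^esub> \<dots> = (\<Oplus>\<^bsub>P\<^esub>\<beta>\<in>?F j. (T \<alpha> \<otimes> a i j) \<odot>\<^bsub>P\<^esub> (S \<beta> \<odot>\<^bsub>P\<^esub> (T \<beta> \<odot>\<^bsub>P\<^esub> y j)))"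
          using p yc[OF j] ac[OF i j] \<alpha>p by (intro P.smult_finsum) (simp_all add: Pi_iff P.smult_closed)
        also have "\<dots> = (\<Oplus>\<^bsub>P\<^esub>\<beta>\<in>?F j. (C (i, \<alpha>) (j, \<beta>) \<odot> \<one>) \<odot>\<^bsub>P\<^esub> (T \<beta> \<odot>\<^bsub>P\<^esub> y j))"
        proof (rule P.M.finsum_cong')
          fix \<beta> assume \<beta>: "\<beta> \<in> ?F j"
          let ?w = "T \<beta> \<odot>\<^bsub>P\<^esub> y j" and ?c = "C (i, \<alpha>) (j, \<beta>)"
          have w: "?w \<in> carrier P" using p[OF \<beta>] yc[OF j] by (simp add: P.smult_closed)
          have ws: "S (src \<Lambda> \<beta>) \<odot>\<^bsub>P\<^esub> ?w = ?w"
            using p[OF \<beta>] yc[OF j] by (simp add: P.smult_assoc[symmetric] src_T)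
          have "(T \<alpha> \<otimes> a i j) \<odot>\<^bsub>P\<^esub> (S \<beta> \<odot>\<^bsub>P\<^esub> ?w) = (T \<alpha> \<otimes> a i j \<otimes> S \<beta>) \<odot>\<^bsub>P\<^esub> ?w"
            using p[OF \<beta>] w ac[OF i j] \<alpha>p by (simp add: P.smult_assoc)
          also have "\<dots> = (?c \<odot> S (src \<Lambda> \<alpha>)) \<odot>\<^bsub>P\<^esub> ?w" by (simp only: step[OF i j \<alpha> \<beta>])
          also have "\<dots> = (?c \<odot> \<one>) \<odot>\<^bsub>P\<^esub> ?w"
          proof (cases "src \<Lambda> \<beta> = src \<Lambda> \<alpha>")
            case True
            then show ?thesis
              using scale_one_smult_vertex[OF src_vertex[OF p[OF \<beta>]] w ws, of ?c] by simp
          next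
            case False
            then have "?c = 0" by (simp add: C_def)
            then show ?thesis using w \<alpha>p by simp
          qed
          finally show "(T \<alpha> \<otimes> a i j) \<odot>\<^bsub>P\<^esub> (S \<beta> \<odot>\<^bsub>P\<^esub> ?w) = (?c \<odot> \<one>) \<odot>\<^bsub>P\<^esub> ?w" .
        qed (use p yc[OF j] in \<open>simp_all add: Pi_iff P.smult_closed\<close>)
        finally show "(T \<alpha> \<otimes> a i j) \<odot>\<^bsub>P\<^esub> y j = (\<Oplus>\<^bsub>P\<^esub>\<beta>\<in>?F j. (C (i, \<alpha>) (j, \<beta>) \<odot> \<one>) \<odot>\<^bsub>P\<^esub> (T \<beta> \<odot>\<^bsub>P\<^esub> y j))" .
      next
        show "(\<lambda>j. \<Oplus>\<^bsub>P\<^esub>\<beta>\<in>?F j. (C (i, \<alpha>) (j, \<beta>) \<odot> \<one>) \<odot>\<^bsub>P\<^esub> (T \<beta> \<odot>\<^bsub>P\<^esub> y j)) \<in> J \<rightarrow> carrier P"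
          using yc by (intro Pi_I P.M.finsum_closed) (simp add: P.smult_closed paths_fromD)
      qed simp
      finally show ?thesis .
    qed
    show ?case
    proof (intro exI[of _ C] ballI conjI impI)
      fix p assume "p \<in> refine_index I \<tau> (\<lambda>_. vec r)"
      then obtain i \<alpha> where p: "p = (i, \<alpha>)" "i \<in> I" "\<alpha> \<in> paths_from \<Lambda> (fst (\<tau> i)) (vec r)" by auto
      have "T \<alpha> \<odot>\<^bsub>P\<^esub> z i = (\<Oplus>\<^bsub>P\<^esub>q\<in>Sigma J ?F. (C (i, \<alpha>) (fst q, snd q) \<odot> \<one>) \<odot>\<^bsub>P\<^esub> (T (snd q) \<odot>\<^bsub>P\<^esub> y (fst q)))"
        unfolding main[OF p(2,3)] using finJ yc
        by (intro P.M.finsum_Sigma) (simp_all add: P.smult_closed paths_fromD)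
      then show "T (snd p) \<odot>\<^bsub>P\<^esub> z (fst p) =
          (\<Oplus>\<^bsub>P\<^esub>q\<in>Sigma J ?F. (C p q \<odot> \<one>) \<odot>\<^bsub>P\<^esub> (T (snd q) \<odot>\<^bsub>P\<^esub> y (fst q)))"
        by (simp add: p(1))
    next
      fix p q assume "p \<in> refine_index I \<tau> (\<lambda>_. vec r)" "q \<in> refine_index J \<sigma> (\<lambda>_. vec r)" "src \<Lambda> (snd q) \<noteq> src \<Lambda> (snd p)"
      then show "C p q = 0" by (simp add: C_def)
    qed
  qed
qed

end

section \<open>Uniqueness of the type of a basis\<close>

context kp_module
begin

lemma finsum_scale_left:
  "finite I \<Longrightarrow> y \<in> carrier A \<Longrightarrow> (\<Oplus>i\<in>I. c i \<odot> y) = (\<Sum>i\<in>I. c i) \<odot> y"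
  by (induction I rule: finite_induct) (simp_all add: scale_plus Pi_iff)

text \<open>The entries are scalars and therefore move past the coefficients \<open>a p\<close>,
  which turns a change of family into multiplication of the coefficients by the matrix.\<close>

lemma sum_transition:
  assumes finI: "finite I" and finJ: "finite J" and w: "\<And>q. q \<in> J \<Longrightarrow> w q \<in> carrier P"
    and x: "\<And>p. p \<in> I \<Longrightarrow> x p = (\<Oplus>\<^bsub>P\<^esub>q\<in>J. (C p q \<odot> \<one>) \<odot>\<^bsub>P\<^esub> w q)"
    and a: "\<And>p. p \<in> I \<Longrightarrow> a p \<in> carrier A"
  shows "(\<Oplus>\<^bsub>P\<^esub>p\<in>I. a p \<odot>\<^bsub>P\<^esub> x p) = (\<Oplus>\<^bsub>P\<^esub>q\<in>J. (\<Oplus>p\<in>I. C p q \<odot> a p) \<odot>\<^bsub>P\<^esub> w q)"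
proof -
  have "(\<Oplus>\<^bsub>P\<^esub>p\<in>I. a p \<odot>\<^bsub>P\<^esub> x p) = (\<Oplus>\<^bsub>P\<^esub>p\<in>I. \<Oplus>\<^bsub>P\<^esub>q\<in>J. (C p q \<odot> a p) \<odot>\<^bsub>P\<^esub> w q)"
  proof (rule P.M.finsum_cong')
    fix p assume p: "p \<in> I"
    have "a p \<odot>\<^bsub>P\<^esub> x p = (\<Oplus>\<^bsub>P\<^esub>q\<in>J. a p \<odot>\<^bsub>P\<^esub> ((C p q \<odot> \<one>) \<odot>\<^bsub>P\<^esub> w q))"
      unfolding x[OF p] using finJ w a[OF p] by (intro P.smult_finsum) (simp_all add: Pi_iff P.smult_closed)
    also have "\<dots> = (\<Oplus>\<^bsub>P\<^esub>q\<in>J. (C p q \<odot> a p) \<odot>\<^bsub>P\<^esub> w q)"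
      using w a[OF p]
      by (intro P.M.finsum_cong') (simp_all add: Pi_iff P.smult_closed P.smult_assoc[symmetric] mult_scale_right)
    finally show "a p \<odot>\<^bsub>P\<^esub> x p = (\<Oplus>\<^bsub>P\<^esub>q\<in>J. (C p q \<odot> a p) \<odot>\<^bsub>P\<^esub> w q)" .
  next
    show "(\<lambda>p. \<Oplus>\<^bsub>P\<^esub>q\<in>J. (C p q \<odot> a p) \<odot>\<^bsub>P\<^esub> w q) \<in> I \<rightarrow> carrier P"
      using w a by (intro Pi_I P.M.finsum_closed) (simp add: P.smult_closed)
  qed simp
  also have "\<dots> = (\<Oplus>\<^bsub>P\<^esub>q\<in>J. \<Oplus>\<^bsub>P\<^esub>p\<in>I. (C p q \<odot> a p) \<odot>\<^bsub>P\<^esub> w q)"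
    using finI finJ w a by (intro P.M.finsum_swap) (simp_all add: P.smult_closed)
  also have "\<dots> = (\<Oplus>\<^bsub>P\<^esub>q\<in>J. (\<Oplus>p\<in>I. C p q \<odot> a p) \<odot>\<^bsub>P\<^esub> w q)"
  proof (rule P.M.finsum_cong')
    fix q assume q: "q \<in> J"
    show "(\<Oplus>\<^bsub>P\<^esub>p\<in>I. (C p q \<odot> a p) \<odot>\<^bsub>P\<^esub> w q) = (\<Oplus>p\<in>I. C p q \<odot> a p) \<odot>\<^bsub>P\<^esub> w q"
      using finI w[OF q] a by (intro P.finsum_smult[symmetric]) (simp_all add: Pi_iff)
  next
    show "(\<lambda>q. (\<Oplus>p\<in>I. C p q \<odot> a p) \<odot>\<^bsub>P\<^esub> w q) \<in> J \<rightarrow> carrier P"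
      using w a by (intro Pi_I P.smult_closed finsum_closed) (simp_all add: Pi_iff)
  qed simp
  finally show ?thesis .
qed

text \<open>The block of the matrix at the vertex \<open>v\<close> has independent rows: a relation
  among them would be one among basis elements, with multiples of \<open>S v\<close> as
  coefficients. So it has at most as many rows as columns.\<close>

lemma card_type_le:
  assumes basis: "graded_basis P I \<tau> x" and finJ: "finite J" and w: "\<And>q. q \<in> J \<Longrightarrow> w q \<in> carrier P"
    and x: "\<And>p. p \<in> I \<Longrightarrow> x p = (\<Oplus>\<^bsub>P\<^esub>q\<in>J. (C p q \<odot> \<one>) \<odot>\<^bsub>P\<^esub> w q)"
    and C: "\<And>p q. p \<in> I \<Longrightarrow> q \<in> J \<Longrightarrow> \<phi> q \<noteq> fst (\<tau> p) \<Longrightarrow> C p q = 0"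
  shows "card {p \<in> I. fst (\<tau> p) = v} \<le> card {q \<in> J. \<phi> q = v}"
proof -
  let ?I = "{p \<in> I. fst (\<tau> p) = v}" and ?J = "{q \<in> J. \<phi> q = v}"
  note finI = basis_finite[OF basis]
  have "rows_independent C ?I ?J"
    unfolding rows_independent_def
  proof (intro allI impI ballI)
    fix c p assume c: "\<forall>q\<in>?J. (\<Sum>p\<in>?I. c p * C p q) = 0" and p: "p \<in> ?I"
    \<comment> \<open>Extension by zero to all rows; the columns at other vertices are harmless
      because the matrix is zero there on rows at \<open>v\<close>.\<close>
    define d where "d p = (if p \<in> ?I then c p else 0)" for p
    have zero: "(\<Sum>p\<in>I. d p * C p q) = 0" if q: "q \<in> J" for q
    proof -
      have "(\<Sum>p\<in>I. d p * C p q) = (\<Sum>p\<in>?I. c p * C p q)"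
        using finI by (intro sum.mono_neutral_cong_right) (auto simp: d_def)
      also have "\<dots> = 0"
      proof (cases "\<phi> q = v")
        case True
        then show ?thesis using c q by simp
      next
        case False
        then show ?thesis using C[OF _ q] by (intro sum.neutral) auto
      qed
      finally show ?thesis .
    qed
    let ?a = "\<lambda>p. d p \<odot> S (fst (\<tau> p))"
    have ac: "?a p \<in> carrier A" if "p \<in> I" for p using basis_vertex[OF basis that] by simp
    have "(\<Oplus>\<^bsub>P\<^esub>p\<in>I. ?a p \<odot>\<^bsub>P\<^esub> x p) = (\<Oplus>\<^bsub>P\<^esub>p\<in>I. (d p \<odot> \<one>) \<odot>\<^bsub>P\<^esub> x p)"
    proof (rule P.M.finsum_cong')
      fix p assume p: "p \<in> I"
      show "?a p \<odot>\<^bsub>P\<^esub> x p = (d p \<odot> \<one>) \<odot>\<^bsub>P\<^esub> x p"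
        by (rule scale_one_smult_vertex[OF basis_vertex[OF basis p] basis_closed[OF basis p]
              basis_absorb[OF basis p], symmetric])
    qed (use basis_closed[OF basis] in \<open>simp_all add: Pi_iff P.smult_closed\<close>)
    also have "\<dots> = (\<Oplus>\<^bsub>P\<^esub>q\<in>J. (\<Oplus>p\<in>I. C p q \<odot> (d p \<odot> \<one>)) \<odot>\<^bsub>P\<^esub> w q)"
      by (rule sum_transition[OF finI finJ w x]) simp_all
    also have "\<dots> = \<zero>\<^bsub>P\<^esub>"
    proof (rule P.M.finsum_zeroI)
      fix q assume q: "q \<in> J"
      have "(\<Oplus>p\<in>I. C p q \<odot> (d p \<odot> \<one>)) = (\<Oplus>p\<in>I. (d p * C p q) \<odot> \<one>)"
        by (intro finsum_cong') (simp_all add: scale_times[symmetric] mult.commute)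
      also have "\<dots> = \<zero>" using finI zero[OF q] by (simp add: finsum_scale_left)
      finally show "(\<Oplus>p\<in>I. C p q \<odot> (d p \<odot> \<one>)) \<odot>\<^bsub>P\<^esub> w q = \<zero>\<^bsub>P\<^esub>" using w[OF q] by simp
    qed
    finally have "?a p = \<zero>"
      using p ac basis_vertex[OF basis]
      by (intro basis_independent[OF basis, of ?a p]) (simp_all add: mult_scale_left S_vertex_mult)
    then have "d p = 0" using p basis_vertex[OF basis, of p] by (simp add: scale_vertex_eq_zero)
    then show "c p = 0" using p by (simp add: d_def)
  qed
  then show ?thesis using finI finJ by (intro rows_independent_card_le) simp_all
qed

lemma talented_eq_refine:
  assumes finI: "finite I" and vert: "\<And>i. i \<in> I \<Longrightarrow> fst (\<tau> i) \<in> vertices \<Lambda>"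
  shows "talented_eq \<Lambda> (image_mset \<tau> (mset_set I))
    (image_mset (refine_type \<tau> q) (mset_set (refine_index I \<tau> q)))"
proof -
  have "talented_eq \<Lambda> (\<Sum>i\<in>I. {#\<tau> i#}) (\<Sum>i\<in>I. unfold \<Lambda> (q i) (\<tau> i))"
  proof (rule talented_eq_sum)
    fix i assume "i \<in> I"
    then show "talented_eq \<Lambda> {#\<tau> i#} (unfold \<Lambda> (q i) (\<tau> i))"
      using talented_eq_unfold[of "fst (\<tau> i)" "snd (\<tau> i)" "q i"] vert by simp
  qed
  also have "(\<Sum>i\<in>I. unfold \<Lambda> (q i) (\<tau> i)) = (\<Sum>p\<in>refine_index I \<tau> q. {#refine_type \<tau> q p#})"
    unfolding unfold_def using finI by (subst sum.Sigma) (simp_all add: case_prod_unfold)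
  finally show ?thesis using finI by (simp add: image_mset_mset_set_eq_sum)
qed

text \<open>Both bases are brought to one diagonal degree and refined by a common
  \<open>vec r\<close> at which the transition matrices in both directions are scalar. Comparing the
  numbers of elements at each vertex in both directions identifies the refined types, and every
  refinement stays within the talented congruence.\<close>

lemma has_basis_unique:
  assumes X: "has_basis P X" and Y: "has_basis P Y"
  shows "talented_eq \<Lambda> X Y"
proof -
  have "\<forall>\<^sub>F N in at_top. below N X \<and> below N Y"
    by (intro eventually_conj eventually_below)
  then obtain N where N: "below N X" "below N Y"
    using eventually_happens[of _ "at_top :: int filter"] by auto
  note vX = has_basis_vertices[OF X] and vY = has_basis_vertices[OF Y]
  have "has_basis P (at_level N (raise \<Lambda> N X))" using X has_basis_at_level_iff[OF vX N(1)] by simp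
  then obtain I :: "nat set" and \<tau> x where I: "graded_basis P I \<tau> x"
    "at_level N (raise \<Lambda> N X) = image_mset \<tau> (mset_set I)" unfolding has_basis_def by blast
  have "has_basis P (at_level N (raise \<Lambda> N Y))" using Y has_basis_at_level_iff[OF vY N(2)] by simp
  then obtain J :: "nat set" and \<sigma> y where J: "graded_basis P J \<sigma> y"
    "at_level N (raise \<Lambda> N Y) = image_mset \<sigma> (mset_set J)" unfolding has_basis_def by blast
  note finI = basis_finite[OF I(1)] and finJ = basis_finite[OF J(1)]
  have levI: "snd (\<tau> i) = vec N" if "i \<in> I" for i
  proof -
    have "\<tau> i \<in># at_level N (raise \<Lambda> N X)" unfolding I(2) using finI that by simp
    then show ?thesis by auto
  qed
  have levJ: "snd (\<sigma> j) = vec N" if "j \<in> J" for j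
  proof -
    have "\<sigma> j \<in># at_level N (raise \<Lambda> N Y)" unfolding J(2) using finJ that by simp
    then show ?thesis by auto
  qed
  note ev1 = eventually_scalar_transition[OF J(1) levJ basis_family[OF I(1)] levI]
  note ev2 = eventually_scalar_transition[OF I(1) levI basis_family[OF J(1)] levJ]
  obtain r C D where
    C: "\<forall>p\<in>refine_index I \<tau> (\<lambda>_. vec r). T (snd p) \<odot>\<^bsub>P\<^esub> x (fst p) =
        (\<Oplus>\<^bsub>P\<^esub>q\<in>refine_index J \<sigma> (\<lambda>_. vec r). (C p q \<odot> \<one>) \<odot>\<^bsub>P\<^esub> (T (snd q) \<odot>\<^bsub>P\<^esub> y (fst q))) \<and>
      (\<forall>q\<in>refine_index J \<sigma> (\<lambda>_. vec r). src \<Lambda> (snd q) \<noteq> src \<Lambda> (snd p) \<longrightarrow> C p q = 0)"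
    and D: "\<forall>p\<in>refine_index J \<sigma> (\<lambda>_. vec r). T (snd p) \<odot>\<^bsub>P\<^esub> y (fst p) =
        (\<Oplus>\<^bsub>P\<^esub>q\<in>refine_index I \<tau> (\<lambda>_. vec r). (D p q \<odot> \<one>) \<odot>\<^bsub>P\<^esub> (T (snd q) \<odot>\<^bsub>P\<^esub> x (fst q))) \<and>
      (\<forall>q\<in>refine_index I \<tau> (\<lambda>_. vec r). src \<Lambda> (snd q) \<noteq> src \<Lambda> (snd p) \<longrightarrow> D p q = 0)"
    using eventually_happens[OF eventually_conj[OF ev1 ev2]] by auto
  let ?q = "\<lambda>_ :: nat. vec r :: nat ^ 'k"
  let ?I = "refine_index I \<tau> ?q" and ?J = "refine_index J \<sigma> ?q"
  note b1 = basis_refine[OF I(1), of ?q] and b2 = basis_refine[OF J(1), of ?q]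
  have c1: "T (snd p) \<odot>\<^bsub>P\<^esub> x (fst p) \<in> carrier P" if "p \<in> ?I" for p by (rule basis_closed[OF b1 that])
  have c2: "T (snd p) \<odot>\<^bsub>P\<^esub> y (fst p) \<in> carrier P" if "p \<in> ?J" for p by (rule basis_closed[OF b2 that])
  have C0: "C p q = 0" if "p \<in> ?I" "q \<in> ?J" "src \<Lambda> (snd q) \<noteq> src \<Lambda> (snd p)" for p q
    using bspec[OF conjunct2[OF bspec[OF C that(1)]] that(2)] that(3) by (rule mp)
  have D0: "D p q = 0" if "p \<in> ?J" "q \<in> ?I" "src \<Lambda> (snd q) \<noteq> src \<Lambda> (snd p)" for p q
    using bspec[OF conjunct2[OF bspec[OF D that(1)]] that(2)] that(3) by (rule mp)
  have le1: "card {p \<in> ?I. src \<Lambda> (snd p) = v} \<le> card {q \<in> ?J. src \<Lambda> (snd q) = v}" for v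
    by (rule card_type_le[OF b1 basis_finite[OF b2] c2 conjunct1[OF bspec[OF C]], where \<phi> = "\<lambda>q. src \<Lambda> (snd q)" and v = v, unfolded fst_conv])
      (assumption | rule C0)+
  have le2: "card {p \<in> ?J. src \<Lambda> (snd p) = v} \<le> card {q \<in> ?I. src \<Lambda> (snd q) = v}" for v
    by (rule card_type_le[OF b2 basis_finite[OF b1] c1 conjunct1[OF bspec[OF D]], where \<phi> = "\<lambda>q. src \<Lambda> (snd q)" and v = v, unfolded fst_conv])
      (assumption | rule D0)+
  have src_eq: "image_mset (\<lambda>p. src \<Lambda> (snd p)) (mset_set ?I) = image_mset (\<lambda>p. src \<Lambda> (snd p)) (mset_set ?J)"
  proof (rule multiset_eqI)
    fix v
    have *: "count (image_mset f (mset_set A)) v = card {p \<in> A. f p = v}" if "finite A" for A and f :: "nat \<times> 'p \<Rightarrow> 'p"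
      using that by (simp add: count_image_mset vimage_def Int_def conj_commute)
    show "count (image_mset (\<lambda>p. src \<Lambda> (snd p)) (mset_set ?I)) v = count (image_mset (\<lambda>p. src \<Lambda> (snd p)) (mset_set ?J)) v"
      using le1[of v] le2[of v] *[OF basis_finite[OF b1]] *[OF basis_finite[OF b2]] by simp
  qed
  let ?l = "vec N + int_vec (vec r) :: int ^ 'k"
  have "image_mset (refine_type \<tau> ?q) (mset_set ?I) = image_mset (\<lambda>v. (v, ?l)) (image_mset (\<lambda>p. src \<Lambda> (snd p)) (mset_set ?I))"
    unfolding multiset.map_comp comp_def using finI levI by (intro image_mset_cong) auto
  also have "\<dots> = image_mset (refine_type \<sigma> ?q) (mset_set ?J)"
    unfolding src_eq multiset.map_comp comp_def using finJ levJ by (intro image_mset_cong) auto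
  finally have e: "image_mset (refine_type \<tau> ?q) (mset_set ?I) = image_mset (refine_type \<sigma> ?q) (mset_set ?J)" .
  have "talented_eq \<Lambda> X (at_level N (raise \<Lambda> N X))" by (rule talented_eq_raise[OF vX N(1)])
  also have "talented_eq \<Lambda> \<dots> (image_mset (refine_type \<tau> ?q) (mset_set ?I))"
    unfolding I(2) by (rule talented_eq_refine[OF finI basis_vertex[OF I(1)]])
  also have "talented_eq \<Lambda> \<dots> (at_level N (raise \<Lambda> N Y))"
    unfolding e J(2) by (rule talented_eq.sym[OF talented_eq_refine[OF finJ basis_vertex[OF J(1)]]])
  also have "talented_eq \<Lambda> \<dots> Y" by (rule talented_eq.sym[OF talented_eq_raise[OF vY N(2)]])
  finally show ?thesis .
qed

text \<open>The submodule generated by a family that is not yet known to be a basis. Being indexed,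
  unlike \<open>lin_span\<close>, it tolerates repeated generators.\<close>

definition combinations :: "'i set \<Rightarrow> ('i \<Rightarrow> 'm) \<Rightarrow> 'm set" where
  "combinations I x = {\<Oplus>\<^bsub>P\<^esub>i\<in>I. a i \<odot>\<^bsub>P\<^esub> x i | a. \<forall>i\<in>I. a i \<in> carrier A}"

section \<open>Submodules generated by a homogeneous family\<close>

context
  fixes I :: "'i set" and \<tau> :: "'i \<Rightarrow> 'p \<times> (int ^ 'k)" and x :: "'i \<Rightarrow> 'm"
  assumes fam: "homogeneous_family P I \<tau> x"
begin

lemma combinations_zero: "\<zero>\<^bsub>P\<^esub> \<in> combinations I x"
proof -
  have "(\<Oplus>\<^bsub>P\<^esub>i\<in>I. \<zero> \<odot>\<^bsub>P\<^esub> x i) = \<zero>\<^bsub>P\<^esub>"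
    by (rule P.M.finsum_zeroI) (simp add: family_closed[OF fam])
  then show ?thesis unfolding combinations_def by (intro CollectI exI[of _ "\<lambda>_. \<zero>"]) simp
qed

lemma combinations_add:
  assumes "y \<in> combinations I x" "w \<in> combinations I x" shows "y \<oplus>\<^bsub>P\<^esub> w \<in> combinations I x"
proof -
  obtain a where a: "\<forall>i\<in>I. a i \<in> carrier A" "y = (\<Oplus>\<^bsub>P\<^esub>i\<in>I. a i \<odot>\<^bsub>P\<^esub> x i)"
    using assms(1) unfolding combinations_def by blast
  obtain b where b: "\<forall>i\<in>I. b i \<in> carrier A" "w = (\<Oplus>\<^bsub>P\<^esub>i\<in>I. b i \<odot>\<^bsub>P\<^esub> x i)"
    using assms(2) unfolding combinations_def by blast
  have "y \<oplus>\<^bsub>P\<^esub> w = (\<Oplus>\<^bsub>P\<^esub>i\<in>I. (a i \<oplus> b i) \<odot>\<^bsub>P\<^esub> x i)"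
    unfolding a(2) b(2) using a(1) b(1) by (intro family_sum_add[OF fam]) simp_all
  then show ?thesis
    unfolding combinations_def using a(1) b(1) by (intro CollectI exI[of _ "\<lambda>i. a i \<oplus> b i"]) simp
qed

lemma combinations_smult:
  assumes "y \<in> combinations I x" "c \<in> carrier A" shows "c \<odot>\<^bsub>P\<^esub> y \<in> combinations I x"
proof -
  obtain a where a: "\<forall>i\<in>I. a i \<in> carrier A" "y = (\<Oplus>\<^bsub>P\<^esub>i\<in>I. a i \<odot>\<^bsub>P\<^esub> x i)"
    using assms(1) unfolding combinations_def by blast
  have "c \<odot>\<^bsub>P\<^esub> y = (\<Oplus>\<^bsub>P\<^esub>i\<in>I. (c \<otimes> a i) \<odot>\<^bsub>P\<^esub> x i)"
    unfolding a(2) using a(1) assms(2) by (intro family_sum_smult[OF fam]) simp_all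
  then show ?thesis
    unfolding combinations_def using a(1) assms(2) by (intro CollectI exI[of _ "\<lambda>i. c \<otimes> a i"]) simp
qed

lemma combinations_closed: "y \<in> combinations I x \<Longrightarrow> y \<in> carrier P"
  unfolding combinations_def using family_sum_closed[OF fam] by blast

lemma combinations_finsum:
  "finite K \<Longrightarrow> (\<And>k. k \<in> K \<Longrightarrow> f k \<in> combinations I x) \<Longrightarrow> (\<Oplus>\<^bsub>P\<^esub>k\<in>K. f k) \<in> combinations I x"
proof (induction K rule: finite_induct)
  case (insert k K)
  have "(\<Oplus>\<^bsub>P\<^esub>k\<in>insert k K. f k) = f k \<oplus>\<^bsub>P\<^esub> (\<Oplus>\<^bsub>P\<^esub>k\<in>K. f k)"
    using insert combinations_closed by (intro P.M.finsum_insert) simp_all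
  then show ?case using insert by (simp add: combinations_add)
qed (simp add: combinations_zero)

lemma combinations_generator:
  assumes i: "i \<in> I" shows "x i \<in> combinations I x"
proof -
  have "(\<Oplus>\<^bsub>P\<^esub>k\<in>I. (if k = i then \<one> else \<zero>) \<odot>\<^bsub>P\<^esub> x k) = (if i = i then \<one> else \<zero>) \<odot>\<^bsub>P\<^esub> x i"
    using i family_finite[OF fam] family_closed[OF fam]
    by (intro P.M.finsum_singleI) (simp_all add: P.smult_one)
  then have "x i = (\<Oplus>\<^bsub>P\<^esub>k\<in>I. (if k = i then \<one> else \<zero>) \<odot>\<^bsub>P\<^esub> x k)"
    using family_closed[OF fam i] by (simp add: P.smult_one)
  then show ?thesis
    unfolding combinations_def by (intro CollectI exI[of _ "\<lambda>k. if k = i then \<one> else \<zero>"]) simp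
qed

lemma combinations_subset:
  assumes "homogeneous_family P K \<sigma> w" "\<And>k. k \<in> K \<Longrightarrow> w k \<in> combinations I x"
  shows "combinations K w \<subseteq> combinations I x"
proof
  fix y assume "y \<in> combinations K w"
  then obtain a where a: "\<forall>k\<in>K. a k \<in> carrier A" "y = (\<Oplus>\<^bsub>P\<^esub>k\<in>K. a k \<odot>\<^bsub>P\<^esub> w k)"
    unfolding combinations_def by blast
  show "y \<in> combinations I x"
    unfolding a(2) using a(1) assms(2) family_finite[OF assms(1)]
    by (intro combinations_finsum combinations_smult) simp_all
qed

text \<open>All generators lie in degree \<open>- n\<close>, so decomposing the coefficients
  decomposes the combination as well. The coefficient parts of degree \<open>m + n\<close> give its
  component in degree \<open>m\<close>, and \<open>y\<close> has no other component.\<close>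

lemma combinations_homogeneous:
  assumes lev: "\<And>i. i \<in> I \<Longrightarrow> snd (\<tau> i) = n" and y: "y \<in> hcomp P m" "y \<in> combinations I x"
  shows "\<exists>a. (\<forall>i\<in>I. a i \<in> hcomp A (m + snd (\<tau> i))) \<and> y = (\<Oplus>\<^bsub>P\<^esub>i\<in>I. a i \<odot>\<^bsub>P\<^esub> x i)"
proof -
  note finI = family_finite[OF fam] and xc = family_closed[OF fam]
  obtain a where a: "\<forall>i\<in>I. a i \<in> carrier A" "y = (\<Oplus>\<^bsub>P\<^esub>i\<in>I. a i \<odot>\<^bsub>P\<^esub> x i)"
    using y(2) unfolding combinations_def by blast
  have "\<forall>i\<in>I. \<exists>p. finite (fst p) \<and> (\<forall>d. snd p d \<in> hcomp A d) \<and> a i = (\<Oplus>d\<in>fst p. snd p d)"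
  proof
    fix i assume "i \<in> I"
    then obtain D f where "finite D" "\<forall>d. f d \<in> hcomp A d" "a i = (\<Oplus>d\<in>D. f d)"
      using hcomp_decompose[of "a i"] a(1) by metis
    then show "\<exists>p. finite (fst p) \<and> (\<forall>d. snd p d \<in> hcomp A d) \<and> a i = (\<Oplus>d\<in>fst p. snd p d)"
      by (intro exI[of _ "(D, f)"]) simp
  qed
  from bchoice[OF this] obtain p where
    p: "\<forall>i\<in>I. finite (fst (p i)) \<and> (\<forall>d. snd (p i) d \<in> hcomp A d) \<and> a i = (\<Oplus>d\<in>fst (p i). snd (p i) d)"
    by (elim exE)
  define D where "D = (\<Union>i\<in>I. fst (p i))"
  define f where "f i d = (if d \<in> fst (p i) then snd (p i) d else \<zero>)" for i d
  have finD: "finite D" unfolding D_def using finI p by simp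
  have fh: "f i d \<in> hcomp A d" if "i \<in> I" for i d using p that by (simp add: f_def hcomp_zero)
  have fc: "f i d \<in> carrier A" if "i \<in> I" for i d by (rule hcomp_closed[OF fh[OF that]])
  have af: "a i = (\<Oplus>d\<in>D. f i d)" if i: "i \<in> I" for i
  proof -
    have "snd (p i) d \<in> carrier A" for d using p i hcomp_closed by blast
    then show ?thesis
      using p i finD unfolding f_def by (subst finsum_extend[symmetric]) (auto simp: D_def)
  qed
  let ?Y = "\<lambda>d. \<Oplus>\<^bsub>P\<^esub>i\<in>I. f i d \<odot>\<^bsub>P\<^esub> x i"
  have Yh: "?Y d \<in> hcomp P (d - n)" for d
  proof (rule P.hcomp_finsum_closed)
    fix i assume i: "i \<in> I"
    have "f i d \<odot>\<^bsub>P\<^esub> x i \<in> hcomp P (d + - snd (\<tau> i))"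
      by (rule smult_hcomp[OF fh[OF i] family_hcomp[OF fam i]])
    then show "f i d \<odot>\<^bsub>P\<^esub> x i \<in> hcomp P (d - n)" using lev[OF i] by simp
  qed (rule finI)
  have "y = (\<Oplus>\<^bsub>P\<^esub>i\<in>I. \<Oplus>\<^bsub>P\<^esub>d\<in>D. f i d \<odot>\<^bsub>P\<^esub> x i)"
    unfolding a(2)
  proof (rule P.M.finsum_cong')
    fix i assume i: "i \<in> I"
    show "a i \<odot>\<^bsub>P\<^esub> x i = (\<Oplus>\<^bsub>P\<^esub>d\<in>D. f i d \<odot>\<^bsub>P\<^esub> x i)"
      unfolding af[OF i] using finD fc[OF i] xc[OF i] by (intro P.finsum_smult) simp_all
  next
    show "(\<lambda>i. \<Oplus>\<^bsub>P\<^esub>d\<in>D. f i d \<odot>\<^bsub>P\<^esub> x i) \<in> I \<rightarrow> carrier P"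
      using fc xc by (intro Pi_I P.M.finsum_closed) (simp add: P.smult_closed)
  qed simp
  also have "\<dots> = (\<Oplus>\<^bsub>P\<^esub>d\<in>D. ?Y d)"
    using finI finD fc xc by (intro P.M.finsum_swap) (simp_all add: P.smult_closed)
  \<comment> \<open>Reindexed by the degree \<open>e = d - n\<close> in the module instead of the
    degree \<open>d\<close> of the coefficients.\<close>
  also have "\<dots> = (\<Oplus>\<^bsub>P\<^esub>e\<in>(\<lambda>d. d - n) ` D. ?Y (e + n))"
  proof -
    have b: "bij_betw (\<lambda>d. d - n) D ((\<lambda>d. d - n) ` D)" by (intro bij_betw_imageI inj_onI) simp_all
    show ?thesis using P.hcomp_carrier[OF Yh] by (subst P.M.finsum_bij[OF b]) simp_all
  qed
  finally have ye: "y = (\<Oplus>\<^bsub>P\<^esub>e\<in>(\<lambda>d. d - n) ` D. ?Y (e + n))" .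
  have ym: "y = (if m \<in> (\<lambda>d. d - n) ` D then ?Y (m + n) else \<zero>\<^bsub>P\<^esub>)"
  proof (rule P.hcomp_component[OF _ _ y(1) ye])
    fix e show "?Y (e + n) \<in> hcomp P e" using Yh[of "e + n"] by simp
  qed (use finD in simp)
  show ?thesis
  proof (cases "m \<in> (\<lambda>d. d - n) ` D")
    case True
    then have "y = ?Y (m + n)" using ym by simp
    then show ?thesis using fh lev by (intro exI[of _ "\<lambda>i. f i (m + n)"]) simp
  next
    case False
    then have "y = \<zero>\<^bsub>P\<^esub>" using ym by simp
    also have "\<dots> = (\<Oplus>\<^bsub>P\<^esub>i\<in>I. \<zero> \<odot>\<^bsub>P\<^esub> x i)"
      by (rule P.M.finsum_zeroI[symmetric]) (simp add: xc)
    finally show ?thesis using hcomp_zero by (intro exI[of _ "\<lambda>_. \<zero>"]) simp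
  qed
qed

end

lemma combinations_refine:
  assumes fam: "homogeneous_family P I \<tau> x"
  shows "combinations I x \<subseteq> combinations (refine_index I \<tau> q) (\<lambda>p. T (snd p) \<odot>\<^bsub>P\<^esub> x (fst p))"
proof (rule combinations_subset[OF family_refine[OF fam] fam])
  note ref = family_refine[OF fam, of q]
  fix i assume i: "i \<in> I"
  have "S (fst (\<tau> i)) \<odot>\<^bsub>P\<^esub> x i = (\<Oplus>\<^bsub>P\<^esub>\<alpha>\<in>paths_from \<Lambda> (fst (\<tau> i)) (q i). S \<alpha> \<odot>\<^bsub>P\<^esub> (T \<alpha> \<odot>\<^bsub>P\<^esub> x i))"
    by (rule smult_vertex_expand[OF family_vertex[OF fam i] family_closed[OF fam i]])
  then have "x i = (\<Oplus>\<^bsub>P\<^esub>\<alpha>\<in>paths_from \<Lambda> (fst (\<tau> i)) (q i). S \<alpha> \<odot>\<^bsub>P\<^esub> (T \<alpha> \<odot>\<^bsub>P\<^esub> x i))"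
    by (simp only: family_absorb[OF fam i])
  also have "\<dots> \<in> combinations (refine_index I \<tau> q) (\<lambda>p. T (snd p) \<odot>\<^bsub>P\<^esub> x (fst p))"
  proof (rule combinations_finsum[OF ref])
    fix \<alpha> assume \<alpha>: "\<alpha> \<in> paths_from \<Lambda> (fst (\<tau> i)) (q i)"
    have "T (snd (i, \<alpha>)) \<odot>\<^bsub>P\<^esub> x (fst (i, \<alpha>)) \<in> combinations (refine_index I \<tau> q) (\<lambda>p. T (snd p) \<odot>\<^bsub>P\<^esub> x (fst p))"
      by (rule combinations_generator[OF ref]) (use i \<alpha> in simp)
    then have "T \<alpha> \<odot>\<^bsub>P\<^esub> x i \<in> combinations (refine_index I \<tau> q) (\<lambda>p. T (snd p) \<odot>\<^bsub>P\<^esub> x (fst p))"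
      by (simp only: fst_conv snd_conv)
    then show "S \<alpha> \<odot>\<^bsub>P\<^esub> (T \<alpha> \<odot>\<^bsub>P\<^esub> x i) \<in> combinations (refine_index I \<tau> q) (\<lambda>p. T (snd p) \<odot>\<^bsub>P\<^esub> x (fst p))"
      by (rule combinations_smult[OF ref]) (simp add: paths_fromD[OF \<alpha>])
  qed simp
  finally show "x i \<in> combinations (refine_index I \<tau> q) (\<lambda>p. T (snd p) \<odot>\<^bsub>P\<^esub> x (fst p))" .
qed

lemma combinations_hom:
  assumes F: "graded_left_module A F" and f: "f \<in> graded_hom A P F"
    and x: "\<And>i. i \<in> I \<Longrightarrow> x i \<in> carrier P" and finI: "finite I" and a: "\<And>i. i \<in> I \<Longrightarrow> a i \<in> carrier A"
  shows "f (\<Oplus>\<^bsub>P\<^esub>i\<in>I. a i \<odot>\<^bsub>P\<^esub> x i) = (\<Oplus>\<^bsub>F\<^esub>i\<in>I. a i \<odot>\<^bsub>F\<^esub> f (x i))"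
proof -
  interpret F: graded_left_module A F by (rule F)
  have "f (\<Oplus>\<^bsub>P\<^esub>i\<in>I. a i \<odot>\<^bsub>P\<^esub> x i) = (\<Oplus>\<^bsub>F\<^esub>i\<in>I. f (a i \<odot>\<^bsub>P\<^esub> x i))"
    using a x finI
    by (intro graded_hom_finsum[OF P.graded_left_module_axioms F f]) (simp_all add: Pi_iff P.smult_closed)
  also have "\<dots> = (\<Oplus>\<^bsub>F\<^esub>i\<in>I. a i \<odot>\<^bsub>F\<^esub> f (x i))"
    using a x
    by (intro F.M.finsum_cong')
      (simp_all add: Pi_iff F.smult_closed graded_hom_closed[OF f] graded_hom_smult[OF f])
  finally show ?thesis .
qed

lemma family_hom:
  assumes F: "graded_left_module A F" and f: "f \<in> graded_hom A P F" and fam: "homogeneous_family P I \<tau> x"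
  shows "homogeneous_family F I \<tau> (\<lambda>i. f (x i))"
  unfolding homogeneous_family_def
proof (intro conjI ballI)
  show "finite I" by (rule family_finite[OF fam])
  fix i assume i: "i \<in> I"
  show v: "fst (\<tau> i) \<in> vertices \<Lambda>" by (rule family_vertex[OF fam i])
  show "f (x i) \<in> hcomp F (- snd (\<tau> i))" by (rule graded_hom_hcomp[OF f family_hcomp[OF fam i]])
  have "S (fst (\<tau> i)) \<odot>\<^bsub>F\<^esub> f (x i) = f (S (fst (\<tau> i)) \<odot>\<^bsub>P\<^esub> x i)"
    using v family_closed[OF fam i] by (intro graded_hom_smult[OF f, symmetric]) simp_all
  then show "S (fst (\<tau> i)) \<odot>\<^bsub>F\<^esub> f (x i) = f (x i)" using family_absorb[OF fam i] by simp
qed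

text \<open>
  The scalar matrix of the section \<open>h\<close> has a maximal independent set of rows, and the
  corresponding generators form a basis: a right inverse of these rows shows that they are
  independent over the algebra.
\<close>

lemma summand_has_basis_level:
  assumes F: "graded_left_module A F" and h: "h \<in> graded_hom A P F" and g: "g \<in> graded_hom A F P"
    and gh: "\<And>y. y \<in> carrier P \<Longrightarrow> g (h y) = y"
    and finJ: "finite J" and levI: "\<And>i. i \<in> I \<Longrightarrow> snd (\<tau> i) = n" and basis: "graded_basis F J \<sigma> e"
    and fam: "homogeneous_family P I \<tau> z" and gen: "carrier P \<subseteq> combinations I z"
    and hz: "\<And>p. p \<in> I \<Longrightarrow> h (z p) = (\<Oplus>\<^bsub>F\<^esub>q\<in>J. (C p q \<odot> \<one>) \<odot>\<^bsub>F\<^esub> e q)"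
    and C: "\<And>p q. p \<in> I \<Longrightarrow> q \<in> J \<Longrightarrow> fst (\<sigma> q) \<noteq> fst (\<tau> p) \<Longrightarrow> C p q = 0"
  shows "\<exists>X. has_basis P X"
proof -
  interpret F: kp_module \<Lambda> A S T W F
    by (intro kp_module.intro graded_kp_algebra_axioms F)
  note finI = family_finite[OF fam] and zc = family_closed[OF fam] and ec = F.basis_closed[OF basis]
  have "\<exists>B. B \<subseteq> I \<and> rows_independent C B J \<and> (\<forall>i\<in>I. \<exists>d. \<forall>j\<in>J. C i j = (\<Sum>b\<in>B. d b * C b j))"
  proof (rule exists_independent_rows[OF finI, of C J])
    fix B assume "B \<subseteq> I" "rows_independent C B J"
      "\<And>i. i \<in> I \<Longrightarrow> \<exists>d. \<forall>j\<in>J. C i j = (\<Sum>b\<in>B. d b * C b j)"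
    then show ?thesis by (intro exI[of _ B] conjI ballI)
  qed
  then obtain B where B: "B \<subseteq> I" "rows_independent C B J"
    "\<forall>i\<in>I. \<exists>d. \<forall>j\<in>J. C i j = (\<Sum>b\<in>B. d b * C b j)"
    by (elim exE conjE)
  have BI: "b \<in> I" if "b \<in> B" for b using B(1) that by blast
  have finB: "finite B" using B(1) finI by (rule finite_subset)
  have famB: "homogeneous_family P B \<tau> z"
    using fam finB BI unfolding homogeneous_family_def by blast
  \<comment> \<open>The dependence of row \<open>p\<close> on the rows in \<open>B\<close> is a
    dependence among the images under \<open>h\<close>; since \<open>g\<close> undoes
    \<open>h\<close>, it already holds among the generators.\<close>
  have zB: "z p \<in> combinations B z" if p: "p \<in> I" for p
  proof -
    obtain d where d: "\<forall>q\<in>J. C p q = (\<Sum>b\<in>B. d b * C b q)" using bspec[OF B(3) p] by (elim exE)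
    let ?y = "\<Oplus>\<^bsub>P\<^esub>b\<in>B. (d b \<odot> \<one>) \<odot>\<^bsub>P\<^esub> z b"
    have yc: "?y \<in> carrier P" by (rule family_sum_closed[OF famB]) simp
    have "h ?y = (\<Oplus>\<^bsub>F\<^esub>b\<in>B. (d b \<odot> \<one>) \<odot>\<^bsub>F\<^esub> h (z b))"
      using zc BI finB by (intro combinations_hom[OF F h]) simp_all
    also have "\<dots> = (\<Oplus>\<^bsub>F\<^esub>q\<in>J. (\<Oplus>b\<in>B. C b q \<odot> (d b \<odot> \<one>)) \<odot>\<^bsub>F\<^esub> e q)"
      by (rule F.sum_transition[OF finB finJ ec hz[OF BI]]) simp_all
    also have "\<dots> = (\<Oplus>\<^bsub>F\<^esub>q\<in>J. (C p q \<odot> \<one>) \<odot>\<^bsub>F\<^esub> e q)"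
    proof (rule F.P.M.finsum_cong')
      fix q assume q: "q \<in> J"
      have "(\<Oplus>b\<in>B. C b q \<odot> (d b \<odot> \<one>)) = (\<Oplus>b\<in>B. (d b * C b q) \<odot> \<one>)"
        by (intro finsum_cong') (simp_all add: scale_times[symmetric] mult.commute)
      also have "\<dots> = C p q \<odot> \<one>" using finB d q by (simp add: finsum_scale_left)
      finally show "(\<Oplus>b\<in>B. C b q \<odot> (d b \<odot> \<one>)) \<odot>\<^bsub>F\<^esub> e q = (C p q \<odot> \<one>) \<odot>\<^bsub>F\<^esub> e q" by simp
    qed (use ec in \<open>simp_all add: Pi_iff F.P.smult_closed\<close>)
    also have "\<dots> = h (z p)" by (rule hz[OF p, symmetric])
    finally have "h ?y = h (z p)" .
    then have "g (h ?y) = g (h (z p))" by (rule arg_cong)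
    then have "z p = ?y" unfolding gh[OF yc] gh[OF zc[OF p]] by (rule HOL.sym)
    then show ?thesis
      unfolding combinations_def by (intro CollectI exI[of _ "\<lambda>b. d b \<odot> \<one>"]) simp
  qed
  have genB: "carrier P \<subseteq> combinations B z"
    using gen combinations_subset[OF famB fam zB] by (rule subset_trans)
  obtain D where D: "\<forall>b\<in>B. \<forall>b'\<in>B. (\<Sum>j\<in>J. C b j * D j b') = (if b = b' then 1 else 0)"
    using rows_independent_right_inverse[OF finB finJ B(2)] by (elim exE)
  have "graded_basis P B \<tau> z"
  proof (rule graded_basisI[OF famB])
    fix m y assume y: "y \<in> hcomp P m"
    show "\<exists>a. (\<forall>i\<in>B. a i \<in> hcomp A (m + snd (\<tau> i))) \<and> y = (\<Oplus>\<^bsub>P\<^esub>i\<in>B. a i \<odot>\<^bsub>P\<^esub> z i)"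
      using levI BI genB P.hcomp_carrier[OF y]
      by (intro combinations_homogeneous[OF famB _ y]) auto
  next
    fix a b' assume a: "\<forall>i\<in>B. a i \<in> carrier A \<and> a i \<otimes> S (fst (\<tau> i)) = a i"
      and zero: "(\<Oplus>\<^bsub>P\<^esub>i\<in>B. a i \<odot>\<^bsub>P\<^esub> z i) = \<zero>\<^bsub>P\<^esub>" and b': "b' \<in> B"
    have ac: "a b \<in> carrier A" "a b \<otimes> S (fst (\<tau> b)) = a b" if "b \<in> B" for b using a that by simp_all
    let ?k = "\<lambda>q. \<Oplus>b\<in>B. C b q \<odot> a b"
    have kc: "?k q \<in> carrier A" for q using ac(1) by (intro finsum_closed) (simp add: Pi_iff)
    have "(\<Oplus>\<^bsub>F\<^esub>q\<in>J. ?k q \<odot>\<^bsub>F\<^esub> e q) = (\<Oplus>\<^bsub>F\<^esub>b\<in>B. a b \<odot>\<^bsub>F\<^esub> h (z b))"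
      by (rule F.sum_transition[OF finB finJ ec hz[OF BI] ac(1), symmetric])
    also have "\<dots> = h (\<Oplus>\<^bsub>P\<^esub>i\<in>B. a i \<odot>\<^bsub>P\<^esub> z i)"
      using zc BI finB ac(1) by (intro combinations_hom[OF F h, symmetric]) simp_all
    also have "\<dots> = \<zero>\<^bsub>F\<^esub>"
      unfolding zero by (rule graded_hom_zero[OF P.graded_left_module_axioms F h])
    finally have ksum: "(\<Oplus>\<^bsub>F\<^esub>q\<in>J. ?k q \<odot>\<^bsub>F\<^esub> e q) = \<zero>\<^bsub>F\<^esub>" .
    \<comment> \<open>The matrix respects vertices, so only those \<open>b\<close> contribute whose
      coefficient \<open>a b\<close> is absorbed by the idempotent at \<open>q\<close>.\<close>
    have kabs: "?k q \<otimes> S (fst (\<sigma> q)) = ?k q" if q: "q \<in> J" for q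
    proof -
      note v = F.basis_vertex[OF basis q]
      have "?k q \<otimes> S (fst (\<sigma> q)) = (\<Oplus>b\<in>B. (C b q \<odot> a b) \<otimes> S (fst (\<sigma> q)))"
        using finB ac(1) v by (intro finsum_mult_left) (simp_all add: Pi_iff)
      also have "\<dots> = ?k q"
      proof (rule finsum_cong')
        fix b assume b: "b \<in> B"
        show "(C b q \<odot> a b) \<otimes> S (fst (\<sigma> q)) = C b q \<odot> a b"
        proof (cases "fst (\<sigma> q) = fst (\<tau> b)")
          case True
          have "(C b q \<odot> a b) \<otimes> S (fst (\<sigma> q)) = C b q \<odot> (a b \<otimes> S (fst (\<sigma> q)))"
            by (rule mult_scale_left[OF ac(1)[OF b] S_closed_vertex[OF v]])
          then show ?thesis unfolding True by (simp only: ac(2)[OF b])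
        next
          case False
          then have "C b q = 0" by (rule C[OF BI[OF b] q])
          then show ?thesis using ac(1)[OF b] v by simp
        qed
      qed (use ac(1) in \<open>simp_all add: Pi_iff\<close>)
      finally show ?thesis .
    qed
    have k0: "?k q = \<zero>" if q: "q \<in> J" for q
      by (rule F.basis_independent[OF basis kc kabs ksum q])
    \<comment> \<open>Applying the column \<open>b'\<close> of the right inverse to the vanishing
      coefficients isolates \<open>a b'\<close>.\<close>
    have "\<zero> = (\<Oplus>q\<in>J. D q b' \<odot> ?k q)"
      by (rule finsum_zeroI[symmetric]) (simp add: k0)
    also have "\<dots> = (\<Oplus>q\<in>J. \<Oplus>b\<in>B. (D q b' * C b q) \<odot> a b)"
    proof (rule finsum_cong')
      fix q assume "q \<in> J"
      have "D q b' \<odot> ?k q = (\<Oplus>b\<in>B. D q b' \<odot> (C b q \<odot> a b))"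
        using finB ac(1) by (intro scale_finsum) (simp_all add: Pi_iff)
      also have "\<dots> = (\<Oplus>b\<in>B. (D q b' * C b q) \<odot> a b)"
        using ac(1) by (intro finsum_cong') (simp_all add: Pi_iff scale_times)
      finally show "D q b' \<odot> ?k q = (\<Oplus>b\<in>B. (D q b' * C b q) \<odot> a b)" .
    next
      show "(\<lambda>q. \<Oplus>b\<in>B. (D q b' * C b q) \<odot> a b) \<in> J \<rightarrow> carrier A"
        using ac(1) by (intro Pi_I finsum_closed) simp
    qed simp
    also have "\<dots> = (\<Oplus>b\<in>B. \<Oplus>q\<in>J. (D q b' * C b q) \<odot> a b)"
      using finB finJ ac(1) by (intro finsum_swap) simp_all
    also have "\<dots> = (\<Oplus>b\<in>B. (if b = b' then 1 else 0) \<odot> a b)"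
    proof (rule finsum_cong')
      fix b assume b: "b \<in> B"
      have "(\<Oplus>q\<in>J. (D q b' * C b q) \<odot> a b) = (\<Sum>q\<in>J. D q b' * C b q) \<odot> a b"
        by (rule finsum_scale_left[OF finJ ac(1)[OF b]])
      also have "(\<Sum>q\<in>J. D q b' * C b q) = (\<Sum>q\<in>J. C b q * D q b')"
        by (simp only: mult.commute)
      also have "\<dots> = (if b = b' then 1 else 0)" using D b b' by simp
      finally show "(\<Oplus>q\<in>J. (D q b' * C b q) \<odot> a b) = (if b = b' then 1 else 0) \<odot> a b" .
    next
      show "(\<lambda>b. (if b = b' then 1 else 0) \<odot> a b) \<in> B \<rightarrow> carrier A" using ac(1) by (intro Pi_I) simp
    qed simp
    also have "\<dots> = (if b' = b' then 1 else 0) \<odot> a b'"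
      using finB b' ac(1) by (intro finsum_singleI) simp_all
    finally show "a b' = \<zero>" using ac(1)[OF b'] by simp
  qed
  then show ?thesis using has_basis_image by blast
qed

text \<open>Two refinements follow each other: one along the gaps, to bring both families to a
  common degree, and one along \<open>vec r\<close>, to make the matrix of \<open>h\<close> scalar.
  The generating property and the basis property survive both.\<close>

lemma summand_has_basis:
  assumes F: "graded_left_module A F" and h: "h \<in> graded_hom A P F" and g: "g \<in> graded_hom A F P"
    and gh: "\<And>y. y \<in> carrier P \<Longrightarrow> g (h y) = y"
    and basis: "graded_basis F J \<sigma> e"
    and fam: "homogeneous_family P I \<tau> z" and gen: "carrier P \<subseteq> combinations I z"
  shows "\<exists>X. has_basis P X"
proof -
  interpret F: kp_module \<Lambda> A S T W F
    by (intro kp_module.intro graded_kp_algebra_axioms F)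
  note finI = family_finite[OF fam] and finJ = F.basis_finite[OF basis]
  have "\<forall>\<^sub>F N in at_top. below N (image_mset \<tau> (mset_set I)) \<and> below N (image_mset \<sigma> (mset_set J))"
    by (intro eventually_conj eventually_below)
  then obtain N where N: "below N (image_mset \<tau> (mset_set I))" "below N (image_mset \<sigma> (mset_set J))"
    using eventually_happens[of _ "at_top :: int filter"] by auto
  define qI where "qI i = gap N (snd (\<tau> i))" for i
  define qJ where "qJ j = gap N (snd (\<sigma> j))" for j
  have lI: "snd (\<tau> i) + int_vec (qI i) = vec N" if "i \<in> I" for i
    using N(1) finI that unfolding qI_def by (intro int_vec_gap) (simp add: below_def)
  have lJ: "snd (\<sigma> j) + int_vec (qJ j) = vec N" if "j \<in> J" for j
    using N(2) finJ that unfolding qJ_def by (intro int_vec_gap) (simp add: below_def)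
  let ?I = "refine_index I \<tau> qI" and ?\<tau> = "refine_type \<tau> qI" and ?z = "\<lambda>p. T (snd p) \<odot>\<^bsub>P\<^esub> z (fst p)"
  let ?J = "refine_index J \<sigma> qJ" and ?\<sigma> = "refine_type \<sigma> qJ" and ?e = "\<lambda>p. T (snd p) \<odot>\<^bsub>F\<^esub> e (fst p)"
  note fam1 = family_refine[OF fam, of qI] and basis1 = F.basis_refine[OF basis, of qJ]
  have gen1: "carrier P \<subseteq> combinations ?I ?z"
    using gen combinations_refine[OF fam] by (rule subset_trans)
  have levI: "snd (?\<tau> p) = vec N" if "p \<in> ?I" for p using lI that by auto
  have levJ: "snd (?\<sigma> p) = vec N" if "p \<in> ?J" for p using lJ that by auto
  note fam2 = family_hom[OF F h fam1]
  obtain r C where C: "\<forall>p\<in>refine_index ?I ?\<tau> (\<lambda>_. vec r).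
    T (snd p) \<odot>\<^bsub>F\<^esub> h (?z (fst p)) =
      (\<Oplus>\<^bsub>F\<^esub>q\<in>refine_index ?J ?\<sigma> (\<lambda>_. vec r). (C p q \<odot> \<one>) \<odot>\<^bsub>F\<^esub> (T (snd q) \<odot>\<^bsub>F\<^esub> ?e (fst q))) \<and>
    (\<forall>q\<in>refine_index ?J ?\<sigma> (\<lambda>_. vec r). src \<Lambda> (snd q) \<noteq> src \<Lambda> (snd p) \<longrightarrow> C p q = 0)"
    using eventually_happens[OF F.eventually_scalar_transition[OF basis1 levJ fam2 levI]] by auto
  let ?I2 = "refine_index ?I ?\<tau> (\<lambda>_. vec r)" and ?J2 = "refine_index ?J ?\<sigma> (\<lambda>_. vec r)"
  note basis2 = F.basis_refine[OF basis1, of "\<lambda>_. vec r"] and fam3 = family_refine[OF fam1, of "\<lambda>_. vec r"]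
  have gen2: "carrier P \<subseteq> combinations ?I2 (\<lambda>p. T (snd p) \<odot>\<^bsub>P\<^esub> ?z (fst p))"
    using gen1 combinations_refine[OF fam1] by (rule subset_trans)
  have hT: "h (T (snd p) \<odot>\<^bsub>P\<^esub> ?z (fst p)) = T (snd p) \<odot>\<^bsub>F\<^esub> h (?z (fst p))" if p: "p \<in> ?I2" for p
  proof (rule graded_hom_smult[OF h])
    have p': "fst p \<in> ?I" "snd p \<in> paths_from \<Lambda> (fst (?\<tau> (fst p))) (vec r)"
      using p by (auto simp only: mem_Sigma_iff fst_conv snd_conv)
    show "?z (fst p) \<in> carrier P" by (rule family_closed[OF fam1 p'(1)])
    show "T (snd p) \<in> carrier A" using paths_fromD[OF p'(2)] by simp
  qed
  show ?thesis
  proof (rule summand_has_basis_level[OF F h g gh F.basis_finite[OF basis2] _ basis2 fam3 gen2, of "vec N + int_vec (vec r)" C])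
    fix p assume p: "p \<in> ?I2"
    show "snd (refine_type ?\<tau> (\<lambda>_. vec r) p) = vec N + int_vec (vec r)"
      using levI[of "fst p"] p by auto
    show "h (T (snd p) \<odot>\<^bsub>P\<^esub> ?z (fst p)) =
      (\<Oplus>\<^bsub>F\<^esub>q\<in>?J2. (C p q \<odot> \<one>) \<odot>\<^bsub>F\<^esub> (T (snd q) \<odot>\<^bsub>F\<^esub> ?e (fst q)))"
      unfolding hT[OF p] using bspec[OF C p] by (rule conjunct1)
    fix q assume q: "q \<in> ?J2" and ne: "fst (refine_type ?\<sigma> (\<lambda>_. vec r) q) \<noteq> fst (refine_type ?\<tau> (\<lambda>_. vec r) p)"
    have "src \<Lambda> (snd q) \<noteq> src \<Lambda> (snd p)" using ne by (simp only: fst_conv not_False_eq_True)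
    then show "C p q = 0" using bspec[OF conjunct2[OF bspec[OF C p]] q] by (simp only: simp_thms)
  qed
qed

end

section \<open>Graded free modules\<close>

text \<open>Unique decomposition over supports is traded for existence over some finite set and
  triviality of relations; uniqueness comes from applying the latter to a difference.\<close>

lemma graded_left_moduleI:
  fixes A :: "('s, 'a, 'z::ab_group_add) graded_module" and M :: "('a, 'm, 'z) graded_module"
  assumes lm: "left_module A M" and sub: "\<And>n. subgroup (hcomp M n) (add_monoid M)"
    and sm: "\<And>a x n m. a \<in> hcomp A n \<Longrightarrow> x \<in> hcomp M m \<Longrightarrow> a \<odot>\<^bsub>M\<^esub> x \<in> hcomp M (n + m)"
    and ex: "\<And>x. x \<in> carrier M \<Longrightarrow> \<exists>D f. finite D \<and> (\<forall>n. f n \<in> hcomp M n) \<and> x = (\<Oplus>\<^bsub>M\<^esub>n\<in>D. f n)"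
    and ind: "\<And>D f m. finite D \<Longrightarrow> \<forall>n. f n \<in> hcomp M n \<Longrightarrow> (\<Oplus>\<^bsub>M\<^esub>n\<in>D. f n) = \<zero>\<^bsub>M\<^esub> \<Longrightarrow> m \<in> D \<Longrightarrow> f m = \<zero>\<^bsub>M\<^esub>"
  shows "graded_left_module A M"
proof -
  interpret left_module A M by (rule lm)
  have hc: "x \<in> carrier M" if "x \<in> hcomp M n" for x n
    using subgroup.subset[OF sub, of n] that by auto
  have hz: "\<zero>\<^bsub>M\<^esub> \<in> hcomp M n" for n using subgroup.one_closed[OF sub, of n] by simp
  have hm: "\<ominus>\<^bsub>M\<^esub> x \<in> hcomp M n" if "x \<in> hcomp M n" for x n
    using subgroup.m_inv_closed[OF sub that] by (simp add: a_inv_def)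
  have ha: "x \<oplus>\<^bsub>M\<^esub> y \<in> hcomp M n" if "x \<in> hcomp M n" "y \<in> hcomp M n" for x y n
    using subgroup.m_closed[OF sub that] by simp
  show ?thesis
  proof (intro graded_left_module.intro lm graded_left_module_axioms.intro sub sm)
    fix x assume x: "x \<in> carrier M"
    show "\<exists>!f. (\<forall>n. f n \<in> hcomp M n) \<and> finite {n. f n \<noteq> \<zero>\<^bsub>M\<^esub>} \<and>
      x = (\<Oplus>\<^bsub>M\<^esub>n\<in>{n. f n \<noteq> \<zero>\<^bsub>M\<^esub>}. f n)"
    proof (rule ex_ex1I)
      obtain D f where f: "finite D" "\<forall>n. f n \<in> hcomp M n" "x = (\<Oplus>\<^bsub>M\<^esub>n\<in>D. f n)"
        using ex[OF x] by (elim exE conjE)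
      define f' where "f' n = (if n \<in> D then f n else \<zero>\<^bsub>M\<^esub>)" for n
      have fc: "f n \<in> carrier M" for n using f(2) hc by blast
      have sub: "{n. f' n \<noteq> \<zero>\<^bsub>M\<^esub>} \<subseteq> D" unfolding f'_def by auto
      have "x = (\<Oplus>\<^bsub>M\<^esub>n\<in>{n. f' n \<noteq> \<zero>\<^bsub>M\<^esub>}. f' n)"
        unfolding f(3) using f(1) sub fc by (intro M.add.finprod_mono_neutral_cong_right) (auto simp: f'_def)
      moreover have "\<forall>n. f' n \<in> hcomp M n" using f(2) hz unfolding f'_def by simp
      moreover have "finite {n. f' n \<noteq> \<zero>\<^bsub>M\<^esub>}" using sub f(1) by (rule finite_subset)
      ultimately show "\<exists>f. (\<forall>n. f n \<in> hcomp M n) \<and> finite {n. f n \<noteq> \<zero>\<^bsub>M\<^esub>} \<and>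
          x = (\<Oplus>\<^bsub>M\<^esub>n\<in>{n. f n \<noteq> \<zero>\<^bsub>M\<^esub>}. f n)"
        by (intro exI[of _ f'] conjI)
    next
      fix f g
      assume f: "(\<forall>n. f n \<in> hcomp M n) \<and> finite {n. f n \<noteq> \<zero>\<^bsub>M\<^esub>} \<and> x = (\<Oplus>\<^bsub>M\<^esub>n\<in>{n. f n \<noteq> \<zero>\<^bsub>M\<^esub>}. f n)"
        and g: "(\<forall>n. g n \<in> hcomp M n) \<and> finite {n. g n \<noteq> \<zero>\<^bsub>M\<^esub>} \<and> x = (\<Oplus>\<^bsub>M\<^esub>n\<in>{n. g n \<noteq> \<zero>\<^bsub>M\<^esub>}. g n)"
      let ?D = "{n. f n \<noteq> \<zero>\<^bsub>M\<^esub>} \<union> {n. g n \<noteq> \<zero>\<^bsub>M\<^esub>}"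
      have fc: "f n \<in> carrier M" "g n \<in> carrier M" for n using f g hc by blast+
      have finD: "finite ?D" using f g by simp
      have fx: "(\<Oplus>\<^bsub>M\<^esub>n\<in>?D. f n) = x"
      proof -
        have "(\<Oplus>\<^bsub>M\<^esub>n\<in>?D. f n) = (\<Oplus>\<^bsub>M\<^esub>n\<in>{n. f n \<noteq> \<zero>\<^bsub>M\<^esub>}. f n)"
          using finD fc by (intro M.add.finprod_mono_neutral_cong_right) auto
        then show ?thesis using f by simp
      qed
      have gx: "(\<Oplus>\<^bsub>M\<^esub>n\<in>?D. g n) = x"
      proof -
        have "(\<Oplus>\<^bsub>M\<^esub>n\<in>?D. g n) = (\<Oplus>\<^bsub>M\<^esub>n\<in>{n. g n \<noteq> \<zero>\<^bsub>M\<^esub>}. g n)"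
          using finD fc by (intro M.add.finprod_mono_neutral_cong_right) auto
        then show ?thesis using g by simp
      qed
      have "(\<Oplus>\<^bsub>M\<^esub>n\<in>?D. \<ominus>\<^bsub>M\<^esub> g n) = \<ominus>\<^bsub>M\<^esub> (\<Oplus>\<^bsub>M\<^esub>n\<in>?D. g n)"
        using finD fc
        by (intro finsum_additive[symmetric] M.abelian_monoid_axioms) (simp_all add: M.minus_add Pi_iff)
      then have "(\<Oplus>\<^bsub>M\<^esub>n\<in>?D. f n \<oplus>\<^bsub>M\<^esub> \<ominus>\<^bsub>M\<^esub> g n) = \<zero>\<^bsub>M\<^esub>"
        using fc fx gx x by (simp add: M.finsum_addf Pi_iff M.r_neg)
      then have *: "f m \<oplus>\<^bsub>M\<^esub> \<ominus>\<^bsub>M\<^esub> g m = \<zero>\<^bsub>M\<^esub>" if "m \<in> ?D" for m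
        using f g ha hm finD that by (intro ind[of ?D "\<lambda>n. f n \<oplus>\<^bsub>M\<^esub> \<ominus>\<^bsub>M\<^esub> g n" m]) simp_all
      show "f = g"
      proof
        fix m show "f m = g m"
        proof (cases "m \<in> ?D")
          case True
          have "\<ominus>\<^bsub>M\<^esub> (\<ominus>\<^bsub>M\<^esub> g m) = f m" using *[OF True] fc by (intro M.minus_equality) simp_all
          then show ?thesis using fc by simp
        next
          case False
          then show ?thesis by simp
        qed
      qed
    qed
  qed
qed

section \<open>The module with a prescribed type\<close>

context graded_kp_algebra
begin

text \<open>The direct sum of the left ideals generated by the vertex idempotents, shifted by the
  second entries. Lists keep it inside the universe over which \<open>graded_projective\<close>
  quantifies.\<close>

definition free_module :: "('p \<times> (int ^ 'k)) list \<Rightarrow> ('a, 'a list, int ^ 'k) graded_module" where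
  "free_module ts =
     \<lparr>carrier = {xs. length xs = length ts \<and> (\<forall>k<length ts. xs ! k \<in> carrier A \<and> xs ! k \<otimes> S (fst (ts ! k)) = xs ! k)},
      monoid.mult = undefined, one = undefined,
      zero = map (\<lambda>k. \<zero>) [0..<length ts],
      add = (\<lambda>xs ys. map (\<lambda>k. xs ! k \<oplus> ys ! k) [0..<length ts]),
      smult = (\<lambda>a xs. map (\<lambda>k. a \<otimes> xs ! k) [0..<length ts]),
      hcomp = (\<lambda>m. {xs. length xs = length ts \<and> (\<forall>k<length ts. xs ! k \<in> hcomp A (m + snd (ts ! k)) \<and>
        xs ! k \<otimes> S (fst (ts ! k)) = xs ! k)})\<rparr>"

context
  fixes ts :: "('p \<times> (int ^ 'k)) list"
  assumes valid: "set ts \<subseteq> vertices \<Lambda> \<times> UNIV"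
begin

lemma free_vertex: "k < length ts \<Longrightarrow> fst (ts ! k) \<in> vertices \<Lambda>"
  using subsetD[OF valid nth_mem[of k ts]] by (simp add: mem_Times_iff)

abbreviation "FM \<equiv> free_module ts"

lemma free_simps:
  "xs \<in> carrier FM \<longleftrightarrow> length xs = length ts \<and> (\<forall>k<length ts. xs ! k \<in> carrier A \<and> xs ! k \<otimes> S (fst (ts ! k)) = xs ! k)"
  "\<zero>\<^bsub>FM\<^esub> = map (\<lambda>k. \<zero>) [0..<length ts]"
  "xs \<oplus>\<^bsub>FM\<^esub> ys = map (\<lambda>k. xs ! k \<oplus> ys ! k) [0..<length ts]"
  "a \<odot>\<^bsub>FM\<^esub> xs = map (\<lambda>k. a \<otimes> xs ! k) [0..<length ts]"
  "xs \<in> hcomp FM m \<longleftrightarrow> length xs = length ts \<and> (\<forall>k<length ts. xs ! k \<in> hcomp A (m + snd (ts ! k)) \<and>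
        xs ! k \<otimes> S (fst (ts ! k)) = xs ! k)"
  by (simp_all add: free_module_def)

lemma free_eqI: "length xs = length ts \<Longrightarrow> length ys = length ts \<Longrightarrow> (\<And>k. k < length ts \<Longrightarrow> xs ! k = ys ! k) \<Longrightarrow> xs = ys"
  by (rule nth_equalityI) simp_all

lemma free_abelian_group: "abelian_group FM"
proof (rule abelian_groupI)
  fix xs ys assume xs: "xs \<in> carrier FM" and ys: "ys \<in> carrier FM"
  show "xs \<oplus>\<^bsub>FM\<^esub> ys \<in> carrier FM"
    using xs ys free_vertex by (simp add: free_simps mult_add_left)
  show "xs \<oplus>\<^bsub>FM\<^esub> ys = ys \<oplus>\<^bsub>FM\<^esub> xs"
    using xs ys by (intro free_eqI) (simp_all add: free_simps a_comm)
  fix zs assume zs: "zs \<in> carrier FM"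
  show "xs \<oplus>\<^bsub>FM\<^esub> ys \<oplus>\<^bsub>FM\<^esub> zs = xs \<oplus>\<^bsub>FM\<^esub> (ys \<oplus>\<^bsub>FM\<^esub> zs)"
    using xs ys zs by (intro free_eqI) (simp_all add: free_simps a_assoc)
next
  show "\<zero>\<^bsub>FM\<^esub> \<in> carrier FM" using free_vertex by (simp add: free_simps)
next
  fix xs assume xs: "xs \<in> carrier FM"
  show "\<zero>\<^bsub>FM\<^esub> \<oplus>\<^bsub>FM\<^esub> xs = xs" using xs by (intro free_eqI) (simp_all add: free_simps)
  let ?y = "map (\<lambda>k. (- 1) \<odot> xs ! k) [0..<length ts]"
  have "?y \<in> carrier FM" using xs free_vertex by (simp add: free_simps mult_scale_left)
  moreover have "?y \<oplus>\<^bsub>FM\<^esub> xs = \<zero>\<^bsub>FM\<^esub>"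
    using xs by (intro free_eqI) (simp_all add: free_simps scale_minus_one l_neg)
  ultimately show "\<exists>y\<in>carrier FM. y \<oplus>\<^bsub>FM\<^esub> xs = \<zero>\<^bsub>FM\<^esub>" by (rule bexI[rotated])
qed

lemma free_left_module: "left_module A FM"
proof (intro left_module.intro free_abelian_group left_module_axioms.intro)
  show "ring A" by (rule R.ring_axioms)
  fix a x assume a: "a \<in> carrier A" and x: "x \<in> carrier FM"
  show "a \<odot>\<^bsub>FM\<^esub> x \<in> carrier FM" using a x free_vertex by (simp add: free_simps mult_assoc)
  fix b assume b: "b \<in> carrier A"
  show "(a \<oplus> b) \<odot>\<^bsub>FM\<^esub> x = a \<odot>\<^bsub>FM\<^esub> x \<oplus>\<^bsub>FM\<^esub> b \<odot>\<^bsub>FM\<^esub> x"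
    using a b x by (intro free_eqI) (simp_all add: free_simps mult_add_left)
  show "(a \<otimes> b) \<odot>\<^bsub>FM\<^esub> x = a \<odot>\<^bsub>FM\<^esub> (b \<odot>\<^bsub>FM\<^esub> x)"
    using a b x by (intro free_eqI) (simp_all add: free_simps mult_assoc)
next
  fix a x y assume "a \<in> carrier A" "x \<in> carrier FM" "y \<in> carrier FM"
  then show "a \<odot>\<^bsub>FM\<^esub> (x \<oplus>\<^bsub>FM\<^esub> y) = a \<odot>\<^bsub>FM\<^esub> x \<oplus>\<^bsub>FM\<^esub> a \<odot>\<^bsub>FM\<^esub> y"
    by (intro free_eqI) (simp_all add: free_simps mult_add_right)
next
  fix x assume "x \<in> carrier FM"
  then show "\<one> \<odot>\<^bsub>FM\<^esub> x = x" by (intro free_eqI) (simp_all add: free_simps)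
qed

lemma nth_free_finsum:
  assumes "finite I" "\<And>i. i \<in> I \<Longrightarrow> f i \<in> carrier FM" "k < length ts"
  shows "(\<Oplus>\<^bsub>FM\<^esub>i\<in>I. f i) ! k = (\<Oplus>i\<in>I. f i ! k)"
proof -
  interpret FM: abelian_group FM by (rule free_abelian_group)
  show ?thesis
    using assms
    by (intro finsum_additive[where g = "\<lambda>xs. xs ! k"] FM.abelian_monoid_axioms abelian_monoid_axioms)
      (simp_all add: free_simps)
qed

lemma free_hcomp_carrier: "xs \<in> hcomp FM m \<Longrightarrow> xs \<in> carrier FM"
  by (simp add: free_simps) (blast intro: hcomp_closed)

text \<open>After extension by zero any larger finite set of degrees may be used, so that the
  coordinates of a list can be decomposed over a common set.\<close>

lemma hcomp_decompose_total:
  assumes "x \<in> carrier A"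
  shows "\<exists>f D. finite D \<and> (\<forall>n. f n \<in> hcomp A n) \<and> (\<forall>E. finite E \<longrightarrow> D \<subseteq> E \<longrightarrow> x = (\<Oplus>n\<in>E. f n))"
proof (rule hcomp_decompose[OF assms])
  fix D f assume D: "finite D" and f: "\<And>n. f n \<in> hcomp A n" and x: "x = (\<Oplus>n\<in>D. f n)"
  let ?f = "\<lambda>n. if n \<in> D then f n else \<zero>"
  have "x = (\<Oplus>n\<in>E. ?f n)" if "finite E" "D \<subseteq> E" for E
    unfolding x using that hcomp_closed[OF f] by (intro finsum_extend) simp_all
  then show ?thesis using D f hcomp_zero by (intro exI[of _ ?f] exI[of _ D]) simp
qed

lemma free_graded: "graded_left_module A FM"
proof (rule graded_left_moduleI[OF free_left_module])
  interpret FM: abelian_group FM by (rule free_abelian_group)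
  fix n
  show "subgroup (hcomp FM n) (add_monoid FM)"
  proof (rule FM.add.subgroupI)
    show "hcomp FM n \<subseteq> carrier FM" using free_hcomp_carrier by auto
    have "\<zero>\<^bsub>FM\<^esub> \<in> hcomp FM n" using free_vertex by (simp add: free_simps hcomp_zero)
    then show "hcomp FM n \<noteq> {}" by blast
    fix xs assume xs: "xs \<in> hcomp FM n"
    let ?y = "map (\<lambda>k. (- 1) \<odot> xs ! k) [0..<length ts]"
    have xc: "xs \<in> carrier FM" by (rule free_hcomp_carrier[OF xs])
    have yc: "?y \<in> carrier FM" using xc free_vertex by (simp add: free_simps mult_scale_left)
    have "?y \<oplus>\<^bsub>FM\<^esub> xs = \<zero>\<^bsub>FM\<^esub>"
      using xc by (intro free_eqI) (simp_all add: free_simps scale_minus_one l_neg)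
    then have "\<ominus>\<^bsub>FM\<^esub> xs = ?y" using xc yc by (intro FM.minus_equality)
    moreover have "?y \<in> hcomp FM n"
      using xs xc free_vertex by (simp add: free_simps mult_scale_left hcomp_scale)
    ultimately show "\<ominus>\<^bsub>FM\<^esub> xs \<in> hcomp FM n" by simp
    fix ys assume ys: "ys \<in> hcomp FM n"
    show "xs \<oplus>\<^bsub>FM\<^esub> ys \<in> hcomp FM n"
      using xs ys xc free_hcomp_carrier[OF ys] free_vertex
      by (simp add: free_simps hcomp_add mult_add_left)
  qed
next
  fix a x n m assume a: "a \<in> hcomp A n" and x: "x \<in> hcomp FM m"
  show "a \<odot>\<^bsub>FM\<^esub> x \<in> hcomp FM (n + m)"
    using x hcomp_closed[OF a] free_hcomp_carrier[OF x] hcomp_mult[OF a] free_vertex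
    by (simp add: free_simps mult_assoc add.assoc)
next
  interpret FM: abelian_group FM by (rule free_abelian_group)
  fix x assume x: "x \<in> carrier FM"
  have "\<forall>k\<in>{..<length ts}. \<exists>p. finite (snd p) \<and> (\<forall>n. fst p n \<in> hcomp A n) \<and>
      (\<forall>E. finite E \<longrightarrow> snd p \<subseteq> E \<longrightarrow> x ! k = (\<Oplus>n\<in>E. fst p n))"
  proof
    fix k assume "k \<in> {..<length ts}"
    then have "x ! k \<in> carrier A" using x by (simp add: free_simps)
    from hcomp_decompose_total[OF this] obtain f D where "finite D \<and> (\<forall>n. f n \<in> hcomp A n) \<and>
      (\<forall>E. finite E \<longrightarrow> D \<subseteq> E \<longrightarrow> x ! k = (\<Oplus>n\<in>E. f n))" by (elim exE)
    then show "\<exists>p. finite (snd p) \<and> (\<forall>n. fst p n \<in> hcomp A n) \<and>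
      (\<forall>E. finite E \<longrightarrow> snd p \<subseteq> E \<longrightarrow> x ! k = (\<Oplus>n\<in>E. fst p n))"
      by (intro exI[of _ "(f, D)"], unfold fst_conv snd_conv)
  qed
  from bchoice[OF this] obtain p where p: "\<forall>k\<in>{..<length ts}. finite (snd (p k)) \<and> (\<forall>n. fst (p k) n \<in> hcomp A n) \<and>
      (\<forall>E. finite E \<longrightarrow> snd (p k) \<subseteq> E \<longrightarrow> x ! k = (\<Oplus>n\<in>E. fst (p k) n))" by (elim exE)
  \<comment> \<open>Coordinate \<open>k\<close> is shifted by \<open>snd (ts ! k)\<close>, so the
    supports are translated back before they are united.\<close>
  define D where "D = (\<Union>k<length ts. (\<lambda>d. d - snd (ts ! k)) ` snd (p k))"
  have finD: "finite D" unfolding D_def using p by simp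
  \<comment> \<open>The homogeneous parts of a coordinate need not lie in the left ideal of its
    idempotent; multiplication by the idempotent puts them there and fixes their sum.\<close>
  define f where "f m = map (\<lambda>k. fst (p k) (m + snd (ts ! k)) \<otimes> S (fst (ts ! k))) [0..<length ts]" for m
  have fh: "fst (p k) n \<in> hcomp A n" if "k < length ts" for k n using p that by simp
  have fc: "fst (p k) n \<in> carrier A" if "k < length ts" for k n by (rule hcomp_closed[OF fh[OF that]])
  have f: "f m \<in> hcomp FM m" for m
    using fh fc free_vertex by (simp add: free_simps f_def hcomp_mult_vertex vertex_absorb)
  have "x = (\<Oplus>\<^bsub>FM\<^esub>m\<in>D. f m)"
  proof (rule free_eqI)
    show "length x = length ts" using x by (simp add: free_simps)
    have "(\<Oplus>\<^bsub>FM\<^esub>m\<in>D. f m) \<in> carrier FM" using free_hcomp_carrier[OF f] by (intro FM.finsum_closed) simp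
    then show "length (\<Oplus>\<^bsub>FM\<^esub>m\<in>D. f m) = length ts" by (simp add: free_simps)
    fix k assume k: "k < length ts"
    let ?g = "fst (p k)" and ?n = "snd (ts ! k)" and ?v = "fst (ts ! k)"
    have v: "S ?v \<in> carrier A" using free_vertex[OF k] by simp
    have "(\<Oplus>\<^bsub>FM\<^esub>m\<in>D. f m) ! k = (\<Oplus>m\<in>D. f m ! k)"
      using finD free_hcomp_carrier[OF f] k by (intro nth_free_finsum) simp_all
    also have "\<dots> = (\<Oplus>m\<in>D. ?g (m + ?n) \<otimes> S ?v)"
      using k fc[OF k] v by (intro finsum_cong') (simp_all add: f_def)
    also have "\<dots> = (\<Oplus>m\<in>D. ?g (m + ?n)) \<otimes> S ?v"
      using finD fc[OF k] v by (intro finsum_mult_left[symmetric]) simp_all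
    also have "(\<Oplus>m\<in>D. ?g (m + ?n)) = (\<Oplus>d\<in>(\<lambda>m. m + ?n) ` D. ?g d)"
    proof (rule finsum_bij[symmetric])
      show "bij_betw (\<lambda>m. m + ?n) D ((\<lambda>m. m + ?n) ` D)" by (intro bij_betw_imageI inj_onI) simp_all
    qed (use fc[OF k] in simp)
    also have "\<dots> = x ! k"
    proof -
      have "snd (p k) \<subseteq> (\<lambda>m. m + ?n) ` D"
      proof
        fix d assume "d \<in> snd (p k)"
        then have "d - ?n \<in> D" unfolding D_def using k by blast
        then show "d \<in> (\<lambda>m. m + ?n) ` D" by (rule rev_image_eqI) simp
      qed
      moreover have "\<forall>E. finite E \<longrightarrow> snd (p k) \<subseteq> E \<longrightarrow> x ! k = (\<Oplus>n\<in>E. ?g n)"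
        using bspec[OF p, of k] k by blast
      ultimately have "x ! k = (\<Oplus>d\<in>(\<lambda>m. m + ?n) ` D. ?g d)" using finite_imageI[OF finD] by blast
      then show ?thesis by (rule HOL.sym)
    qed
    also have "x ! k \<otimes> S ?v = x ! k" using x k by (simp add: free_simps)
    finally show "x ! k = (\<Oplus>\<^bsub>FM\<^esub>m\<in>D. f m) ! k" by simp
  qed
  then show "\<exists>D f. finite D \<and> (\<forall>n. f n \<in> hcomp FM n) \<and> x = (\<Oplus>\<^bsub>FM\<^esub>n\<in>D. f n)"
    using finD f by (intro exI[of _ D] exI[of _ f] conjI allI)
next
  interpret FM: abelian_group FM by (rule free_abelian_group)
  fix D m and f :: "int ^ 'k \<Rightarrow> 'a list"
  assume D: "finite D" and f: "\<forall>n. f n \<in> hcomp FM n" and zero: "(\<Oplus>\<^bsub>FM\<^esub>n\<in>D. f n) = \<zero>\<^bsub>FM\<^esub>" and m: "m \<in> D"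
  have fc: "f n \<in> carrier FM" for n using f free_hcomp_carrier by blast
  show "f m = \<zero>\<^bsub>FM\<^esub>"
  proof (rule free_eqI)
    show "length (f m) = length ts" using fc[of m] by (simp add: free_simps)
    show "length \<zero>\<^bsub>FM\<^esub> = length ts" by (simp add: free_simps)
    fix k assume k: "k < length ts"
    let ?n = "snd (ts ! k)"
    have fk: "f n ! k \<in> hcomp A (n + ?n)" for n using f k by (simp add: free_simps)
    have "(\<Oplus>n\<in>D. f n ! k) = \<zero>"
      using nth_free_finsum[OF D, of f k] fc k unfolding zero by (simp add: free_simps(2))
    \<comment> \<open>Back to the degrees of the algebra, where \<open>hcomp_independent\<close>
      applies.\<close>
    moreover have "(\<Oplus>d\<in>(\<lambda>n. n + ?n) ` D. f (d - ?n) ! k) = (\<Oplus>n\<in>D. f (n + ?n - ?n) ! k)"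
    proof (rule finsum_bij)
      show "bij_betw (\<lambda>n. n + ?n) D ((\<lambda>n. n + ?n) ` D)" by (intro bij_betw_imageI inj_onI) simp_all
    qed (use hcomp_closed[OF fk] in simp)
    ultimately have z: "(\<Oplus>d\<in>(\<lambda>n. n + ?n) ` D. f (d - ?n) ! k) = \<zero>" by simp
    have "f (m + ?n - ?n) ! k = \<zero>"
    proof (rule hcomp_independent[OF _ _ z])
      fix d show "f (d - ?n) ! k \<in> hcomp A d" using fk[of "d - ?n"] by simp
    qed (use D m in auto)
    then show "f m ! k = \<zero>\<^bsub>FM\<^esub> ! k" using k by (simp add: free_simps)
  qed
qed

lemma free_has_basis: "has_basis FM (mset ts)"
proof -
  interpret FM: kp_module \<Lambda> A S T W FM
    by (intro kp_module.intro graded_kp_algebra_axioms free_graded)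
  let ?e = "\<lambda>i. map (\<lambda>k. if k = i then S (fst (ts ! i)) else \<zero>) [0..<length ts]"
  have eh: "?e i \<in> hcomp FM (- snd (ts ! i))" if "i < length ts" for i
    using that free_vertex S_vertex_hcomp[OF free_vertex[OF that]]
    by (simp add: free_simps hcomp_zero S_vertex_mult)
  have ec: "?e i \<in> carrier FM" if "i < length ts" for i by (rule free_hcomp_carrier[OF eh[OF that]])
  have sum: "(\<Oplus>\<^bsub>FM\<^esub>i\<in>{..<length ts}. a i \<odot>\<^bsub>FM\<^esub> ?e i) ! k = a k \<otimes> S (fst (ts ! k))"
    if a: "\<And>i. i < length ts \<Longrightarrow> a i \<in> carrier A" and k: "k < length ts" for a k
  proof -
    have v: "S (fst (ts ! i)) \<in> carrier A" if "i < length ts" for i using free_vertex[OF that] by simp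
    have "(\<Oplus>\<^bsub>FM\<^esub>i\<in>{..<length ts}. a i \<odot>\<^bsub>FM\<^esub> ?e i) ! k = (\<Oplus>i\<in>{..<length ts}. (a i \<odot>\<^bsub>FM\<^esub> ?e i) ! k)"
      using a k ec by (intro nth_free_finsum) (simp_all add: FM.P.smult_closed)
    also have "\<dots> = (a k \<odot>\<^bsub>FM\<^esub> ?e k) ! k"
      using a k v by (intro finsum_singleI) (simp_all add: free_simps)
    also have "\<dots> = a k \<otimes> S (fst (ts ! k))" using k by (simp add: free_simps)
    finally show ?thesis .
  qed
  have sumc: "(\<Oplus>\<^bsub>FM\<^esub>i\<in>{..<length ts}. a i \<odot>\<^bsub>FM\<^esub> ?e i) \<in> carrier FM"
    if a: "\<And>i. i < length ts \<Longrightarrow> a i \<in> carrier A" for a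
    using a ec by (intro FM.P.M.finsum_closed) (simp add: FM.P.smult_closed Pi_iff)
  have "graded_basis FM {..<length ts} ((!) ts) ?e"
  proof (rule FM.graded_basisI)
    show "homogeneous_family FM {..<length ts} ((!) ts) ?e"
      unfolding homogeneous_family_def
    proof (intro conjI ballI)
      fix i assume "i \<in> {..<length ts}"
      then have i: "i < length ts" by simp
      show v: "fst (ts ! i) \<in> vertices \<Lambda>" by (rule free_vertex[OF i])
      show "?e i \<in> hcomp FM (- snd (ts ! i))" by (rule eh[OF i])
      show "S (fst (ts ! i)) \<odot>\<^bsub>FM\<^esub> ?e i = ?e i"
        using v by (intro free_eqI) (simp_all add: free_simps S_vertex_mult)
    qed simp
  next
    fix m y assume y: "y \<in> hcomp FM m"
    then have yk: "y ! k \<in> hcomp A (m + snd (ts ! k))" "y ! k \<otimes> S (fst (ts ! k)) = y ! k" if "k < length ts" for k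
      using that by (simp_all add: free_simps)
    have yc: "y ! k \<in> carrier A" if "k < length ts" for k by (rule hcomp_closed[OF yk(1)[OF that]])
    have "y = (\<Oplus>\<^bsub>FM\<^esub>i\<in>{..<length ts}. (y ! i) \<odot>\<^bsub>FM\<^esub> ?e i)"
    proof (rule free_eqI)
      show "length y = length ts" using y by (simp add: free_simps)
      show "length (\<Oplus>\<^bsub>FM\<^esub>i\<in>{..<length ts}. (y ! i) \<odot>\<^bsub>FM\<^esub> ?e i) = length ts"
        using sumc[of "(!) y"] yc by (simp add: free_simps(1))
    next
      fix k assume k: "k < length ts"
      show "y ! k = (\<Oplus>\<^bsub>FM\<^esub>i\<in>{..<length ts}. (y ! i) \<odot>\<^bsub>FM\<^esub> ?e i) ! k"
        using sum[OF yc k] yk(2)[OF k] by simp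
    qed
    then show "\<exists>a. (\<forall>i\<in>{..<length ts}. a i \<in> hcomp A (m + snd (ts ! i))) \<and>
        y = (\<Oplus>\<^bsub>FM\<^esub>i\<in>{..<length ts}. a i \<odot>\<^bsub>FM\<^esub> ?e i)"
      using yk(1) by (intro exI[of _ "(!) y"] conjI ballI) simp_all
  next
    fix a i assume a: "\<forall>i\<in>{..<length ts}. a i \<in> carrier A \<and> a i \<otimes> S (fst (ts ! i)) = a i"
      and zero: "(\<Oplus>\<^bsub>FM\<^esub>i\<in>{..<length ts}. a i \<odot>\<^bsub>FM\<^esub> ?e i) = \<zero>\<^bsub>FM\<^esub>" and i: "i \<in> {..<length ts}"
    have "(\<Oplus>\<^bsub>FM\<^esub>i\<in>{..<length ts}. a i \<odot>\<^bsub>FM\<^esub> ?e i) ! i = a i \<otimes> S (fst (ts ! i))"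
      using a i by (intro sum) simp_all
    then show "a i = \<zero>" unfolding zero using a i by (simp add: free_simps)
  qed
  from FM.has_basis_image[OF this] show ?thesis
    by (simp only: lessThan_atLeast0 mset_upt[symmetric] mset_map[symmetric] map_nth)
qed

end

end

section \<open>Modules with a basis are finitely generated projective\<close>

context kp_module
begin

text \<open>A basis is a family, whereas \<open>finitely_generated\<close> asks for a set. Two equal
  members would give one element two different families of absorbed coefficients.\<close>

lemma basis_inj:
  assumes basis: "graded_basis P I \<tau> x" shows "inj_on x I"
proof (rule inj_onI, rule ccontr)
  fix i j assume i: "i \<in> I" and j: "j \<in> I" and eq: "x i = x j" and ne: "i \<noteq> j"
  note vi = basis_vertex[OF basis i] and vj = basis_vertex[OF basis j]
  note finI = basis_finite[OF basis] and xc = basis_closed[OF basis]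
  let ?a = "\<lambda>k. if k = i then S (fst (\<tau> i)) else \<zero>" and ?b = "\<lambda>k. if k = j then S (fst (\<tau> j)) else \<zero>"
  have a: "(\<Oplus>\<^bsub>P\<^esub>k\<in>I. ?a k \<odot>\<^bsub>P\<^esub> x k) = ?a i \<odot>\<^bsub>P\<^esub> x i"
    using finI i xc vi by (intro P.M.finsum_singleI) (simp_all add: P.smult_closed)
  have b: "(\<Oplus>\<^bsub>P\<^esub>k\<in>I. ?b k \<odot>\<^bsub>P\<^esub> x k) = ?b j \<odot>\<^bsub>P\<^esub> x j"
    using finI j xc vj by (intro P.M.finsum_singleI) (simp_all add: P.smult_closed)
  have e: "(\<Oplus>\<^bsub>P\<^esub>k\<in>I. ?a k \<odot>\<^bsub>P\<^esub> x k) = (\<Oplus>\<^bsub>P\<^esub>k\<in>I. ?b k \<odot>\<^bsub>P\<^esub> x k)"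
    unfolding a b using basis_absorb[OF basis i] basis_absorb[OF basis j] eq by simp
  have "?a i = ?b i"
    using vi vj basis_vertex[OF basis]
    by (intro basis_coefficients_unique[OF basis _ _ _ _ e i]) (simp_all add: S_vertex_mult)
  then have "1 \<odot> S (fst (\<tau> i)) = \<zero>" using ne vi by simp
  then show False using scale_vertex_eq_zero[OF vi, of 1] by simp
qed

lemma has_basis_finitely_generated:
  assumes X: "has_basis P X" shows "finitely_generated A P"
proof -
  obtain I :: "nat set" and \<tau> x where b: "graded_basis P I \<tau> x" using X unfolding has_basis_def by blast
  note finI = basis_finite[OF b] and xc = basis_closed[OF b] and inj = basis_inj[OF b]
  have sub: "x ` I \<subseteq> carrier P" using xc by blast
  have "carrier P = lin_span (carrier A) P (x ` I)"
  proof
    show "lin_span (carrier A) P (x ` I) \<subseteq> carrier P"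
      unfolding lin_span_def using sub by (auto simp: Pi_iff intro!: P.M.finsum_closed P.smult_closed)
    show "carrier P \<subseteq> lin_span (carrier A) P (x ` I)"
    proof
      fix y assume "y \<in> carrier P"
      from basis_span_ex[OF b this] obtain a where
        a: "\<forall>i\<in>I. a i \<in> carrier A \<and> a i \<otimes> S (fst (\<tau> i)) = a i" "y = (\<Oplus>\<^bsub>P\<^esub>i\<in>I. a i \<odot>\<^bsub>P\<^esub> x i)"
        by (elim exE conjE)
      let ?c = "\<lambda>y. a (the_inv_into I x y)"
      have ci: "?c (x i) = a i" if "i \<in> I" for i using the_inv_into_f_f[OF inj that] by simp
      have cc: "?c \<in> x ` I \<rightarrow> carrier A" using ci a(1) by auto
      have "(\<Oplus>\<^bsub>P\<^esub>y\<in>x ` I. ?c y \<odot>\<^bsub>P\<^esub> y) = (\<Oplus>\<^bsub>P\<^esub>i\<in>I. ?c (x i) \<odot>\<^bsub>P\<^esub> x i)"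
        using inj cc sub by (intro P.M.finsum_reindex) (auto simp: Pi_iff intro!: P.smult_closed)
      also have "\<dots> = y"
        unfolding a(2) using ci a(1) xc by (intro P.M.finsum_cong') (simp_all add: Pi_iff P.smult_closed)
      finally have "y = (\<Oplus>\<^bsub>P\<^esub>y\<in>x ` I. ?c y \<odot>\<^bsub>P\<^esub> y)" by simp
      then show "y \<in> lin_span (carrier A) P (x ` I)"
        unfolding lin_span_def using finI cc
        by (intro CollectI exI[of _ "x ` I"] exI[of _ ?c] conjI finite_imageI subset_refl)
    qed
  qed
  then show ?thesis unfolding finitely_generated_def using finI sub
    by (intro exI[of _ "x ` I"] conjI finite_imageI)
qed

text \<open>Each \<open>f (x i)\<close> has a homogeneous preimage of the same degree; multiplying
  it by the vertex idempotent keeps degree and image and makes the lifts a homogeneous family, to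
  which \<open>hom_from_basis\<close> applies.\<close>

lemma has_basis_projective:
  assumes X: "has_basis P X" shows "graded_projective A P"
  unfolding graded_projective_def
proof (intro allI ballI impI, elim conjE)
  fix E N :: "('a, 'a list, int ^ 'k) graded_module" and g f
  assume g: "g \<in> graded_hom A E N" and f: "f \<in> graded_hom A P N"
    and E: "graded_left_module A E" and N: "graded_left_module A N" and surj: "g ` carrier E = carrier N"
  interpret E: kp_module \<Lambda> A S T W E by (intro kp_module.intro graded_kp_algebra_axioms E)
  interpret N: kp_module \<Lambda> A S T W N by (intro kp_module.intro graded_kp_algebra_axioms N)
  obtain I :: "nat set" and \<tau> x where b: "graded_basis P I \<tau> x" using X unfolding has_basis_def by blast
  note finI = basis_finite[OF b] and xc = basis_closed[OF b]
  have "\<forall>i\<in>I. \<exists>e. e \<in> hcomp E (- snd (\<tau> i)) \<and> S (fst (\<tau> i)) \<odot>\<^bsub>E\<^esub> e = e \<and> g e = f (x i)"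
  proof
    fix i assume i: "i \<in> I"
    note v = basis_vertex[OF b i]
    obtain w where w: "w \<in> hcomp E (- snd (\<tau> i))" "g w = f (x i)"
      by (rule graded_hom_surj_hcomp[OF E N g surj graded_hom_hcomp[OF f basis_hcomp[OF b i]]]) (rule that)
    note wc = E.P.hcomp_carrier[OF w(1)]
    let ?e = "S (fst (\<tau> i)) \<odot>\<^bsub>E\<^esub> w"
    have "?e \<in> hcomp E (0 + - snd (\<tau> i))" by (rule E.smult_hcomp[OF S_vertex_hcomp[OF v] w(1)])
    moreover have "S (fst (\<tau> i)) \<odot>\<^bsub>E\<^esub> ?e = ?e"
      using v wc by (simp add: E.P.smult_assoc[symmetric] S_vertex_mult)
    moreover have "g ?e = f (x i)"
    proof -
      have "g ?e = S (fst (\<tau> i)) \<odot>\<^bsub>N\<^esub> f (x i)" using v wc w(2) by (simp add: graded_hom_smult[OF g])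
      also have "\<dots> = f (S (fst (\<tau> i)) \<odot>\<^bsub>P\<^esub> x i)" using v xc[OF i] by (simp add: graded_hom_smult[OF f])
      finally show ?thesis by (simp only: basis_absorb[OF b i])
    qed
    ultimately show "\<exists>e. e \<in> hcomp E (- snd (\<tau> i)) \<and> S (fst (\<tau> i)) \<odot>\<^bsub>E\<^esub> e = e \<and> g e = f (x i)"
      by (intro exI[of _ ?e] conjI) simp_all
  qed
  from bchoice[OF this] obtain e where
    e: "\<forall>i\<in>I. e i \<in> hcomp E (- snd (\<tau> i)) \<and> S (fst (\<tau> i)) \<odot>\<^bsub>E\<^esub> e i = e i \<and> g (e i) = f (x i)" by (elim exE)
  have fam: "homogeneous_family E I \<tau> e"
    unfolding homogeneous_family_def using finI e basis_vertex[OF b] by simp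
  obtain h where h: "h \<in> graded_hom A P E"
    "\<forall>a. (\<forall>i\<in>I. a i \<in> carrier A) \<longrightarrow> h (\<Oplus>\<^bsub>P\<^esub>i\<in>I. a i \<odot>\<^bsub>P\<^esub> x i) = (\<Oplus>\<^bsub>E\<^esub>i\<in>I. a i \<odot>\<^bsub>E\<^esub> e i)"
    by (rule hom_from_basis[OF b E fam])
  have "g (h y) = f y" if y: "y \<in> carrier P" for y
  proof -
    from basis_span_ex[OF b y] obtain a where
      a: "\<forall>i\<in>I. a i \<in> carrier A \<and> a i \<otimes> S (fst (\<tau> i)) = a i" "y = (\<Oplus>\<^bsub>P\<^esub>i\<in>I. a i \<odot>\<^bsub>P\<^esub> x i)"
      by (elim exE conjE)
    have ac: "a i \<in> carrier A" if "i \<in> I" for i using a(1) that by simp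
    have "h y = (\<Oplus>\<^bsub>E\<^esub>i\<in>I. a i \<odot>\<^bsub>E\<^esub> e i)" unfolding a(2) using h(2) ac by simp
    then have "g (h y) = (\<Oplus>\<^bsub>N\<^esub>i\<in>I. a i \<odot>\<^bsub>N\<^esub> g (e i))"
      using E.combinations_hom[OF N g E.family_closed[OF fam] finI ac] by simp
    also have "\<dots> = (\<Oplus>\<^bsub>N\<^esub>i\<in>I. a i \<odot>\<^bsub>N\<^esub> f (x i))"
      using e ac graded_hom_closed[OF f xc]
      by (intro N.P.M.finsum_cong') (simp_all add: Pi_iff N.P.smult_closed)
    also have "\<dots> = f y" unfolding a(2) by (rule combinations_hom[OF N f xc finI ac, symmetric])
    finally show ?thesis .
  qed
  then show "\<exists>h\<in>graded_hom A P E. \<forall>x\<in>carrier P. g (h x) = f x"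
    using h(1) by (intro bexI[of _ h] ballI)
qed

lemma has_basis_fg_projective: "has_basis P X \<Longrightarrow> graded_fg_projective A P"
  unfolding graded_fg_projective_def
  by (intro conjI P.graded_left_module_axioms has_basis_finitely_generated has_basis_projective)

text \<open>The generators are replaced by their homogeneous components, and these by their parts
  under the vertex idempotents.\<close>

lemma finitely_generated_family:
  assumes "finitely_generated A P"
  shows "\<exists>(I :: ('m \<times> (int ^ 'k) \<times> 'p) set) \<tau> z. homogeneous_family P I \<tau> z \<and> carrier P \<subseteq> combinations I z"
proof -
  obtain G where G: "finite G" "G \<subseteq> carrier P" "carrier P = lin_span (carrier A) P G"
    using assms unfolding finitely_generated_def by (elim exE conjE)
  have "\<forall>s\<in>G. \<exists>p. finite (fst p) \<and> (\<forall>n. snd p n \<in> hcomp P n) \<and> s = (\<Oplus>\<^bsub>P\<^esub>n\<in>fst p. snd p n)"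
  proof
    fix s assume "s \<in> G"
    then have "s \<in> carrier P" using G(2) by blast
    then show "\<exists>p. finite (fst p) \<and> (\<forall>n. snd p n \<in> hcomp P n) \<and> s = (\<Oplus>\<^bsub>P\<^esub>n\<in>fst p. snd p n)"
    proof (rule P.hcomp_decomposition)
      fix f D assume "finite D" "\<And>n. f n \<in> hcomp P n" "s = (\<Oplus>\<^bsub>P\<^esub>n\<in>D. f n)"
      then show ?thesis by (intro exI[of _ "(D, f)"]) simp
    qed
  qed
  from bchoice[OF this] obtain p where
    p: "\<forall>s\<in>G. finite (fst (p s)) \<and> (\<forall>n. snd (p s) n \<in> hcomp P n) \<and> s = (\<Oplus>\<^bsub>P\<^esub>n\<in>fst (p s). snd (p s) n)"
    by (elim exE)
  let ?I = "SIGMA s:G. fst (p s) \<times> vertices \<Lambda>"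
  \<comment> \<open>An element of degree \<open>n\<close> has \<open>- n\<close> as second entry of
    its type.\<close>
  let ?\<tau> = "\<lambda>(s :: 'm, n, v :: 'p). (v, - n)" and ?z = "\<lambda>(s, n, v). S v \<odot>\<^bsub>P\<^esub> snd (p s) n"
  have fh: "snd (p s) n \<in> hcomp P n" if "s \<in> G" for s n using p that by simp
  have fc: "snd (p s) n \<in> carrier P" if "s \<in> G" for s n by (rule P.hcomp_carrier[OF fh[OF that]])
  have fam: "homogeneous_family P ?I ?\<tau> ?z"
    unfolding homogeneous_family_def
  proof (intro conjI ballI)
    show "finite ?I" using G(1) p by simp
    fix i assume "i \<in> ?I"
    then obtain s n v where i: "i = (s, n, v)" "s \<in> G" "v \<in> vertices \<Lambda>" by auto
    show "fst (?\<tau> i) \<in> vertices \<Lambda>" using i by simp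
    have "S v \<odot>\<^bsub>P\<^esub> snd (p s) n \<in> hcomp P (0 + n)" by (rule smult_hcomp[OF S_vertex_hcomp[OF i(3)] fh[OF i(2)]])
    then show "?z i \<in> hcomp P (- snd (?\<tau> i))" by (simp add: i(1))
    show "S (fst (?\<tau> i)) \<odot>\<^bsub>P\<^esub> ?z i = ?z i"
      using i fc[OF i(2)] by (simp add: P.smult_assoc[symmetric] S_vertex_mult)
  qed
  have s: "s \<in> combinations ?I ?z" if s: "s \<in> G" for s
  proof -
    have "snd (p s) n \<in> combinations ?I ?z" if n: "n \<in> fst (p s)" for n
    proof -
      have "(\<Oplus>\<^bsub>P\<^esub>v\<in>vertices \<Lambda>. S v \<odot>\<^bsub>P\<^esub> snd (p s) n) \<in> combinations ?I ?z"
      proof (rule combinations_finsum[OF fam])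
        fix v assume v: "v \<in> vertices \<Lambda>"
        have "?z (s, n, v) \<in> combinations ?I ?z"
          by (rule combinations_generator[OF fam]) (use s n v in simp)
        then show "S v \<odot>\<^bsub>P\<^esub> snd (p s) n \<in> combinations ?I ?z" by simp
      qed simp
      then show ?thesis using sum_vertices_smult[OF fc[OF s, of n]] by simp
    qed
    then have "(\<Oplus>\<^bsub>P\<^esub>n\<in>fst (p s). snd (p s) n) \<in> combinations ?I ?z"
      using p s by (intro combinations_finsum[OF fam]) simp_all
    then show ?thesis using p s by simp
  qed
  have "carrier P \<subseteq> combinations ?I ?z"
  proof
    fix y assume "y \<in> carrier P"
    then obtain B c where c: "y = (\<Oplus>\<^bsub>P\<^esub>x\<in>B. c x \<odot>\<^bsub>P\<^esub> x)" "finite B" "B \<subseteq> G" "c \<in> B \<rightarrow> carrier A"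
      using G(3) unfolding lin_span_def by blast
    show "y \<in> combinations ?I ?z"
      unfolding c(1)
    proof (rule combinations_finsum[OF fam c(2)])
      fix x assume x: "x \<in> B"
      show "c x \<odot>\<^bsub>P\<^esub> x \<in> combinations ?I ?z"
        using x c(3,4) s by (intro combinations_smult[OF fam]) (blast, auto)
    qed
  qed
  with fam show ?thesis by blast
qed

end

section \<open>Finitely generated projective modules have a basis\<close>

context graded_kp_algebra
begin

lemma kp_moduleI: "graded_left_module A P \<Longrightarrow> kp_module \<Lambda> A S T W P"
  by (intro kp_module.intro graded_kp_algebra_axioms)

text \<open>A generating family yields a surjection from the free module of its type. Projectivity
  splits it, which makes \<open>P\<close> a graded direct summand of a module with a basis.\<close>

lemma fg_projective_has_basis:
  fixes P :: "('a, 'a list, int ^ 'k) graded_module"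
  assumes "graded_fg_projective A P"
  shows "\<exists>X. has_basis P X"
proof -
  have P: "graded_left_module A P" and fg: "finitely_generated A P" and proj: "graded_projective A P"
    using assms unfolding graded_fg_projective_def by simp_all
  interpret P: kp_module \<Lambda> A S T W P by (rule kp_moduleI[OF P])
  from P.finitely_generated_family[OF fg] obtain I :: "('a list \<times> (int ^ 'k) \<times> 'p) set" and \<tau> z
    where fam: "homogeneous_family P I \<tau> z" and gen: "carrier P \<subseteq> P.combinations I z" by (elim exE conjE)
  note finI = P.family_finite[OF fam]
  obtain ts where ts: "mset ts = image_mset \<tau> (mset_set I)" using ex_mset by blast
  have valid: "set ts \<subseteq> vertices \<Lambda> \<times> UNIV"
  proof
    fix t assume "t \<in> set ts"
    then have "t \<in># image_mset \<tau> (mset_set I)" by (simp flip: ts)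
    then obtain i where "i \<in> I" "t = \<tau> i" using finI by auto
    then show "t \<in> vertices \<Lambda> \<times> UNIV" using P.family_vertex[OF fam] by (simp add: mem_Times_iff)
  qed
  let ?F = "free_module ts"
  note F = free_graded[OF valid]
  interpret F: kp_module \<Lambda> A S T W ?F by (rule kp_moduleI[OF F])
  have "has_basis ?F (image_mset \<tau> (mset_set I))" using free_has_basis[OF valid] by (simp only: ts)
  then obtain e where e: "graded_basis ?F I \<tau> e" using finI by (elim F.has_basis_obtain)
  obtain g where g: "g \<in> graded_hom A ?F P"
    "\<forall>a. (\<forall>i\<in>I. a i \<in> carrier A) \<longrightarrow> g (\<Oplus>\<^bsub>?F\<^esub>i\<in>I. a i \<odot>\<^bsub>?F\<^esub> e i) = (\<Oplus>\<^bsub>P\<^esub>i\<in>I. a i \<odot>\<^bsub>P\<^esub> z i)"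
    by (rule F.hom_from_basis[OF e P fam])
  have surj: "g ` carrier ?F = carrier P"
  proof
    show "g ` carrier ?F \<subseteq> carrier P" using graded_hom_closed[OF g(1)] by (rule image_subsetI)
    show "carrier P \<subseteq> g ` carrier ?F"
    proof
      fix y assume "y \<in> carrier P"
      then obtain a where a: "\<forall>i\<in>I. a i \<in> carrier A" "y = (\<Oplus>\<^bsub>P\<^esub>i\<in>I. a i \<odot>\<^bsub>P\<^esub> z i)"
        using gen unfolding P.combinations_def by blast
      have "y = g (\<Oplus>\<^bsub>?F\<^esub>i\<in>I. a i \<odot>\<^bsub>?F\<^esub> e i)" unfolding a(2) using g(2) a(1) by simp
      moreover have "(\<Oplus>\<^bsub>?F\<^esub>i\<in>I. a i \<odot>\<^bsub>?F\<^esub> e i) \<in> carrier ?F"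
        using a(1) by (intro F.basis_sum_closed[OF e]) simp
      ultimately show "y \<in> g ` carrier ?F" by (rule image_eqI)
    qed
  qed
  \<comment> \<open>The splitting is a lift of the identity; as its carrier type is that of lists,
    \<open>P\<close> may itself be the target in the lifting property.\<close>
  have idhom: "(\<lambda>x. x) \<in> graded_hom A P P" by (auto simp: graded_hom_def hom_def)
  note lift = spec[OF spec[OF proj[unfolded graded_projective_def], of ?F], of P]
  have "\<exists>h\<in>graded_hom A P ?F. \<forall>x\<in>carrier P. g (h x) = x"
    by (rule mp[OF bspec[OF bspec[OF lift g(1)] idhom]]) (intro conjI F P surj)
  then obtain h where h: "h \<in> graded_hom A P ?F" "\<And>y. y \<in> carrier P \<Longrightarrow> g (h y) = y" by blast
  show ?thesis by (rule P.summand_has_basis[OF F h(1) g(1) h(2) e fam gen])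
qed

end

section \<open>Direct sums and shifts\<close>

lemma shift_simps [simp]:
  "carrier (shift n P) = carrier P" "zero (shift n P) = zero P" "add (shift n P) = add P"
  "smult (shift n P) = smult P" "hcomp (shift n P) m = hcomp P (n + m)"
  by (simp_all add: shift_def)

lemma finsum_shift [simp]: "finsum (shift n P) = finsum P"
  by (simp add: finsum_def fun_eq_iff)

lemma direct_sum_simps [simp]:
  "carrier (direct_sum P Q) = carrier P \<times> carrier Q" "zero (direct_sum P Q) = (\<zero>\<^bsub>P\<^esub>, \<zero>\<^bsub>Q\<^esub>)"
  "hcomp (direct_sum P Q) n = hcomp P n \<times> hcomp Q n"
  "add (direct_sum P Q) u w = (fst u \<oplus>\<^bsub>P\<^esub> fst w, snd u \<oplus>\<^bsub>Q\<^esub> snd w)"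
  "smult (direct_sum P Q) a u = (a \<odot>\<^bsub>P\<^esub> fst u, a \<odot>\<^bsub>Q\<^esub> snd u)"
  by (simp_all add: direct_sum_def case_prod_unfold)

lemma shift_graded:
  assumes "graded_left_module A P" shows "graded_left_module A (shift n P)"
proof (rule graded_left_moduleI)
  interpret P: graded_left_module A P by (rule assms)
  show "left_module A (shift n P)"
    using P.left_module_axioms
    by (simp add: left_module_def left_module_axioms_def abelian_group_def abelian_group_axioms_def
        abelian_monoid_def)
  show "subgroup (hcomp (shift n P) m) (add_monoid (shift n P))" for m
    using P.hcomp_subgroup[of "n + m"] by simp
  show "a \<odot>\<^bsub>shift n P\<^esub> x \<in> hcomp (shift n P) (m + l)"
    if "a \<in> hcomp A m" "x \<in> hcomp (shift n P) l" for a x m l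
    using P.hcomp_smult[OF that(1), of x "n + l"] that(2) by (simp add: ac_simps)
  fix x assume "x \<in> carrier (shift n P)"
  then have "x \<in> carrier P" by simp
  then show "\<exists>D f. finite D \<and> (\<forall>m. f m \<in> hcomp (shift n P) m) \<and> x = (\<Oplus>\<^bsub>shift n P\<^esub>m\<in>D. f m)"
  proof (rule P.hcomp_decomposition)
    fix f D assume D: "finite D" and f: "\<And>n. f n \<in> hcomp P n" and x: "x = (\<Oplus>\<^bsub>P\<^esub>n\<in>D. f n)"
    have "bij_betw (\<lambda>m. n + m) ((\<lambda>d. d - n) ` D) D"
      by (rule bij_betwI'[where f = "\<lambda>m. n + m"]) (auto simp: image_iff)
    then have "x = (\<Oplus>\<^bsub>P\<^esub>m\<in>(\<lambda>d. d - n) ` D. f (n + m))"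
      unfolding x using P.hcomp_carrier[OF f] by (intro P.M.finsum_bij) simp_all
    then show ?thesis
      using D f by (intro exI[of _ "(\<lambda>d. d - n) ` D"] exI[of _ "\<lambda>m. f (n + m)"]) simp
  qed
next
  interpret P: graded_left_module A P by (rule assms)
  fix D f m assume D: "finite D" and f: "\<forall>m. f m \<in> hcomp (shift n P) m"
    and zero: "(\<Oplus>\<^bsub>shift n P\<^esub>m\<in>D. f m) = \<zero>\<^bsub>shift n P\<^esub>" and m: "m \<in> D"
  have fh: "f m \<in> hcomp P (n + m)" for m using f by simp
  have b: "bij_betw (\<lambda>d. d - n) ((\<lambda>m. n + m) ` D) D"
    by (rule bij_betwI'[where f = "\<lambda>d. d - n"]) (auto simp: image_iff)
  have "(\<Oplus>\<^bsub>P\<^esub>d\<in>(\<lambda>m. n + m) ` D. f (d - n)) = (\<Oplus>\<^bsub>P\<^esub>m\<in>D. f m)"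
    using P.hcomp_carrier[OF fh] by (intro P.M.finsum_bij[OF b, symmetric]) simp
  also have "\<dots> = (\<Oplus>\<^bsub>P\<^esub>d\<in>(\<lambda>m. n + m) ` D. \<zero>\<^bsub>P\<^esub>)" using zero by (simp add: P.M.finsum_zero)
  finally have e: "(\<Oplus>\<^bsub>P\<^esub>d\<in>(\<lambda>m. n + m) ` D. f (d - n)) = (\<Oplus>\<^bsub>P\<^esub>d\<in>(\<lambda>m. n + m) ` D. \<zero>\<^bsub>P\<^esub>)" .
  have "f (n + m - n) = \<zero>\<^bsub>P\<^esub>"
  proof (rule P.hcomp_unique[OF _ _ _ e])
    fix d show "f (d - n) \<in> hcomp P d" using fh[of "d - n"] by simp
  qed (use D m in simp_all)
  then show "f m = \<zero>\<^bsub>shift n P\<^esub>" by simp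
qed

lemma direct_sum_abelian_group:
  assumes "abelian_group P" "abelian_group Q" shows "abelian_group (direct_sum P Q)"
proof (rule abelian_groupI)
  interpret P: abelian_group P by (rule assms)
  interpret Q: abelian_group Q by (rule assms)
  fix x y assume x: "x \<in> carrier (direct_sum P Q)" and y: "y \<in> carrier (direct_sum P Q)"
  show "x \<oplus>\<^bsub>direct_sum P Q\<^esub> y \<in> carrier (direct_sum P Q)" using x y by auto
  show "x \<oplus>\<^bsub>direct_sum P Q\<^esub> y = y \<oplus>\<^bsub>direct_sum P Q\<^esub> x" using x y by (auto simp: P.a_comm Q.a_comm)
  fix z assume z: "z \<in> carrier (direct_sum P Q)"
  show "x \<oplus>\<^bsub>direct_sum P Q\<^esub> y \<oplus>\<^bsub>direct_sum P Q\<^esub> z = x \<oplus>\<^bsub>direct_sum P Q\<^esub> (y \<oplus>\<^bsub>direct_sum P Q\<^esub> z)"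
    using x y z by (auto simp: P.a_assoc Q.a_assoc)
next
  interpret P: abelian_group P by (rule assms)
  interpret Q: abelian_group Q by (rule assms)
  show "\<zero>\<^bsub>direct_sum P Q\<^esub> \<in> carrier (direct_sum P Q)" by simp
  fix x assume x: "x \<in> carrier (direct_sum P Q)"
  show "\<zero>\<^bsub>direct_sum P Q\<^esub> \<oplus>\<^bsub>direct_sum P Q\<^esub> x = x" using x by auto
  have "(\<ominus>\<^bsub>P\<^esub> fst x, \<ominus>\<^bsub>Q\<^esub> snd x) \<oplus>\<^bsub>direct_sum P Q\<^esub> x = \<zero>\<^bsub>direct_sum P Q\<^esub>"
    using x by (auto simp: P.l_neg Q.l_neg)
  moreover have "(\<ominus>\<^bsub>P\<^esub> fst x, \<ominus>\<^bsub>Q\<^esub> snd x) \<in> carrier (direct_sum P Q)" using x by auto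
  ultimately show "\<exists>y\<in>carrier (direct_sum P Q). y \<oplus>\<^bsub>direct_sum P Q\<^esub> x = \<zero>\<^bsub>direct_sum P Q\<^esub>"
    by (rule bexI)
qed

lemma direct_sum_finsum:
  assumes P: "abelian_group P" and Q: "abelian_group Q"
    and fin: "finite I" and f: "\<And>i. i \<in> I \<Longrightarrow> fst (f i) \<in> carrier P" "\<And>i. i \<in> I \<Longrightarrow> snd (f i) \<in> carrier Q"
  shows "(\<Oplus>\<^bsub>direct_sum P Q\<^esub>i\<in>I. f i) = (\<Oplus>\<^bsub>P\<^esub>i\<in>I. fst (f i), \<Oplus>\<^bsub>Q\<^esub>i\<in>I. snd (f i))"
proof -
  interpret P: abelian_group P by (rule P)
  interpret Q: abelian_group Q by (rule Q)
  interpret D: abelian_group "direct_sum P Q" by (rule direct_sum_abelian_group[OF P Q])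
  have fc: "f \<in> I \<rightarrow> carrier (direct_sum P Q)" using f by (simp add: Pi_iff mem_Times_iff)
  have "fst (\<Oplus>\<^bsub>direct_sum P Q\<^esub>i\<in>I. f i) = (\<Oplus>\<^bsub>P\<^esub>i\<in>I. fst (f i))"
    by (rule finsum_additive[OF D.abelian_monoid_axioms P.abelian_monoid_axioms fc fin]) auto
  moreover have "snd (\<Oplus>\<^bsub>direct_sum P Q\<^esub>i\<in>I. f i) = (\<Oplus>\<^bsub>Q\<^esub>i\<in>I. snd (f i))"
    by (rule finsum_additive[OF D.abelian_monoid_axioms Q.abelian_monoid_axioms fc fin]) auto
  ultimately show ?thesis by (simp add: prod_eq_iff)
qed

lemma direct_sum_graded:
  assumes P: "graded_left_module A P" and Q: "graded_left_module A Q"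
  shows "graded_left_module A (direct_sum P Q)"
proof (rule graded_left_moduleI)
  interpret P: graded_left_module A P by (rule P)
  interpret Q: graded_left_module A Q by (rule Q)
  interpret D: abelian_group "direct_sum P Q"
    by (rule direct_sum_abelian_group[OF P.M.abelian_group_axioms Q.M.abelian_group_axioms])
  show "left_module A (direct_sum P Q)"
    by (intro left_module.intro P.R.ring_axioms D.abelian_group_axioms left_module_axioms.intro)
      (auto simp: P.smult_closed Q.smult_closed P.smult_l_distr Q.smult_l_distr P.smult_r_distr
        Q.smult_r_distr P.smult_assoc Q.smult_assoc P.smult_one Q.smult_one)
  show "subgroup (hcomp (direct_sum P Q) n) (add_monoid (direct_sum P Q))" for n
  proof (rule D.add.subgroupI)
    show "hcomp (direct_sum P Q) n \<subseteq> carrier (direct_sum P Q)"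
      using P.hcomp_carrier Q.hcomp_carrier by auto
    have "(\<zero>\<^bsub>P\<^esub>, \<zero>\<^bsub>Q\<^esub>) \<in> hcomp (direct_sum P Q) n" by simp
    then show "hcomp (direct_sum P Q) n \<noteq> {}" by blast
    fix a assume a: "a \<in> hcomp (direct_sum P Q) n"
    have m: "\<ominus>\<^bsub>P\<^esub> fst a \<in> hcomp P n" "\<ominus>\<^bsub>Q\<^esub> snd a \<in> hcomp Q n"
      using subgroup.m_inv_closed[OF P.hcomp_subgroup, of "fst a" n]
        subgroup.m_inv_closed[OF Q.hcomp_subgroup, of "snd a" n] a by (auto simp: a_inv_def)
    have ac: "fst a \<in> carrier P" "snd a \<in> carrier Q" using a P.hcomp_carrier Q.hcomp_carrier by auto
    have "\<ominus>\<^bsub>direct_sum P Q\<^esub> a = (\<ominus>\<^bsub>P\<^esub> fst a, \<ominus>\<^bsub>Q\<^esub> snd a)"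
      using ac by (intro D.minus_equality) (simp_all add: P.M.l_neg Q.M.l_neg mem_Times_iff)
    then show "\<ominus>\<^bsub>direct_sum P Q\<^esub> a \<in> hcomp (direct_sum P Q) n" using m by simp
    fix b assume b: "b \<in> hcomp (direct_sum P Q) n"
    show "a \<oplus>\<^bsub>direct_sum P Q\<^esub> b \<in> hcomp (direct_sum P Q) n"
      using a b by (auto intro: P.hcomp_add_closed Q.hcomp_add_closed)
  qed
  show "a \<odot>\<^bsub>direct_sum P Q\<^esub> x \<in> hcomp (direct_sum P Q) (n + m)"
    if "a \<in> hcomp A n" "x \<in> hcomp (direct_sum P Q) m" for a x n m
    using that by (auto intro: P.hcomp_smult Q.hcomp_smult)
next
  interpret P: graded_left_module A P by (rule P)
  interpret Q: graded_left_module A Q by (rule Q)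
  fix x assume "x \<in> carrier (direct_sum P Q)"
  then have x: "fst x \<in> carrier P" "snd x \<in> carrier Q" by auto
  show "\<exists>D f. finite D \<and> (\<forall>n. f n \<in> hcomp (direct_sum P Q) n) \<and> x = (\<Oplus>\<^bsub>direct_sum P Q\<^esub>n\<in>D. f n)"
  proof (rule P.hcomp_decomposition[OF x(1)], rule Q.hcomp_decomposition[OF x(2)])
    fix D f E g assume D: "finite D" and f: "\<And>n. f n \<in> hcomp P n" and fx: "fst x = (\<Oplus>\<^bsub>P\<^esub>n\<in>D. f n)"
      and E: "finite E" and g: "\<And>n. g n \<in> hcomp Q n" and gx: "snd x = (\<Oplus>\<^bsub>Q\<^esub>n\<in>E. g n)"
    let ?h = "\<lambda>n. (if n \<in> D then f n else \<zero>\<^bsub>P\<^esub>, if n \<in> E then g n else \<zero>\<^bsub>Q\<^esub>)"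
    have fc: "f n \<in> carrier P" and gc: "g n \<in> carrier Q" for n
      by (rule P.hcomp_carrier[OF f], rule Q.hcomp_carrier[OF g])
    have "(\<Oplus>\<^bsub>direct_sum P Q\<^esub>n\<in>D \<union> E. ?h n) =
        (\<Oplus>\<^bsub>P\<^esub>n\<in>D \<union> E. fst (?h n), \<Oplus>\<^bsub>Q\<^esub>n\<in>D \<union> E. snd (?h n))"
      using D E fc gc by (intro direct_sum_finsum P.M.abelian_group_axioms Q.M.abelian_group_axioms) simp_all
    also have "\<dots> = (fst x, snd x)"
      unfolding fx gx fst_conv snd_conv
      using D E fc gc P.M.finsum_extend[of "D \<union> E" D f] Q.M.finsum_extend[of "D \<union> E" E g] by simp
    finally have "x = (\<Oplus>\<^bsub>direct_sum P Q\<^esub>n\<in>D \<union> E. ?h n)" by simp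
    moreover have "\<forall>n. ?h n \<in> hcomp (direct_sum P Q) n" using f g by simp
    ultimately show ?thesis
      using D E by (intro exI[of _ "D \<union> E"] exI[of _ ?h] conjI finite_UnI)
  qed
next
  interpret P: graded_left_module A P by (rule P)
  interpret Q: graded_left_module A Q by (rule Q)
  fix D m f assume D: "finite D" and f: "\<forall>n. f n \<in> hcomp (direct_sum P Q) n"
    and zero: "(\<Oplus>\<^bsub>direct_sum P Q\<^esub>n\<in>D. f n) = \<zero>\<^bsub>direct_sum P Q\<^esub>" and m: "m \<in> D"
  have fh: "fst (f n) \<in> hcomp P n" "snd (f n) \<in> hcomp Q n" for n using f by (simp_all add: mem_Times_iff)
  have "(\<Oplus>\<^bsub>direct_sum P Q\<^esub>n\<in>D. f n) = (\<Oplus>\<^bsub>P\<^esub>n\<in>D. fst (f n), \<Oplus>\<^bsub>Q\<^esub>n\<in>D. snd (f n))"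
    using D P.hcomp_carrier[OF fh(1)] Q.hcomp_carrier[OF fh(2)]
    by (intro direct_sum_finsum P.M.abelian_group_axioms Q.M.abelian_group_axioms)
  then have "(\<Oplus>\<^bsub>P\<^esub>n\<in>D. fst (f n)) = \<zero>\<^bsub>P\<^esub>" "(\<Oplus>\<^bsub>Q\<^esub>n\<in>D. snd (f n)) = \<zero>\<^bsub>Q\<^esub>"
    unfolding zero by simp_all
  then have z: "(\<Oplus>\<^bsub>P\<^esub>n\<in>D. fst (f n)) = (\<Oplus>\<^bsub>P\<^esub>n\<in>D. \<zero>\<^bsub>P\<^esub>)" "(\<Oplus>\<^bsub>Q\<^esub>n\<in>D. snd (f n)) = (\<Oplus>\<^bsub>Q\<^esub>n\<in>D. \<zero>\<^bsub>Q\<^esub>)"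
    by (simp_all add: P.M.finsum_zero Q.M.finsum_zero)
  have "fst (f m) = \<zero>\<^bsub>P\<^esub>" by (rule P.hcomp_unique[OF D _ _ z(1) m]) (simp_all add: fh)
  moreover have "snd (f m) = \<zero>\<^bsub>Q\<^esub>" by (rule Q.hcomp_unique[OF D _ _ z(2) m]) (simp_all add: fh)
  ultimately show "f m = \<zero>\<^bsub>direct_sum P Q\<^esub>" by (simp add: prod_eq_iff)
qed

context graded_kp_algebra
begin

text \<open>Shifting by \<open>n\<close> lowers the degree of every element by \<open>n\<close> and
  so raises the second entry of its type, in accordance with the action on the talented
  monoid.\<close>

lemma has_basis_shift:
  assumes P: "graded_left_module A P" and X: "has_basis P X"
  shows "has_basis (shift n P) (image_mset (\<lambda>(v, m). (v, m + n)) X)"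
proof -
  interpret P: kp_module \<Lambda> A S T W P by (rule kp_moduleI[OF P])
  interpret N: kp_module \<Lambda> A S T W "shift n P" by (rule kp_moduleI[OF shift_graded[OF P]])
  obtain I :: "nat set" and \<tau> x where I: "graded_basis P I \<tau> x" "X = image_mset \<tau> (mset_set I)"
    using X unfolding has_basis_def by blast
  let ?\<tau> = "\<lambda>i. (fst (\<tau> i), snd (\<tau> i) + n)"
  have "graded_basis (shift n P) I ?\<tau> x"
  proof (rule N.graded_basisI)
    show "homogeneous_family (shift n P) I ?\<tau> x"
      using P.basis_family[OF I(1)] unfolding homogeneous_family_def by simp
    fix m y assume "y \<in> hcomp (shift n P) m"
    then have y: "y \<in> hcomp P (n + m)" by simp
    from P.basis_span_hcomp_ex[OF I(1) y] obtain a where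
      a: "\<forall>i\<in>I. a i \<in> hcomp A (n + m + snd (\<tau> i)) \<and> a i \<otimes> S (fst (\<tau> i)) = a i"
      "y = (\<Oplus>\<^bsub>P\<^esub>i\<in>I. a i \<odot>\<^bsub>P\<^esub> x i)" by (elim exE conjE)
    have "\<forall>i\<in>I. a i \<in> hcomp A (m + snd (?\<tau> i))" using a(1) by (simp add: ac_simps)
    then show "\<exists>a. (\<forall>i\<in>I. a i \<in> hcomp A (m + snd (?\<tau> i))) \<and> y = (\<Oplus>\<^bsub>shift n P\<^esub>i\<in>I. a i \<odot>\<^bsub>shift n P\<^esub> x i)"
      unfolding finsum_shift shift_simps using a(2) by (intro exI[of _ a] conjI)
  next
    fix a i assume "\<forall>i\<in>I. a i \<in> carrier A \<and> a i \<otimes> S (fst (?\<tau> i)) = a i"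
      "(\<Oplus>\<^bsub>shift n P\<^esub>i\<in>I. a i \<odot>\<^bsub>shift n P\<^esub> x i) = \<zero>\<^bsub>shift n P\<^esub>" "i \<in> I"
    then show "a i = \<zero>" by (intro P.basis_independent[OF I(1), of a i]) simp_all
  qed
  from N.has_basis_image[OF this] show ?thesis
    unfolding I(2) by (simp add: multiset.map_comp comp_def case_prod_unfold)
qed

lemma has_basis_direct_sum:
  fixes P :: "('a, 'm, int ^ 'k) graded_module" and Q :: "('a, 'n, int ^ 'k) graded_module"
  assumes P: "graded_left_module A P" and Q: "graded_left_module A Q"
    and X: "has_basis P X" and Y: "has_basis Q Y"
  shows "has_basis (direct_sum P Q) (X + Y)"
proof -
  interpret P: kp_module \<Lambda> A S T W P by (rule kp_moduleI[OF P])
  interpret Q: kp_module \<Lambda> A S T W Q by (rule kp_moduleI[OF Q])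
  let ?D = "direct_sum P Q"
  interpret D: kp_module \<Lambda> A S T W ?D by (rule kp_moduleI[OF direct_sum_graded[OF P Q]])
  obtain I :: "nat set" and \<tau> x where I: "graded_basis P I \<tau> x" "X = image_mset \<tau> (mset_set I)"
    using X unfolding has_basis_def by blast
  obtain J :: "nat set" and \<sigma> y where J: "graded_basis Q J \<sigma> y" "Y = image_mset \<sigma> (mset_set J)"
    using Y unfolding has_basis_def by blast
  note finI = P.basis_finite[OF I(1)] and finJ = Q.basis_finite[OF J(1)]
  note xc = P.basis_closed[OF I(1)] and yc = Q.basis_closed[OF J(1)]
  let ?K = "I <+> J" and ?\<rho> = "case_sum \<tau> \<sigma>" and ?z = "case_sum (\<lambda>i. (x i, \<zero>\<^bsub>Q\<^esub>)) (\<lambda>j. (\<zero>\<^bsub>P\<^esub>, y j))"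
  have sum: "(\<Oplus>\<^bsub>?D\<^esub>k\<in>?K. a k \<odot>\<^bsub>?D\<^esub> ?z k) =
      (\<Oplus>\<^bsub>P\<^esub>i\<in>I. a (Inl i) \<odot>\<^bsub>P\<^esub> x i, \<Oplus>\<^bsub>Q\<^esub>j\<in>J. a (Inr j) \<odot>\<^bsub>Q\<^esub> y j)"
    if a: "\<And>k. k \<in> ?K \<Longrightarrow> a k \<in> carrier A" for a
  proof -
    have c: "fst (a k \<odot>\<^bsub>?D\<^esub> ?z k) \<in> carrier P" "snd (a k \<odot>\<^bsub>?D\<^esub> ?z k) \<in> carrier Q" if "k \<in> ?K" for k
      using that a[OF that] xc yc by (auto simp: P.P.smult_closed Q.P.smult_closed)
    have "(\<Oplus>\<^bsub>?D\<^esub>k\<in>?K. a k \<odot>\<^bsub>?D\<^esub> ?z k) =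
        (\<Oplus>\<^bsub>P\<^esub>k\<in>?K. fst (a k \<odot>\<^bsub>?D\<^esub> ?z k), \<Oplus>\<^bsub>Q\<^esub>k\<in>?K. snd (a k \<odot>\<^bsub>?D\<^esub> ?z k))"
      using finI finJ c
      by (intro direct_sum_finsum P.P.M.abelian_group_axioms Q.P.M.abelian_group_axioms) simp_all
    moreover have "(\<Oplus>\<^bsub>P\<^esub>k\<in>?K. fst (a k \<odot>\<^bsub>?D\<^esub> ?z k)) = (\<Oplus>\<^bsub>P\<^esub>k\<in>Inl ` I. fst (a k \<odot>\<^bsub>?D\<^esub> ?z k))"
    proof (rule P.P.M.add.finprod_mono_neutral_cong_right)
      fix k assume "k \<in> ?K - Inl ` I"
      then obtain j where "j \<in> J" "k = Inr j" by auto
      then show "fst (a k \<odot>\<^bsub>?D\<^esub> ?z k) = \<zero>\<^bsub>P\<^esub>" using a[OF InrI[of j J]] by simp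
    qed (use finI finJ c in auto)
    moreover have "\<dots> = (\<Oplus>\<^bsub>P\<^esub>i\<in>I. fst (a (Inl i) \<odot>\<^bsub>?D\<^esub> ?z (Inl i)))"
      using c by (intro P.P.M.finsum_reindex) auto
    moreover have "(\<Oplus>\<^bsub>Q\<^esub>k\<in>?K. snd (a k \<odot>\<^bsub>?D\<^esub> ?z k)) = (\<Oplus>\<^bsub>Q\<^esub>k\<in>Inr ` J. snd (a k \<odot>\<^bsub>?D\<^esub> ?z k))"
    proof (rule Q.P.M.add.finprod_mono_neutral_cong_right)
      fix k assume "k \<in> ?K - Inr ` J"
      then obtain i where "i \<in> I" "k = Inl i" by auto
      then show "snd (a k \<odot>\<^bsub>?D\<^esub> ?z k) = \<zero>\<^bsub>Q\<^esub>" using a[OF InlI[of i I]] by simp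
    qed (use finI finJ c in auto)
    moreover have "\<dots> = (\<Oplus>\<^bsub>Q\<^esub>j\<in>J. snd (a (Inr j) \<odot>\<^bsub>?D\<^esub> ?z (Inr j)))"
      using c by (intro Q.P.M.finsum_reindex) auto
    ultimately show ?thesis by simp
  qed
  have "graded_basis ?D ?K ?\<rho> ?z"
  proof (rule D.graded_basisI)
    show "homogeneous_family ?D ?K ?\<rho> ?z"
      unfolding homogeneous_family_def
    proof (intro conjI ballI)
      show "finite ?K" using finI finJ by simp
      fix k assume "k \<in> ?K"
      then consider i where "i \<in> I" "k = Inl i" | j where "j \<in> J" "k = Inr j" by auto
      then have "fst (?\<rho> k) \<in> vertices \<Lambda> \<and> ?z k \<in> hcomp ?D (- snd (?\<rho> k)) \<and> S (fst (?\<rho> k)) \<odot>\<^bsub>?D\<^esub> ?z k = ?z k"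
      proof cases
        case 1
        then show ?thesis
          using P.basis_vertex[OF I(1) 1(1)] P.basis_hcomp[OF I(1) 1(1)] P.basis_absorb[OF I(1) 1(1)] by simp
      next
        case 2
        then show ?thesis
          using Q.basis_vertex[OF J(1) 2(1)] Q.basis_hcomp[OF J(1) 2(1)] Q.basis_absorb[OF J(1) 2(1)] by simp
      qed
      then show "fst (?\<rho> k) \<in> vertices \<Lambda>" "?z k \<in> hcomp ?D (- snd (?\<rho> k))" "S (fst (?\<rho> k)) \<odot>\<^bsub>?D\<^esub> ?z k = ?z k"
        by blast+
    qed
  next
    fix m w assume "w \<in> hcomp ?D m"
    then have w: "fst w \<in> hcomp P m" "snd w \<in> hcomp Q m" by auto
    from P.basis_span_hcomp_ex[OF I(1) w(1)] obtain a where
      a: "\<forall>i\<in>I. a i \<in> hcomp A (m + snd (\<tau> i)) \<and> a i \<otimes> S (fst (\<tau> i)) = a i"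
      "fst w = (\<Oplus>\<^bsub>P\<^esub>i\<in>I. a i \<odot>\<^bsub>P\<^esub> x i)" by (elim exE conjE)
    from Q.basis_span_hcomp_ex[OF J(1) w(2)] obtain b where
      b: "\<forall>j\<in>J. b j \<in> hcomp A (m + snd (\<sigma> j)) \<and> b j \<otimes> S (fst (\<sigma> j)) = b j"
      "snd w = (\<Oplus>\<^bsub>Q\<^esub>j\<in>J. b j \<odot>\<^bsub>Q\<^esub> y j)" by (elim exE conjE)
    have h: "case_sum a b k \<in> hcomp A (m + snd (?\<rho> k))" if "k \<in> ?K" for k
      using that a(1) b(1) by auto
    have "w = (\<Oplus>\<^bsub>?D\<^esub>k\<in>?K. case_sum a b k \<odot>\<^bsub>?D\<^esub> ?z k)"
      using sum[of "case_sum a b"] hcomp_closed[OF h] a(2) b(2) by (simp add: prod_eq_iff)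
    then show "\<exists>a. (\<forall>k\<in>?K. a k \<in> hcomp A (m + snd (?\<rho> k))) \<and> w = (\<Oplus>\<^bsub>?D\<^esub>k\<in>?K. a k \<odot>\<^bsub>?D\<^esub> ?z k)"
      using h by (intro exI[of _ "case_sum a b"] conjI ballI)
  next
    fix a k assume a: "\<forall>k\<in>?K. a k \<in> carrier A \<and> a k \<otimes> S (fst (?\<rho> k)) = a k"
      and zero: "(\<Oplus>\<^bsub>?D\<^esub>k\<in>?K. a k \<odot>\<^bsub>?D\<^esub> ?z k) = \<zero>\<^bsub>?D\<^esub>" and k: "k \<in> ?K"
    have aI: "a (Inl i) \<in> carrier A" "a (Inl i) \<otimes> S (fst (\<tau> i)) = a (Inl i)" if "i \<in> I" for i
      using bspec[OF a InlI[OF that]] by simp_all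
    have aJ: "a (Inr j) \<in> carrier A" "a (Inr j) \<otimes> S (fst (\<sigma> j)) = a (Inr j)" if "j \<in> J" for j
      using bspec[OF a InrI[OF that]] by simp_all
    have z: "(\<Oplus>\<^bsub>P\<^esub>i\<in>I. a (Inl i) \<odot>\<^bsub>P\<^esub> x i) = \<zero>\<^bsub>P\<^esub>" "(\<Oplus>\<^bsub>Q\<^esub>j\<in>J. a (Inr j) \<odot>\<^bsub>Q\<^esub> y j) = \<zero>\<^bsub>Q\<^esub>"
      using sum[of a] a zero by simp_all
    from k consider i where "i \<in> I" "k = Inl i" | j where "j \<in> J" "k = Inr j" by auto
    then show "a k = \<zero>"
    proof cases
      case 1
      show ?thesis unfolding 1(2)
        using P.basis_independent[OF I(1), of "\<lambda>i. a (Inl i)" i] aI z(1) 1(1) by simp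
    next
      case 2
      show ?thesis unfolding 2(2)
        using Q.basis_independent[OF J(1), of "\<lambda>j. a (Inr j)" j] aJ z(2) 2(1) by simp
    qed
  qed
  from D.has_basis_image[OF this] have "has_basis ?D (image_mset ?\<rho> (mset_set ?K))" .
  moreover have "image_mset ?\<rho> (mset_set ?K) = X + Y"
    unfolding I(2) J(2) using finI finJ by (simp add: image_mset_mset_set_eq_sum sum.Plus)
  ultimately show ?thesis by simp
qed

end

section \<open>The talented monoid and the graded projective modules\<close>

text \<open>The properties that the talented monoid and the monoid of projective modules share, and
  from which the passage to and from the completion is derived.\<close>

locale cancellative_act_monoid = comm_monoid M for M :: "('z, 'a) act_monoid" (structure) +
  assumes right_cancel: "\<lbrakk>x \<in> carrier M; y \<in> carrier M; z \<in> carrier M; x \<otimes> z = y \<otimes> z\<rbrakk> \<Longrightarrow> x = y"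
    and act_closed [simp]: "x \<in> carrier M \<Longrightarrow> act M n x \<in> carrier M"
    and act_mult: "\<lbrakk>x \<in> carrier M; y \<in> carrier M\<rbrakk> \<Longrightarrow> act M n (x \<otimes> y) = act M n x \<otimes> act M n y"
begin

text \<open>By cancellation the unit is the only idempotent, so multiplicative maps into such a
  monoid preserve the unit.\<close>

lemma idempotent_eq_one: "x \<in> carrier M \<Longrightarrow> x \<otimes> x = x \<Longrightarrow> x = \<one>"
  using right_cancel[of x "\<one>" x] by simp

lemma act_one [simp]: "act M n \<one> = \<one>"
  using idempotent_eq_one[of "act M n \<one>"] act_mult[of "\<one>" "\<one>" n] by simp

end

definition shift_type :: "int ^ 'k \<Rightarrow> ('p \<times> (int ^ 'k)) multiset \<Rightarrow> ('p \<times> (int ^ 'k)) multiset" where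
  "shift_type q X = image_mset (\<lambda>(v, n). (v, n + q)) X"

definition valid_types :: "('p, 'k::finite) kgraph \<Rightarrow> ('p \<times> (int ^ 'k)) multiset set" where
  "valid_types \<Lambda> = {X. set_mset X \<subseteq> vertices \<Lambda> \<times> UNIV}"

definition talented_class :: "('p, 'k::finite) kgraph \<Rightarrow> ('p \<times> (int ^ 'k)) multiset \<Rightarrow> ('p \<times> (int ^ 'k)) multiset set" where
  "talented_class \<Lambda> X = talented_rel \<Lambda> `` {X}"

lemma valid_types_add [simp]: "X \<in> valid_types \<Lambda> \<Longrightarrow> Y \<in> valid_types \<Lambda> \<Longrightarrow> X + Y \<in> valid_types \<Lambda>"
  and valid_types_empty [simp]: "{#} \<in> valid_types \<Lambda>"
  and valid_types_shift [simp]: "X \<in> valid_types \<Lambda> \<Longrightarrow> shift_type q X \<in> valid_types \<Lambda>"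
  by (auto simp: valid_types_def shift_type_def)

lemma shift_type_add: "shift_type q (X + Y) = shift_type q X + shift_type q Y"
  by (simp add: shift_type_def)

lemma equiv_talented_rel: "equiv (valid_types \<Lambda>) (talented_rel \<Lambda>)"
  unfolding valid_types_def talented_rel_def
  by (rule equivI) (auto simp: refl_on_def sym_def trans_def intro: talented_eq.refl talented_eq.sym talented_eq.trans)

lemma talented_class_eq_iff:
  assumes "X \<in> valid_types \<Lambda>" "Y \<in> valid_types \<Lambda>"
  shows "talented_class \<Lambda> X = talented_class \<Lambda> Y \<longleftrightarrow> talented_eq \<Lambda> X Y"
  unfolding talented_class_def
  using eq_equiv_class_iff[OF equiv_talented_rel assms] assms by (simp add: talented_rel_def valid_types_def)

lemma talented_carrier: "carrier (talented_monoid \<Lambda>) = talented_class \<Lambda> ` valid_types \<Lambda>"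
  unfolding talented_monoid_def talented_class_def valid_types_def quotient_def by auto

lemma talented_one: "\<one>\<^bsub>talented_monoid \<Lambda>\<^esub> = talented_class \<Lambda> {#}"
  by (simp add: talented_monoid_def talented_class_def)

lemma talented_mult:
  assumes "X \<in> valid_types \<Lambda>" "Y \<in> valid_types \<Lambda>"
  shows "talented_class \<Lambda> X \<otimes>\<^bsub>talented_monoid \<Lambda>\<^esub> talented_class \<Lambda> Y = talented_class \<Lambda> (X + Y)"
proof -
  have "(\<lambda>x y. talented_rel \<Lambda> `` {x + y}) respects2 talented_rel \<Lambda>"
  proof (rule congruent2I', rule equiv_class_eq[OF equiv_talented_rel])
    fix x x' y y' assume "(x, x') \<in> talented_rel \<Lambda>" "(y, y') \<in> talented_rel \<Lambda>"
    then show "(x + y, x' + y') \<in> talented_rel \<Lambda>"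
      unfolding talented_rel_def using talented_eq_add[of \<Lambda> x x' y y'] by auto
  qed
  from UN_equiv_class2[OF equiv_talented_rel equiv_talented_rel this assms]
  show ?thesis by (simp add: talented_monoid_def talented_class_def)
qed

section \<open>The talented monoid on representatives\<close>

context row_finite_k_graph
begin

lemma talented_act:
  assumes "X \<in> valid_types \<Lambda>"
  shows "act (talented_monoid \<Lambda>) q (talented_class \<Lambda> X) = talented_class \<Lambda> (shift_type q X)"
proof -
  have "(\<lambda>x. talented_rel \<Lambda> `` {image_mset (\<lambda>(v, n). (v, n + q)) x}) respects talented_rel \<Lambda>"
  proof (rule congruentI, rule equiv_class_eq[OF equiv_talented_rel])
    fix x y assume "(x, y) \<in> talented_rel \<Lambda>"
    then show "(image_mset (\<lambda>(v, n). (v, n + q)) x, image_mset (\<lambda>(v, n). (v, n + q)) y) \<in> talented_rel \<Lambda>"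
      unfolding talented_rel_def using talented_eq_act[of x y q] by auto
  qed
  from UN_equiv_class[OF equiv_talented_rel this assms]
  show ?thesis by (simp add: talented_monoid_def talented_class_def shift_type_def)
qed

lemma talented_class_cases:
  assumes "K \<in> carrier (talented_monoid \<Lambda>)"
  obtains X where "X \<in> valid_types \<Lambda>" "K = talented_class \<Lambda> X"
  using assms unfolding talented_carrier by blast

lemma talented_class_closed [simp]: "X \<in> valid_types \<Lambda> \<Longrightarrow> talented_class \<Lambda> X \<in> carrier (talented_monoid \<Lambda>)"
  unfolding talented_carrier by blast

lemma talented_cancellative: "cancellative_act_monoid (talented_monoid \<Lambda>)"
proof (intro cancellative_act_monoid.intro comm_monoidI cancellative_act_monoid_axioms.intro)
  let ?T = "talented_monoid \<Lambda>"
  show "\<one>\<^bsub>?T\<^esub> \<in> carrier ?T" by (simp add: talented_one)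
  fix x assume "x \<in> carrier ?T"
  then obtain X where X: "X \<in> valid_types \<Lambda>" "x = talented_class \<Lambda> X" by (rule talented_class_cases)
  show "\<one>\<^bsub>?T\<^esub> \<otimes>\<^bsub>?T\<^esub> x = x" using X by (simp add: talented_one talented_mult)
  show "act ?T n x \<in> carrier ?T" for n using X by (simp add: talented_act)
  fix y assume "y \<in> carrier ?T"
  then obtain Y where Y: "Y \<in> valid_types \<Lambda>" "y = talented_class \<Lambda> Y" by (rule talented_class_cases)
  show "x \<otimes>\<^bsub>?T\<^esub> y \<in> carrier ?T" using X Y by (simp add: talented_mult)
  show "x \<otimes>\<^bsub>?T\<^esub> y = y \<otimes>\<^bsub>?T\<^esub> x" using X Y by (simp add: talented_mult add.commute)
  show "act ?T n (x \<otimes>\<^bsub>?T\<^esub> y) = act ?T n x \<otimes>\<^bsub>?T\<^esub> act ?T n y" for n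
    using X Y by (simp add: talented_mult talented_act shift_type_add)
  fix z assume "z \<in> carrier ?T"
  then obtain Z where Z: "Z \<in> valid_types \<Lambda>" "z = talented_class \<Lambda> Z" by (rule talented_class_cases)
  show "x \<otimes>\<^bsub>?T\<^esub> y \<otimes>\<^bsub>?T\<^esub> z = x \<otimes>\<^bsub>?T\<^esub> (y \<otimes>\<^bsub>?T\<^esub> z)"
    using X Y Z by (simp add: talented_mult add.assoc)
  assume "x \<otimes>\<^bsub>?T\<^esub> z = y \<otimes>\<^bsub>?T\<^esub> z"
  then have "talented_eq \<Lambda> (X + Z) (Y + Z)" using X Y Z by (simp add: talented_mult talented_class_eq_iff)
  then have "talented_eq \<Lambda> X Y" using X(1) Y(1) by (intro talented_eq_cancel[of X Y Z]) (simp_all add: valid_types_def)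
  then show "x = y" using X Y by (simp add: talented_class_eq_iff)
qed

end

section \<open>Isomorphism classes of projective modules\<close>

context graded_kp_algebra
begin

text \<open>Names an isomorphism class by a type, so that the operations of \<open>V_gr\<close>,
  which are unions over classes, can be computed on multisets.\<close>

definition modules_with_basis :: "('p \<times> (int ^ 'k)) multiset \<Rightarrow> ('a, 'a list, int ^ 'k) graded_module set" where
  "modules_with_basis X = {Q. graded_left_module A Q \<and> has_basis Q X}"

lemma has_basis_valid: "graded_left_module A P \<Longrightarrow> has_basis P X \<Longrightarrow> X \<in> valid_types \<Lambda>"
  unfolding valid_types_def using kp_module.has_basis_vertices[OF kp_moduleI] by blast

text \<open>A basis transports along a graded isomorphism, and modules with bases of one type are
  isomorphic.\<close>

lemma graded_class_eq:
  assumes P: "graded_left_module A P" and X: "has_basis P X"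
  shows "graded_class A P = modules_with_basis X"
proof (intro equalityI subsetI)
  fix Q assume "Q \<in> graded_class A P"
  then have Q: "graded_left_module A Q" "graded_isomorphic A P Q"
    by (simp_all add: graded_class_def graded_fg_projective_def)
  then show "Q \<in> modules_with_basis X"
    unfolding modules_with_basis_def using kp_module.has_basis_isomorphic[OF kp_moduleI[OF P] X Q] by simp
next
  fix Q assume "Q \<in> modules_with_basis X"
  then have Q: "graded_left_module A Q" "has_basis Q X" by (simp_all add: modules_with_basis_def)
  show "Q \<in> graded_class A P"
    unfolding graded_class_def
    using kp_module.has_basis_fg_projective[OF kp_moduleI[OF Q(1)] Q(2)]
      kp_module.isomorphic_if_has_basis[OF kp_moduleI[OF P] X Q] by simp
qed

text \<open>Free modules realise every valid type. Nonemptiness also keeps unions over a class from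
  collapsing to the empty set.\<close>

lemma modules_with_basis_nonempty:
  assumes "X \<in> valid_types \<Lambda>" shows "\<exists>P. P \<in> modules_with_basis X"
proof -
  obtain ts where ts: "mset ts = X" using ex_mset by blast
  have v: "set ts \<subseteq> vertices \<Lambda> \<times> UNIV" using assms ts by (auto simp: valid_types_def)
  have "free_module ts \<in> modules_with_basis X"
    unfolding modules_with_basis_def using free_graded[OF v] free_has_basis[OF v] ts by simp
  then show ?thesis by (rule exI)
qed

text \<open>From left to right a single module with both types suffices, by
  \<open>has_basis_unique\<close>; the converse is \<open>has_basis_talented\<close> in both
  directions.\<close>

lemma modules_with_basis_eq_iff:
  assumes X: "X \<in> valid_types \<Lambda>" and Y: "Y \<in> valid_types \<Lambda>"
  shows "modules_with_basis X = modules_with_basis Y \<longleftrightarrow> talented_eq \<Lambda> X Y"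
proof
  assume e: "modules_with_basis X = modules_with_basis Y"
  obtain P where "P \<in> modules_with_basis X" using modules_with_basis_nonempty[OF X] by blast
  then have "graded_left_module A P" "has_basis P X" "has_basis P Y"
    using e unfolding modules_with_basis_def by blast+
  then show "talented_eq \<Lambda> X Y" by (intro kp_module.has_basis_unique[OF kp_moduleI])
next
  assume e: "talented_eq \<Lambda> X Y"
  have "has_basis P X \<longleftrightarrow> has_basis P Y" if P: "graded_left_module A P" for P :: "('a, 'a list, int ^ 'k) graded_module"
  proof
    show "has_basis P X \<Longrightarrow> has_basis P Y"
      using Y by (intro kp_module.has_basis_talented[OF kp_moduleI[OF P] _ e]) (simp_all add: valid_types_def)
    show "has_basis P Y \<Longrightarrow> has_basis P X"
      using X by (intro kp_module.has_basis_talented[OF kp_moduleI[OF P] _ talented_eq.sym[OF e]]) (simp_all add: valid_types_def)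
  qed
  then show "modules_with_basis X = modules_with_basis Y" unfolding modules_with_basis_def by blast
qed

lemma V_gr_carrier: "carrier (V_gr A) = modules_with_basis ` valid_types \<Lambda>"
proof (intro equalityI subsetI)
  fix K assume "K \<in> carrier (V_gr A)"
  then obtain P :: "('a, 'a list, int ^ 'k) graded_module" where P: "graded_fg_projective A P" "K = graded_class A P"
    by (auto simp: V_gr_def)
  have gm: "graded_left_module A P" using P(1) by (simp add: graded_fg_projective_def)
  obtain X where X: "has_basis P X" using fg_projective_has_basis[OF P(1)] by blast
  show "K \<in> modules_with_basis ` valid_types \<Lambda>"
    unfolding P(2) graded_class_eq[OF gm X] using has_basis_valid[OF gm X] by (rule imageI)
next
  fix K assume "K \<in> modules_with_basis ` valid_types \<Lambda>"
  then obtain X where X: "X \<in> valid_types \<Lambda>" "K = modules_with_basis X" by blast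
  obtain P where "P \<in> modules_with_basis X" using modules_with_basis_nonempty[OF X(1)] by blast
  then have P: "graded_left_module A P" "has_basis P X" unfolding modules_with_basis_def by simp_all
  have "graded_class A P \<in> carrier (V_gr A)"
    using kp_module.has_basis_fg_projective[OF kp_moduleI[OF P(1)] P(2)] by (simp add: V_gr_def)
  then show "K \<in> carrier (V_gr A)" unfolding X(2) graded_class_eq[OF P] .
qed

lemma V_gr_mult:
  assumes X: "X \<in> valid_types \<Lambda>" and Y: "Y \<in> valid_types \<Lambda>"
  shows "modules_with_basis X \<otimes>\<^bsub>V_gr A\<^esub> modules_with_basis Y = modules_with_basis (X + Y)"
proof -
  have c: "graded_class A (direct_sum P Q) = modules_with_basis (X + Y)"
    if "P \<in> modules_with_basis X" "Q \<in> modules_with_basis Y" for P Q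
  proof -
    have P: "graded_left_module A P" "has_basis P X" and Q: "graded_left_module A Q" "has_basis Q Y"
      using that unfolding modules_with_basis_def by simp_all
    show ?thesis by (rule graded_class_eq[OF direct_sum_graded[OF P(1) Q(1)] has_basis_direct_sum[OF P(1) Q(1) P(2) Q(2)]])
  qed
  obtain P where P: "P \<in> modules_with_basis X" using modules_with_basis_nonempty[OF X] by blast
  obtain Q where Q: "Q \<in> modules_with_basis Y" using modules_with_basis_nonempty[OF Y] by blast
  have "modules_with_basis X \<otimes>\<^bsub>V_gr A\<^esub> modules_with_basis Y =
      (\<Union>P\<in>modules_with_basis X. \<Union>Q\<in>modules_with_basis Y. graded_class A (direct_sum P Q))"
    by (simp add: V_gr_def)
  also have "\<dots> = (\<Union>P\<in>modules_with_basis X. \<Union>Q\<in>modules_with_basis Y. modules_with_basis (X + Y))"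
    using c by (intro SUP_cong[OF HOL.refl]) simp_all
  also have "\<dots> = modules_with_basis (X + Y)" using P Q by blast
  finally show ?thesis .
qed

lemma V_gr_act:
  assumes X: "X \<in> valid_types \<Lambda>"
  shows "act (V_gr A) n (modules_with_basis X) = modules_with_basis (shift_type n X)"
proof -
  have c: "graded_class A (shift n P) = modules_with_basis (shift_type n X)" if "P \<in> modules_with_basis X" for P
  proof -
    have P: "graded_left_module A P" "has_basis P X" using that unfolding modules_with_basis_def by simp_all
    show ?thesis
      by (rule graded_class_eq[OF shift_graded[OF P(1)] has_basis_shift[OF P, folded shift_type_def]])
  qed
  obtain P where P: "P \<in> modules_with_basis X" using modules_with_basis_nonempty[OF X] by blast
  have "act (V_gr A) n (modules_with_basis X) = (\<Union>P\<in>modules_with_basis X. graded_class A (shift n P))"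
    by (simp add: V_gr_def)
  also have "\<dots> = (\<Union>P\<in>modules_with_basis X. modules_with_basis (shift_type n X))"
    using c by (intro SUP_cong[OF HOL.refl]) simp_all
  also have "\<dots> = modules_with_basis (shift_type n X)" using P by blast
  finally show ?thesis .
qed

lemma V_gr_one: "\<one>\<^bsub>V_gr A\<^esub> = modules_with_basis {#}"
proof (intro equalityI subsetI)
  fix P assume "P \<in> \<one>\<^bsub>V_gr A\<^esub>"
  then have fg: "graded_fg_projective A P" and c: "carrier P = {\<zero>\<^bsub>P\<^esub>}" by (simp_all add: V_gr_def)
  have P: "graded_left_module A P" using fg by (simp add: graded_fg_projective_def)
  interpret P: kp_module \<Lambda> A S T W P by (rule kp_moduleI[OF P])
  have "graded_basis P ({} :: nat set) (\<lambda>_. undefined) (\<lambda>_. undefined)"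
  proof (rule P.graded_basisI)
    fix m y assume "y \<in> hcomp P m"
    then have "y = \<zero>\<^bsub>P\<^esub>" using P.P.hcomp_carrier c by blast
    then show "\<exists>a. (\<forall>i\<in>{}. a i \<in> hcomp A (m + snd undefined)) \<and> y = (\<Oplus>\<^bsub>P\<^esub>i\<in>{}. a i \<odot>\<^bsub>P\<^esub> undefined)" by simp
  qed (simp_all add: homogeneous_family_def)
  then show "P \<in> modules_with_basis {#}"
    unfolding modules_with_basis_def using P P.has_basis_image by fastforce
next
  fix P assume "P \<in> modules_with_basis {#}"
  then have P: "graded_left_module A P" "has_basis P {#}" unfolding modules_with_basis_def by simp_all
  interpret P: kp_module \<Lambda> A S T W P by (rule kp_moduleI[OF P(1)])
  obtain I :: "nat set" and \<tau> x where I: "graded_basis P I \<tau> x" "{#} = image_mset \<tau> (mset_set I)"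
    using P(2) unfolding has_basis_def by blast
  have "I = {}" using I(2) P.basis_finite[OF I(1)] by (metis image_mset_is_empty_iff mset_set_empty_iff)
  have "carrier P = {\<zero>\<^bsub>P\<^esub>}"
  proof
    show "carrier P \<subseteq> {\<zero>\<^bsub>P\<^esub>}"
    proof
      fix y assume "y \<in> carrier P"
      from P.basis_span_ex[OF I(1) this] show "y \<in> {\<zero>\<^bsub>P\<^esub>}" using \<open>I = {}\<close> by auto
    qed
  qed simp
  then show "P \<in> \<one>\<^bsub>V_gr A\<^esub>"
    using P.has_basis_fg_projective[OF P(2)] by (simp add: V_gr_def)
qed

text \<open>On a talented class all terms of this union coincide, so a map on the quotient is
  obtained without choosing representatives.\<close>

definition class_map :: "('p \<times> (int ^ 'k)) multiset set \<Rightarrow> ('a, 'a list, int ^ 'k) graded_module set" where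
  "class_map K = (\<Union>X\<in>K. modules_with_basis X)"

lemma class_map_class:
  assumes X: "X \<in> valid_types \<Lambda>"
  shows "class_map (talented_class \<Lambda> X) = modules_with_basis X"
proof -
  have "modules_with_basis Y = modules_with_basis X" if "Y \<in> talented_class \<Lambda> X" for Y
  proof -
    have "Y \<in> valid_types \<Lambda>" "talented_eq \<Lambda> X Y"
      using that unfolding talented_class_def talented_rel_def valid_types_def by auto
    then have "modules_with_basis X = modules_with_basis Y" using modules_with_basis_eq_iff[OF X] by blast
    then show ?thesis by (rule HOL.sym)
  qed
  moreover have "X \<in> talented_class \<Lambda> X"
    using X unfolding talented_class_def talented_rel_def valid_types_def by (simp add: talented_eq.refl)
  ultimately show ?thesis unfolding class_map_def by blast
qed

lemma talented_iso_V_gr: "act_monoid_isomorphic (talented_monoid \<Lambda>) (V_gr A)"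
  unfolding act_monoid_isomorphic_def
proof (intro bexI[of _ class_map] allI ballI)
  show "class_map \<in> iso (talented_monoid \<Lambda>) (V_gr A)"
  proof (rule isoI)
    show "class_map \<in> hom (talented_monoid \<Lambda>) (V_gr A)"
    proof (rule homI)
      fix x assume "x \<in> carrier (talented_monoid \<Lambda>)"
      then obtain X where X: "X \<in> valid_types \<Lambda>" "x = talented_class \<Lambda> X" by (rule talented_class_cases)
      show "class_map x \<in> carrier (V_gr A)" using X by (simp add: class_map_class V_gr_carrier)
      fix y assume "y \<in> carrier (talented_monoid \<Lambda>)"
      then obtain Y where Y: "Y \<in> valid_types \<Lambda>" "y = talented_class \<Lambda> Y" by (rule talented_class_cases)
      show "class_map (x \<otimes>\<^bsub>talented_monoid \<Lambda>\<^esub> y) = class_map x \<otimes>\<^bsub>V_gr A\<^esub> class_map y"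
        using X Y by (simp add: talented_mult class_map_class V_gr_mult)
    qed
    show "bij_betw class_map (carrier (talented_monoid \<Lambda>)) (carrier (V_gr A))"
    proof (rule bij_betw_imageI)
      show "inj_on class_map (carrier (talented_monoid \<Lambda>))"
      proof (rule inj_onI)
        fix x y assume x: "x \<in> carrier (talented_monoid \<Lambda>)" and y: "y \<in> carrier (talented_monoid \<Lambda>)"
          and e: "class_map x = class_map y"
        obtain X where X: "X \<in> valid_types \<Lambda>" "x = talented_class \<Lambda> X" using x by (rule talented_class_cases)
        obtain Y where Y: "Y \<in> valid_types \<Lambda>" "y = talented_class \<Lambda> Y" using y by (rule talented_class_cases)
        show "x = y"
          using e X Y by (simp add: class_map_class modules_with_basis_eq_iff talented_class_eq_iff)
      qed
      show "class_map ` carrier (talented_monoid \<Lambda>) = carrier (V_gr A)"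
        unfolding talented_carrier V_gr_carrier image_image by (rule image_cong[OF HOL.refl class_map_class])
    qed
  qed
  fix n x assume "x \<in> carrier (talented_monoid \<Lambda>)"
  then obtain X where X: "X \<in> valid_types \<Lambda>" "x = talented_class \<Lambda> X" by (rule talented_class_cases)
  show "class_map (act (talented_monoid \<Lambda>) n x) = act (V_gr A) n (class_map x)"
    using X by (simp add: talented_act class_map_class V_gr_act)
qed

lemma V_gr_cancellative: "cancellative_act_monoid (V_gr A)"
proof (intro cancellative_act_monoid.intro comm_monoidI cancellative_act_monoid_axioms.intro)
  let ?V = "V_gr A"
  have cases: "\<exists>X\<in>valid_types \<Lambda>. x = modules_with_basis X" if "x \<in> carrier ?V" for x
    using that unfolding V_gr_carrier by blast
  have closed: "modules_with_basis X \<in> carrier ?V" if "X \<in> valid_types \<Lambda>" for X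
    unfolding V_gr_carrier using that by (rule imageI)
  show "\<one>\<^bsub>?V\<^esub> \<in> carrier ?V" unfolding V_gr_one by (rule closed) simp
  fix x assume "x \<in> carrier ?V"
  from cases[OF this] obtain X where X: "X \<in> valid_types \<Lambda>" "x = modules_with_basis X" by blast
  show "\<one>\<^bsub>?V\<^esub> \<otimes>\<^bsub>?V\<^esub> x = x" using X by (simp add: V_gr_one V_gr_mult)
  show "act ?V n x \<in> carrier ?V" for n using X by (simp add: V_gr_act closed)
  fix y assume "y \<in> carrier ?V"
  from cases[OF this] obtain Y where Y: "Y \<in> valid_types \<Lambda>" "y = modules_with_basis Y" by blast
  show "x \<otimes>\<^bsub>?V\<^esub> y \<in> carrier ?V" using X Y by (simp add: V_gr_mult closed)
  show "x \<otimes>\<^bsub>?V\<^esub> y = y \<otimes>\<^bsub>?V\<^esub> x" using X Y by (simp add: V_gr_mult add.commute)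
  show "act ?V n (x \<otimes>\<^bsub>?V\<^esub> y) = act ?V n x \<otimes>\<^bsub>?V\<^esub> act ?V n y" for n
    using X Y by (simp add: V_gr_mult V_gr_act shift_type_add)
  fix z assume "z \<in> carrier ?V"
  from cases[OF this] obtain Z where Z: "Z \<in> valid_types \<Lambda>" "z = modules_with_basis Z" by blast
  show "x \<otimes>\<^bsub>?V\<^esub> y \<otimes>\<^bsub>?V\<^esub> z = x \<otimes>\<^bsub>?V\<^esub> (y \<otimes>\<^bsub>?V\<^esub> z)"
    using X Y Z by (simp add: V_gr_mult add.assoc)
  assume "x \<otimes>\<^bsub>?V\<^esub> z = y \<otimes>\<^bsub>?V\<^esub> z"
  then have "talented_eq \<Lambda> (X + Z) (Y + Z)" using X Y Z by (simp add: V_gr_mult modules_with_basis_eq_iff)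
  then have "talented_eq \<Lambda> X Y" using X(1) Y(1) by (intro talented_eq_cancel[of X Y Z]) (simp_all add: valid_types_def)
  then show "x = y" using X Y by (simp add: modules_with_basis_eq_iff)
qed

end

section \<open>Group completion\<close>

lemma act_monoid_isomorphic_sym:
  assumes M: "cancellative_act_monoid M" and iso: "act_monoid_isomorphic M N"
  shows "act_monoid_isomorphic N M"
proof -
  interpret M: cancellative_act_monoid M by fact
  obtain h where h: "h \<in> iso M N" and e: "\<forall>n. \<forall>x\<in>carrier M. h (act M n x) = act N n (h x)"
    using iso unfolding act_monoid_isomorphic_def by blast
  have b: "bij_betw h (carrier M) (carrier N)" using h by (simp add: iso_def)
  have "inv_into (carrier M) h (act N n y) = act M n (inv_into (carrier M) h y)" if y: "y \<in> carrier N" for n y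
  proof -
    have c: "inv_into (carrier M) h y \<in> carrier M" using b y by (simp add: bij_betw_def inv_into_into)
    have "act N n y = h (act M n (inv_into (carrier M) h y))"
      using e c bij_betw_inv_into_right[OF b y] by simp
    then show ?thesis using bij_betw_inv_into_left[OF b M.act_closed[OF c]] by simp
  qed
  moreover have "inv_into (carrier M) h \<in> hom N M"
  proof (rule homI)
    fix x y assume x: "x \<in> carrier N" and y: "y \<in> carrier N"
    let ?x = "inv_into (carrier M) h x" and ?y = "inv_into (carrier M) h y"
    show c: "?x \<in> carrier M" using b x by (simp add: bij_betw_def inv_into_into)
    have d: "?y \<in> carrier M" using b y by (simp add: bij_betw_def inv_into_into)
    have "h (?x \<otimes>\<^bsub>M\<^esub> ?y) = x \<otimes>\<^bsub>N\<^esub> y"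
      using h c d bij_betw_inv_into_right[OF b x] bij_betw_inv_into_right[OF b y] by (simp add: iso_def hom_def)
    then show "inv_into (carrier M) h (x \<otimes>\<^bsub>N\<^esub> y) = ?x \<otimes>\<^bsub>M\<^esub> ?y"
      using bij_betw_inv_into_left[OF b M.m_closed[OF c d]] by simp
  qed
  ultimately show ?thesis
    unfolding act_monoid_isomorphic_def iso_def using bij_betw_inv_into[OF b] by blast
qed

lemma act_monoid_isomorphic_trans:
  assumes "act_monoid_isomorphic L M" and "act_monoid_isomorphic M N"
  shows "act_monoid_isomorphic L N"
proof -
  obtain g where g: "g \<in> iso L M" "\<forall>n. \<forall>x\<in>carrier L. g (act L n x) = act M n (g x)"
    using assms(1) unfolding act_monoid_isomorphic_def by blast
  obtain h where h: "h \<in> iso M N" "\<forall>n. \<forall>x\<in>carrier M. h (act M n x) = act N n (h x)"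
    using assms(2) unfolding act_monoid_isomorphic_def by blast
  have "g x \<in> carrier M" if "x \<in> carrier L" for x using g(1) that by (auto simp: iso_def hom_def)
  have "h \<circ> g \<in> iso L N" using iso_set_trans[OF g(1) h(1)] .
  moreover have "\<forall>n. \<forall>x\<in>carrier L. (h \<circ> g) (act L n x) = act N n ((h \<circ> g) x)"
    using g(2) h(2) \<open>\<And>x. x \<in> carrier L \<Longrightarrow> g x \<in> carrier M\<close> by simp
  ultimately show ?thesis unfolding act_monoid_isomorphic_def by blast
qed

section \<open>The completion of a cancellative monoid with action\<close>

context cancellative_act_monoid
begin

definition diff_class :: "'a \<Rightarrow> 'a \<Rightarrow> ('a \<times> 'a) set" where
  "diff_class a b = completion_rel M `` {(a, b)}"

text \<open>Cancellation removes the auxiliary element \<open>e\<close> from the definition of the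
  completion.\<close>

lemma completion_rel_iff:
  "(x, y) \<in> completion_rel M \<longleftrightarrow> x \<in> carrier M \<times> carrier M \<and> y \<in> carrier M \<times> carrier M \<and>
     fst x \<otimes> snd y = fst y \<otimes> snd x"
proof -
  have "(\<exists>e\<in>carrier M. a \<otimes> d \<otimes> e = c \<otimes> b \<otimes> e) \<longleftrightarrow> a \<otimes> d = c \<otimes> b"
    if "a \<in> carrier M" "b \<in> carrier M" "c \<in> carrier M" "d \<in> carrier M" for a b c d
    using that right_cancel[of "a \<otimes> d" "c \<otimes> b"] by auto
  then show ?thesis unfolding completion_rel_def by (cases x; cases y) (simp add: conj_assoc cong: conj_cong)
qed

lemma equiv_completion_rel: "equiv (carrier M \<times> carrier M) (completion_rel M)"
proof (rule equivI)
  show "completion_rel M \<subseteq> (carrier M \<times> carrier M) \<times> (carrier M \<times> carrier M)"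
    by (auto simp: completion_rel_iff)
  show "refl_on (carrier M \<times> carrier M) (completion_rel M)"
    by (auto simp: refl_on_def completion_rel_iff)
  show "sym (completion_rel M)" by (auto simp: sym_def completion_rel_iff)
  show "trans (completion_rel M)"
  proof (rule transI)
    fix x y z assume "(x, y) \<in> completion_rel M" "(y, z) \<in> completion_rel M"
    then obtain a b c d e f where xyz: "x = (a, b)" "y = (c, d)" "z = (e, f)"
      and car: "a \<in> carrier M" "b \<in> carrier M" "c \<in> carrier M" "d \<in> carrier M" "e \<in> carrier M" "f \<in> carrier M"
      and e1: "a \<otimes> d = c \<otimes> b" and e2: "c \<otimes> f = e \<otimes> d"
      by (cases x; cases y; cases z) (auto simp: completion_rel_iff)
    \<comment> \<open>Both sides of the desired equation are multiplied by \<open>d\<close>, which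
      is cancelled at the end.\<close>
    have "(a \<otimes> f) \<otimes> d = (a \<otimes> d) \<otimes> f" using car by (simp add: m_ac)
    also have "\<dots> = (c \<otimes> f) \<otimes> b" unfolding e1 using car by (simp add: m_ac)
    also have "\<dots> = (e \<otimes> b) \<otimes> d" unfolding e2 using car by (simp add: m_ac)
    finally have "a \<otimes> f = e \<otimes> b" using car by (intro right_cancel[of "a \<otimes> f" "e \<otimes> b" d]) simp_all
    then show "(x, z) \<in> completion_rel M" using car by (simp add: xyz completion_rel_iff)
  qed
qed

lemma diff_class_eq_iff:
  assumes "a \<in> carrier M" "b \<in> carrier M" "c \<in> carrier M" "d \<in> carrier M"
  shows "diff_class a b = diff_class c d \<longleftrightarrow> a \<otimes> d = c \<otimes> b"
  unfolding diff_class_def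
  using eq_equiv_class_iff[OF equiv_completion_rel, of "(a, b)" "(c, d)"] assms by (simp add: completion_rel_iff)

lemma completion_carrier:
  "carrier (completion_group M) = (\<lambda>(a, b). diff_class a b) ` (carrier M \<times> carrier M)"
  unfolding completion_group_def diff_class_def quotient_def by auto

lemma completion_cases:
  assumes "x \<in> carrier (completion_group M)"
  obtains a b where "a \<in> carrier M" "b \<in> carrier M" "x = diff_class a b"
  using assms unfolding completion_carrier by auto

lemma diff_class_closed [simp]:
  "a \<in> carrier M \<Longrightarrow> b \<in> carrier M \<Longrightarrow> diff_class a b \<in> carrier (completion_group M)"
  unfolding completion_carrier by auto

lemma completion_zero: "\<zero>\<^bsub>completion_group M\<^esub> = diff_class \<one> \<one>"
  by (simp add: completion_group_def diff_class_def)

lemma completion_add: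
  assumes "a \<in> carrier M" "b \<in> carrier M" "c \<in> carrier M" "d \<in> carrier M"
  shows "diff_class a b \<oplus>\<^bsub>completion_group M\<^esub> diff_class c d = diff_class (a \<otimes> c) (b \<otimes> d)"
proof -
  have "(\<lambda>x y. completion_rel M `` {(fst x \<otimes> fst y, snd x \<otimes> snd y)}) respects2 completion_rel M"
  proof (rule congruent2I', rule equiv_class_eq[OF equiv_completion_rel])
    fix x x' y y' assume r: "(x, x') \<in> completion_rel M" "(y, y') \<in> completion_rel M"
    obtain a b c d where x: "x = (a, b)" "x' = (c, d)" by (metis surj_pair)
    obtain a' b' c' d' where y: "y = (a', b')" "y' = (c', d')" by (metis surj_pair)
    have car: "a \<in> carrier M" "b \<in> carrier M" "c \<in> carrier M" "d \<in> carrier M"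
      "a' \<in> carrier M" "b' \<in> carrier M" "c' \<in> carrier M" "d' \<in> carrier M"
      and e: "a \<otimes> d = c \<otimes> b" "a' \<otimes> d' = c' \<otimes> b'"
      using r by (simp_all add: x y completion_rel_iff)
    have "(a \<otimes> a') \<otimes> (d \<otimes> d') = (a \<otimes> d) \<otimes> (a' \<otimes> d')" using car by (simp add: m_ac)
    also have "\<dots> = (c \<otimes> c') \<otimes> (b \<otimes> b')" unfolding e using car by (simp add: m_ac)
    finally show "((fst x \<otimes> fst y, snd x \<otimes> snd y), (fst x' \<otimes> fst y', snd x' \<otimes> snd y')) \<in> completion_rel M"
      using car by (simp add: x y completion_rel_iff)
  qed
  from UN_equiv_class2[OF equiv_completion_rel equiv_completion_rel this, of "(a, b)" "(c, d)"] assms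
  show ?thesis by (simp add: completion_group_def diff_class_def case_prod_beta)
qed

lemma completion_act_diff_class:
  assumes "a \<in> carrier M" "b \<in> carrier M"
  shows "completion_act M n (diff_class a b) = diff_class (act M n a) (act M n b)"
proof -
  have "(\<lambda>x. completion_rel M `` {(act M n (fst x), act M n (snd x))}) respects completion_rel M"
  proof (rule congruentI, rule equiv_class_eq[OF equiv_completion_rel])
    fix x y assume "(x, y) \<in> completion_rel M"
    then show "((act M n (fst x), act M n (snd x)), (act M n (fst y), act M n (snd y))) \<in> completion_rel M"
      by (auto simp: completion_rel_iff act_mult[symmetric])
  qed
  from UN_equiv_class[OF equiv_completion_rel this, of "(a, b)"] assms
  show ?thesis by (simp add: completion_act_def diff_class_def case_prod_beta)
qed

lemma completion_abelian_group: "abelian_group (completion_group M)"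
proof (rule abelian_groupI)
  let ?G = "completion_group M"
  show "\<zero>\<^bsub>?G\<^esub> \<in> carrier ?G" by (simp add: completion_zero)
  fix x assume "x \<in> carrier ?G"
  then obtain a b where x: "a \<in> carrier M" "b \<in> carrier M" "x = diff_class a b" by (rule completion_cases)
  show "\<zero>\<^bsub>?G\<^esub> \<oplus>\<^bsub>?G\<^esub> x = x" using x by (simp add: completion_zero completion_add)
  have "diff_class b a \<oplus>\<^bsub>?G\<^esub> x = \<zero>\<^bsub>?G\<^esub>"
    using x by (simp add: completion_zero completion_add diff_class_eq_iff m_comm)
  then show "\<exists>y\<in>carrier ?G. y \<oplus>\<^bsub>?G\<^esub> x = \<zero>\<^bsub>?G\<^esub>" using x by (intro bexI[of _ "diff_class b a"]) simp_all
  fix y assume "y \<in> carrier ?G"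
  then obtain c d where y: "c \<in> carrier M" "d \<in> carrier M" "y = diff_class c d" by (rule completion_cases)
  show "x \<oplus>\<^bsub>?G\<^esub> y \<in> carrier ?G" using x y by (simp add: completion_add)
  show "x \<oplus>\<^bsub>?G\<^esub> y = y \<oplus>\<^bsub>?G\<^esub> x" using x y by (simp add: completion_add m_comm)
  fix z assume "z \<in> carrier ?G"
  then obtain e f where z: "e \<in> carrier M" "f \<in> carrier M" "z = diff_class e f" by (rule completion_cases)
  show "x \<oplus>\<^bsub>?G\<^esub> y \<oplus>\<^bsub>?G\<^esub> z = x \<oplus>\<^bsub>?G\<^esub> (y \<oplus>\<^bsub>?G\<^esub> z)"
    using x y z by (simp add: completion_add m_assoc)
qed

lemma completion_act_closed:
  "x \<in> carrier (completion_group M) \<Longrightarrow> completion_act M n x \<in> carrier (completion_group M)"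
  by (erule completion_cases) (simp add: completion_act_diff_class)

text \<open>Because the group element \<open>n\<close> in the group ring acts as the monoid action,
  a module isomorphism commutes with that action.\<close>

lemma single_one_smult:
  assumes "x \<in> carrier (completion_group M)"
  shows "Poly_Mapping.single n (1 :: int) \<odot>\<^bsub>completion M\<^esub> x = completion_act M n x"
proof -
  interpret G: abelian_group "completion_group M" by (rule completion_abelian_group)
  have "add_pow (completion_group M) (1 :: int) (completion_act M n x) = completion_act M n x"
    using completion_act_closed[OF assms] G.add.int_pow_1 by simp
  then show ?thesis using completion_act_closed[OF assms] by (simp add: completion_def ring.defs)
qed

end

lemma completion_simps [simp]:
  "carrier (completion M) = carrier (completion_group M)"
  "add (completion M) = add (completion_group M)"
  "zero (completion M) = zero (completion_group M)"
  "pos_cone (completion M) = (\<lambda>a. completion_rel M `` {(a, \<one>\<^bsub>M\<^esub>)}) ` carrier M"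
  by (simp_all add: completion_def ring.defs)

lemma completion_smult:
  "c \<odot>\<^bsub>completion M\<^esub> x = (\<Oplus>\<^bsub>completion_group M\<^esub> n \<in> Poly_Mapping.keys c.
     [Poly_Mapping.lookup c n] \<cdot>\<^bsub>completion_group M\<^esub> completion_act M n x)"
  by (simp add: completion_def ring.defs)

text \<open>The isomorphism extends to formal differences. Scalars of the group ring act by sums,
  integer multiples and the action, each of which the extension preserves.\<close>

lemma completion_isomorphic:
  assumes M: "cancellative_act_monoid M" and N: "cancellative_act_monoid N" and iso: "act_monoid_isomorphic M N"
  shows "preordered_module_isomorphic (completion M) (completion N)"
proof -
  interpret M: cancellative_act_monoid M by fact
  interpret N: cancellative_act_monoid N by fact
  let ?G = "completion_group M" and ?H = "completion_group N"
  interpret G: abelian_group ?G by (rule M.completion_abelian_group)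
  interpret H: abelian_group ?H by (rule N.completion_abelian_group)
  obtain h where h: "h \<in> iso M N" and e: "\<forall>n. \<forall>x\<in>carrier M. h (act M n x) = act N n (h x)"
    using iso unfolding act_monoid_isomorphic_def by blast
  have b: "bij_betw h (carrier M) (carrier N)" using h by (simp add: iso_def)
  have c [simp]: "h x \<in> carrier N" if "x \<in> carrier M" for x using bij_betwE[OF b] that by blast
  have m [simp]: "h (x \<otimes>\<^bsub>M\<^esub> y) = h x \<otimes>\<^bsub>N\<^esub> h y" if "x \<in> carrier M" "y \<in> carrier M" for x y
    using h that by (simp add: iso_def hom_def)
  have inj: "h x = h y \<longleftrightarrow> x = y" if "x \<in> carrier M" "y \<in> carrier M" for x y
    using b that by (meson bij_betw_imp_inj_on inj_on_eq_iff)
  have one [simp]: "h \<one>\<^bsub>M\<^esub> = \<one>\<^bsub>N\<^esub>"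
    using N.idempotent_eq_one[of "h \<one>\<^bsub>M\<^esub>"] m[of "\<one>\<^bsub>M\<^esub>" "\<one>\<^bsub>M\<^esub>"] by simp
  define g where "g = (\<lambda>X. \<Union>(a, b) \<in> X. N.diff_class (h a) (h b))"
  have g [simp]: "g (M.diff_class x y) = N.diff_class (h x) (h y)" if "x \<in> carrier M" "y \<in> carrier M" for x y
  proof -
    have "(\<lambda>p. N.diff_class (h (fst p)) (h (snd p))) respects completion_rel M"
    proof (rule congruentI)
      fix p q assume "(p, q) \<in> completion_rel M"
      then show "N.diff_class (h (fst p)) (h (snd p)) = N.diff_class (h (fst q)) (h (snd q))"
        by (clarsimp simp: M.completion_rel_iff) (simp add: N.diff_class_eq_iff m[symmetric] del: m)
    qed
    from UN_equiv_class[OF M.equiv_completion_rel this, of "(x, y)"] that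
    show ?thesis by (simp add: g_def M.diff_class_def case_prod_beta)
  qed
  have g_closed: "g x \<in> carrier ?H" if "x \<in> carrier ?G" for x
    using that by (auto elim!: M.completion_cases)
  have g_add: "g (x \<oplus>\<^bsub>?G\<^esub> y) = g x \<oplus>\<^bsub>?H\<^esub> g y" if "x \<in> carrier ?G" "y \<in> carrier ?G" for x y
    using that by (auto elim!: M.completion_cases simp: M.completion_add N.completion_add)
  have g_zero: "g \<zero>\<^bsub>?G\<^esub> = \<zero>\<^bsub>?H\<^esub>" by (simp add: M.completion_zero N.completion_zero)
  have hom: "g \<in> hom (add_monoid ?G) (add_monoid ?H)" using g_closed g_add by (simp add: hom_def)
  have g_act: "g (completion_act M n x) = completion_act N n (g x)" if "x \<in> carrier ?G" for n x
    using that e by (auto elim!: M.completion_cases simp: M.completion_act_diff_class N.completion_act_diff_class)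
  have g_pow: "g ([k] \<cdot>\<^bsub>?G\<^esub> x) = [k] \<cdot>\<^bsub>?H\<^esub> g x" if "x \<in> carrier ?G" for k :: int and x
    using hom_int_pow[OF hom _ G.a_group H.a_group, of x k] that by (simp add: add_pow_def)
  have g_smult: "g (r \<odot>\<^bsub>completion M\<^esub> x) = r \<odot>\<^bsub>completion N\<^esub> g x" if x: "x \<in> carrier ?G" for r x
  proof -
    have a: "completion_act M n x \<in> carrier ?G" for n using x by (rule M.completion_act_closed)
    have p: "[k] \<cdot>\<^bsub>?G\<^esub> completion_act M n x \<in> carrier ?G" for k :: int and n
      using a by (rule G.add.int_pow_closed)
    have "g (r \<odot>\<^bsub>completion M\<^esub> x) =
        (\<Oplus>\<^bsub>?H\<^esub> n \<in> Poly_Mapping.keys r. g ([Poly_Mapping.lookup r n] \<cdot>\<^bsub>?G\<^esub> completion_act M n x))"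
      unfolding completion_smult
      by (rule finsum_additive[OF G.abelian_monoid_axioms H.abelian_monoid_axioms])
        (use p g_closed g_zero g_add in auto)
    also have "\<dots> = r \<odot>\<^bsub>completion N\<^esub> g x" unfolding completion_smult g_pow[OF a] g_act[OF x] ..
    finally show ?thesis .
  qed
  have "bij_betw g (carrier ?G) (carrier ?H)"
  proof (rule bij_betw_imageI)
    show "inj_on g (carrier ?G)"
    proof (rule inj_onI)
      fix x y assume x: "x \<in> carrier ?G" and y: "y \<in> carrier ?G" and xy: "g x = g y"
      obtain a b where ab: "a \<in> carrier M" "b \<in> carrier M" "x = M.diff_class a b" using x by (rule M.completion_cases)
      obtain a' b' where ab': "a' \<in> carrier M" "b' \<in> carrier M" "y = M.diff_class a' b'" using y by (rule M.completion_cases)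
      have "h (a \<otimes>\<^bsub>M\<^esub> b') = h (a' \<otimes>\<^bsub>M\<^esub> b)" using xy ab ab' by (simp add: N.diff_class_eq_iff)
      then show "x = y" using ab ab' by (simp add: M.diff_class_eq_iff inj del: m)
    qed
    show "g ` carrier ?G = carrier ?H"
    proof
      show "g ` carrier ?G \<subseteq> carrier ?H" using g_closed by blast
      show "carrier ?H \<subseteq> g ` carrier ?G"
      proof
        fix y assume "y \<in> carrier ?H"
        then obtain c d where cd: "c \<in> carrier N" "d \<in> carrier N" "y = N.diff_class c d" by (rule N.completion_cases)
        obtain a where a: "a \<in> carrier M" "c = h a" using cd(1) b unfolding bij_betw_def by blast
        obtain a' where a': "a' \<in> carrier M" "d = h a'" using cd(2) b unfolding bij_betw_def by blast
        have "y = g (M.diff_class a a')" using cd a a' by simp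
        then show "y \<in> g ` carrier ?G" by (rule image_eqI) (simp add: a a')
      qed
    qed
  qed
  with hom have "g \<in> iso (add_monoid (completion M)) (add_monoid (completion N))"
    by (simp add: iso_def hom_def)
  moreover have "\<forall>r. \<forall>x\<in>carrier (completion M). g (r \<odot>\<^bsub>completion M\<^esub> x) = r \<odot>\<^bsub>completion N\<^esub> g x"
    using g_smult by simp
  moreover have "g ` pos_cone (completion M) = pos_cone (completion N)"
  proof -
    have "g ` pos_cone (completion M) = (\<lambda>a. N.diff_class (h a) \<one>\<^bsub>N\<^esub>) ` carrier M"
      by (simp add: image_image M.diff_class_def[symmetric])
    also have "\<dots> = (\<lambda>a. N.diff_class a \<one>\<^bsub>N\<^esub>) ` (h ` carrier M)" by (simp add: image_image)
    also have "\<dots> = pos_cone (completion N)" using b by (simp add: N.diff_class_def bij_betw_def)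
    finally show ?thesis .
  qed
  ultimately show ?thesis unfolding preordered_module_isomorphic_def by blast
qed

lemma isomorphic_if_completion_isomorphic:
  assumes M: "cancellative_act_monoid M" and N: "cancellative_act_monoid N"
    and iso: "preordered_module_isomorphic (completion M) (completion N)"
  shows "act_monoid_isomorphic M N"
proof -
  interpret M: cancellative_act_monoid M by fact
  interpret N: cancellative_act_monoid N by fact
  let ?G = "completion_group M" and ?H = "completion_group N"
  obtain g where g: "g \<in> iso (add_monoid (completion M)) (add_monoid (completion N))"
    and s: "\<forall>c. \<forall>x\<in>carrier (completion M). g (c \<odot>\<^bsub>completion M\<^esub> x) = c \<odot>\<^bsub>completion N\<^esub> g x"
    and p: "g ` pos_cone (completion M) = pos_cone (completion N)"
    using iso unfolding preordered_module_isomorphic_def by blast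
  have g_closed: "g x \<in> carrier ?H" if "x \<in> carrier ?G" for x using g that by (auto simp: iso_def hom_def)
  have g_add: "g (x \<oplus>\<^bsub>?G\<^esub> y) = g x \<oplus>\<^bsub>?H\<^esub> g y" if "x \<in> carrier ?G" "y \<in> carrier ?G" for x y
    using g that by (auto simp: iso_def hom_def)
  have g_inj: "inj_on g (carrier ?G)" using g by (auto simp: iso_def bij_betw_def)
  have g_act: "g (completion_act M n x) = completion_act N n (g x)" if x: "x \<in> carrier ?G" for n x
    \<comment> \<open>Linearity over the group ring is used only for the scalars
      \<open>Poly_Mapping.single n 1\<close>, which stand for the group elements.\<close>
    using s[rule_format, of x "Poly_Mapping.single n 1"] x
    by (simp add: M.single_one_smult N.single_one_smult g_closed)
  \<comment> \<open>\<open>i\<close> and \<open>j\<close> embed the monoids in their completions,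
    injectively by cancellation and with the positive cones as images.\<close>
  define i where "i = (\<lambda>a. M.diff_class a \<one>\<^bsub>M\<^esub>)"
  define j where "j = (\<lambda>a. N.diff_class a \<one>\<^bsub>N\<^esub>)"
  have i_closed [simp]: "i a \<in> carrier ?G" if "a \<in> carrier M" for a using that by (simp add: i_def)
  have i_inj: "inj_on i (carrier M)" by (rule inj_onI) (simp add: i_def M.diff_class_eq_iff)
  have j_inj: "inj_on j (carrier N)" by (rule inj_onI) (simp add: j_def N.diff_class_eq_iff)
  have p': "g ` i ` carrier M = j ` carrier N"
    using p by (simp add: i_def j_def M.diff_class_def N.diff_class_def)
  define h where "h = (\<lambda>a. inv_into (carrier N) j (g (i a)))"
  have h: "h a \<in> carrier N" "j (h a) = g (i a)" if "a \<in> carrier M" for a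
  proof -
    have "g (i a) \<in> j ` carrier N" using that p' by blast
    then show "h a \<in> carrier N" "j (h a) = g (i a)" by (simp_all add: h_def inv_into_into f_inv_into_f)
  qed
  have h_eqI: "h a = b" if "a \<in> carrier M" "b \<in> carrier N" "j b = g (i a)" for a b
    using that h inj_onD[OF j_inj, of "h a" b] by simp
  have "h \<in> hom M N"
  proof (rule homI)
    fix x y assume x: "x \<in> carrier M" and y: "y \<in> carrier M"
    have "j (h x \<otimes>\<^bsub>N\<^esub> h y) = j (h x) \<oplus>\<^bsub>?H\<^esub> j (h y)" using h(1) x y by (simp add: j_def N.completion_add)
    also have "\<dots> = g (i x \<oplus>\<^bsub>?G\<^esub> i y)" using h x y by (simp add: g_add)
    also have "i x \<oplus>\<^bsub>?G\<^esub> i y = i (x \<otimes>\<^bsub>M\<^esub> y)" using x y by (simp add: i_def M.completion_add)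
    finally show "h (x \<otimes>\<^bsub>M\<^esub> y) = h x \<otimes>\<^bsub>N\<^esub> h y" using x y h by (intro h_eqI) simp_all
  qed (rule h)
  moreover have "bij_betw h (carrier M) (carrier N)"
  proof (rule bij_betw_imageI)
    show "inj_on h (carrier M)"
    proof (rule inj_onI)
      fix x y assume x: "x \<in> carrier M" and y: "y \<in> carrier M" and e: "h x = h y"
      have "g (i x) = g (i y)" using h(2)[OF x] h(2)[OF y] e by simp
      then have "i x = i y" using inj_onD[OF g_inj] x y by simp
      then show "x = y" using inj_onD[OF i_inj] x y by simp
    qed
    show "h ` carrier M = carrier N"
    proof
      show "h ` carrier M \<subseteq> carrier N" using h by blast
      show "carrier N \<subseteq> h ` carrier M"
      proof
        fix b assume b: "b \<in> carrier N"
        then obtain a where a: "a \<in> carrier M" "j b = g (i a)" using p' by blast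
        then show "b \<in> h ` carrier M" using h_eqI[OF a(1) b a(2)] by blast
      qed
    qed
  qed
  moreover have "h (act M n x) = act N n (h x)" if x: "x \<in> carrier M" for n x
  proof (rule h_eqI)
    have "j (act N n (h x)) = completion_act N n (j (h x))"
      using h(1)[OF x] by (simp add: j_def N.completion_act_diff_class)
    also have "\<dots> = g (completion_act M n (i x))" using h(2)[OF x] x by (simp add: g_act)
    also have "completion_act M n (i x) = i (act M n x)" using x by (simp add: i_def M.completion_act_diff_class)
    finally show "j (act N n (h x)) = g (i (act M n x))" .
  qed (use x h in simp_all)
  ultimately show ?thesis unfolding act_monoid_isomorphic_def iso_def by blast
qed

section \<open>Local finiteness\<close>

text \<open>Phrased by product and unit alone, so that an isomorphism of monoids transports it; it
  carries the bound on paths from one graph to the other.\<close>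

definition finite_length :: "('a, 'b) monoid_scheme \<Rightarrow> bool" where
  "finite_length M \<longleftrightarrow> (\<forall>x\<in>carrier M. \<exists>C. \<forall>xs. set xs \<subseteq> carrier M - {\<one>\<^bsub>M\<^esub>} \<and>
     foldr (\<otimes>\<^bsub>M\<^esub>) xs \<one>\<^bsub>M\<^esub> = x \<longrightarrow> length xs \<le> C)"

lemma finite_length_isomorphic:
  assumes M: "cancellative_act_monoid M" and N: "cancellative_act_monoid N"
    and iso: "act_monoid_isomorphic M N" and fin: "finite_length N"
  shows "finite_length M"
  unfolding finite_length_def
proof
  interpret M: cancellative_act_monoid M by fact
  interpret N: cancellative_act_monoid N by fact
  obtain h where h: "h \<in> iso M N" using iso unfolding act_monoid_isomorphic_def by blast
  have inj: "inj_on h (carrier M)" using h by (simp add: iso_def bij_betw_def)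
  have c: "h x \<in> carrier N" if "x \<in> carrier M" for x using h that by (auto simp: iso_def hom_def)
  have m: "h (x \<otimes>\<^bsub>M\<^esub> y) = h x \<otimes>\<^bsub>N\<^esub> h y" if "x \<in> carrier M" "y \<in> carrier M" for x y
    using h that by (simp add: iso_def hom_def)
  have one: "h \<one>\<^bsub>M\<^esub> = \<one>\<^bsub>N\<^esub>"
    using N.idempotent_eq_one[of "h \<one>\<^bsub>M\<^esub>"] m[of "\<one>\<^bsub>M\<^esub>" "\<one>\<^bsub>M\<^esub>"] c by simp
  fix x assume x: "x \<in> carrier M"
  then obtain C where C: "\<And>xs. set xs \<subseteq> carrier N - {\<one>\<^bsub>N\<^esub>} \<Longrightarrow>
      foldr (\<otimes>\<^bsub>N\<^esub>) xs \<one>\<^bsub>N\<^esub> = h x \<Longrightarrow> length xs \<le> C"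
    using fin c unfolding finite_length_def by meson
  have "length xs \<le> C" if xs: "set xs \<subseteq> carrier M - {\<one>\<^bsub>M\<^esub>}" and e: "foldr (\<otimes>\<^bsub>M\<^esub>) xs \<one>\<^bsub>M\<^esub> = x" for xs
  proof -
    have "h y \<in> carrier N - {\<one>\<^bsub>N\<^esub>}" if "y \<in> carrier M - {\<one>\<^bsub>M\<^esub>}" for y
      using that c one inj_onD[OF inj, of y "\<one>\<^bsub>M\<^esub>"] by auto
    then have "set (map h xs) \<subseteq> carrier N - {\<one>\<^bsub>N\<^esub>}" using xs by auto
    moreover have "foldr (\<otimes>\<^bsub>M\<^esub>) ys \<one>\<^bsub>M\<^esub> \<in> carrier M \<and>
        h (foldr (\<otimes>\<^bsub>M\<^esub>) ys \<one>\<^bsub>M\<^esub>) = foldr (\<otimes>\<^bsub>N\<^esub>) (map h ys) \<one>\<^bsub>N\<^esub>"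
      if "set ys \<subseteq> carrier M" for ys
      using that by (induction ys) (simp_all add: one m)
    then have "foldr (\<otimes>\<^bsub>N\<^esub>) (map h xs) \<one>\<^bsub>N\<^esub> = h x" using xs e by (metis Diff_subset subset_trans)
    ultimately show ?thesis using C[of "map h xs"] by simp
  qed
  then show "\<exists>C. \<forall>xs. set xs \<subseteq> carrier M - {\<one>\<^bsub>M\<^esub>} \<and> foldr (\<otimes>\<^bsub>M\<^esub>) xs \<one>\<^bsub>M\<^esub> = x \<longrightarrow> length xs \<le> C"
    by blast
qed

section \<open>Bounds on paths and on decompositions\<close>

context row_finite_k_graph
begin

definition bounded_paths :: bool where
  "bounded_paths \<longleftrightarrow> (\<exists>C. \<forall>n. card (paths_deg \<Lambda> n) \<le> C)"

lemma paths_deg_Union: "paths_deg \<Lambda> n = (\<Union>v\<in>vertices \<Lambda>. paths_from \<Lambda> v n)"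
  using rng_vertex[OF paths_degD] by (auto simp: paths_from_def)

lemma finite_paths_deg: "finite (vertices \<Lambda>) \<Longrightarrow> finite (paths_deg \<Lambda> n)"
  unfolding paths_deg_Union[of n] by (rule finite_UN_I) simp_all

text \<open>A nonempty type equivalent to the empty one would raise to the empty multiset, which the
  absence of sources excludes.\<close>

lemma talented_class_nonempty:
  assumes "X \<in> valid_types \<Lambda>" "X \<noteq> {#}"
  shows "talented_class \<Lambda> X \<noteq> \<one>\<^bsub>talented_monoid \<Lambda>\<^esub>"
proof
  assume "talented_class \<Lambda> X = \<one>\<^bsub>talented_monoid \<Lambda>\<^esub>"
  then have "talented_eq \<Lambda> X {#}" using assms(1) by (simp add: talented_one talented_class_eq_iff)
  then have "\<forall>\<^sub>F M in at_top. raise \<Lambda> M X = {#}" using talented_eq_eventually_raise[of X "{#}"] by simp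
  then obtain M where "raise \<Lambda> M X = {#}"
    using eventually_happens[of _ "at_top :: int filter"] by auto
  then show False using raise_nonempty[of X M] assms by (simp add: valid_types_def)
qed

text \<open>Each factor other than the unit contributes at least one vertex after raising.
  \<open>M\<close> stays arbitrary because it is fixed only when the product is compared with
  another representative.\<close>

lemma nonone_product_size:
  assumes "set xs \<subseteq> carrier (talented_monoid \<Lambda>) - {\<one>\<^bsub>talented_monoid \<Lambda>\<^esub>}"
  shows "\<exists>Y\<in>valid_types \<Lambda>. foldr (\<otimes>\<^bsub>talented_monoid \<Lambda>\<^esub>) xs \<one>\<^bsub>talented_monoid \<Lambda>\<^esub> = talented_class \<Lambda> Y \<and>
    (\<forall>M. length xs \<le> size (raise \<Lambda> M Y))"
  using assms
proof (induction xs)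
  case Nil
  show ?case by (rule bexI[of _ "{#}"]) (simp_all add: talented_one)
next
  case (Cons x xs)
  then obtain Y where Y: "Y \<in> valid_types \<Lambda>"
    "foldr (\<otimes>\<^bsub>talented_monoid \<Lambda>\<^esub>) xs \<one>\<^bsub>talented_monoid \<Lambda>\<^esub> = talented_class \<Lambda> Y"
    "\<forall>M. length xs \<le> size (raise \<Lambda> M Y)" by auto
  have "x \<in> carrier (talented_monoid \<Lambda>)" using Cons.prems by simp
  then obtain X where X: "X \<in> valid_types \<Lambda>" "x = talented_class \<Lambda> X" by (rule talented_class_cases)
  have "X \<noteq> {#}" using Cons.prems X(2) by (auto simp: talented_one)
  then have "size (raise \<Lambda> M X) > 0" for M
    using raise_nonempty[of X M] X(1) by (simp add: valid_types_def nonempty_has_size)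
  then have "1 \<le> size (raise \<Lambda> M X)" for M by (simp add: Suc_le_eq)
  then have "length (x # xs) \<le> size (raise \<Lambda> M (X + Y))" for M
    using add_mono[of 1 "size (raise \<Lambda> M X)" "length xs" "size (raise \<Lambda> M Y)"] Y(3) by simp
  then show ?case using X Y by (intro bexI[of _ "X + Y"]) (simp_all add: talented_mult)
qed

lemma talented_class_product:
  assumes "X \<in> valid_types \<Lambda>"
  shows "\<exists>xs. set xs \<subseteq> carrier (talented_monoid \<Lambda>) - {\<one>\<^bsub>talented_monoid \<Lambda>\<^esub>} \<and>
    foldr (\<otimes>\<^bsub>talented_monoid \<Lambda>\<^esub>) xs \<one>\<^bsub>talented_monoid \<Lambda>\<^esub> = talented_class \<Lambda> X \<and> length xs = size X"
  using assms
proof (induction X)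
  case empty
  show ?case by (rule exI[of _ "[]"]) (simp add: talented_one)
next
  case (add t X)
  have t: "{#t#} \<in> valid_types \<Lambda>" and X: "X \<in> valid_types \<Lambda>" using add.prems by (simp_all add: valid_types_def)
  from add.IH[OF X] obtain xs where xs: "set xs \<subseteq> carrier (talented_monoid \<Lambda>) - {\<one>\<^bsub>talented_monoid \<Lambda>\<^esub>}"
    "foldr (\<otimes>\<^bsub>talented_monoid \<Lambda>\<^esub>) xs \<one>\<^bsub>talented_monoid \<Lambda>\<^esub> = talented_class \<Lambda> X" "length xs = size X"
    by (elim exE conjE)
  have "talented_class \<Lambda> {#t#} \<noteq> \<one>\<^bsub>talented_monoid \<Lambda>\<^esub>" by (rule talented_class_nonempty[OF t]) simp
  then show ?case
    using xs t X by (intro exI[of _ "talented_class \<Lambda> {#t#} # xs"]) (simp add: talented_mult)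
qed

lemma size_raise_le:
  assumes "\<And>v n. card (paths_from \<Lambda> v n) \<le> C"
  shows "size (raise \<Lambda> M X) \<le> C * size X"
proof (induction X)
  case (add t X)
  have "size (\<Sum>\<alpha>\<in>paths_from \<Lambda> (fst t) (gap M (snd t)). {#src \<Lambda> \<alpha>#}) \<le> C"
    using assms[of "fst t" "gap M (snd t)"]
      size_mset_set[of "paths_from \<Lambda> (fst t) (gap M (snd t))"]
    by (simp flip: image_mset_mset_set_eq_sum)
  then show ?case using add by (simp add: raise_def)
qed simp

text \<open>A decomposition into elements other than the unit is at most as long as a raised
  representative is large, and that size is controlled by the number of paths. Conversely, expanding
  \<open>v\<close> in degree \<open>n\<close> decomposes one fixed element into as many such
  elements as there are paths of degree \<open>n\<close> with range \<open>v\<close>.\<close>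

lemma finite_length_talented_iff:
  assumes fin: "finite (vertices \<Lambda>)"
  shows "finite_length (talented_monoid \<Lambda>) \<longleftrightarrow> bounded_paths"
proof
  let ?T = "talented_monoid \<Lambda>"
  assume "bounded_paths"
  then obtain C where C: "card (paths_deg \<Lambda> n) \<le> C" for n unfolding bounded_paths_def by blast
  have "paths_from \<Lambda> v n \<subseteq> paths_deg \<Lambda> n" for v n by (auto simp: paths_from_def)
  then have C': "card (paths_from \<Lambda> v n) \<le> C" for v n
    using card_mono[OF finite_paths_deg[OF fin, of n]] C[of n] by (meson order_trans)
  show "finite_length ?T"
    unfolding finite_length_def
  proof
    fix x assume "x \<in> carrier ?T"
    then obtain X where X: "X \<in> valid_types \<Lambda>" "x = talented_class \<Lambda> X" by (rule talented_class_cases)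
    have "length xs \<le> C * size X"
      if xs: "set xs \<subseteq> carrier ?T - {\<one>\<^bsub>?T\<^esub>}" and e: "foldr (\<otimes>\<^bsub>?T\<^esub>) xs \<one>\<^bsub>?T\<^esub> = x" for xs
    proof -
      obtain Y where Y: "Y \<in> valid_types \<Lambda>" "foldr (\<otimes>\<^bsub>?T\<^esub>) xs \<one>\<^bsub>?T\<^esub> = talented_class \<Lambda> Y"
        "\<forall>M. length xs \<le> size (raise \<Lambda> M Y)" using nonone_product_size[OF xs] by blast
      have "talented_eq \<Lambda> Y X" using e X Y(1,2) by (simp add: talented_class_eq_iff)
      \<comment> \<open>This \<open>M\<close> depends on the decomposition, but the bound
        \<open>C * size X\<close> does not.\<close>
      then obtain M where "raise \<Lambda> M Y = raise \<Lambda> M X"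
        using eventually_happens[OF talented_eq_eventually_raise] by fastforce
      then show ?thesis using Y(3)[rule_format, of M] size_raise_le[of C M X] C' by simp
    qed
    then show "\<exists>C. \<forall>xs. set xs \<subseteq> carrier ?T - {\<one>\<^bsub>?T\<^esub>} \<and> foldr (\<otimes>\<^bsub>?T\<^esub>) xs \<one>\<^bsub>?T\<^esub> = x \<longrightarrow> length xs \<le> C"
      by blast
  qed
next
  let ?T = "talented_monoid \<Lambda>"
  assume fl: "finite_length ?T"
  have "\<exists>C. \<forall>n. card (paths_from \<Lambda> v n) \<le> C" if v: "v \<in> vertices \<Lambda>" for v
  proof -
    have v0: "{#(v, 0)#} \<in> valid_types \<Lambda>" using v by (simp add: valid_types_def)
    then obtain C where C: "\<And>xs. set xs \<subseteq> carrier ?T - {\<one>\<^bsub>?T\<^esub>} \<Longrightarrow>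
        foldr (\<otimes>\<^bsub>?T\<^esub>) xs \<one>\<^bsub>?T\<^esub> = talented_class \<Lambda> {#(v, 0)#} \<Longrightarrow> length xs \<le> C"
      using fl talented_class_closed unfolding finite_length_def by meson
    have "card (paths_from \<Lambda> v n) \<le> C" for n
    proof -
      let ?X = "unfold \<Lambda> n (v, 0)"
      have X: "?X = image_mset (\<lambda>\<alpha>. (src \<Lambda> \<alpha>, int_vec n)) (mset_set (paths_from \<Lambda> v n))"
        by (simp add: unfold_def image_mset_mset_set_eq_sum)
      then have "?X \<in> valid_types \<Lambda>" by (auto simp: valid_types_def src_paths_from)
      from talented_class_product[OF this] obtain xs where xs: "set xs \<subseteq> carrier ?T - {\<one>\<^bsub>?T\<^esub>}"
        "foldr (\<otimes>\<^bsub>?T\<^esub>) xs \<one>\<^bsub>?T\<^esub> = talented_class \<Lambda> ?X" "length xs = size ?X" by (elim exE conjE)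
      have "talented_class \<Lambda> ?X = talented_class \<Lambda> {#(v, 0)#}"
        using talented_eq_unfold[OF v, of 0 n] \<open>?X \<in> valid_types \<Lambda>\<close> v0
        by (simp add: talented_class_eq_iff talented_eq.sym)
      then have "length xs \<le> C" using C[OF xs(1)] xs(2) by simp
      then show ?thesis using xs(3) X by simp
    qed
    then show ?thesis by blast
  qed
  then have "\<exists>C. \<forall>v\<in>vertices \<Lambda>. \<forall>n. card (paths_from \<Lambda> v n) \<le> C v" by (intro bchoice) blast
  then obtain C where C: "\<And>v n. v \<in> vertices \<Lambda> \<Longrightarrow> card (paths_from \<Lambda> v n) \<le> C v" by blast
  have "card (paths_deg \<Lambda> n) \<le> (\<Sum>v\<in>vertices \<Lambda>. C v)" for n
  proof -
    have "card (paths_deg \<Lambda> n) \<le> (\<Sum>v\<in>vertices \<Lambda>. card (paths_from \<Lambda> v n))"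
      unfolding paths_deg_Union[of n] using fin by (rule card_UN_le)
    also have "\<dots> \<le> (\<Sum>v\<in>vertices \<Lambda>. C v)" using C by (rule sum_mono)
    finally show ?thesis .
  qed
  then show "bounded_paths" unfolding bounded_paths_def by blast
qed

end

lemma (in scalar_group) lin_span_finite:
  assumes "finite B" "B \<subseteq> carrier V" "x \<in> lin_span UNIV V B"
  shows "\<exists>c. x = (\<Oplus>b\<in>B. c b \<odot> b)"
proof -
  obtain F a where x: "x = (\<Oplus>v\<in>F. a v \<odot> v)" "F \<subseteq> B" using assms(3) by (auto simp: lin_span_def)
  have "x = (\<Oplus>b\<in>B. if b \<in> F then a b \<odot> b else \<zero>)"
    unfolding x(1) using assms(1,2) x(2) by (intro finsum_extend) auto
  also have "\<dots> = (\<Oplus>b\<in>B. (if b \<in> F then a b else 0) \<odot> b)"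
    using assms(2) by (intro finsum_cong') auto
  finally show ?thesis by (intro exI[of _ "\<lambda>b. if b \<in> F then a b else 0"])
qed

section \<open>Dimensions of the homogeneous components\<close>

context graded_kp_algebra
begin

text \<open>For paths \<open>\<mu>\<close> of one degree the elements
  \<open>S \<mu> \<otimes> T \<mu>\<close> are linearly independent, and they all lie in the
  component of degree zero, whatever that degree is. A finite spanning set of this component
  therefore bounds the number of paths.\<close>

lemma locally_finite_imp_bounded:
  assumes "locally_finite A" shows bounded_paths
proof -
  obtain B where B: "finite B" "B \<subseteq> hcomp A 0" "hcomp A 0 = lin_span UNIV A B"
    using assms unfolding locally_finite_def by blast
  have Bc: "B \<subseteq> carrier A" using B(2) hcomp_closed by blast
  have "card (paths_deg \<Lambda> n) \<le> card B" for n
  proof -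
    let ?I = "paths_deg \<Lambda> n"
    have fin: "finite ?I" using finite_vertices by (rule finite_paths_deg)
    have "\<exists>c. S \<mu> \<otimes> T \<mu> = (\<Oplus>b\<in>B. c b \<odot> b)" if "\<mu> \<in> ?I" for \<mu>
    proof -
      have "S \<mu> \<otimes> T \<mu> \<in> lin_span UNIV A B"
        using monomial_hcomp[of \<mu> \<mu>] that B(3) by (simp add: paths_degD)
      then show ?thesis by (rule lin_span_finite[OF B(1) Bc])
    qed
    then have "\<exists>C. \<forall>\<mu>\<in>?I. S \<mu> \<otimes> T \<mu> = (\<Oplus>b\<in>B. C \<mu> b \<odot> b)" by (intro bchoice) blast
    then obtain C where C: "\<And>\<mu>. \<mu> \<in> ?I \<Longrightarrow> S \<mu> \<otimes> T \<mu> = (\<Oplus>b\<in>B. C \<mu> b \<odot> b)" by blast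
    have "rows_independent C ?I B"
      unfolding rows_independent_def
    proof (intro allI impI ballI)
      fix c \<nu> assume zero: "\<forall>b\<in>B. (\<Sum>\<mu>\<in>?I. c \<mu> * C \<mu> b) = 0" and \<nu>: "\<nu> \<in> ?I"
      have p: "\<mu> \<in> paths \<Lambda>" "deg \<Lambda> \<mu> = n" if "\<mu> \<in> ?I" for \<mu> using that by (rule paths_degD, rule deg_paths_deg)
      have "(\<Oplus>\<mu>\<in>?I. c \<mu> \<odot> (S \<mu> \<otimes> T \<mu>)) = (\<Oplus>\<mu>\<in>?I. \<Oplus>b\<in>B. (c \<mu> * C \<mu> b) \<odot> b)"
      proof (rule finsum_cong')
        fix \<mu> assume \<mu>: "\<mu> \<in> ?I"
        have "c \<mu> \<odot> (S \<mu> \<otimes> T \<mu>) = (\<Oplus>b\<in>B. c \<mu> \<odot> (C \<mu> b \<odot> b))"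
          unfolding C[OF \<mu>] using B(1) Bc by (intro scale_finsum) auto
        also have "\<dots> = (\<Oplus>b\<in>B. (c \<mu> * C \<mu> b) \<odot> b)"
          using Bc by (intro finsum_cong') (auto simp: scale_times)
        finally show "c \<mu> \<odot> (S \<mu> \<otimes> T \<mu>) = (\<Oplus>b\<in>B. (c \<mu> * C \<mu> b) \<odot> b)" .
      qed (use Bc in \<open>auto intro!: finsum_closed\<close>)
      also have "\<dots> = (\<Oplus>b\<in>B. \<Oplus>\<mu>\<in>?I. (c \<mu> * C \<mu> b) \<odot> b)"
        using fin B(1) Bc by (intro finsum_swap) auto
      also have "\<dots> = \<zero>"
      proof (rule finsum_zeroI)
        fix b assume b: "b \<in> B"
        then have bc: "b \<in> carrier A" using Bc by blast
        have "(\<Oplus>\<mu>\<in>J. (c \<mu> * C \<mu> b) \<odot> b) = (\<Sum>\<mu>\<in>J. c \<mu> * C \<mu> b) \<odot> b" if "finite J" for J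
          using that bc by (induction J rule: finite_induct) (simp_all add: scale_plus Pi_iff)
        from this[OF fin] show "(\<Oplus>\<mu>\<in>?I. (c \<mu> * C \<mu> b) \<odot> b) = \<zero>" using zero b bc by simp
      qed
      finally have z: "(\<Oplus>\<mu>\<in>?I. c \<mu> \<odot> (S \<mu> \<otimes> T \<mu>)) = \<zero>" .
      \<comment> \<open>Compression by \<open>T \<nu>\<close> and \<open>S \<nu>\<close> isolates
        the coefficient of \<open>\<nu>\<close>, by (KP3).\<close>
      have "T \<nu> \<otimes> (\<Oplus>\<mu>\<in>?I. c \<mu> \<odot> (S \<mu> \<otimes> T \<mu>)) = (\<Oplus>\<mu>\<in>?I. T \<nu> \<otimes> (c \<mu> \<odot> (S \<mu> \<otimes> T \<mu>)))"
        using fin p \<nu> by (intro finsum_mult_right) auto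
      also have "\<dots> = T \<nu> \<otimes> (c \<nu> \<odot> (S \<nu> \<otimes> T \<nu>))"
        using fin \<nu> p by (intro finsum_singleI) (auto simp: mult_scale_right T_S mult_assoc[symmetric])
      also have "\<dots> = c \<nu> \<odot> T \<nu>"
        using p[OF \<nu>] by (simp add: mult_scale_right mult_assoc[symmetric] T_S src_T)
      finally have "c \<nu> \<odot> T \<nu> = \<zero>" using z p[OF \<nu>] by simp
      then have "(c \<nu> \<odot> T \<nu>) \<otimes> S \<nu> = \<zero>" using p[OF \<nu>] by simp
      then have "c \<nu> \<odot> S (src \<Lambda> \<nu>) = \<zero>" using p[OF \<nu>] by (simp add: mult_scale_left T_S)
      then show "c \<nu> = 0" using p[OF \<nu>] by (simp add: scale_vertex_eq_zero)
    qed
    then show ?thesis using rows_independent_card_le[OF B(1) fin] by blast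
  qed
  then show ?thesis unfolding bounded_paths_def by blast
qed

text \<open>The relation (KP4), inserted at the common source.\<close>

lemma monomial_expand:
  assumes "\<mu> \<in> paths \<Lambda>" "\<nu> \<in> paths \<Lambda>" "src \<Lambda> \<mu> = src \<Lambda> \<nu>"
  shows "S \<mu> \<otimes> T \<nu> = (\<Oplus>\<beta>\<in>paths_from \<Lambda> (src \<Lambda> \<mu>) n. S (cmp \<Lambda> \<mu> \<beta>) \<otimes> T (cmp \<Lambda> \<nu> \<beta>))"
proof -
  let ?B = "paths_from \<Lambda> (src \<Lambda> \<mu>) n"
  have "S \<mu> \<otimes> T \<nu> = (S \<mu> \<otimes> S (src \<Lambda> \<mu>)) \<otimes> T \<nu>" using S_src[OF assms(1)] by simp
  also have "S \<mu> \<otimes> S (src \<Lambda> \<mu>) = (\<Oplus>\<beta>\<in>?B. (S \<mu> \<otimes> S \<beta>) \<otimes> T \<beta>)"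
    using assms by (intro vertex_expand_right) auto
  also have "\<dots> \<otimes> T \<nu> = (\<Oplus>\<beta>\<in>?B. ((S \<mu> \<otimes> S \<beta>) \<otimes> T \<beta>) \<otimes> T \<nu>)"
    using assms by (intro finsum_mult_left) (auto simp: paths_fromD)
  also have "\<dots> = (\<Oplus>\<beta>\<in>?B. S (cmp \<Lambda> \<mu> \<beta>) \<otimes> T (cmp \<Lambda> \<nu> \<beta>))"
  proof (rule finsum_cong')
    fix \<beta> assume "\<beta> \<in> ?B"
    then have b: "\<beta> \<in> paths \<Lambda>" "rng \<Lambda> \<beta> = src \<Lambda> \<mu>" by (rule paths_fromD, rule rng_paths_from)
    have "((S \<mu> \<otimes> S \<beta>) \<otimes> T \<beta>) \<otimes> T \<nu> = (S \<mu> \<otimes> S \<beta>) \<otimes> (T \<beta> \<otimes> T \<nu>)"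
      using assms b by (simp add: mult_assoc)
    then show "((S \<mu> \<otimes> S \<beta>) \<otimes> T \<beta>) \<otimes> T \<nu> = S (cmp \<Lambda> \<mu> \<beta>) \<otimes> T (cmp \<Lambda> \<nu> \<beta>)"
      using assms b by (simp add: S_mult T_mult)
  qed (use assms in \<open>auto simp: cmp_closed paths_fromD rng_paths_from\<close>)
  finally show ?thesis .
qed

text \<open>The number of pairs \<open>(\<mu>, \<nu>)\<close> of degrees \<open>(p + r, q + r)\<close> with a common source is
  non-decreasing in \<open>r\<close>; where it is maximal, each pair has a single extension of each degree,
  so that by the relation (KP4) the span of the monomials no longer grows.\<close>

lemma bounded_imp_locally_finite:
  assumes bounded_paths shows "locally_finite A"
  unfolding locally_finite_def
proof
  fix n :: "int ^ 'k"
  \<comment> \<open>Positive and negative parts of \<open>n\<close>: every pair of degrees of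
    difference \<open>n\<close> has the form \<open>(p + s, q + s)\<close>.\<close>
  define p :: "nat ^ 'k" where "p = (\<chi> i. nat (n $ i))"
  define q :: "nat ^ 'k" where "q = (\<chi> i. nat (- n $ i))"
  define R where "R = (\<lambda>r. {(\<mu>, \<nu>) \<in> paths_deg \<Lambda> (p + r) \<times> paths_deg \<Lambda> (q + r). src \<Lambda> \<mu> = src \<Lambda> \<nu>})"
  obtain C where C: "card (paths_deg \<Lambda> m) \<le> C" for m using assms unfolding bounded_paths_def by blast
  have fin: "finite (paths_deg \<Lambda> m)" for m using finite_vertices by (rule finite_paths_deg)
  have Rsub: "R r \<subseteq> paths_deg \<Lambda> (p + r) \<times> paths_deg \<Lambda> (q + r)" for r by (auto simp: R_def)
  have finR: "finite (R r)" for r using finite_subset[OF Rsub] fin by simp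
  have "card (R r) \<le> C * C" for r
  proof -
    have "card (R r) \<le> card (paths_deg \<Lambda> (p + r) \<times> paths_deg \<Lambda> (q + r))"
      using Rsub fin by (intro card_mono) simp_all
    also have "\<dots> \<le> C * C" unfolding card_cartesian_product by (intro mult_le_mono C)
    finally show ?thesis .
  qed
  \<comment> \<open>The successor turns the bound into the strict one that
    \<open>ex_has_greatest_nat\<close> expects.\<close>
  then have "\<forall>y. True \<longrightarrow> card (R y) < Suc (C * C)" by (simp add: less_Suc_eq_le)
  from ex_has_greatest_nat[OF TrueI this] obtain r where max: "card (R s) \<le> card (R r)" for s by blast
  define B where "B = (\<lambda>(\<mu>, \<nu>). S \<mu> \<otimes> T \<nu>) ` R r"
  have pq: "int_vec p - int_vec q = n" by (simp add: vec_eq_iff int_vec_def p_def q_def)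
  have R: "\<mu> \<in> paths \<Lambda>" "\<nu> \<in> paths \<Lambda>" "deg \<Lambda> \<mu> = p + s" "deg \<Lambda> \<nu> = q + s" "src \<Lambda> \<mu> = src \<Lambda> \<nu>"
    if "(\<mu>, \<nu>) \<in> R s" for \<mu> \<nu> s
    using that by (auto simp: R_def paths_degD deg_paths_deg)
  have RI: "(\<mu>, \<nu>) \<in> R s" if "\<mu> \<in> paths \<Lambda>" "\<nu> \<in> paths \<Lambda>" "deg \<Lambda> \<mu> = p + s" "deg \<Lambda> \<nu> = q + s"
    "src \<Lambda> \<mu> = src \<Lambda> \<nu>" for \<mu> \<nu> s
    using that unfolding R_def paths_deg_def by simp
  have Bh: "B \<subseteq> hcomp A n"
  proof
    fix x assume "x \<in> B"
    then obtain \<mu> \<nu> where x: "(\<mu>, \<nu>) \<in> R r" "x = S \<mu> \<otimes> T \<nu>" unfolding B_def by auto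
    have "int_vec (deg \<Lambda> \<mu>) - int_vec (deg \<Lambda> \<nu>) = n" using R[OF x(1)] pq by (simp add: int_vec_add)
    then show "x \<in> hcomp A n" using monomial_hcomp[of \<mu> \<nu>] R[OF x(1)] x(2) by simp
  qed
  have Bc: "B \<subseteq> carrier A" using Bh hcomp_closed by blast
  have stable: "S \<mu> \<otimes> T \<nu> \<in> B" if mn: "(\<mu>, \<nu>) \<in> R (r + t)" for \<mu> \<nu> t
  proof -
    \<comment> \<open>Extending the pairs in \<open>R r\<close> by paths of degree \<open>t\<close>
      is injective into \<open>R (r + t)\<close>. Absence of sources makes the domain at least as
      large as \<open>R r\<close>, and maximality makes the target no larger, so all these
      cardinalities agree.\<close>
    let ?E = "SIGMA x:R r. paths_from \<Lambda> (src \<Lambda> (fst x)) t"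
    let ?e = "\<lambda>(x, \<beta>). (cmp \<Lambda> (fst x) \<beta>, cmp \<Lambda> (snd x) \<beta>)"
    have inj: "inj_on ?e ?E"
    proof (rule inj_onI, clarsimp)
      fix a b \<beta> a' b' \<beta>'
      assume "(a, b) \<in> R r" "\<beta> \<in> paths_from \<Lambda> (src \<Lambda> a) t" "(a', b') \<in> R r" "\<beta>' \<in> paths_from \<Lambda> (src \<Lambda> a') t"
        and e: "cmp \<Lambda> a \<beta> = cmp \<Lambda> a' \<beta>'" "cmp \<Lambda> b \<beta> = cmp \<Lambda> b' \<beta>'"
      note f = R[OF this(1)] R[OF this(3)] this(2)[THEN paths_fromD] this(2)[THEN rng_paths_from]
        this(4)[THEN paths_fromD] this(4)[THEN rng_paths_from]
      have "a = a' \<and> \<beta> = \<beta>'" using f e(1) by (intro factor_unique) simp_all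
      moreover have "b = b' \<and> \<beta> = \<beta>'" using f e(2) by (intro factor_unique) simp_all
      ultimately show "a = a' \<and> b = b' \<and> \<beta> = \<beta>'" by blast
    qed
    have sub: "?e ` ?E \<subseteq> R (r + t)"
    proof clarsimp
      fix a b \<beta> assume "(a, b) \<in> R r" "\<beta> \<in> paths_from \<Lambda> (src \<Lambda> a) t"
      note f = R[OF this(1)] this(2)[THEN paths_fromD] this(2)[THEN rng_paths_from] this(2)[THEN deg_paths_from]
      show "(cmp \<Lambda> a \<beta>, cmp \<Lambda> b \<beta>) \<in> R (r + t)"
        using f by (intro RI) (simp_all add: cmp_closed deg_cmp src_cmp add.assoc)
    qed
    have pos: "card (paths_from \<Lambda> (src \<Lambda> (fst x)) t) \<ge> 1" if "x \<in> R r" for x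
      using that no_sources[of "src \<Lambda> (fst x)" t] R[of "fst x" "snd x" r]
      by (simp add: Suc_le_eq card_gt_0_iff)
    have cardE: "card ?E = (\<Sum>x\<in>R r. card (paths_from \<Lambda> (src \<Lambda> (fst x)) t))"
      using finR by (simp add: card_SigmaI)
    have le: "card ?E \<le> card (R r)"
      using card_mono[OF finR sub] max[of "r + t"] by (simp add: card_image[OF inj])
    have ge: "card (R r) \<le> card ?E"
      unfolding cardE using sum_mono[of "R r" "\<lambda>_. 1", OF pos] by simp
    have "card (?e ` ?E) = card (R (r + t))"
      using card_mono[OF finR sub] max[of "r + t"] le ge by (simp add: card_image[OF inj])
    then have "?e ` ?E = R (r + t)" by (rule card_subset_eq[OF finR sub])
    then have "(\<mu>, \<nu>) \<in> ?e ` ?E" using mn by simp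
    then obtain a b \<beta> where ab: "(a, b) \<in> R r" "\<beta> \<in> paths_from \<Lambda> (src \<Lambda> a) t"
      "\<mu> = cmp \<Lambda> a \<beta>" "\<nu> = cmp \<Lambda> b \<beta>" by auto
    \<comment> \<open>A second extension of even one pair would push the count beyond the
      maximum.\<close>
    have "card (paths_from \<Lambda> (src \<Lambda> a) t) = 1"
    proof (rule ccontr)
      assume "card (paths_from \<Lambda> (src \<Lambda> a) t) \<noteq> 1"
      then have "1 < card (paths_from \<Lambda> (src \<Lambda> (fst (a, b))) t)" using pos[OF ab(1)] by simp
      then have "(\<Sum>x\<in>R r. 1) < (\<Sum>x\<in>R r. card (paths_from \<Lambda> (src \<Lambda> (fst x)) t))"
        using pos finR by (intro sum_strict_mono_ex1 bexI[OF _ ab(1)]) simp_all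
      then show False using le cardE by simp
    qed
    then have single: "paths_from \<Lambda> (src \<Lambda> a) t = {\<beta>}" using ab(2) by (auto simp: card_1_singleton_iff)
    have "S a \<otimes> T b = S \<mu> \<otimes> T \<nu>"
      using monomial_expand[of a b t] R[OF ab(1)] paths_fromD[OF ab(2)] rng_paths_from[OF ab(2)]
      unfolding single by (simp add: ab(3,4) cmp_closed)
    then show ?thesis unfolding B_def using ab(1) by force
  qed
  have "monomials n \<subseteq> lin_span UNIV A B"
  proof
    fix x assume "x \<in> monomials n"
    then obtain \<mu> \<nu> where x: "x = S \<mu> \<otimes> T \<nu>" and m: "\<mu> \<in> paths \<Lambda>" "\<nu> \<in> paths \<Lambda>"
      and d: "int_vec (deg \<Lambda> \<mu>) - int_vec (deg \<Lambda> \<nu>) = n" by (auto simp: monomials_def)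
    note L = subspace_lin_span[OF Bc]
    show "x \<in> lin_span UNIV A B"
    proof (cases "src \<Lambda> \<mu> = src \<Lambda> \<nu>")
      case False
      then show ?thesis using x m L by (simp add: S_T_zero subspace_def)
    next
      case True
      have di: "int (deg \<Lambda> \<mu> $ i) - int (deg \<Lambda> \<nu> $ i) = n $ i" for i
        using d by (auto simp: vec_eq_iff int_vec_def)
      define s where "s = deg \<Lambda> \<mu> - p"
      \<comment> \<open>The truncated difference \<open>a - nat m\<close> is exact, because
        \<open>a\<close> is at least the positive part of \<open>m\<close>.\<close>
      have "int a - int b = m \<Longrightarrow> a = nat m + (a - nat m) \<and> b = nat (- m) + (a - nat m)" for a b :: nat and m
        by arith
      from this[OF di] have s: "deg \<Lambda> \<mu> = p + s" "deg \<Lambda> \<nu> = q + s"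
        unfolding vec_eq_iff s_def p_def q_def by simp_all
      \<comment> \<open>Expanding by the maximising degree \<open>r\<close> moves an arbitrary
        monomial to the level \<open>r + s\<close>, where \<open>stable\<close> applies.\<close>
      have "(\<Oplus>\<beta>\<in>paths_from \<Lambda> (src \<Lambda> \<mu>) r. S (cmp \<Lambda> \<mu> \<beta>) \<otimes> T (cmp \<Lambda> \<nu> \<beta>)) \<in> lin_span UNIV A B"
      proof (rule subspace_finsum[OF _ L])
        fix \<beta> assume b: "\<beta> \<in> paths_from \<Lambda> (src \<Lambda> \<mu>) r"
        have "(cmp \<Lambda> \<mu> \<beta>, cmp \<Lambda> \<nu> \<beta>) \<in> R (r + s)"
          using m True s paths_fromD[OF b] rng_paths_from[OF b] deg_paths_from[OF b]
          by (intro RI) (simp_all add: cmp_closed deg_cmp src_cmp ac_simps)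
        from stable[OF this] show "S (cmp \<Lambda> \<mu> \<beta>) \<otimes> T (cmp \<Lambda> \<nu> \<beta>) \<in> lin_span UNIV A B"
          using lin_span_superset[OF Bc] by blast
      qed simp
      then show ?thesis unfolding x by (subst monomial_expand[OF m True, of r])
    qed
  qed
  then have "hcomp A n \<subseteq> lin_span UNIV A B"
    unfolding hcomp_span by (rule lin_span_subset[OF subspace_lin_span[OF Bc]])
  moreover have "lin_span UNIV A B \<subseteq> hcomp A n" by (rule lin_span_subset[OF hcomp_subspace Bh])
  ultimately have "hcomp A n = lin_span UNIV A B" by (rule equalityI)
  moreover have "finite B" unfolding B_def using finR by simp
  ultimately show "\<exists>B. finite B \<and> B \<subseteq> hcomp A n \<and> hcomp A n = lin_span UNIV A B"
    using Bh by blast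
qed

lemma locally_finite_iff: "locally_finite A \<longleftrightarrow> finite_length (talented_monoid \<Lambda>)"
  using locally_finite_imp_bounded bounded_imp_locally_finite finite_length_talented_iff[OF finite_vertices]
  by blast

end

theorem corollary5p1p5:
  fixes \<Lambda> :: "('p, 'k::finite) kgraph" and \<Omega> :: "('q, 'k) kgraph"
  assumes "row_finite_k_graph \<Lambda>" and "row_finite_k_graph \<Omega>"
    and "finite (vertices \<Lambda>)" and "finite (vertices \<Omega>)"
  shows "(act_monoid_isomorphic (talented_monoid \<Lambda>) (talented_monoid \<Omega>) \<longleftrightarrow>
          preordered_module_isomorphic
            (K0_gr (kp TYPE('f::field) \<Lambda>)) (K0_gr (kp TYPE('f) \<Omega>))) \<and>
         (act_monoid_isomorphic (talented_monoid \<Lambda>) (talented_monoid \<Omega>) \<or>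
          preordered_module_isomorphic
            (K0_gr (kp TYPE('f) \<Lambda>)) (K0_gr (kp TYPE('f) \<Omega>)) \<longrightarrow>
          (locally_finite (kp TYPE('f) \<Lambda>) \<longleftrightarrow> locally_finite (kp TYPE('f) \<Omega>)))"
proof -
  let ?A = "kp TYPE('f) \<Lambda>" and ?B = "kp TYPE('f) \<Omega>"
  interpret L: row_finite_k_graph \<Lambda> by fact
  interpret O: row_finite_k_graph \<Omega> by fact
  obtain W where "graded_kp_algebra \<Lambda> ?A (kp_path TYPE('f) \<Lambda>) (kp_ghost TYPE('f) \<Lambda>) W"
    using L.kp_graded_kp_algebra[OF assms(3)] by blast
  then interpret A: graded_kp_algebra \<Lambda> ?A "kp_path TYPE('f) \<Lambda>" "kp_ghost TYPE('f) \<Lambda>" W .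
  obtain W' where "graded_kp_algebra \<Omega> ?B (kp_path TYPE('f) \<Omega>) (kp_ghost TYPE('f) \<Omega>) W'"
    using O.kp_graded_kp_algebra[OF assms(4)] by blast
  then interpret B: graded_kp_algebra \<Omega> ?B "kp_path TYPE('f) \<Omega>" "kp_ghost TYPE('f) \<Omega>" W' .
  let ?T = "talented_monoid \<Lambda>" and ?U = "talented_monoid \<Omega>"
  note T = L.talented_cancellative and U = O.talented_cancellative
  note TV = A.talented_iso_V_gr and UV = B.talented_iso_V_gr
  note VT = act_monoid_isomorphic_sym[OF T TV] and VU = act_monoid_isomorphic_sym[OF U UV]
  have "act_monoid_isomorphic ?T ?U \<longleftrightarrow> act_monoid_isomorphic (V_gr ?A) (V_gr ?B)"
    using act_monoid_isomorphic_trans[OF VT act_monoid_isomorphic_trans[OF _ UV]]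
      act_monoid_isomorphic_trans[OF TV act_monoid_isomorphic_trans[OF _ VU]] by blast
  also have "\<dots> \<longleftrightarrow> preordered_module_isomorphic (K0_gr ?A) (K0_gr ?B)"
    unfolding K0_gr_def
    using completion_isomorphic[OF A.V_gr_cancellative B.V_gr_cancellative]
      isomorphic_if_completion_isomorphic[OF A.V_gr_cancellative B.V_gr_cancellative] by blast
  finally have iff: "act_monoid_isomorphic ?T ?U \<longleftrightarrow> preordered_module_isomorphic (K0_gr ?A) (K0_gr ?B)" .
  \<comment> \<open>It is enough to start from an isomorphism of the talented monoids, the other
    alternative being equivalent to it by \<open>iff\<close>.\<close>
  have "locally_finite ?A \<longleftrightarrow> locally_finite ?B" if iso: "act_monoid_isomorphic ?T ?U"
    unfolding A.locally_finite_iff B.locally_finite_iff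
    using finite_length_isomorphic[OF T U iso] finite_length_isomorphic[OF U T act_monoid_isomorphic_sym[OF T iso]]
    by blast
  with iff show ?thesis by blast
qed

end
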